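(* Fix $m>0$ and let $h\in\mathcal{C}_b(\mathcal{T}^{V_m})$. Then, for $u^{(n)}(\omega)\in\mathcal{T}^{V_n}$ (where $n>m$), $\mathfrak P$-almost surely, $$\lim_{n\to\infty}\frac1{|V_n|}\sum_{j\in V_n}h\left(\pi^{V_m}(\mathcal S^ju^{(n)}(\omega))\right)=\int_{\mathcal{T}^{V_m}}h(u)\,d\mu_e^{V_m}(u).$$ Hence $\hat\mu_n(u^{(n)}(\omega))$ converges (weakly) $\mathfrak P$-almost surely to $\mu_e$.
   Context: Spaces. $T\ge 1$ is an integer, $\mathcal{T}=\mathbb{R}^{T+1}$ (coordinates indexed by times $0,\dots,T$), $\mathcal{T}^{\mathbb Z}$ has the product topology and its Borel $\sigma$-algebra. $\mathcal{M}(\Omega)$ is the set of Borel probability measures on $\Omega$ with the weak topology. The shift is $(\mathcal S^j\omega)^k=\omega^{j+k}$, and $\mathcal{M}_{\mathcal S}(\mathcal{T}^{\mathbb Z})$ is the set of $\mu\in\mathcal{M}(\mathcal{T}^{\mathbb Z})$ with $\mu\circ(\mathcal S^j)^{-1}=\mu$ for all $j$. $\mathcal C_b$ denotes bounded continuous real functions. $V_n=\{j\in\mathbb Z:|j|\le n\}$, $|V_n|=2n+1$, and $k\bmod V_n$ is the element of $V_n$ congruent to $k$ modulo $|V_n|$; on $\mathcal{T}^{V_n}$ the shift acts cyclically, $(\mathcal S^j\omega)^k=\omega^{(j+k)\bmod V_n}$. $\pi^{V_m}$ is the projection onto the coordinates in $V_m$ and $\mu^{V_m}$ the marginal of $\mu$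 on $\mathcal{T}^{V_m}$. The empirical measure $\hat\mu_n:\mathcal{T}^{V_n}\to\mathcal{M}_{\mathcal S}(\mathcal{T}^{\mathbb Z})$ is $\hat\mu_n(\omega)=\frac1{|V_n|}\sum_{k\in V_n}\delta_{\mathcal S^kp_n(\omega)}$, where $p_n(\omega)^k=\omega^{k\bmod V_n}$, $k\in\mathbb Z$. The network. $\mathfrak P$ is a probability measure on a space $\mathfrak W$ (elements $\omega$) carrying all the following random variables: $(B^j_t)_{j\in\mathbb Z,0\le t\le T-1}$ i.i.d. $\mathcal N(0,\sigma^2)$ with $\sigma>0$; $(\theta^j)_{j\in\mathbb Z}$ i.i.d. $\mathcal N(\bar\theta,\theta^2)$; $(u^j_0)_{j\in\mathbb Z}$ i.i.d. of law $\mu_I\in\mathcal{M}(\mathbb{R})$; and, for every $n\ge1$, a Gaussian field $J^n=(J^n_{ij})_{i,j\in V_n}$ with mean $\mathbb E[J^n_{ij}]=\bar J/|V_n|$ and covariance $\mathrm{cov}(J^n_{ij},J^n_{kl})=\frac1{|V_n|}\Lambda((k-i)\bmod V_n,(l-j)\bmod V_n)$, where $\Lambda:\mathbb Z\times\mathbb Z\to\mathbb R$ is such that this is a covariance for every $n$ and $\sum_{k,l}|\Lambda(k,l)|<\infty$. For each $n$ the families $B,\theta^\cdot,u_0,J^n$ are independent of each other. Let $f:\mathbb{R}\to(0,1)$ be an increasing Lipschitz continuous bijection and $\gamma\in[0,1)$. Then $u^{(n)}(\omega)=(U^j_t)_{j\in V_n,0\le t\le T}\in\mathcal{T}^{V_n}$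 is the solution of $$U^j_t=\gamma U^j_{t-1}+\sum_{i\in V_n}J^n_{ji}f(U^i_{t-1})+\theta^j+B^j_{t-1},\quad 1\le t\le T,\qquad U^j_0=u^j_0.$$ The limit $\mu_e$. $\Psi:\mathcal T\to\mathcal T$ is the affine bijection $\Psi(u)_0=u_0$, $\Psi(u)_s=u_s-\gamma u_{s-1}-\bar\theta$ for $1\le s\le T$, extended componentwise to $\mathcal{T}^{\mathbb Z}$; $\underline\mu$ is the push-forward of $\mu$ under $\Psi$. For $\nu\in\mathcal{M}_{\mathcal S}(\mathcal{T}^{\mathbb Z})$, $1\le r,s\le T$, $k,l\in\mathbb Z$ put $c^\nu_s=\bar J\int f(u^0_{s-1})\,\nu(du)$, $M^{\nu,l}_{rs}=\int f(u^0_{r-1})f(u^l_{s-1})\,\nu(du)$, $K^{\nu,k}_{rs}=\theta^2\mathbf 1_{k=0}+\sum_{l\in\mathbb Z}\Lambda(k,l)M^{\nu,l}_{rs}$. $Q^\nu\in\mathcal{M}_{\mathcal S}(\mathcal{T}^{\mathbb Z})$ is defined by: $\underline{Q^\nu}$ is the product of $\mu_I^{\otimes\mathbb Z}$ (time $0$ coordinates) and the law (times $1$ to $T$) of the stationary Gaussian process $(v^j_{1,T})_{j\in\mathbb Z}$ in $\mathbb{R}^T$ with mean $c^\nu$ and covariance $\mathrm{cov}(v^j_r,v^{j+k}_s)=\sigma^2\mathbf 1_{k=0}\mathbf 1_{r=s}+K^{\nu,k}_{rs}$. $\mu_e$ is the unique element of $\mathcal{M}_{\mathcal S}(\mathcal{T}^{\mathbb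 Z})$ with $\mu_e=Q^{\mu_e}$. *)

theory Defs
  imports "HOL-Probability.Probability"
begin

text \<open>
  A point of \<open>\<T> = \<real>\<^bsup>T+1\<^esup>\<close> is a function on \<open>{0..T}\<close>, and a point of \<open>\<T>\<^sup>V\<close> (for a set \<open>V\<close> of
  sites) is a function \<open>u\<close> on \<open>V\<close> with values in \<open>\<T>\<close>; \<open>u j t\<close> is the coordinate of site \<open>j\<close> at time
  \<open>t\<close>. Both are extensional: they take the value \<^const>\<open>undefined\<close> outside their index sets.
\<close>

type_synonym field = "int \<Rightarrow> nat \<Rightarrow> real"

definition field_topology :: "nat \<Rightarrow> int set \<Rightarrow> field topology" where
  "field_topology T V =
     product_topology (\<lambda>_. product_topology (\<lambda>_. euclideanreal) {0..T}) V"

definition borel_of :: "'a topology \<Rightarrow> 'a measure" where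
  "borel_of X = sigma (topspace X) {U. openin X U}"

definition bounded_continuous :: "'a topology \<Rightarrow> ('a \<Rightarrow> real) set" where
  "bounded_continuous X = {h. continuous_map X euclideanreal h \<and> bounded (h ` topspace X)}"

definition weakly_converges :: "'a topology \<Rightarrow> (nat \<Rightarrow> 'a measure) \<Rightarrow> 'a measure \<Rightarrow> bool" where
  "weakly_converges X M N \<longleftrightarrow>
     (\<forall>h \<in> bounded_continuous X. (\<lambda>n. \<integral>u. h u \<partial>M n) \<longlonglongrightarrow> (\<integral>u. h u \<partial>N))"

abbreviation field_space :: "nat \<Rightarrow> int set \<Rightarrow> field measure" where
  "field_space T V \<equiv> borel_of (field_topology T V)"

definition shift :: "int \<Rightarrow> field \<Rightarrow> field" where
  "shift j u = (\<lambda>k. u (j + k))"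

definition stationary_measures :: "nat \<Rightarrow> field measure set" where
  "stationary_measures T = {\<mu>. prob_space \<mu> \<and> sets \<mu> = sets (field_space T UNIV) \<and>
     (\<forall>j. distr \<mu> (field_space T UNIV) (shift j) = \<mu>)}"

definition marginal :: "nat \<Rightarrow> int set \<Rightarrow> field measure \<Rightarrow> field measure" where
  "marginal T V \<mu> = distr \<mu> (field_space T V) (\<lambda>u. restrict u V)"

definition sites :: "nat \<Rightarrow> int set" where
  "sites n = {j. \<bar>j\<bar> \<le> int n}"

definition site_mod :: "int \<Rightarrow> nat \<Rightarrow> int" where
  "site_mod k n = (k + int n) mod (2 * int n + 1) - int n"

lemma sites_eq: "sites n = {- int n..int n}"
  by (auto simp: sites_def)

lemma card_sites: "card (sites n) = 2 * n + 1"
  by (simp add: sites_eq)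

lemma site_mod_in_sites: "site_mod k n \<in> sites n"
proof -
  have "0 \<le> (k + int n) mod (2 * int n + 1)" "(k + int n) mod (2 * int n + 1) < 2 * int n + 1"
    by (rule pos_mod_sign pos_mod_bound; simp)+
  then show ?thesis
    unfolding site_mod_def sites_eq atLeastAtMost_iff by linarith
qed

lemma site_mod_cong: "site_mod k n mod int (card (sites n)) = k mod int (card (sites n))"
  unfolding site_mod_def card_sites by (simp add: mod_diff_left_eq algebra_simps)

definition cyclic_shift :: "nat \<Rightarrow> int \<Rightarrow> field \<Rightarrow> field" where
  "cyclic_shift n j u = (\<lambda>k\<in>sites n. u (site_mod (j + k) n))"

definition periodise :: "nat \<Rightarrow> field \<Rightarrow> field" where
  "periodise n u = (\<lambda>k. u (site_mod k n))"

definition empirical_measure :: "nat \<Rightarrow> nat \<Rightarrow> field \<Rightarrow> field measure" where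
  "empirical_measure T n u =
     measure_of (space (field_space T UNIV)) (sets (field_space T UNIV))
       (\<lambda>A. (\<Sum>k\<in>sites n. emeasure (return (field_space T UNIV) (shift k (periodise n u))) A)
              / ennreal (real (card (sites n))))"

text \<open>The set function above is countably additive, so \<^const>\<open>measure_of\<close> does not alter it.\<close>

lemma emeasure_empirical_measure:
  assumes "A \<in> sets (field_space T UNIV)"
  shows "emeasure (empirical_measure T n u) A =
    (\<Sum>k\<in>sites n. indicator A (shift k (periodise n u))) / ennreal (real (card (sites n)))"
proof -
  let ?N = "field_space T UNIV"
  let ?\<mu> = "\<lambda>A. (\<Sum>k\<in>sites n. emeasure (return ?N (shift k (periodise n u))) A)
              / ennreal (real (card (sites n)))"
  have "emeasure (empirical_measure T n u) A = ?\<mu> A"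
  proof (rule emeasure_measure_of[OF empirical_measure_def])
    show "sets ?N \<subseteq> Pow (space ?N)" by (rule sets.space_closed)
    show "positive (sets (empirical_measure T n u)) ?\<mu>"
      by (simp add: positive_def)
    show "countably_additive (sets (empirical_measure T n u)) ?\<mu>"
    proof (rule countably_additiveI)
      fix F :: "nat \<Rightarrow> field set"
      assume F: "range F \<subseteq> sets (empirical_measure T n u)" "disjoint_family F"
      have "sets (empirical_measure T n u) = sets ?N"
        unfolding empirical_measure_def by (simp add: sets.sigma_sets_eq)
      with F have "range F \<subseteq> sets (return ?N x)" for x by simp
      then have "(\<Sum>i. emeasure (return ?N x) (F i)) = emeasure (return ?N x) (\<Union>i. F i)" for x
        using suminf_emeasure F(2) by blast
      then show "(\<Sum>i. ?\<mu> (F i)) = ?\<mu> (\<Union>i. F i)"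
        by (simp add: ennreal_suminf_divide suminf_sum)
    qed
    show "A \<in> sets (empirical_measure T n u)"
      unfolding empirical_measure_def using assms by (simp add: sets.sigma_sets_eq)
  qed
  then show ?thesis using assms by simp
qed

text \<open>The second parameter is a standard deviation; value 0 gives a Dirac mass.\<close>

definition normal_law :: "real \<Rightarrow> real \<Rightarrow> real measure" where
  "normal_law m s =
     (if s = 0 then return borel m else density lborel (\<lambda>x. ennreal (normal_density m s x)))"

text \<open>Jointly Gaussian, possibly degenerate: every finite linear combination is normal.\<close>

definition gaussian_family :: "'a measure \<Rightarrow> 'i set \<Rightarrow> ('i \<Rightarrow> 'a \<Rightarrow> real) \<Rightarrow> bool" where
  "gaussian_family M I X \<longleftrightarrow>
     (\<forall>i\<in>I. X i \<in> borel_measurable M) \<and>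
     (\<forall>F a. finite F \<and> F \<subseteq> I \<longrightarrow>
        (\<exists>m s. distr M borel (\<lambda>\<omega>. \<Sum>i\<in>F. a i * X i \<omega>) = normal_law m s))"

definition cov :: "'a measure \<Rightarrow> ('a \<Rightarrow> real) \<Rightarrow> ('a \<Rightarrow> real) \<Rightarrow> real" where
  "cov M X Y = (\<integral>\<omega>. (X \<omega> - (\<integral>\<omega>'. X \<omega>' \<partial>M)) * (Y \<omega> - (\<integral>\<omega>'. Y \<omega>' \<partial>M)) \<partial>M)"

definition iid_family :: "'a measure \<Rightarrow> 'i set \<Rightarrow> ('i \<Rightarrow> 'a \<Rightarrow> real) \<Rightarrow> real measure \<Rightarrow> bool" where
  "iid_family M I X D \<longleftrightarrow>
     prob_space.indep_vars M (\<lambda>_. borel) X I \<and> (\<forall>i\<in>I. distr M borel (X i) = D)"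

definition generated_events :: "'a measure \<Rightarrow> 'i set \<Rightarrow> ('i \<Rightarrow> 'a \<Rightarrow> real) \<Rightarrow> 'a set set" where
  "generated_events M I X =
     sigma_sets (space M) (\<Union>i\<in>I. {X i -` A \<inter> space M | A. A \<in> sets borel})"

text \<open>
  \<open>Jm\<close>, \<open>th\<close>, \<open>b\<close>, \<open>x0\<close> are one realisation of the weights, thresholds, noise and initial values.
\<close>

primrec potential :: "real \<Rightarrow> (real \<Rightarrow> real) \<Rightarrow> int set \<Rightarrow> (int \<Rightarrow> int \<Rightarrow> real) \<Rightarrow> (int \<Rightarrow> real) \<Rightarrow>
    (int \<Rightarrow> nat \<Rightarrow> real) \<Rightarrow> (int \<Rightarrow> real) \<Rightarrow> nat \<Rightarrow> int \<Rightarrow> real" where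
  "potential \<gamma> f V Jm th b x0 0 j = x0 j"
| "potential \<gamma> f V Jm th b x0 (Suc t) j =
     \<gamma> * potential \<gamma> f V Jm th b x0 t j
     + (\<Sum>i\<in>V. Jm j i * f (potential \<gamma> f V Jm th b x0 t i)) + th j + b j t"

definition network_field :: "nat \<Rightarrow> real \<Rightarrow> (real \<Rightarrow> real) \<Rightarrow> (nat \<Rightarrow> int \<Rightarrow> int \<Rightarrow> 'w \<Rightarrow> real) \<Rightarrow>
    (int \<Rightarrow> 'w \<Rightarrow> real) \<Rightarrow> (int \<Rightarrow> nat \<Rightarrow> 'w \<Rightarrow> real) \<Rightarrow> (int \<Rightarrow> 'w \<Rightarrow> real) \<Rightarrow> nat \<Rightarrow> 'w \<Rightarrow> field" where
  "network_field T \<gamma> f J th B u0 n \<omega> =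
     (\<lambda>j\<in>sites n. \<lambda>t\<in>{0..T}.
        potential \<gamma> f (sites n) (\<lambda>i k. J n i k \<omega>) (\<lambda>i. th i \<omega>) (\<lambda>i s. B i s \<omega>) (\<lambda>i. u0 i \<omega>) t j)"

definition Psi :: "nat \<Rightarrow> real \<Rightarrow> real \<Rightarrow> field \<Rightarrow> field" where
  "Psi T \<gamma> \<theta>bar u =
     (\<lambda>j. \<lambda>s\<in>{0..T}. if s = 0 then u j 0 else u j s - \<gamma> * u j (s - 1) - \<theta>bar)"

definition mean_coeff :: "real \<Rightarrow> (real \<Rightarrow> real) \<Rightarrow> field measure \<Rightarrow> nat \<Rightarrow> real" where
  "mean_coeff Jbar f \<nu> s = Jbar * (\<integral>u. f (u 0 (s - 1)) \<partial>\<nu>)"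

definition corr_coeff :: "(real \<Rightarrow> real) \<Rightarrow> field measure \<Rightarrow> int \<Rightarrow> nat \<Rightarrow> nat \<Rightarrow> real" where
  "corr_coeff f \<nu> l r s = (\<integral>u. f (u 0 (r - 1)) * f (u l (s - 1)) \<partial>\<nu>)"

definition cov_coeff :: "real \<Rightarrow> (int \<Rightarrow> int \<Rightarrow> real) \<Rightarrow> (real \<Rightarrow> real) \<Rightarrow> field measure \<Rightarrow>
    int \<Rightarrow> nat \<Rightarrow> nat \<Rightarrow> real" where
  "cov_coeff \<theta> \<Lambda> f \<nu> k r s =
     (if k = 0 then \<theta>\<^sup>2 else 0) + (\<Sum>\<^sub>\<infinity>l\<in>UNIV. \<Lambda> k l * corr_coeff f \<nu> l r s)"

text \<open>\<open>is_stationary_gaussian_law T c C G\<close>: \<open>G\<close> is the law of a stationary Gaussian process in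
  \<open>\<real>\<^sup>T\<close> (times \<open>1\<close> to \<open>T\<close>) indexed by the integers, with mean \<open>c r\<close> and lag-\<open>k\<close> covariance \<open>C k r s\<close>.\<close>

definition is_stationary_gaussian_law ::
    "nat \<Rightarrow> (nat \<Rightarrow> real) \<Rightarrow> (int \<Rightarrow> nat \<Rightarrow> nat \<Rightarrow> real) \<Rightarrow> field measure \<Rightarrow> bool" where
  "is_stationary_gaussian_law T c C G \<longleftrightarrow>
     prob_space G \<and> sets G = sets (\<Pi>\<^sub>M j\<in>UNIV. \<Pi>\<^sub>M s\<in>{1..T}. borel) \<and>
     gaussian_family G (UNIV \<times> {1..T}) (\<lambda>(j, s) v. v j s) \<and>
     (\<forall>j. \<forall>r\<in>{1..T}. (\<integral>v. v j r \<partial>G) = c r) \<and>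
     (\<forall>j k. \<forall>r\<in>{1..T}. \<forall>s\<in>{1..T}. cov G (\<lambda>v. v j r) (\<lambda>v. v (j + k) s) = C k r s)"

text \<open>
  \<open>is_Q \<dots> \<nu> Q\<close> says \<open>Q = Q\<^sup>\<nu>\<close>: under the identification of \<open>\<T>\<^bsup>\<int>\<^esup>\<close> with
  \<open>\<real>\<^bsup>\<int>\<^esup> \<times> (\<real>\<^sup>T)\<^bsup>\<int>\<^esup>\<close> that separates time \<open>0\<close> from the times \<open>1\<close> to \<open>T\<close>, the image of \<open>Q\<close> under
  \<open>Psi\<close> is the product measure. This determines \<open>Q\<close>, since \<open>Psi\<close> is a bijection and a Gaussian
  law is determined by its mean and covariance.
\<close>

definition is_Q :: "nat \<Rightarrow> real \<Rightarrow> real \<Rightarrow> real \<Rightarrow> real \<Rightarrow> real \<Rightarrow> (int \<Rightarrow> int \<Rightarrow> real) \<Rightarrow>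
    (real \<Rightarrow> real) \<Rightarrow> real measure \<Rightarrow> field measure \<Rightarrow> field measure \<Rightarrow> bool" where
  "is_Q T \<gamma> \<sigma> \<theta>bar \<theta> Jbar \<Lambda> f \<mu>I \<nu> Q \<longleftrightarrow>
     Q \<in> stationary_measures T \<and>
     (\<exists>G. is_stationary_gaussian_law T (mean_coeff Jbar f \<nu>)
            (\<lambda>k r s. (if k = 0 \<and> r = s then \<sigma>\<^sup>2 else 0) + cov_coeff \<theta> \<Lambda> f \<nu> k r s) G \<and>
          distr (distr Q (field_space T UNIV) (Psi T \<gamma> \<theta>bar))
            ((\<Pi>\<^sub>M j\<in>UNIV. borel) \<Otimes>\<^sub>M (\<Pi>\<^sub>M j\<in>UNIV. \<Pi>\<^sub>M s\<in>{1..T}. borel))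
            (\<lambda>v. (\<lambda>j. v j 0, \<lambda>j. restrict (v j) {1..T}))
          = (\<Pi>\<^sub>M j\<in>UNIV. \<mu>I) \<Otimes>\<^sub>M G)"

end

theory Submission
  imports Defs
begin

text \<open>
  Let \<open>w\<close> be the field of increments \<open>U\<^sub>s - \<gamma> U\<^bsub>s - 1\<^esub>\<close> up to time \<open>t\<close>, with the initial values at time \<open>0\<close>.
  The interaction is linear in the Gaussian weights, so integrating out weights, thresholds and noise gives
  \<open>w\<close> an explicit density: the Gaussian density at \<open>w\<close> whose mean and covariance are determined by the cyclic
  averages, along the path of \<open>w\<close> itself, of \<open>f (u\<^sup>0 s)\<close> and \<open>f (u\<^sup>0 r) f (u\<^sup>l s)\<close> with \<open>r, s < t\<close>. By induction on
  \<open>t\<close> these averages are close to their values under \<open>\<mu>\<^sub>e\<close>, up to events of summable probability. On the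
  remaining event the density is at most \<open>exp (\<kappa> n)\<close> times a fixed Gaussian density, with \<open>\<kappa>\<close> as small as desired.

  Divide the sites into residue classes modulo a large \<open>R\<close>. Since \<open>\<Lambda>\<close> is summable, neglecting the covariances
  between the blocks around the sites of one class costs another factor \<open>exp (\<kappa> n)\<close>; the blocks are then
  independent and each has nearly the law prescribed by the fixed point equation of \<open>\<mu>\<^sub>e\<close>. The exponential Markov inequality bounds
  the probability of a deviation of a cylinder average by \<open>exp (- c n)\<close>, and Borel--Cantelli gives almost sure
  convergence. For the empirical measure, a countable family of cylinder functions approximates every
  bounded continuous function from below.
\<close>

section \<open>Positive semidefinite kernels\<close>

text \<open>As a function of \<open>w\<close> the density is not Gaussian, since its mean and
  covariance move with \<open>w\<close>; it can be neither marginalised nor factorised. Hence two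
  comparisons. On the whole grid the parameters are frozen at one path of the remaining event, which
  gives a genuine Gaussian density. This is restricted exactly to the blocks of one class, and only
  there is its covariance replaced by a block diagonal one. The first comparison pays for every
  site, while the gain comes from the \<open>Q\<close> blocks of one class, about one site in
  \<open>R\<close>; so its price is fixed after \<open>R\<close>, and \<open>R\<close> after the
  tolerance of the second comparison. Each comparison enlarges the covariance by a small multiple of
  the identity: the first increase is an error term of the second comparison, the second is
  independent noise added to the limit law. Densities are averages of products of one-dimensional
  normal densities, so estimates reduce to single coordinates. Functions of times up to
  \<open>t\<close> require only averages at times below \<open>t\<close>; at \<open>t = 0\<close>
  there are none, so the induction has no separate base case.\<close>

definition quad_form :: "'i set \<Rightarrow> ('i \<Rightarrow> 'i \<Rightarrow> real) \<Rightarrow> ('i \<Rightarrow> real) \<Rightarrow> real" where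
  "quad_form I K \<xi> = (\<Sum>i\<in>I. \<Sum>j\<in>I. \<xi> i * K i j * \<xi> j)"

definition psd :: "'i set \<Rightarrow> ('i \<Rightarrow> 'i \<Rightarrow> real) \<Rightarrow> bool" where
  "psd I K \<longleftrightarrow> (\<forall>i\<in>I. \<forall>j\<in>I. K i j = K j i) \<and> (\<forall>\<xi>. 0 \<le> quad_form I K \<xi>)"

abbreviation add_diag :: "('i \<Rightarrow> 'i \<Rightarrow> real) \<Rightarrow> real \<Rightarrow> 'i \<Rightarrow> 'i \<Rightarrow> real" where
  "add_diag K a \<equiv> (\<lambda>i j. K i j + (if i = j then a else 0))"

lemma quad_form_cong: "(\<And>i j. i \<in> I \<Longrightarrow> j \<in> I \<Longrightarrow> K i j = K' i j) \<Longrightarrow> (\<And>i. i \<in> I \<Longrightarrow> \<xi> i = \<xi>' i) \<Longrightarrow> quad_form I K \<xi> = quad_form I K' \<xi>'"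
  unfolding quad_form_def by (intro sum.cong) auto

lemma quad_form_add: "quad_form I (\<lambda>i j. K i j + L i j) \<xi> = quad_form I K \<xi> + quad_form I L \<xi>"
  by (simp add: quad_form_def algebra_simps sum.distrib)

lemma quad_form_diff: "quad_form I (\<lambda>i j. K i j - L i j) \<xi> = quad_form I K \<xi> - quad_form I L \<xi>"
  by (simp add: quad_form_def algebra_simps sum_subtractf)

lemma quad_form_diag:
  assumes "finite I"
  shows "quad_form I (\<lambda>i j. if i = j then a else 0) \<xi> = a * (\<Sum>i\<in>I. (\<xi> i)\<^sup>2)"
proof -
  have "(\<Sum>j\<in>I. \<xi> i * (if i = j then a else 0) * \<xi> j) = a * (\<xi> i)\<^sup>2" if "i \<in> I" for i
  proof -
    have "(\<Sum>j\<in>I. \<xi> i * (if i = j then a else 0) * \<xi> j) = (\<Sum>j\<in>I. if i = j then a * (\<xi> i)\<^sup>2 else 0)"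
      by (intro sum.cong) (auto simp: power2_eq_square)
    then show ?thesis using that assms by simp
  qed
  then show ?thesis unfolding quad_form_def by (simp add: sum_distrib_left)
qed

lemma quad_form_add_diag:
  "finite I \<Longrightarrow> quad_form I (add_diag K a) \<xi> = quad_form I K \<xi> + a * (\<Sum>i\<in>I. (\<xi> i)\<^sup>2)"
  by (simp add: quad_form_add quad_form_diag)

lemma quad_form_gram:
  "quad_form I (\<lambda>i j. \<Sum>k\<in>L. w k i * w k j) \<xi> = (\<Sum>k\<in>L. (\<Sum>i\<in>I. \<xi> i * w k i)\<^sup>2)"
proof -
  have "(\<Sum>k\<in>L. (\<Sum>i\<in>I. \<xi> i * w k i)\<^sup>2) = (\<Sum>k\<in>L. \<Sum>i\<in>I. \<Sum>j\<in>I. \<xi> i * w k i * (\<xi> j * w k j))"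
    by (simp add: power2_eq_square sum_product)
  also have "\<dots> = (\<Sum>i\<in>I. \<Sum>j\<in>I. \<Sum>k\<in>L. \<xi> i * w k i * (\<xi> j * w k j))"
    by (subst sum.swap, intro sum.cong refl, subst sum.swap, simp)
  finally show ?thesis
    unfolding quad_form_def by (simp add: sum_distrib_left sum_distrib_right algebra_simps)
qed

lemma quad_form_insert:
  assumes "finite I" "a \<notin> I" "\<And>i. i \<in> I \<Longrightarrow> K i a = K a i"
  shows "quad_form (insert a I) K \<xi> = K a a * (\<xi> a)\<^sup>2 + 2 * \<xi> a * (\<Sum>i\<in>I. K a i * \<xi> i) + quad_form I K \<xi>"
proof -
  have *: "(\<Sum>i\<in>I. \<xi> i * K i a * \<xi> a) = \<xi> a * (\<Sum>i\<in>I. K a i * \<xi> i)"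
    using assms(3) by (simp add: sum_distrib_left algebra_simps cong: sum.cong)
  have **: "(\<Sum>j\<in>I. \<xi> a * K a j * \<xi> j) = \<xi> a * (\<Sum>i\<in>I. K a i * \<xi> i)"
    by (simp add: sum_distrib_left algebra_simps)
  have "quad_form (insert a I) K \<xi> = \<xi> a * K a a * \<xi> a + (\<Sum>j\<in>I. \<xi> a * K a j * \<xi> j)
      + ((\<Sum>i\<in>I. \<xi> i * K i a * \<xi> a) + quad_form I K \<xi>)"
    unfolding quad_form_def using assms(1,2) by (simp add: sum.distrib)
  then show ?thesis
    unfolding * ** by (simp add: power2_eq_square)
qed

lemma psd_sym: "psd I K \<Longrightarrow> i \<in> I \<Longrightarrow> j \<in> I \<Longrightarrow> K i j = K j i"
  by (simp add: psd_def)

text \<open>With a zero entry at \<open>a\<close>, the form at the vector with values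
  \<open>c\<close> at \<open>a\<close> and \<open>1\<close> at \<open>i\<close> is affine in
  \<open>c\<close>, hence negative for suitable \<open>c\<close> unless the entry between
  \<open>a\<close> and \<open>i\<close> vanishes.\<close>

lemma psd_zero_diag:
  assumes "finite I" "psd I K" "a \<in> I" "i \<in> I" "K a a = 0"
  shows "K a i = 0"
proof (rule ccontr)
  assume nz: "K a i \<noteq> 0"
  then have ai: "a \<noteq> i" using assms by auto
  \<comment> \<open>This value makes the form equal to \<open>- 1\<close>.\<close>
  define c where "c = - (K i i + 1) / (2 * K a i)"
  define \<xi> where "\<xi> = (\<lambda>j. if j = a then c else if j = i then 1 else 0 :: real)"
  have "quad_form I K \<xi> = (\<Sum>k\<in>I. \<Sum>j\<in>I. if j \<in> {a,i} \<and> k \<in> {a,i} then \<xi> k * K k j * \<xi> j else 0)"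
    unfolding quad_form_def by (intro sum.cong refl) (auto simp: \<xi>_def)
  also have "\<dots> = (\<Sum>k\<in>{a,i}. \<Sum>j\<in>{a,i}. \<xi> k * K k j * \<xi> j)"
  proof -
    have "(\<Sum>k\<in>{a,i}. \<Sum>j\<in>{a,i}. \<xi> k * K k j * \<xi> j)
       = (\<Sum>k\<in>{a,i}. \<Sum>j\<in>{a,i}. if j \<in> {a,i} \<and> k \<in> {a,i} then \<xi> k * K k j * \<xi> j else 0)"
      by (intro sum.cong refl) simp
    also have "\<dots> = (\<Sum>k\<in>{a,i}. \<Sum>j\<in>I. if j \<in> {a,i} \<and> k \<in> {a,i} then \<xi> k * K k j * \<xi> j else 0)"
      using assms by (intro sum.cong refl sum.mono_neutral_left) auto
    also have "\<dots> = (\<Sum>k\<in>I. \<Sum>j\<in>I. if j \<in> {a,i} \<and> k \<in> {a,i} then \<xi> k * K k j * \<xi> j else 0)"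
      using assms by (intro sum.mono_neutral_left) (auto intro!: sum.neutral)
    finally show ?thesis ..
  qed
  also have "\<dots> = c * K a i + K i a * c + K i i"
    using ai assms by (simp add: \<xi>_def)
  also have "\<dots> = 2 * c * K a i + K i i" using psd_sym[OF assms(2,3,4)] by simp
  also have "\<dots> = - 1" using nz by (simp add: c_def field_simps)
  finally show False using assms(2) unfolding psd_def by (metis not_one_le_zero neg_0_le_iff_le)
qed

lemma quad_form_zero_outside:
  assumes "finite E" "I \<subseteq> E" "\<And>i. i \<in> E - I \<Longrightarrow> \<xi> i = 0"
  shows "quad_form E K \<xi> = quad_form I K \<xi>"
proof -
  have "quad_form E K \<xi> = (\<Sum>i\<in>I. \<Sum>j\<in>E. \<xi> i * K i j * \<xi> j)"
    unfolding quad_form_def by (rule sum.mono_neutral_right) (use assms in auto)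
  also have "\<dots> = quad_form I K \<xi>"
    unfolding quad_form_def by (intro sum.cong refl sum.mono_neutral_right) (use assms in auto)
  finally show ?thesis .
qed

lemma psd_subset:
  assumes "psd E K" "finite E" "I \<subseteq> E"
  shows "psd I K"
  unfolding psd_def
proof (intro conjI allI)
  fix \<xi> :: "'a \<Rightarrow> real"
  define \<zeta> where "\<zeta> = (\<lambda>i. if i \<in> I then \<xi> i else 0)"
  have "0 \<le> quad_form E K \<zeta>" using assms(1) by (simp add: psd_def)
  also have "\<dots> = quad_form I K \<zeta>" by (rule quad_form_zero_outside) (use assms in \<open>auto simp: \<zeta>_def\<close>)
  also have "\<dots> = quad_form I K \<xi>" by (rule quad_form_cong) (auto simp: \<zeta>_def)
  finally show "0 \<le> quad_form I K \<xi>" .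
qed (use assms in \<open>auto simp: psd_def\<close>)

text \<open>Cholesky factorisation by induction: \<open>a\<close> is eliminated through the Schur
  complement \<open>K'\<close>. A zero pivot is harmless, because its whole row vanishes by
  \<open>psd_zero_diag\<close> and division by zero gives \<open>0\<close>.\<close>

lemma psd_factor:
  assumes "finite I" "psd I K"
  shows "\<exists>w. \<forall>i\<in>I. \<forall>j\<in>I. K i j = (\<Sum>k\<in>I. w k i * w k j)"
  using assms
proof (induction I arbitrary: K rule: finite_induct)
  case empty
  then show ?case by simp
next
  case (insert a I)
  have sym: "K i j = K j i" if "i \<in> insert a I" "j \<in> insert a I" for i j
    using insert.prems that psd_sym by metis
  define K' where "K' = (\<lambda>i j. K i j - K a i * K a j / K a a)"
  define e where "e = (\<lambda>i. if i = a then 1 else 0 :: real)"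
  have e0: "i \<in> I \<Longrightarrow> e i = 0" for i using insert.hyps by (auto simp: e_def)
  have "quad_form (insert a I) K e = quad_form {a} K e"
    by (rule quad_form_zero_outside) (use insert.hyps e0 in auto)
  then have "quad_form (insert a I) K e = K a a"
    by (simp add: quad_form_def e_def)
  then have Kaa: "0 \<le> K a a" using insert.prems unfolding psd_def by metis
  have zero: "K a i = 0" if "K a a = 0" "i \<in> I" for i
    using psd_zero_diag[OF _ insert.prems, of a i] that insert.hyps by simp
  have "psd I K'"
    unfolding psd_def
  proof (intro conjI allI)
    show "\<forall>i\<in>I. \<forall>j\<in>I. K' i j = K' j i" using sym by (auto simp: K'_def)
    fix \<xi> :: "'a \<Rightarrow> real"
    define s where "s = (\<Sum>i\<in>I. K a i * \<xi> i)"
    \<comment> \<open>For a positive pivot this value at \<open>a\<close> minimises the form over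
      that coordinate, and the minimum is the form of the Schur complement.\<close>
    define \<zeta> where "\<zeta> = \<xi>(a := - s / K a a)"
    have I\<zeta>: "i \<in> I \<Longrightarrow> \<zeta> i = \<xi> i" for i using insert.hyps by (auto simp: \<zeta>_def)
    have s': "(\<Sum>i\<in>I. K a i * \<zeta> i) = s" by (simp add: I\<zeta> s_def)
    have q\<zeta>: "quad_form I K \<zeta> = quad_form I K \<xi>" by (rule quad_form_cong) (auto simp: I\<zeta>)
    have "0 \<le> quad_form (insert a I) K \<zeta>" using insert.prems by (simp add: psd_def)
    also have "\<dots> = K a a * (\<zeta> a)\<^sup>2 + 2 * \<zeta> a * s + quad_form I K \<xi>"
      using insert.hyps by (subst quad_form_insert) (auto simp: s' q\<zeta> intro: sym)
    also have "\<dots> = quad_form I K \<xi> - s\<^sup>2 / K a a"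
      by (cases "K a a = 0") (auto simp: \<zeta>_def power2_eq_square)
    also have "s\<^sup>2 / K a a = quad_form I (\<lambda>i j. K a i * K a j / K a a) \<xi>"
      unfolding s_def quad_form_def power2_eq_square sum_product sum_divide_distrib
      by (simp add: algebra_simps)
    also have "quad_form I K \<xi> - quad_form I (\<lambda>i j. K a i * K a j / K a a) \<xi> = quad_form I K' \<xi>"
      unfolding K'_def by (simp add: quad_form_diff)
    finally show "0 \<le> quad_form I K' \<xi>" .
  qed
  then obtain w where w: "\<forall>i\<in>I. \<forall>j\<in>I. K' i j = (\<Sum>k\<in>I. w k i * w k j)"
    using insert.IH by blast
  define w' where "w' = (\<lambda>k i. if k = a then K a i / sqrt (K a a) else if i = a then 0 else w k i)"
  have "K i j = (\<Sum>k\<in>insert a I. w' k i * w' k j)" if ij: "i \<in> insert a I" "j \<in> insert a I" for i j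
  proof -
    have 1: "(\<Sum>k\<in>insert a I. w' k i * w' k j)
       = K a i * K a j / K a a + (\<Sum>k\<in>I. if i = a \<or> j = a then 0 else w k i * w k j)"
      using insert.hyps Kaa by (auto simp: w'_def intro!: sum.cong)
    show ?thesis
    proof (cases "i = a \<or> j = a")
      case True
      then show ?thesis unfolding 1 using sym[OF ij] zero ij by (cases "K a a = 0") auto
    next
      case False
      then have "K' i j = (\<Sum>k\<in>I. w k i * w k j)" using w ij by auto
      then show ?thesis unfolding 1 using False by (simp add: K'_def)
    qed
  qed
  then show ?case by blast
qed

section \<open>Gaussian vectors and their densities\<close>

abbreviation lebP :: "'i set \<Rightarrow> ('i \<Rightarrow> real) measure" where
  "lebP I \<equiv> PiM I (\<lambda>_. lborel)"

interpretation lebP: product_sigma_finite "\<lambda>_. lborel :: real measure"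
  by standard

text \<open>Fourier inversion. The value is the Gaussian density only if \<open>S\<close> dominates a positive multiple of the
  identity; otherwise the integral may be the junk value \<open>0\<close>.\<close>

definition gauss_density_fourier :: "'i set \<Rightarrow> ('i \<Rightarrow> real) \<Rightarrow> ('i \<Rightarrow> 'i \<Rightarrow> real) \<Rightarrow> ('i \<Rightarrow> real) \<Rightarrow> complex" where
  "gauss_density_fourier I m S v = complex_of_real ((1 / (2 * pi)) ^ card I) *
     (\<integral>\<zeta>. cis (\<Sum>i\<in>I. \<zeta> i * (v i - m i)) * complex_of_real (exp (- (quad_form I S \<zeta> / 2))) \<partial>lebP I)"

definition gauss_density :: "'i set \<Rightarrow> ('i \<Rightarrow> real) \<Rightarrow> ('i \<Rightarrow> 'i \<Rightarrow> real) \<Rightarrow> ('i \<Rightarrow> real) \<Rightarrow> real" where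
  "gauss_density I m S v = Re (gauss_density_fourier I m S v)"

text \<open>Specifying the characteristic function keeps degenerate covariances \<open>K\<close> possible.\<close>

definition gaussian_vector :: "'a measure \<Rightarrow> 'i set \<Rightarrow> ('i \<Rightarrow> 'a \<Rightarrow> real) \<Rightarrow> ('i \<Rightarrow> real) \<Rightarrow> ('i \<Rightarrow> 'i \<Rightarrow> real) \<Rightarrow> bool" where
  "gaussian_vector M I G m K \<longleftrightarrow> (\<forall>i\<in>I. G i \<in> borel_measurable M) \<and>
     (\<forall>\<xi>. (\<integral>\<omega>. cis (\<Sum>i\<in>I. \<xi> i * G i \<omega>) \<partial>M)
        = cis (\<Sum>i\<in>I. \<xi> i * m i) * complex_of_real (exp (- (quad_form I K \<xi> / 2))))"

section \<open>Characteristic functions and Fourier inversion for smoothed Gaussian vectors\<close>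

lemma cis_measurable [measurable]: "cis \<in> borel_measurable borel"
  by (intro borel_measurable_continuous_onI continuous_on_cis continuous_on_id)

lemma prod_cis: "(\<Prod>i\<in>I. cis (f i)) = cis (\<Sum>i\<in>I. f i)"
  by (induction I rule: infinite_finite_induct) (auto simp: cis_mult)

lemma char_std_normal_cis: "(\<integral>x. cis (t * x) \<partial>density lborel std_normal_density) = complex_of_real (exp (- (t\<^sup>2 / 2)))"
proof -
  have "char std_normal_distribution t = complex_of_real (exp (- (t\<^sup>2) / 2))"
    by (simp add: char_std_normal_distribution)
  then show ?thesis by (simp add: char_def cis_conv_exp mult.commute)
qed

text \<open>Substituting \<open>x / r\<close> for the variable turns the integral into the
  characteristic function of the standard normal law at \<open>w / r\<close>.\<close>

lemma fourier_gauss: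
  assumes r: "r > 0"
  shows "integrable lborel (\<lambda>\<zeta>. cis (\<zeta> * w) * complex_of_real (exp (- (r\<^sup>2 * \<zeta>\<^sup>2 / 2))))"
    and "(\<integral>\<zeta>. cis (\<zeta> * w) * complex_of_real (exp (- (r\<^sup>2 * \<zeta>\<^sup>2 / 2))) \<partial>lborel)
         = complex_of_real (2 * pi * normal_density 0 r w)"
proof -
  have e: "exp (- (r\<^sup>2 * \<zeta>\<^sup>2 / 2)) = sqrt (2 * pi) / r * normal_density 0 (1 / r) \<zeta>" for \<zeta>
    using r by (simp add: normal_density_def power_divide real_sqrt_divide field_simps)
  have int: "integrable lborel (\<lambda>\<zeta>. exp (- (r\<^sup>2 * \<zeta>\<^sup>2 / 2)))"
    unfolding e by (intro integrable_mult_right integrable_normal_density)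
       (use r in simp)
  show "integrable lborel (\<lambda>\<zeta>. cis (\<zeta> * w) * complex_of_real (exp (- (r\<^sup>2 * \<zeta>\<^sup>2 / 2))))"
    by (rule Bochner_Integration.integrable_bound[OF int]) (auto simp: norm_mult)
  have "(\<integral>\<zeta>. cis (\<zeta> * w) * complex_of_real (exp (- (r\<^sup>2 * \<zeta>\<^sup>2 / 2))) \<partial>lborel)
     = (1 / r) *\<^sub>R (\<integral>x. cis ((0 + (1 / r) * x) * w) * complex_of_real (exp (- (r\<^sup>2 * (0 + (1 / r) * x)\<^sup>2 / 2))) \<partial>lborel)"
    using r by (subst lborel_integral_real_affine[where c = "1 / r" and t = 0]) auto
  also have "(\<integral>x. cis ((0 + (1 / r) * x) * w) * complex_of_real (exp (- (r\<^sup>2 * (0 + (1 / r) * x)\<^sup>2 / 2))) \<partial>lborel)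
     = (\<integral>x. sqrt (2 * pi) *\<^sub>R (std_normal_density x *\<^sub>R cis ((w / r) * x)) \<partial>lborel)"
  proof (rule Bochner_Integration.integral_cong[OF refl])
    fix x
    have "r\<^sup>2 * (0 + (1 / r) * x)\<^sup>2 = x\<^sup>2" using r by (simp add: power_divide)
    moreover have "(0 + (1 / r) * x) * w = (w / r) * x" by simp
    moreover have "exp (- x\<^sup>2 / 2) = sqrt (2 * pi) * std_normal_density x"
      by (simp add: std_normal_density_def)
    ultimately show "cis ((0 + (1 / r) * x) * w) * complex_of_real (exp (- (r\<^sup>2 * (0 + (1 / r) * x)\<^sup>2 / 2)))
       = sqrt (2 * pi) *\<^sub>R (std_normal_density x *\<^sub>R cis ((w / r) * x))"
      by (simp add: scaleR_conv_of_real mult_ac)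
  qed
  also have "\<dots> = sqrt (2 * pi) *\<^sub>R (\<integral>x. cis ((w / r) * x) \<partial>density lborel std_normal_density)"
    by (subst integral_density) (simp_all del: scaleR_scaleR)
  also have "\<dots> = sqrt (2 * pi) *\<^sub>R complex_of_real (exp (- ((w / r)\<^sup>2 / 2)))"
    by (simp only: char_std_normal_cis)
  also have "(1 / r) *\<^sub>R \<dots> = complex_of_real (sqrt (2 * pi) / r * exp (- ((w / r)\<^sup>2 / 2)))"
    by (simp add: scaleR_conv_of_real)
  also have "sqrt (2 * pi) / r * exp (- ((w / r)\<^sup>2 / 2)) = 2 * pi * normal_density 0 r w"
    using r by (simp add: normal_density_def real_sqrt_mult power_divide field_simps)
  finally show "(\<integral>\<zeta>. cis (\<zeta> * w) * complex_of_real (exp (- (r\<^sup>2 * \<zeta>\<^sup>2 / 2))) \<partial>lborel)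
         = complex_of_real (2 * pi * normal_density 0 r w)" .
qed

lemma fourier_gauss_prod:
  assumes r: "r > 0" and I: "finite I"
  shows "integrable (lebP I) (\<lambda>\<zeta>. exp (- (r\<^sup>2 * (\<Sum>i\<in>I. (\<zeta> i)\<^sup>2) / 2)))"
    and "(\<integral>\<zeta>. cis (\<Sum>i\<in>I. \<zeta> i * w i) * complex_of_real (exp (- (r\<^sup>2 * (\<Sum>i\<in>I. (\<zeta> i)\<^sup>2) / 2))) \<partial>lebP I)
         = complex_of_real (\<Prod>i\<in>I. 2 * pi * normal_density 0 r (w i))"
proof -
  have e: "exp (- (r\<^sup>2 * (\<Sum>i\<in>I. (\<zeta> i)\<^sup>2) / 2)) = (\<Prod>i\<in>I. exp (- (r\<^sup>2 * (\<zeta> i)\<^sup>2 / 2)))" for \<zeta>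
    using I by (simp add: exp_sum[symmetric] sum_distrib_left sum_divide_distrib sum_negf)
  have "integrable lborel (\<lambda>\<zeta>. norm (cis (\<zeta> * 0) * complex_of_real (exp (- (r\<^sup>2 * \<zeta>\<^sup>2 / 2)))))"
    by (rule integrable_norm[OF fourier_gauss(1)[OF r]])
  then have "integrable lborel (\<lambda>\<zeta>. exp (- (r\<^sup>2 * \<zeta>\<^sup>2 / 2)))" by simp
  then show "integrable (lebP I) (\<lambda>\<zeta>. exp (- (r\<^sup>2 * (\<Sum>i\<in>I. (\<zeta> i)\<^sup>2) / 2)))"
    unfolding e by (intro lebP.product_integrable_prod I)
  have "(\<integral>\<zeta>. cis (\<Sum>i\<in>I. \<zeta> i * w i) * complex_of_real (exp (- (r\<^sup>2 * (\<Sum>i\<in>I. (\<zeta> i)\<^sup>2) / 2))) \<partial>lebP I)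
     = (\<integral>\<zeta>. (\<Prod>i\<in>I. cis (\<zeta> i * w i) * complex_of_real (exp (- (r\<^sup>2 * (\<zeta> i)\<^sup>2 / 2)))) \<partial>lebP I)"
    unfolding e by (simp add: prod.distrib prod_cis)
  also have "\<dots> = (\<Prod>i\<in>I. \<integral>\<zeta>. cis (\<zeta> * w i) * complex_of_real (exp (- (r\<^sup>2 * \<zeta>\<^sup>2 / 2))) \<partial>lborel)"
    by (intro lebP.product_integral_prod I fourier_gauss(1)[OF r])
  also have "\<dots> = complex_of_real (\<Prod>i\<in>I. 2 * pi * normal_density 0 r (w i))"
    by (simp add: fourier_gauss(2)[OF r])
  finally show "(\<integral>\<zeta>. cis (\<Sum>i\<in>I. \<zeta> i * w i) * complex_of_real (exp (- (r\<^sup>2 * (\<Sum>i\<in>I. (\<zeta> i)\<^sup>2) / 2))) \<partial>lebP I)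
         = complex_of_real (\<Prod>i\<in>I. 2 * pi * normal_density 0 r (w i))" .
qed

lemma normal_density_shift: "normal_density \<mu> \<sigma> x = normal_density 0 \<sigma> (x - \<mu>)"
  by (simp add: normal_density_def)

text \<open>Independent noise of variance \<open>r\<^sup>2\<close> multiplies the characteristic
  function by an integrable Gaussian factor. This makes the Fourier inversion absolutely convergent
  and Fubini applicable, even if \<open>K\<close> is degenerate. The left side is the density of the
  vector with the noise added.\<close>

lemma gaussian_vector_smoothed_density:
  assumes "prob_space M" and G: "gaussian_vector M I G m K" and r: "r > 0" and I: "finite I"
  shows "complex_of_real (\<integral>\<omega>. (\<Prod>i\<in>I. normal_density (G i \<omega>) r (v i)) \<partial>M) = gauss_density_fourier I m (add_diag K (r\<^sup>2)) v"
proof -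
  interpret M: prob_space M by fact
  interpret lebI: finite_product_sigma_finite "\<lambda>_. lborel :: real measure" I by standard fact
  interpret pair_sigma_finite "lebP I" M by standard
  have [measurable]: "i \<in> I \<Longrightarrow> G i \<in> borel_measurable M" for i using G by (simp add: gaussian_vector_def)
  define E where "E = (\<lambda>\<zeta>::'b \<Rightarrow> real. exp (- (r\<^sup>2 * (\<Sum>i\<in>I. (\<zeta> i)\<^sup>2) / 2)))"
  have [measurable]: "E \<in> borel_measurable (lebP I)" unfolding E_def by measurable
  define F where "F = (\<lambda>\<zeta> \<omega>. cis (\<Sum>i\<in>I. \<zeta> i * (v i - G i \<omega>)) * complex_of_real (E \<zeta>))"
  have F[measurable]: "(\<lambda>(\<zeta>, \<omega>). F \<zeta> \<omega>) \<in> borel_measurable (lebP I \<Otimes>\<^sub>M M)"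
    unfolding F_def by measurable
  have nF: "norm (F \<zeta> \<omega>) = E \<zeta>" for \<zeta> \<omega>
    by (simp add: F_def norm_mult E_def)
  have intE: "integrable (lebP I) E"
    unfolding E_def by (rule fourier_gauss_prod(1)[OF r I])
  have intF: "integrable (lebP I \<Otimes>\<^sub>M M) (\<lambda>(\<zeta>, \<omega>). F \<zeta> \<omega>)"
  proof (rule Fubini_integrable[OF F])
    show "integrable (lebP I) (\<lambda>x. \<integral>y. norm (case (x, y) of (x, xa) \<Rightarrow> F x xa) \<partial>M)"
      using intE by (simp add: nF M.prob_space)
    show "AE x in lebP I. integrable M (\<lambda>y. case (x, y) of (x, xa) \<Rightarrow> F x xa)"
    proof (rule AE_I2)
      fix x assume [measurable]: "x \<in> space (lebP I)"
      show "integrable M (\<lambda>y. case (x, y) of (x, xa) \<Rightarrow> F x xa)"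
        by (rule M.integrable_const_bound[where B = "E x"]) (auto simp: nF)
    qed
  qed
  have "complex_of_real (\<integral>\<omega>. (\<Prod>i\<in>I. normal_density (G i \<omega>) r (v i)) \<partial>M)
      = (\<integral>\<omega>. complex_of_real (\<Prod>i\<in>I. normal_density (G i \<omega>) r (v i)) \<partial>M)"
    by (rule integral_complex_of_real[symmetric])
  also have "\<dots> = (\<integral>\<omega>. complex_of_real ((1 / (2 * pi)) ^ card I) * (\<integral>\<zeta>. F \<zeta> \<omega> \<partial>lebP I) \<partial>M)"
  proof (rule Bochner_Integration.integral_cong[OF refl])
    fix \<omega>
    have "(\<integral>\<zeta>. F \<zeta> \<omega> \<partial>lebP I) = complex_of_real (\<Prod>i\<in>I. 2 * pi * normal_density 0 r (v i - G i \<omega>))"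
      unfolding F_def E_def by (rule fourier_gauss_prod(2)[OF r I])
    also have "\<dots> = complex_of_real ((2 * pi) ^ card I * (\<Prod>i\<in>I. normal_density (G i \<omega>) r (v i)))"
      by (simp add: prod.distrib normal_density_shift[of "G _ \<omega>"])
    finally show "complex_of_real (\<Prod>i\<in>I. normal_density (G i \<omega>) r (v i))
       = complex_of_real ((1 / (2 * pi)) ^ card I) * (\<integral>\<zeta>. F \<zeta> \<omega> \<partial>lebP I)"
      by (simp add: power_one_over field_simps)
  qed
  also have "\<dots> = complex_of_real ((1 / (2 * pi)) ^ card I) * (\<integral>\<omega>. (\<integral>\<zeta>. F \<zeta> \<omega> \<partial>lebP I) \<partial>M)"
    by simp
  also have "(\<integral>\<omega>. (\<integral>\<zeta>. F \<zeta> \<omega> \<partial>lebP I) \<partial>M) = (\<integral>\<zeta>. (\<integral>\<omega>. F \<zeta> \<omega> \<partial>M) \<partial>lebP I)"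
    by (rule Fubini_integral[OF intF])
  also have "\<dots> = (\<integral>\<zeta>. cis (\<Sum>i\<in>I. \<zeta> i * (v i - m i)) *
      complex_of_real (exp (- (quad_form I (add_diag K (r\<^sup>2)) \<zeta> / 2))) \<partial>lebP I)"
  proof (rule Bochner_Integration.integral_cong[OF refl])
    fix \<zeta> :: "'b \<Rightarrow> real"
    have "(\<integral>\<omega>. F \<zeta> \<omega> \<partial>M) = (\<integral>\<omega>. (cis (\<Sum>i\<in>I. \<zeta> i * v i) * complex_of_real (E \<zeta>)) * cis (\<Sum>i\<in>I. (- \<zeta> i) * G i \<omega>) \<partial>M)"
      unfolding F_def
      by (intro Bochner_Integration.integral_cong refl)
         (simp add: cis_mult sum.distrib[symmetric] algebra_simps sum_subtractf sum_negf)
    also have "\<dots> = (cis (\<Sum>i\<in>I. \<zeta> i * v i) * complex_of_real (E \<zeta>)) * (\<integral>\<omega>. cis (\<Sum>i\<in>I. (- \<zeta> i) * G i \<omega>) \<partial>M)"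
      by simp
    also have "(\<integral>\<omega>. cis (\<Sum>i\<in>I. (- \<zeta> i) * G i \<omega>) \<partial>M) = cis (\<Sum>i\<in>I. (- \<zeta> i) * m i) * complex_of_real (exp (- (quad_form I K (\<lambda>i. - \<zeta> i) / 2)))"
      using G[unfolded gaussian_vector_def, THEN conjunct2, rule_format, of "\<lambda>i. - \<zeta> i"] .
    also have "quad_form I K (\<lambda>i. - \<zeta> i) = quad_form I K \<zeta>" by (simp add: quad_form_def)
    also have "(cis (\<Sum>i\<in>I. \<zeta> i * v i) * complex_of_real (E \<zeta>)) * (cis (\<Sum>i\<in>I. (- \<zeta> i) * m i) * complex_of_real (exp (- (quad_form I K \<zeta> / 2))))
       = cis ((\<Sum>i\<in>I. \<zeta> i * v i) + (\<Sum>i\<in>I. (- \<zeta> i) * m i)) * complex_of_real (E \<zeta> * exp (- (quad_form I K \<zeta> / 2)))"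
      by (simp add: cis_mult[symmetric])
    also have "(\<Sum>i\<in>I. \<zeta> i * v i) + (\<Sum>i\<in>I. (- \<zeta> i) * m i) = (\<Sum>i\<in>I. \<zeta> i * (v i - m i))"
      by (simp add: algebra_simps sum_subtractf sum_negf)
    also have "E \<zeta> * exp (- (quad_form I K \<zeta> / 2)) = exp (- (quad_form I (add_diag K (r\<^sup>2)) \<zeta> / 2))"
      unfolding E_def exp_add[symmetric] quad_form_add_diag[OF I] by (simp add: field_simps)
    finally show "(\<integral>\<omega>. F \<zeta> \<omega> \<partial>M) = cis (\<Sum>i\<in>I. \<zeta> i * (v i - m i)) *
      complex_of_real (exp (- (quad_form I (add_diag K (r\<^sup>2)) \<zeta> / 2)))" .
  qed
  finally show ?thesis unfolding gauss_density_fourier_def .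
qed

lemma gaussian_vector_gauss_density:
  assumes "prob_space M" "gaussian_vector M I G m K" "r > 0" "finite I"
  shows "gauss_density I m (add_diag K (r\<^sup>2)) v = (\<integral>\<omega>. (\<Prod>i\<in>I. normal_density (G i \<omega>) r (v i)) \<partial>M)"
    and "gauss_density_fourier I m (add_diag K (r\<^sup>2)) v = complex_of_real (gauss_density I m (add_diag K (r\<^sup>2)) v)"
  unfolding gauss_density_def gaussian_vector_smoothed_density[OF assms, symmetric] by auto

lemma normal_density_le:
  assumes "r > 0"
  shows "normal_density \<mu> r x \<le> 1 / sqrt (2 * pi * r\<^sup>2)"
  using assms by (simp add: normal_density_def field_simps)

text \<open>The integrand is bounded, so the two kinds of integral agree; this is the form in which
  mixtures are estimated and orders of integration exchanged later.\<close>

lemma gaussian_vector_gauss_density_nn: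
  assumes M: "prob_space M" and G: "gaussian_vector M I G m K" and r: "r > 0" and I: "finite I"
  shows "ennreal (gauss_density I m (add_diag K (r\<^sup>2)) v) = (\<integral>\<^sup>+\<omega>. ennreal (\<Prod>i\<in>I. normal_density (G i \<omega>) r (v i)) \<partial>M)"
proof -
  interpret M: prob_space M by fact
  have [measurable]: "i \<in> I \<Longrightarrow> G i \<in> borel_measurable M" for i using G by (simp add: gaussian_vector_def)
  have "integrable M (\<lambda>\<omega>. \<Prod>i\<in>I. normal_density (G i \<omega>) r (v i))"
  proof (rule M.integrable_const_bound[where B = "\<Prod>i\<in>I. 1 / sqrt (2 * pi * r\<^sup>2)"])
    have "(\<Prod>i\<in>I. normal_density (G i x) r (v i)) \<le> (\<Prod>i\<in>I. 1 / sqrt (2 * pi * r\<^sup>2))" for x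
      by (intro prod_mono) (simp add: normal_density_le[OF r])
    then show "AE x in M. norm (\<Prod>i\<in>I. normal_density (G i x) r (v i)) \<le> (\<Prod>i\<in>I. 1 / sqrt (2 * pi * r\<^sup>2))"
      by (intro AE_I2) (subst real_norm_def, subst abs_of_nonneg, intro prod_nonneg, simp, blast)
    show "(\<lambda>\<omega>. \<Prod>i\<in>I. normal_density (G i \<omega>) r (v i)) \<in> borel_measurable M"
      unfolding normal_density_def by measurable
  qed
  then show ?thesis
    unfolding gaussian_vector_gauss_density(1)[OF assms]
    by (subst nn_integral_eq_integral) (auto intro!: prod_nonneg)
qed

lemma gauss_density_fourier_cong:
  assumes "\<And>i. i \<in> I \<Longrightarrow> m i = m' i" "\<And>i j. i \<in> I \<Longrightarrow> j \<in> I \<Longrightarrow> S i j = S' i j" "\<And>i. i \<in> I \<Longrightarrow> v i = v' i"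
  shows "gauss_density_fourier I m S v = gauss_density_fourier I m' S' v'"
  unfolding gauss_density_fourier_def using assms
  by (intro arg_cong2[where f = "(*)"] refl Bochner_Integration.integral_cong) (auto simp: quad_form_cong[of I S S'])

lemma gauss_density_cong:
  assumes "\<And>i. i \<in> I \<Longrightarrow> m i = m' i" "\<And>i j. i \<in> I \<Longrightarrow> j \<in> I \<Longrightarrow> S i j = S' i j" "\<And>i. i \<in> I \<Longrightarrow> v i = v' i"
  shows "gauss_density I m S v = gauss_density I m' S' v'"
  using gauss_density_fourier_cong[of I m m' S S' v v'] assms by (simp add: gauss_density_def)

section \<open>Gaussian vectors as affine images of independent standard normals\<close>

abbreviation stdP :: "'i set \<Rightarrow> ('i \<Rightarrow> real) measure" where
  "stdP I \<equiv> PiM I (\<lambda>_. density lborel std_normal_density)"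

lemma prob_std_normal: "prob_space (density lborel std_normal_density)"
  by (rule prob_space_normal_density) simp

lemma prob_stdP: "prob_space (stdP I)"
  by (intro prob_space_PiM prob_std_normal)

interpretation stdP: product_sigma_finite "\<lambda>_. density lborel std_normal_density"
  by (intro product_sigma_finite.intro prob_space_imp_sigma_finite prob_std_normal)

lemma gaussian_vector_linear:
  assumes L: "finite L" and I: "finite I"
  shows "gaussian_vector (stdP L) I (\<lambda>i z. m i + (\<Sum>k\<in>L. w k i * z k)) m (\<lambda>i j. \<Sum>k\<in>L. w k i * w k j)"
  unfolding gaussian_vector_def
proof (intro conjI ballI allI)
  show "(\<lambda>z. m i + (\<Sum>k\<in>L. w k i * z k)) \<in> borel_measurable (stdP L)" for i
  proof -
    have [measurable]: "k \<in> L \<Longrightarrow> (\<lambda>z. z k) \<in> borel_measurable (stdP L)" for k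
      using measurable_component_singleton[of k L "\<lambda>_. density lborel std_normal_density"] by simp
    show ?thesis by measurable
  qed
  fix \<xi> :: "'b \<Rightarrow> real"
  define c where "c = (\<lambda>k. \<Sum>i\<in>I. \<xi> i * w k i)"
  have "(\<Sum>i\<in>I. \<xi> i * (m i + (\<Sum>k\<in>L. w k i * z k))) = (\<Sum>i\<in>I. \<xi> i * m i) + (\<Sum>k\<in>L. c k * z k)" for z
  proof -
    have "(\<Sum>i\<in>I. \<xi> i * (\<Sum>k\<in>L. w k i * z k)) = (\<Sum>k\<in>L. c k * z k)"
      unfolding c_def sum_distrib_left sum_distrib_right by (subst sum.swap) (simp add: mult_ac)
    then show ?thesis by (simp add: algebra_simps sum.distrib)
  qed
  then have "(\<integral>z. cis (\<Sum>i\<in>I. \<xi> i * (m i + (\<Sum>k\<in>L. w k i * z k))) \<partial>stdP L)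
     = (\<integral>z. cis (\<Sum>i\<in>I. \<xi> i * m i) * (\<Prod>k\<in>L. cis (c k * z k)) \<partial>stdP L)"
    by (simp add: prod_cis cis_mult)
  also have "\<dots> = cis (\<Sum>i\<in>I. \<xi> i * m i) * (\<integral>z. (\<Prod>k\<in>L. cis (c k * z k)) \<partial>stdP L)"
    by simp
  also have "(\<integral>z. (\<Prod>k\<in>L. cis (c k * z k)) \<partial>stdP L) = (\<Prod>k\<in>L. \<integral>x. cis (c k * x) \<partial>density lborel std_normal_density)"
  proof (rule stdP.product_integral_prod[OF L])
    interpret prob_space "density lborel std_normal_density" by (rule prob_std_normal)
    fix k show "integrable (density lborel std_normal_density) (\<lambda>x. cis (c k * x))"
      by (rule integrable_const_bound[where B = 1]) auto
  qed
  also have "\<dots> = complex_of_real (exp (- ((\<Sum>k\<in>L. (c k)\<^sup>2) / 2)))"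
  proof -
    have "(\<Prod>k\<in>L. exp (- ((c k)\<^sup>2 / 2))) = exp (- ((\<Sum>k\<in>L. (c k)\<^sup>2) / 2))"
      by (simp only: exp_sum[OF L, symmetric] sum_negf sum_divide_distrib)
    then show ?thesis
      unfolding char_std_normal_cis of_real_prod[symmetric] by (rule arg_cong)
  qed
  also have "(\<Sum>k\<in>L. (c k)\<^sup>2) = quad_form I (\<lambda>i j. \<Sum>k\<in>L. w k i * w k j) \<xi>"
    by (simp add: quad_form_gram c_def)
  finally show "(\<integral>z. cis (\<Sum>i\<in>I. \<xi> i * (m i + (\<Sum>k\<in>L. w k i * z k))) \<partial>stdP L) = cis (\<Sum>i\<in>I. \<xi> i * m i)
    * complex_of_real (exp (- (quad_form I (\<lambda>i j. \<Sum>k\<in>L. w k i * w k j) \<xi> / 2)))" .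
qed

lemma gaussian_vector_cong:
  assumes "gaussian_vector M I G m K" "\<And>i j. i \<in> I \<Longrightarrow> j \<in> I \<Longrightarrow> K i j = K' i j"
  shows "gaussian_vector M I G m K'"
proof -
  have "quad_form I K \<xi> = quad_form I K' \<xi>" for \<xi> by (rule quad_form_cong) (use assms in auto)
  then show ?thesis using assms(1) by (simp add: gaussian_vector_def)
qed

text \<open>Realises a kernel on a concrete product space, with coefficients that serve all means at
  once. Identities and bounds for \<open>gauss_density\<close> are obtained by integrating over this
  space.\<close>

lemma psd_gaussian_vector:
  assumes I: "finite I" and "psd I K"
  obtains w where "\<And>m. gaussian_vector (stdP I) I (\<lambda>i z. m i + (\<Sum>k\<in>I. w k i * z k)) m K"
    "\<And>i j. i \<in> I \<Longrightarrow> j \<in> I \<Longrightarrow> (\<Sum>k\<in>I. w k i * w k j) = K i j"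
proof -
  obtain w where w: "\<forall>i\<in>I. \<forall>j\<in>I. K i j = (\<Sum>k\<in>I. w k i * w k j)"
    using psd_factor[OF assms] by blast
  show thesis
  proof (rule that[of w])
    show "gaussian_vector (stdP I) I (\<lambda>i z. m i + (\<Sum>k\<in>I. w k i * z k)) m K" for m
      by (rule gaussian_vector_cong[OF gaussian_vector_linear[OF I I]]) (use w in simp)
  qed (use w in simp)
qed

text \<open>Each factor of the product carries one summand of the covariance; a density with
  covariance \<open>K1 + K2\<close> thereby becomes a mixture of translates.\<close>

lemma gaussian_vector_add_pair:
  assumes M1: "prob_space M1" and M2: "prob_space M2"
    and G1: "gaussian_vector M1 I G1 m1 K1" and G2: "gaussian_vector M2 I G2 m2 K2"
  shows "gaussian_vector (M1 \<Otimes>\<^sub>M M2) I (\<lambda>i \<omega>. G1 i (fst \<omega>) + G2 i (snd \<omega>)) (\<lambda>i. m1 i + m2 i) (\<lambda>i j. K1 i j + K2 i j)"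
proof -
  interpret M1: prob_space M1 by fact
  interpret M2: prob_space M2 by fact
  interpret pair_prob_space M1 M2 ..
  have [measurable]: "i \<in> I \<Longrightarrow> G1 i \<in> borel_measurable M1" for i using G1 by (simp add: gaussian_vector_def)
  have [measurable]: "i \<in> I \<Longrightarrow> G2 i \<in> borel_measurable M2" for i using G2 by (simp add: gaussian_vector_def)
  show ?thesis
    unfolding gaussian_vector_def
  proof (intro conjI ballI allI)
    fix i assume "i \<in> I"
    then show "(\<lambda>\<omega>. G1 i (fst \<omega>) + G2 i (snd \<omega>)) \<in> borel_measurable (M1 \<Otimes>\<^sub>M M2)" by measurable
  next
    fix \<xi> :: "'c \<Rightarrow> real"
    let ?f = "\<lambda>x. cis (\<Sum>i\<in>I. \<xi> i * G1 i x)" and ?g = "\<lambda>y. cis (\<Sum>i\<in>I. \<xi> i * G2 i y)"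
    have "(\<integral>\<omega>. cis (\<Sum>i\<in>I. \<xi> i * (G1 i (fst \<omega>) + G2 i (snd \<omega>))) \<partial>(M1 \<Otimes>\<^sub>M M2))
       = (\<integral>\<omega>. ?f (fst \<omega>) * ?g (snd \<omega>) \<partial>(M1 \<Otimes>\<^sub>M M2))"
      by (simp add: cis_mult algebra_simps sum.distrib)
    also have "\<dots> = (\<integral>x. (\<integral>y. ?f x * ?g y \<partial>M2) \<partial>M1)"
    proof (subst integral_fst'[symmetric])
      show "integrable (M1 \<Otimes>\<^sub>M M2) (\<lambda>\<omega>. ?f (fst \<omega>) * ?g (snd \<omega>))"
        by (rule P.integrable_const_bound[where B = 1]) (auto simp: norm_mult)
    qed simp
    also have "\<dots> = (\<integral>x. ?f x \<partial>M1) * (\<integral>y. ?g y \<partial>M2)"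
      by simp
    also have "(\<integral>x. ?f x \<partial>M1) = cis (\<Sum>i\<in>I. \<xi> i * m1 i) * complex_of_real (exp (- (quad_form I K1 \<xi> / 2)))"
      using G1 by (simp add: gaussian_vector_def)
    also have "(\<integral>x. ?g x \<partial>M2) = cis (\<Sum>i\<in>I. \<xi> i * m2 i) * complex_of_real (exp (- (quad_form I K2 \<xi> / 2)))"
      using G2 by (simp add: gaussian_vector_def)
    also have "cis (\<Sum>i\<in>I. \<xi> i * m1 i) * complex_of_real (exp (- (quad_form I K1 \<xi> / 2)))
       * (cis (\<Sum>i\<in>I. \<xi> i * m2 i) * complex_of_real (exp (- (quad_form I K2 \<xi> / 2))))
      = cis (\<Sum>i\<in>I. \<xi> i * (m1 i + m2 i)) * complex_of_real (exp (- (quad_form I (\<lambda>i j. K1 i j + K2 i j) \<xi> / 2)))"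
    proof -
      have 1: "cis (\<Sum>i\<in>I. \<xi> i * (m1 i + m2 i)) = cis (\<Sum>i\<in>I. \<xi> i * m1 i) * cis (\<Sum>i\<in>I. \<xi> i * m2 i)"
        unfolding cis_mult by (simp only: distrib_left sum.distrib)
      have "exp (- (quad_form I (\<lambda>i j. K1 i j + K2 i j) \<xi> / 2)) = exp (- (quad_form I K1 \<xi> / 2)) * exp (- (quad_form I K2 \<xi> / 2))"
        unfolding quad_form_add exp_add[symmetric] by (simp add: field_simps)
      then show ?thesis unfolding 1 by simp
    qed
    finally show "(\<integral>\<omega>. cis (\<Sum>i\<in>I. \<xi> i * (G1 i (fst \<omega>) + G2 i (snd \<omega>))) \<partial>(M1 \<Otimes>\<^sub>M M2))
      = cis (\<Sum>i\<in>I. \<xi> i * (m1 i + m2 i)) * complex_of_real (exp (- (quad_form I (\<lambda>i j. K1 i j + K2 i j) \<xi> / 2)))" .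
  qed
qed

section \<open>Comparison of Gaussian densities\<close>

lemma nn_integral_std_normal_exp_linear:
  "(\<integral>\<^sup>+x. ennreal (exp (c * x)) \<partial>density lborel std_normal_density) = ennreal (exp (c\<^sup>2 / 2))"
proof -
  have e: "std_normal_density x * exp (c * x) = exp (c\<^sup>2 / 2) * normal_density c 1 x" for x :: real
    by (simp add: normal_density_def exp_add[symmetric] power2_eq_square field_simps)
  have "(\<integral>\<^sup>+x. ennreal (exp (c * x)) \<partial>density lborel std_normal_density)
      = (\<integral>\<^sup>+x. ennreal (exp (c\<^sup>2 / 2)) * ennreal (normal_density c 1 x) \<partial>lborel)"
    by (subst nn_integral_density) (auto simp: ennreal_mult[symmetric] e)
  also have "\<dots> = ennreal (exp (c\<^sup>2 / 2)) * (\<integral>\<^sup>+x. ennreal (normal_density c 1 x) \<partial>lborel)"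
    by (rule nn_integral_cmult) simp
  also have "(\<integral>\<^sup>+x. ennreal (normal_density c 1 x) \<partial>lborel) = 1"
    by (subst nn_integral_eq_integral) auto
  finally show ?thesis by simp
qed

lemma nn_integral_std_normal_exp_square:
  assumes b: "2 * b < 1"
  shows "(\<integral>\<^sup>+x. ennreal (exp (b * x\<^sup>2)) \<partial>density lborel std_normal_density) = ennreal (1 / sqrt (1 - 2 * b))"
proof -
  define r where "r = 1 / sqrt (1 - 2 * b)"
  have r: "r > 0" "r\<^sup>2 = 1 / (1 - 2 * b)" using b by (auto simp: r_def power_divide)
  have e: "std_normal_density x * exp (b * x\<^sup>2) = r * normal_density 0 r x" for x :: real
  proof -
    have "- (x\<^sup>2 / 2) + b * x\<^sup>2 = - (x\<^sup>2 / (2 * r\<^sup>2))" using b by (simp add: r(2) field_simps)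
    then have "exp (- (x\<^sup>2 / 2)) * exp (b * x\<^sup>2) = exp (- (x\<^sup>2 / (2 * r\<^sup>2)))"
      by (simp add: exp_add[symmetric])
    then show ?thesis using r(1) by (simp add: normal_density_def real_sqrt_mult)
  qed
  have "(\<integral>\<^sup>+x. ennreal (exp (b * x\<^sup>2)) \<partial>density lborel std_normal_density)
      = (\<integral>\<^sup>+x. ennreal r * ennreal (normal_density 0 r x) \<partial>lborel)"
    using r(1) by (subst nn_integral_density) (auto simp: ennreal_mult[symmetric] e)
  also have "\<dots> = ennreal r * (\<integral>\<^sup>+x. ennreal (normal_density 0 r x) \<partial>lborel)"
    by (rule nn_integral_cmult) simp
  also have "(\<integral>\<^sup>+x. ennreal (normal_density 0 r x) \<partial>lborel) = 1"
    using r(1) by (subst nn_integral_eq_integral) auto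
  finally show ?thesis by (simp add: r_def)
qed

lemma measurable_stdP_component:
  "k \<in> L \<Longrightarrow> (\<lambda>z. z k) \<in> borel_measurable (stdP L)"
  using measurable_component_singleton[of k L "\<lambda>_. density lborel std_normal_density"] by simp

text \<open>The square is linearised: \<open>exp (b * h\<^sup>2)\<close> is the mean of
  \<open>exp (c * h * y)\<close> over a standard normal \<open>y\<close>, where
  \<open>c\<^sup>2 = 2 * b\<close>. After the integrals are exchanged, the inner one is the
  exponential of a quadratic form in \<open>y\<close>; bounded by \<open>\<rho>\<close> times a sum
  of squares, it factorises over the coordinates.\<close>

lemma nn_integral_exp_square_linear_le:
  fixes I L :: "'i set"
  assumes L: "finite L" and I: "finite I" and b: "0 \<le> b" "2 * b * \<rho> < 1"
    and \<rho>: "\<And>\<xi>. quad_form I (\<lambda>i j. \<Sum>k\<in>L. w k i * w k j) \<xi> \<le> \<rho> * (\<Sum>i\<in>I. (\<xi> i)\<^sup>2)"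
  shows "(\<integral>\<^sup>+z. ennreal (exp (b * (\<Sum>i\<in>I. (\<Sum>k\<in>L. w k i * z k)\<^sup>2))) \<partial>stdP L)
    \<le> ennreal ((1 / sqrt (1 - 2 * b * \<rho>)) ^ card I)"
proof -
  interpret PL: prob_space "stdP L" by (rule prob_stdP)
  interpret PI: prob_space "stdP I" by (rule prob_stdP)
  interpret pair_prob_space "stdP L" "stdP I" ..
  define c where "c = sqrt (2 * b)"
  have c2: "c\<^sup>2 = 2 * b" using b by (simp add: c_def)
  define H where "H = (\<lambda>z i. \<Sum>k\<in>L. w k i * z k)"
  note measurable_stdP_component [measurable]
  have [measurable]: "(\<lambda>z. H z i) \<in> borel_measurable (stdP L)" for i unfolding H_def by measurable
  have "(\<integral>\<^sup>+z. ennreal (exp (b * (\<Sum>i\<in>I. (H z i)\<^sup>2))) \<partial>stdP L)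
     = (\<integral>\<^sup>+z. (\<integral>\<^sup>+y. ennreal (exp (\<Sum>i\<in>I. c * H z i * y i)) \<partial>stdP I) \<partial>stdP L)"
  proof (rule nn_integral_cong)
    fix z
    have "(\<integral>\<^sup>+y. ennreal (exp (\<Sum>i\<in>I. c * H z i * y i)) \<partial>stdP I)
       = (\<integral>\<^sup>+y. (\<Prod>i\<in>I. ennreal (exp (c * H z i * y i))) \<partial>stdP I)"
      using I by (simp add: exp_sum prod_ennreal)
    also have "\<dots> = (\<Prod>i\<in>I. \<integral>\<^sup>+y. ennreal (exp (c * H z i * y)) \<partial>density lborel std_normal_density)"
      by (rule stdP.product_nn_integral_prod[OF I]) simp
    also have "\<dots> = ennreal (\<Prod>i\<in>I. exp ((c * H z i)\<^sup>2 / 2))"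
      by (simp add: nn_integral_std_normal_exp_linear prod_ennreal)
    also have "(\<Prod>i\<in>I. exp ((c * H z i)\<^sup>2 / 2)) = exp (b * (\<Sum>i\<in>I. (H z i)\<^sup>2))"
      by (simp add: exp_sum[OF I, symmetric] power_mult_distrib c2 sum_distrib_left)
    finally show "ennreal (exp (b * (\<Sum>i\<in>I. (H z i)\<^sup>2))) = (\<integral>\<^sup>+y. ennreal (exp (\<Sum>i\<in>I. c * H z i * y i)) \<partial>stdP I)" ..
  qed
  also have "\<dots> = (\<integral>\<^sup>+y. (\<integral>\<^sup>+z. ennreal (exp (\<Sum>i\<in>I. c * H z i * y i)) \<partial>stdP L) \<partial>stdP I)"
    by (rule Fubini'[symmetric]) measurable
  also have "\<dots> \<le> (\<integral>\<^sup>+y. (\<Prod>i\<in>I. ennreal (exp (b * \<rho> * (y i)\<^sup>2))) \<partial>stdP I)"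
  proof (rule nn_integral_mono)
    fix y :: "'i \<Rightarrow> real"
    define d where "d = (\<lambda>k. \<Sum>i\<in>I. y i * w k i)"
    have "(\<Sum>i\<in>I. c * H z i * y i) = (\<Sum>k\<in>L. (c * d k) * z k)" for z
      unfolding H_def d_def sum_distrib_left sum_distrib_right
      by (subst sum.swap) (simp add: mult_ac)
    then have "(\<integral>\<^sup>+z. ennreal (exp (\<Sum>i\<in>I. c * H z i * y i)) \<partial>stdP L)
       = (\<integral>\<^sup>+z. (\<Prod>k\<in>L. ennreal (exp ((c * d k) * z k))) \<partial>stdP L)"
      using L by (simp add: exp_sum prod_ennreal)
    also have "\<dots> = (\<Prod>k\<in>L. \<integral>\<^sup>+z. ennreal (exp ((c * d k) * z)) \<partial>density lborel std_normal_density)"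
      by (rule stdP.product_nn_integral_prod[OF L]) simp
    also have "\<dots> = ennreal (\<Prod>k\<in>L. exp ((c * d k)\<^sup>2 / 2))"
      by (simp only: nn_integral_std_normal_exp_linear prod_ennreal exp_ge_zero)
    also have "(\<Prod>k\<in>L. exp ((c * d k)\<^sup>2 / 2)) = exp (b * (\<Sum>k\<in>L. (d k)\<^sup>2))"
      by (simp add: exp_sum[OF L, symmetric] power_mult_distrib c2 sum_distrib_left)
    also have "(\<Sum>k\<in>L. (d k)\<^sup>2) = quad_form I (\<lambda>i j. \<Sum>k\<in>L. w k i * w k j) y"
      by (simp add: quad_form_gram d_def)
    also have "ennreal (exp (b * \<dots>)) \<le> ennreal (exp (b * (\<rho> * (\<Sum>i\<in>I. (y i)\<^sup>2))))"
      using b by (intro ennreal_leI) (simp add: mult_left_mono \<rho>)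
    also have "exp (b * (\<rho> * (\<Sum>i\<in>I. (y i)\<^sup>2))) = (\<Prod>i\<in>I. exp (b * \<rho> * (y i)\<^sup>2))"
      by (simp add: exp_sum[OF I, symmetric] sum_distrib_left mult_ac)
    finally show "(\<integral>\<^sup>+z. ennreal (exp (\<Sum>i\<in>I. c * H z i * y i)) \<partial>stdP L) \<le> (\<Prod>i\<in>I. ennreal (exp (b * \<rho> * (y i)\<^sup>2)))"
      by (simp add: prod_ennreal)
  qed
  also have "\<dots> = (\<Prod>i\<in>I. \<integral>\<^sup>+y. ennreal (exp (b * \<rho> * y\<^sup>2)) \<partial>density lborel std_normal_density)"
    by (rule stdP.product_nn_integral_prod[OF I]) simp
  also have "\<dots> = (\<Prod>i\<in>I. ennreal (1 / sqrt (1 - 2 * b * \<rho>)))"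
    using b(2) by (subst nn_integral_std_normal_exp_square) (auto simp: mult_ac)
  also have "\<dots> = ennreal (1 / sqrt (1 - 2 * b * \<rho>)) ^ card I" by simp
  also have "\<dots> = ennreal ((1 / sqrt (1 - 2 * b * \<rho>)) ^ card I)"
    using b(2) by (subst ennreal_power) auto
  finally show ?thesis unfolding H_def .
qed

text \<open>Widening raises the exponential factor, so only the ratio of the normalising constants
  is lost.\<close>

lemma normal_density_le_wider:
  assumes r: "r > 0" and \<delta>: "\<delta> \<ge> 0"
  shows "normal_density \<mu> r x \<le> sqrt (1 + \<delta> / r\<^sup>2) * normal_density \<mu> (sqrt (r\<^sup>2 + \<delta>)) x"
proof -
  have r2: "r\<^sup>2 > 0" using r by simp
  have q: "(sqrt (r\<^sup>2 + \<delta>))\<^sup>2 = r\<^sup>2 + \<delta>" using \<delta> r2 by simp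
  have a: "1 + \<delta> / r\<^sup>2 = (r\<^sup>2 + \<delta>) / r\<^sup>2" using r2 by (simp add: field_simps)
  have c: "sqrt (1 + \<delta> / r\<^sup>2) * (1 / sqrt (2 * pi * (r\<^sup>2 + \<delta>))) = 1 / sqrt (2 * pi * r\<^sup>2)"
  proof -
    define X where "X = r\<^sup>2 + \<delta>"
    have "X > 0" unfolding X_def using r2 \<delta> by (rule add_pos_nonneg)
    then show ?thesis
      unfolding a X_def[symmetric] using r by (simp add: real_sqrt_mult real_sqrt_divide)
  qed
  have "(x - \<mu>)\<^sup>2 / (2 * (r\<^sup>2 + \<delta>)) \<le> (x - \<mu>)\<^sup>2 / (2 * r\<^sup>2)"
    using r2 \<delta> by (intro divide_left_mono mult_pos_pos) (auto intro: add_pos_nonneg)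
  then have "exp (- (x - \<mu>)\<^sup>2 / (2 * r\<^sup>2)) \<le> exp (- (x - \<mu>)\<^sup>2 / (2 * (r\<^sup>2 + \<delta>)))" by simp
  then have "1 / sqrt (2 * pi * r\<^sup>2) * exp (- (x - \<mu>)\<^sup>2 / (2 * r\<^sup>2))
      \<le> 1 / sqrt (2 * pi * r\<^sup>2) * exp (- (x - \<mu>)\<^sup>2 / (2 * (r\<^sup>2 + \<delta>)))"
    by (intro mult_left_mono) auto
  then show ?thesis unfolding normal_density_def q c[symmetric] by (simp only: mult.assoc)
qed

text \<open>By \<open>2 * a * h \<le> \<eta> * a\<^sup>2 + h\<^sup>2 / \<eta>\<close> the
  translation costs a fraction \<open>\<eta>\<close> of the quadratic exponent, absorbed by the
  larger variance, and a factor depending on \<open>h\<close> alone.\<close>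

lemma normal_density_translate_le:
  assumes r: "r > 0" and \<eta>: "0 < \<eta>" "\<eta> < 1"
  shows "normal_density (g + h) r x
     \<le> 1 / sqrt (1 - \<eta>) * normal_density g (r / sqrt (1 - \<eta>)) x * exp (1 / (2 * \<eta> * r\<^sup>2) * h\<^sup>2)"
proof -
  define a where "a = x - g"
  have r2: "r\<^sup>2 > 0" using r by simp
  have q: "(r / sqrt (1 - \<eta>))\<^sup>2 = r\<^sup>2 / (1 - \<eta>)" using \<eta> by (simp add: power_divide)
  have "0 \<le> (\<eta> * a - h)\<^sup>2" by simp
  then have "2 * \<eta> * a * h \<le> \<eta>\<^sup>2 * a\<^sup>2 + h\<^sup>2" by (simp add: power2_eq_square algebra_simps)
  then have "2 * a * h \<le> \<eta> * a\<^sup>2 + h\<^sup>2 / \<eta>" using \<eta> by (simp add: power2_eq_square field_simps)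
  then have "(1 - \<eta>) * a\<^sup>2 - h\<^sup>2 / \<eta> \<le> (a - h)\<^sup>2"
    by (simp add: power2_eq_square algebra_simps) (smt (verit) zero_le_square)
  then have "((1 - \<eta>) * a\<^sup>2 - h\<^sup>2 / \<eta>) / (2 * r\<^sup>2) \<le> (a - h)\<^sup>2 / (2 * r\<^sup>2)"
    using r2 by (intro divide_right_mono) auto
  then have "- ((a - h)\<^sup>2 / (2 * r\<^sup>2)) \<le> - (a\<^sup>2 / (2 * (r\<^sup>2 / (1 - \<eta>)))) + 1 / (2 * \<eta> * r\<^sup>2) * h\<^sup>2"
    using \<eta> r2 by (simp add: diff_divide_distrib mult_ac)
  then have "exp (- ((a - h)\<^sup>2 / (2 * r\<^sup>2))) \<le> exp (- (a\<^sup>2 / (2 * (r\<^sup>2 / (1 - \<eta>))))) * exp (1 / (2 * \<eta> * r\<^sup>2) * h\<^sup>2)"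
    by (simp add: exp_add[symmetric])
  then have le: "1 / sqrt (2 * pi * r\<^sup>2) * exp (- ((a - h)\<^sup>2 / (2 * r\<^sup>2)))
     \<le> 1 / sqrt (2 * pi * r\<^sup>2) * (exp (- (a\<^sup>2 / (2 * (r\<^sup>2 / (1 - \<eta>))))) * exp (1 / (2 * \<eta> * r\<^sup>2) * h\<^sup>2))"
    by (intro mult_left_mono) auto
  have c: "1 / sqrt (2 * pi * r\<^sup>2) = 1 / sqrt (1 - \<eta>) * (1 / sqrt (2 * pi * (r\<^sup>2 / (1 - \<eta>))))"
    using r \<eta> by (simp add: real_sqrt_mult real_sqrt_divide field_simps)
  have ah: "x - (g + h) = a - h" by (simp add: a_def)
  show ?thesis
    using le unfolding normal_density_def q ah a_def[symmetric] c by (simp only: mult.assoc minus_divide_left)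
qed

text \<open>\<open>N(m1, S1)\<close> with slightly widened covariance is a mixture of the translates \<open>N(m2 + h, S2)\<close> over a
  small Gaussian \<open>h\<close>. By AM-GM each translate costs a factor \<open>exp (O (\<bar>h\<bar>\<^sup>2))\<close> and a small
  increase of the variance, and \<open>h\<close> is then integrated out.\<close>

lemma gauss_density_domination_explicit:
  fixes I :: "'i set"
  assumes I: "finite I" and r: "r > 0" and \<eta>: "0 < \<eta>" "\<eta> < 1" and \<delta>: "0 < \<delta>" "\<delta> \<le> r\<^sup>2"
    and lam: "lam = 1 / (2 * \<eta> * r\<^sup>2)" "8 * lam * \<delta> < 1"
    and S1: "psd I (add_diag S1 (- (2 * r\<^sup>2)))"
    and S2: "\<And>i j. i \<in> I \<Longrightarrow> j \<in> I \<Longrightarrow> S2 i j = S2 j i"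
    and S12: "\<And>\<xi>. \<bar>quad_form I S1 \<xi> - quad_form I S2 \<xi>\<bar> \<le> \<delta> * (\<Sum>i\<in>I. (\<xi> i)\<^sup>2)"
    and m12: "\<And>i. i \<in> I \<Longrightarrow> \<bar>m1 i - m2 i\<bar> \<le> \<delta>"
  shows "0 \<le> gauss_density I m2 (add_diag S2 (r\<^sup>2 * \<eta> / (1 - \<eta>))) v \<and>
    gauss_density I m1 S1 v \<le> (sqrt (1 + \<delta> / r\<^sup>2) * exp (2 * lam * \<delta>\<^sup>2) * (1 / sqrt (1 - 8 * lam * \<delta>)) * (1 / sqrt (1 - \<eta>))) ^ card I
      * gauss_density I m2 (add_diag S2 (r\<^sup>2 * \<eta> / (1 - \<eta>))) v"
proof -
  interpret PI: prob_space "stdP I" by (rule prob_stdP)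
  interpret PP: pair_prob_space "stdP I" "stdP I" ..
  let ?N = "\<lambda>\<xi> :: 'i \<Rightarrow> real. \<Sum>i\<in>I. (\<xi> i)\<^sup>2"
  have N0: "0 \<le> ?N \<xi>" for \<xi> by (simp add: sum_nonneg)
  have r2: "r\<^sup>2 > 0" using r by simp
  have lam0: "lam > 0" using lam(1) \<eta> r2 by simp
  have symS1: "S1 i j = S1 j i" if "i \<in> I" "j \<in> I" for i j
    using psd_sym[OF S1 that] by (auto split: if_splits)
  have low: "2 * r\<^sup>2 * ?N \<xi> \<le> quad_form I S1 \<xi>" for \<xi>
    using S1 I by (auto simp: psd_def quad_form_add_diag dest: spec[of _ \<xi>])
  have mono: "\<delta> * ?N \<xi> \<le> r\<^sup>2 * ?N \<xi>" for \<xi> using \<delta> N0 by (intro mult_right_mono) auto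
  \<comment> \<open>All three kernels are positive semidefinite: the lower bound
    \<open>2 * r\<^sup>2\<close> for \<open>S1\<close> leaves room for subtracting
    \<open>r\<^sup>2\<close> and for the perturbation \<open>\<delta> \<le> r\<^sup>2\<close>. They
    are tied together because \<open>S1\<close> plus \<open>\<delta>\<close> on the diagonal equals
    \<open>K2 + R\<close> plus \<open>r\<^sup>2\<close> on the diagonal.\<close>
  define K1 where "K1 = add_diag S1 (- (r\<^sup>2))"
  define K2 where "K2 = add_diag S2 (- (r\<^sup>2))"
  define R where "R = add_diag (\<lambda>i j. S1 i j - S2 i j) \<delta>"
  have qK1: "quad_form I K1 \<xi> = quad_form I S1 \<xi> - r\<^sup>2 * ?N \<xi>" for \<xi>
    unfolding K1_def using quad_form_add_diag[OF I, of S1 "- (r\<^sup>2)" \<xi>] by simp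
  have qK2: "quad_form I K2 \<xi> = quad_form I S2 \<xi> - r\<^sup>2 * ?N \<xi>" for \<xi>
    unfolding K2_def using quad_form_add_diag[OF I, of S2 "- (r\<^sup>2)" \<xi>] by simp
  have qR: "quad_form I R \<xi> = quad_form I S1 \<xi> - quad_form I S2 \<xi> + \<delta> * ?N \<xi>" for \<xi>
    unfolding R_def by (simp add: quad_form_add_diag[OF I] quad_form_diff)
  have "psd I K1"
    unfolding psd_def
  proof (intro conjI allI ballI)
    show "0 \<le> quad_form I K1 \<xi>" for \<xi>
    proof -
      have "0 \<le> r\<^sup>2 * ?N \<xi>" using r2 N0[of \<xi>] by simp
      then show ?thesis using low[of \<xi>] unfolding qK1 by linarith
    qed
  qed (auto simp: K1_def intro: symS1)
  then obtain w1 where w1: "\<And>m. gaussian_vector (stdP I) I (\<lambda>i z. m i + (\<Sum>k\<in>I. w1 k i * z k)) m K1"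
    by (rule psd_gaussian_vector[OF I]) (rule that)
  have "psd I K2"
    unfolding psd_def
  proof (intro conjI allI ballI)
    show "0 \<le> quad_form I K2 \<xi>" for \<xi>
    proof -
      have "2 * r\<^sup>2 * ?N \<xi> = r\<^sup>2 * ?N \<xi> + r\<^sup>2 * ?N \<xi>" by simp
      then show ?thesis
        using low[of \<xi>] mono[of \<xi>] S12[of \<xi>] unfolding qK2 by linarith
    qed
  qed (auto simp: K2_def intro: S2)
  then obtain w2 where w2: "\<And>m. gaussian_vector (stdP I) I (\<lambda>i z. m i + (\<Sum>k\<in>I. w2 k i * z k)) m K2"
    by (rule psd_gaussian_vector[OF I]) (rule that)
  have "psd I R"
    unfolding psd_def
  proof (intro conjI allI ballI)
    show "0 \<le> quad_form I R \<xi>" for \<xi> using S12[of \<xi>] unfolding qR by linarith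
  qed (simp add: R_def, metis S2 symS1)
  then obtain wR where wR: "\<And>m. gaussian_vector (stdP I) I (\<lambda>i z. m i + (\<Sum>k\<in>I. wR k i * z k)) m R"
    and wR2: "\<And>i j. i \<in> I \<Longrightarrow> j \<in> I \<Longrightarrow> (\<Sum>k\<in>I. wR k i * wR k j) = R i j"
    by (rule psd_gaussian_vector[OF I]) (rule that)
  have qwR: "quad_form I (\<lambda>i j. \<Sum>k\<in>I. wR k i * wR k j) \<xi> \<le> (2 * \<delta>) * ?N \<xi>" for \<xi>
  proof -
    have "quad_form I (\<lambda>i j. \<Sum>k\<in>I. wR k i * wR k j) \<xi> = quad_form I R \<xi>" by (rule quad_form_cong) (auto simp: wR2)
    then show ?thesis using S12[of \<xi>] unfolding qR by simp
  qed
  \<comment> \<open>The diagonal increase \<open>\<delta>\<close>, which makes \<open>R\<close>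
    positive semidefinite, is bought by widening each one-dimensional density from \<open>r\<close>
    to \<open>q\<close>.\<close>
  define c where "c = sqrt (1 + \<delta> / r\<^sup>2)"
  define q where "q = sqrt (r\<^sup>2 + \<delta>)"
  have q: "q > 0" "q\<^sup>2 = r\<^sup>2 + \<delta>" using \<delta> r2 by (auto simp: q_def)
  have c0: "0 \<le> c" using \<delta> by (simp add: c_def)
  let ?G1 = "\<lambda>i z. m1 i + (\<Sum>k\<in>I. w1 k i * z k)"
  have "gauss_density I m1 S1 v = gauss_density I m1 (add_diag K1 (r\<^sup>2)) v" by (rule gauss_density_cong) (auto simp: K1_def)
  then have "ennreal (gauss_density I m1 S1 v) = (\<integral>\<^sup>+z. ennreal (\<Prod>i\<in>I. normal_density (?G1 i z) r (v i)) \<partial>stdP I)"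
    using gaussian_vector_gauss_density_nn[OF prob_stdP w1 r I] by simp
  also have "\<dots> \<le> (\<integral>\<^sup>+z. ennreal (c ^ card I) * ennreal (\<Prod>i\<in>I. normal_density (?G1 i z) q (v i)) \<partial>stdP I)"
  proof (rule nn_integral_mono)
    fix z
    have "(\<Prod>i\<in>I. normal_density (?G1 i z) r (v i)) \<le> (\<Prod>i\<in>I. c * normal_density (?G1 i z) q (v i))"
      unfolding c_def q_def by (intro prod_mono conjI normal_density_le_wider) (use r \<delta> in auto)
    also have "\<dots> = c ^ card I * (\<Prod>i\<in>I. normal_density (?G1 i z) q (v i))"
      by (simp add: prod.distrib)
    finally show "ennreal (\<Prod>i\<in>I. normal_density (?G1 i z) r (v i))
       \<le> ennreal (c ^ card I) * ennreal (\<Prod>i\<in>I. normal_density (?G1 i z) q (v i))"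
      using c0 by (simp add: ennreal_mult[symmetric] prod_nonneg ennreal_leI)
  qed
  also have "\<dots> = ennreal (c ^ card I) * (\<integral>\<^sup>+z. ennreal (\<Prod>i\<in>I. normal_density (?G1 i z) q (v i)) \<partial>stdP I)"
    by (rule nn_integral_cmult) (simp add: normal_density_def)
  also have "(\<integral>\<^sup>+z. ennreal (\<Prod>i\<in>I. normal_density (?G1 i z) q (v i)) \<partial>stdP I) = ennreal (gauss_density I m1 (add_diag K1 (q\<^sup>2)) v)"
    by (rule gaussian_vector_gauss_density_nn[OF prob_stdP w1 q(1) I, symmetric])
  also have "gauss_density I m1 (add_diag K1 (q\<^sup>2)) v = gauss_density I (\<lambda>i. m2 i + (m1 i - m2 i)) (add_diag (\<lambda>i j. K2 i j + R i j) (r\<^sup>2)) v"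
    by (rule gauss_density_cong) (auto simp: K1_def K2_def R_def q)
  finally have step1: "ennreal (gauss_density I m1 S1 v) \<le> ennreal (c ^ card I) *
      ennreal (gauss_density I (\<lambda>i. m2 i + (m1 i - m2 i)) (add_diag (\<lambda>i j. K2 i j + R i j) (r\<^sup>2)) v)" .
  \<comment> \<open>The deviation in the translation bound. Adding \<open>r'\<^sup>2\<close> to the
    diagonal of \<open>K2\<close> gives \<open>S2\<close> increased by
    \<open>r\<^sup>2 * \<eta> / (1 - \<eta>)\<close>.\<close>
  define r' where "r' = r / sqrt (1 - \<eta>)"
  have r': "r' > 0" "r'\<^sup>2 = r\<^sup>2 / (1 - \<eta>)" using r \<eta> by (auto simp: r'_def power_divide)
  let ?G2 = "\<lambda>i z. m2 i + (\<Sum>k\<in>I. w2 k i * z k)"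
  let ?Hz = "\<lambda>i y. \<Sum>k\<in>I. wR k i * y k"
  let ?H = "\<lambda>i y. (m1 i - m2 i) + ?Hz i y"
  define b where "b = 1 / sqrt (1 - \<eta>)"
  have b0: "0 \<le> b" using \<eta> by (simp add: b_def)
  define A where "A = (\<lambda>z. ennreal (\<Prod>i\<in>I. normal_density (?G2 i z) r' (v i)))"
  define E where "E = (\<lambda>y. ennreal (exp (2 * lam * (\<Sum>i\<in>I. (?Hz i y)\<^sup>2))))"
  note measurable_stdP_component [measurable]
  have [measurable]: "A \<in> borel_measurable (stdP I)" "E \<in> borel_measurable (stdP I)"
    unfolding A_def E_def normal_density_def by measurable
  define C where "C = (b * exp (2 * lam * \<delta>\<^sup>2)) ^ card I"
  have C0: "0 \<le> C" using b0 by (simp add: C_def)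
  have "ennreal (gauss_density I (\<lambda>i. m2 i + (m1 i - m2 i)) (add_diag (\<lambda>i j. K2 i j + R i j) (r\<^sup>2)) v)
      = (\<integral>\<^sup>+\<omega>. ennreal (\<Prod>i\<in>I. normal_density (?G2 i (fst \<omega>) + ?H i (snd \<omega>)) r (v i)) \<partial>(stdP I \<Otimes>\<^sub>M stdP I))"
    by (rule gaussian_vector_gauss_density_nn[OF PP.P.prob_space_axioms gaussian_vector_add_pair[OF prob_stdP prob_stdP w2 wR] r I])
  also have "\<dots> \<le> (\<integral>\<^sup>+\<omega>. ennreal C * (A (fst \<omega>) * E (snd \<omega>)) \<partial>(stdP I \<Otimes>\<^sub>M stdP I))"
  proof (rule nn_integral_mono)
    fix \<omega> :: "('i \<Rightarrow> real) \<times> ('i \<Rightarrow> real)"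
    obtain z y where \<omega>: "\<omega> = (z, y)" by force
    have "(\<Prod>i\<in>I. normal_density (?G2 i z + ?H i y) r (v i))
       \<le> (\<Prod>i\<in>I. (b * exp (2 * lam * \<delta>\<^sup>2)) * (normal_density (?G2 i z) r' (v i) * exp (2 * lam * (?Hz i y)\<^sup>2)))"
    proof (intro prod_mono conjI)
      fix i assume i: "i \<in> I"
      have h: "(?H i y)\<^sup>2 \<le> 2 * \<delta>\<^sup>2 + 2 * (?Hz i y)\<^sup>2"
      proof -
        have "(x + t)\<^sup>2 \<le> 2 * x\<^sup>2 + 2 * t\<^sup>2" for x t :: real
          using zero_le_power2[of "x - t"] by (simp add: power2_eq_square algebra_simps)
        from this[of "m1 i - m2 i" "?Hz i y"] have "(?H i y)\<^sup>2 \<le> 2 * (m1 i - m2 i)\<^sup>2 + 2 * (?Hz i y)\<^sup>2" .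
        moreover have "(m1 i - m2 i)\<^sup>2 \<le> \<delta>\<^sup>2"
          using m12[OF i] by (metis abs_ge_zero power2_abs power_mono)
        ultimately show ?thesis by linarith
      qed
      have "normal_density (?G2 i z + ?H i y) r (v i) \<le> b * normal_density (?G2 i z) r' (v i) * exp (lam * (?H i y)\<^sup>2)"
        unfolding b_def r'_def lam(1) by (rule normal_density_translate_le[OF r \<eta>])
      also have "\<dots> \<le> b * normal_density (?G2 i z) r' (v i) * exp (lam * (2 * \<delta>\<^sup>2 + 2 * (?Hz i y)\<^sup>2))"
        using b0 lam0 h by (intro mult_left_mono) auto
      also have "exp (lam * (2 * \<delta>\<^sup>2 + 2 * (?Hz i y)\<^sup>2)) = exp (2 * lam * \<delta>\<^sup>2) * exp (2 * lam * (?Hz i y)\<^sup>2)"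
        by (simp add: exp_add[symmetric] algebra_simps)
      finally show "normal_density (?G2 i z + ?H i y) r (v i)
        \<le> (b * exp (2 * lam * \<delta>\<^sup>2)) * (normal_density (?G2 i z) r' (v i) * exp (2 * lam * (?Hz i y)\<^sup>2))"
        by (simp only: mult_ac)
    qed simp
    also have "\<dots> = C * ((\<Prod>i\<in>I. normal_density (?G2 i z) r' (v i)) * exp (2 * lam * (\<Sum>i\<in>I. (?Hz i y)\<^sup>2)))"
      unfolding prod.distrib prod_constant C_def by (simp add: exp_sum[OF I] sum_distrib_left power_mult_distrib)
    finally show "ennreal (\<Prod>i\<in>I. normal_density (?G2 i (fst \<omega>) + ?H i (snd \<omega>)) r (v i)) \<le> ennreal C * (A (fst \<omega>) * E (snd \<omega>))"
      unfolding A_def E_def \<omega> using C0 by (simp add: ennreal_mult[symmetric] prod_nonneg ennreal_leI)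
  qed
  also have "\<dots> = ennreal C * ((\<integral>\<^sup>+z. A z \<partial>stdP I) * (\<integral>\<^sup>+y. E y \<partial>stdP I))"
    by (simp add: nn_integral_cmult PI.nn_integral_fst[symmetric] nn_integral_multc)
  also have "(\<integral>\<^sup>+z. A z \<partial>stdP I) = ennreal (gauss_density I m2 (add_diag K2 (r'\<^sup>2)) v)"
    unfolding A_def by (rule gaussian_vector_gauss_density_nn[OF prob_stdP w2 r'(1) I, symmetric])
  also have "gauss_density I m2 (add_diag K2 (r'\<^sup>2)) v = gauss_density I m2 (add_diag S2 (r\<^sup>2 * \<eta> / (1 - \<eta>))) v"
    by (rule gauss_density_cong) (use \<eta> in \<open>auto simp: K2_def r' field_simps\<close>)
  \<comment> \<open>Here \<open>b = 2 * lam\<close>, where the \<open>2\<close> comes from splitting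
    the square of mean difference plus \<open>?Hz\<close>, and \<open>\<rho> = 2 * \<delta>\<close>
    by \<open>qwR\<close>; so \<open>2 * b * \<rho>\<close> is
    \<open>8 * lam * \<delta>\<close>.\<close>
  also have "(\<integral>\<^sup>+y. E y \<partial>stdP I) \<le> ennreal ((1 / sqrt (1 - 8 * lam * \<delta>)) ^ card I)"
    unfolding E_def using nn_integral_exp_square_linear_le[OF I I _ _ qwR, of "2 * lam"] lam0 lam(2)
    by (simp add: mult_ac)
  finally have step2: "ennreal (gauss_density I (\<lambda>i. m2 i + (m1 i - m2 i)) (add_diag (\<lambda>i j. K2 i j + R i j) (r\<^sup>2)) v)
     \<le> ennreal C * (ennreal (gauss_density I m2 (add_diag S2 (r\<^sup>2 * \<eta> / (1 - \<eta>))) v) * ennreal ((1 / sqrt (1 - 8 * lam * \<delta>)) ^ card I))"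
    by (simp add: mult_left_mono)
  have g0: "0 \<le> gauss_density I m2 (add_diag S2 (r\<^sup>2 * \<eta> / (1 - \<eta>))) v"
  proof -
    have "gauss_density I m2 (add_diag S2 (r\<^sup>2 * \<eta> / (1 - \<eta>))) v = gauss_density I m2 (add_diag K2 (r'\<^sup>2)) v"
      by (rule gauss_density_cong) (use \<eta> in \<open>auto simp: K2_def r' field_simps\<close>)
    then show ?thesis
      using gaussian_vector_gauss_density(1)[OF prob_stdP w2 r'(1) I] by (simp add: prod_nonneg)
  qed
  have d0: "0 \<le> 1 / sqrt (1 - 8 * lam * \<delta>)" using lam(2) by simp
  from step1 have "ennreal (gauss_density I m1 S1 v) \<le> ennreal (c ^ card I) * (ennreal C * (ennreal (gauss_density I m2 (add_diag S2 (r\<^sup>2 * \<eta> / (1 - \<eta>))) v) * ennreal ((1 / sqrt (1 - 8 * lam * \<delta>)) ^ card I)))"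
    by (rule order_trans) (rule mult_left_mono[OF step2], simp)
  also have "\<dots> = ennreal (c ^ card I * (C * (gauss_density I m2 (add_diag S2 (r\<^sup>2 * \<eta> / (1 - \<eta>))) v * (1 / sqrt (1 - 8 * lam * \<delta>)) ^ card I)))"
    using c0 C0 g0 d0 by (simp only: ennreal_mult[symmetric] mult_nonneg_nonneg zero_le_power)
  finally have "gauss_density I m1 S1 v \<le> c ^ card I * (C * (gauss_density I m2 (add_diag S2 (r\<^sup>2 * \<eta> / (1 - \<eta>))) v * (1 / sqrt (1 - 8 * lam * \<delta>)) ^ card I))"
    using c0 C0 g0 d0 by (simp add: mult_nonneg_nonneg del: ennreal_mult)
  then show ?thesis
    unfolding c_def C_def b_def power_mult_distrib using g0 by (simp only: mult_ac simp_thms)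
qed

text \<open>The constants depend on \<open>s\<close>, \<open>\<kappa>\<close> and
  \<open>\<tau>\<close> only and serve all finite index sets. The parameter \<open>\<eta>\<close> is
  fixed before \<open>\<delta>\<close>, because the rate \<open>lam\<close> grows as
  \<open>\<eta>\<close> shrinks and \<open>\<delta>\<close> must be small against
  \<open>1 / lam\<close>.\<close>

lemma gauss_density_domination:
  assumes s: "s > 0" and \<kappa>: "\<kappa> > 0" and \<tau>: "\<tau> > 0"
  obtains \<delta> a where "\<delta> > 0" "0 < a" "a < \<tau>"
    "\<And>(I :: 'i set) m1 m2 S1 S2 v. finite I \<Longrightarrow> psd I (add_diag S1 (- (s\<^sup>2))) \<Longrightarrow>
       (\<And>i j. i \<in> I \<Longrightarrow> j \<in> I \<Longrightarrow> S2 i j = S2 j i) \<Longrightarrow>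
       (\<And>\<xi>. \<bar>quad_form I S1 \<xi> - quad_form I S2 \<xi>\<bar> \<le> \<delta> * (\<Sum>i\<in>I. (\<xi> i)\<^sup>2)) \<Longrightarrow>
       (\<And>i. i \<in> I \<Longrightarrow> \<bar>m1 i - m2 i\<bar> \<le> \<delta>) \<Longrightarrow>
       gauss_density I m1 S1 v \<le> exp (\<kappa> * real (card I)) * gauss_density I m2 (add_diag S2 a) v"
proof -
  \<comment> \<open>Turns the lower bound \<open>s\<^sup>2\<close> on the covariance into the
    \<open>2 * r\<^sup>2\<close> of the explicit version.\<close>
  define r where "r = s / sqrt 2"
  have r: "r > 0" and r2: "2 * r\<^sup>2 = s\<^sup>2" using s by (auto simp: r_def power_divide)
  have r20: "r\<^sup>2 > 0" using r by simp
  have "((\<lambda>\<eta>. 1 / sqrt (1 - \<eta>)) \<longlongrightarrow> 1 / sqrt (1 - 0)) (at_right (0::real))"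
    by (intro tendsto_intros) auto
  then have 1: "eventually (\<lambda>\<eta>. 1 / sqrt (1 - \<eta>) < exp (\<kappa> / 2)) (at_right (0::real))"
    using \<kappa> by (intro order_tendstoD(2)[of _ "1 / sqrt (1 - 0)"]) auto
  have "((\<lambda>\<eta>. r\<^sup>2 * \<eta> / (1 - \<eta>)) \<longlongrightarrow> r\<^sup>2 * 0 / (1 - 0)) (at_right (0::real))"
    by (intro tendsto_intros) auto
  then have 2: "eventually (\<lambda>\<eta>. r\<^sup>2 * \<eta> / (1 - \<eta>) < \<tau>) (at_right (0::real))"
    using \<tau> by (intro order_tendstoD(2)[of _ "r\<^sup>2 * 0 / (1 - 0)"]) auto
  have 3: "eventually (\<lambda>\<eta>::real. 0 < \<eta> \<and> \<eta> < 1) (at_right 0)"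
    using eventually_at_right_less[of "0::real"] eventually_at_right_real[of 0 1] by (auto elim: eventually_mono)
  obtain \<eta> where \<eta>: "1 / sqrt (1 - \<eta>) < exp (\<kappa> / 2)" "r\<^sup>2 * \<eta> / (1 - \<eta>) < \<tau>" "0 < \<eta>" "\<eta> < 1"
    using eventually_happens[OF eventually_conj[OF 1 eventually_conj[OF 2 3]]] by auto
  define lam where "lam = 1 / (2 * \<eta> * r\<^sup>2)"
  have lam0: "lam > 0" using \<eta> r20 by (simp add: lam_def)
  have "((\<lambda>\<delta>. sqrt (1 + \<delta> / r\<^sup>2) * exp (2 * lam * \<delta>\<^sup>2) * (1 / sqrt (1 - 8 * lam * \<delta>))) \<longlongrightarrow>
      sqrt (1 + 0 / r\<^sup>2) * exp (2 * lam * 0\<^sup>2) * (1 / sqrt (1 - 8 * lam * 0))) (at_right (0::real))"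
    by (intro tendsto_intros) (use r20 in auto)
  then have 4: "eventually (\<lambda>\<delta>. sqrt (1 + \<delta> / r\<^sup>2) * exp (2 * lam * \<delta>\<^sup>2) * (1 / sqrt (1 - 8 * lam * \<delta>)) < exp (\<kappa> / 2)) (at_right (0::real))"
    using \<kappa> by (elim order_tendstoD(2)) auto
  have 5: "eventually (\<lambda>\<delta>. 0 < \<delta> \<and> \<delta> < min (r\<^sup>2) (1 / (8 * lam))) (at_right (0::real))"
    using eventually_at_right_real[of 0 "min (r\<^sup>2) (1 / (8 * lam))"] r20 lam0 by (auto elim: eventually_mono)
  obtain \<delta> where \<delta>: "sqrt (1 + \<delta> / r\<^sup>2) * exp (2 * lam * \<delta>\<^sup>2) * (1 / sqrt (1 - 8 * lam * \<delta>)) < exp (\<kappa> / 2)"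
     "0 < \<delta>" "\<delta> < r\<^sup>2" "\<delta> < 1 / (8 * lam)"
    using eventually_happens[OF eventually_conj[OF 4 5]] by auto
  have \<delta>8: "8 * lam * \<delta> < 1" using \<delta>(4) lam0 by (simp add: field_simps)
  let ?C = "sqrt (1 + \<delta> / r\<^sup>2) * exp (2 * lam * \<delta>\<^sup>2) * (1 / sqrt (1 - 8 * lam * \<delta>)) * (1 / sqrt (1 - \<eta>))"
  have C0: "0 \<le> sqrt (1 + \<delta> / r\<^sup>2) * exp (2 * lam * \<delta>\<^sup>2) * (1 / sqrt (1 - 8 * lam * \<delta>))"
    using \<delta> \<delta>8 by simp
  have C: "?C \<le> exp \<kappa>"
  proof -
    have "?C \<le> exp (\<kappa> / 2) * exp (\<kappa> / 2)"
      by (rule mult_mono[OF less_imp_le[OF \<delta>(1)] less_imp_le[OF \<eta>(1)]]) (use \<eta> in auto)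
    then show ?thesis by (simp add: exp_add[symmetric])
  qed
  have C0': "0 \<le> ?C" by (rule mult_nonneg_nonneg[OF C0]) (use \<eta> in auto)
  show thesis
  proof (rule that[of \<delta> "r\<^sup>2 * \<eta> / (1 - \<eta>)"])
    show "0 < r\<^sup>2 * \<eta> / (1 - \<eta>)" using \<eta> r20 by simp
    fix I :: "'i set" and m1 m2 S1 S2 v
    assume I: "finite I" and a: "psd I (add_diag S1 (- (s\<^sup>2)))" "\<And>i j. i \<in> I \<Longrightarrow> j \<in> I \<Longrightarrow> S2 i j = S2 j i"
      "\<And>\<xi>. \<bar>quad_form I S1 \<xi> - quad_form I S2 \<xi>\<bar> \<le> \<delta> * (\<Sum>i\<in>I. (\<xi> i)\<^sup>2)" "\<And>i. i \<in> I \<Longrightarrow> \<bar>m1 i - m2 i\<bar> \<le> \<delta>"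
    let ?g = "gauss_density I m2 (add_diag S2 (r\<^sup>2 * \<eta> / (1 - \<eta>))) v"
    have "0 \<le> ?g \<and> gauss_density I m1 S1 v \<le> ?C ^ card I * ?g"
      by (rule gauss_density_domination_explicit[OF I r \<eta>(3,4) \<delta>(2) less_imp_le[OF \<delta>(3)] lam_def \<delta>8 a(1)[folded r2] a(2) a(3) a(4)])
    then have g0: "0 \<le> ?g" and le: "gauss_density I m1 S1 v \<le> ?C ^ card I * ?g" by auto
    have "?C ^ card I \<le> exp \<kappa> ^ card I" by (rule power_mono[OF C C0'])
    then have "?C ^ card I * ?g \<le> exp \<kappa> ^ card I * ?g" using g0 by (rule mult_right_mono)
    then show "gauss_density I m1 S1 v \<le> exp (\<kappa> * real (card I)) * ?g"
      using le by (simp add: exp_of_nat2_mult)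
  qed (use \<eta> \<delta> in auto)
qed

section \<open>Densities over sites and times\<close>

type_synonym site_time = "int \<times> nat"

text \<open>The initial law may have no density. It therefore serves as its own reference measure at
  time \<open>0\<close>, while later times carry Lebesgue measure; Gaussian densities then involve
  only the coordinates in \<open>pos D\<close>.\<close>

definition coord_measure :: "real measure \<Rightarrow> site_time \<Rightarrow> real measure" where
  "coord_measure \<mu> i = (if snd i = 0 then \<mu> else lborel)"

definition pos :: "site_time set \<Rightarrow> site_time set" where
  "pos D = {i \<in> D. snd i \<noteq> 0}"

lemma pos_simps: "finite D \<Longrightarrow> finite (pos D)" "pos D \<subseteq> D" "pos (D \<union> E) = pos D \<union> pos E"
  "D \<subseteq> E \<Longrightarrow> pos D \<subseteq> pos E" "i \<in> pos D \<longleftrightarrow> i \<in> D \<and> snd i \<noteq> 0"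
  by (auto simp: pos_def)

lemma gauss_density_measurable:
  fixes I :: "'i set"
  assumes I: "finite I"
    and [measurable]: "\<And>i. i \<in> I \<Longrightarrow> (\<lambda>x. m x i) \<in> borel_measurable N"
    "\<And>i j. i \<in> I \<Longrightarrow> j \<in> I \<Longrightarrow> (\<lambda>x. S x i j) \<in> borel_measurable N"
    "\<And>i. i \<in> I \<Longrightarrow> (\<lambda>x. v x i) \<in> borel_measurable N"
  shows "(\<lambda>x. gauss_density I (m x) (S x) (v x)) \<in> borel_measurable N"
proof -
  interpret lebI: finite_product_sigma_finite "\<lambda>_. lborel :: real measure" I by standard fact
  have [measurable]: "i \<in> I \<Longrightarrow> (\<lambda>x. snd x i) \<in> borel_measurable (N \<Otimes>\<^sub>M lebP I)" for i
    by measurable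
  have "(\<lambda>(x, \<zeta>). cis (\<Sum>i\<in>I. \<zeta> i * (v x i - m x i)) * complex_of_real (exp (- (quad_form I (S x) \<zeta> / 2))))
     \<in> borel_measurable (N \<Otimes>\<^sub>M lebP I)"
    unfolding quad_form_def by measurable
  then have "(\<lambda>x. \<integral>\<zeta>. cis (\<Sum>i\<in>I. \<zeta> i * (v x i - m x i)) * complex_of_real (exp (- (quad_form I (S x) \<zeta> / 2))) \<partial>lebP I)
     \<in> borel_measurable N"
    by (rule sigma_finite_measure.borel_measurable_lebesgue_integral[OF lebI.sigma_finite_measure_axioms])
  then show ?thesis unfolding gauss_density_def gauss_density_fourier_def by measurable
qed

lemma normal_density_measurable [measurable (raw)]:
  assumes [measurable]: "g \<in> borel_measurable N" "v \<in> borel_measurable N"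
  shows "(\<lambda>x. normal_density (g x) r (v x)) \<in> borel_measurable N"
  unfolding normal_density_def by measurable

section \<open>Marginals and block factorisation of Gaussian densities\<close>

lemma gaussian_vector_subset:
  assumes "gaussian_vector M E G m K" "finite E" "I \<subseteq> E"
  shows "gaussian_vector M I G m K"
  unfolding gaussian_vector_def
proof (intro conjI ballI allI)
  show "i \<in> I \<Longrightarrow> G i \<in> borel_measurable M" for i using assms by (auto simp: gaussian_vector_def)
  fix \<xi> :: "'b \<Rightarrow> real"
  define \<zeta> where "\<zeta> = (\<lambda>i. if i \<in> I then \<xi> i else 0)"
  have s: "(\<Sum>i\<in>E. \<zeta> i * h i) = (\<Sum>i\<in>I. \<xi> i * h i)" for h
  proof -
    have "(\<Sum>i\<in>E. \<zeta> i * h i) = (\<Sum>i\<in>I. \<zeta> i * h i)"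
      by (rule sum.mono_neutral_right) (use assms in \<open>auto simp: \<zeta>_def\<close>)
    then show ?thesis by (simp add: \<zeta>_def)
  qed
  have q: "quad_form E K \<zeta> = quad_form I K \<xi>"
  proof -
    have "quad_form E K \<zeta> = quad_form I K \<zeta>" by (rule quad_form_zero_outside) (use assms in \<open>auto simp: \<zeta>_def\<close>)
    also have "\<dots> = quad_form I K \<xi>" by (rule quad_form_cong) (auto simp: \<zeta>_def)
    finally show ?thesis .
  qed
  show "(\<integral>\<omega>. cis (\<Sum>i\<in>I. \<xi> i * G i \<omega>) \<partial>M) = cis (\<Sum>i\<in>I. \<xi> i * m i) * complex_of_real (exp (- (quad_form I K \<xi> / 2)))"
    using assms(1)[unfolded gaussian_vector_def, THEN conjunct2, rule_format, of \<zeta>] unfolding s q .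
qed

lemma gauss_density_nonneg:
  assumes "finite I" "psd I K" "r > 0"
  shows "0 \<le> gauss_density I m (add_diag K (r\<^sup>2)) v"
proof -
  obtain w where w: "\<And>m. gaussian_vector (stdP I) I (\<lambda>i z. m i + (\<Sum>k\<in>I. w k i * z k)) m K"
    by (rule psd_gaussian_vector[OF assms(1,2)]) (rule that)
  show ?thesis
    unfolding gaussian_vector_gauss_density(1)[OF prob_stdP w assms(3,1)] by (simp add: prod_nonneg)
qed

lemma psd_block:
  assumes fin: "finite I" "finite J" "I \<inter> J = {}" and K: "psd I K" "psd J K"
    and zero: "\<And>i j. i \<in> I \<Longrightarrow> j \<in> J \<Longrightarrow> K i j = 0 \<and> K j i = 0"
  shows "psd (I \<union> J) K" and "quad_form (I \<union> J) K \<xi> = quad_form I K \<xi> + quad_form J K \<xi>"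
proof -
  have q: "quad_form (I \<union> J) K \<xi> = quad_form I K \<xi> + quad_form J K \<xi>" for \<xi>
  proof -
    have "(\<Sum>i\<in>I. \<Sum>j\<in>I \<union> J. \<xi> i * K i j * \<xi> j) = quad_form I K \<xi>"
      unfolding quad_form_def using fin zero
      by (intro sum.cong refl sum.mono_neutral_right) auto
    moreover have "(\<Sum>i\<in>J. \<Sum>j\<in>I \<union> J. \<xi> i * K i j * \<xi> j) = quad_form J K \<xi>"
      unfolding quad_form_def using fin zero
      by (intro sum.cong refl sum.mono_neutral_right) auto
    ultimately show ?thesis
      unfolding quad_form_def[of "I \<union> J"] by (subst sum.union_disjoint) (use fin in auto)
  qed
  show "quad_form (I \<union> J) K \<xi> = quad_form I K \<xi> + quad_form J K \<xi>" by (rule q)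
  show "psd (I \<union> J) K"
    unfolding psd_def
  proof (intro conjI ballI allI)
    fix i j assume "i \<in> I \<union> J" "j \<in> I \<union> J"
    then show "K i j = K j i" using zero psd_sym[OF K(1)] psd_sym[OF K(2)] by (metis UnE)
  next
    show "0 \<le> quad_form (I \<union> J) K \<xi>" for \<xi> unfolding q using K by (simp add: psd_def)
  qed
qed

text \<open>A kernel without entries between \<open>I\<close> and \<open>J\<close> is realised by
  vectors on the two factors of a product space, where the averaged product of normal densities
  splits.\<close>

lemma gauss_density_block:
  fixes I J :: "'i set"
  assumes fin: "finite I" "finite J" "I \<inter> J = {}" and K: "psd I K" "psd J K" and r: "r > 0"
    and zero: "\<And>i j. i \<in> I \<Longrightarrow> j \<in> J \<Longrightarrow> K i j = 0 \<and> K j i = 0"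
  shows "gauss_density (I \<union> J) m (add_diag K (r\<^sup>2)) v = gauss_density I m (add_diag K (r\<^sup>2)) v * gauss_density J m (add_diag K (r\<^sup>2)) v"
proof -
  interpret PI: prob_space "stdP I" by (rule prob_stdP)
  interpret PJ: prob_space "stdP J" by (rule prob_stdP)
  interpret PP: pair_prob_space "stdP I" "stdP J" ..
  obtain w1 where w1: "\<And>m. gaussian_vector (stdP I) I (\<lambda>i z. m i + (\<Sum>k\<in>I. w1 k i * z k)) m K"
    by (rule psd_gaussian_vector[OF fin(1) K(1)]) (rule that)
  obtain w2 where w2: "\<And>m. gaussian_vector (stdP J) J (\<lambda>i z. m i + (\<Sum>k\<in>J. w2 k i * z k)) m K"
    by (rule psd_gaussian_vector[OF fin(2) K(2)]) (rule that)
  define G1 where "G1 = (\<lambda>i z. m i + (\<Sum>k\<in>I. w1 k i * z k))"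
  define G2 where "G2 = (\<lambda>i z. m i + (\<Sum>k\<in>J. w2 k i * z k))"
  define G where "G = (\<lambda>i (\<omega> :: ('i \<Rightarrow> real) \<times> ('i \<Rightarrow> real)). if i \<in> I then G1 i (fst \<omega>) else G2 i (snd \<omega>))"
  have g1: "gaussian_vector (stdP I) I G1 m K" and g2: "gaussian_vector (stdP J) J G2 m K"
    using w1 w2 by (auto simp: G1_def G2_def)
  have [measurable]: "i \<in> I \<Longrightarrow> G1 i \<in> borel_measurable (stdP I)" "i \<in> J \<Longrightarrow> G2 i \<in> borel_measurable (stdP J)" for i
    using g1 g2 by (auto simp: gaussian_vector_def)
  have GJ: "i \<in> J \<Longrightarrow> G i \<omega> = G2 i (snd \<omega>)" and GI: "i \<in> I \<Longrightarrow> G i \<omega> = G1 i (fst \<omega>)" for i \<omega>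
    using fin by (auto simp: G_def)
  have "gaussian_vector (stdP I \<Otimes>\<^sub>M stdP J) (I \<union> J) G m K"
    unfolding gaussian_vector_def
  proof (intro conjI ballI allI)
    fix i assume i: "i \<in> I \<union> J"
    show "G i \<in> borel_measurable (stdP I \<Otimes>\<^sub>M stdP J)"
    proof (cases "i \<in> I")
      case True
      then have "G i = (\<lambda>\<omega>. G1 i (fst \<omega>))" by (auto simp: G_def)
      with True show ?thesis by simp
    next
      case False
      with i have "G i = (\<lambda>\<omega>. G2 i (snd \<omega>))" "i \<in> J" by (auto simp: G_def)
      then show ?thesis by simp
    qed
  next
    fix \<xi> :: "'i \<Rightarrow> real"
    let ?f = "\<lambda>x. cis (\<Sum>i\<in>I. \<xi> i * G1 i x)" and ?g = "\<lambda>y. cis (\<Sum>i\<in>J. \<xi> i * G2 i y)"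
    have sp: "(\<Sum>i\<in>I \<union> J. h i) = (\<Sum>i\<in>I. h i) + (\<Sum>i\<in>J. h i)" for h :: "'i \<Rightarrow> real"
      using fin by (rule sum.union_disjoint)
    have "(\<integral>\<omega>. cis (\<Sum>i\<in>I \<union> J. \<xi> i * G i \<omega>) \<partial>(stdP I \<Otimes>\<^sub>M stdP J))
       = (\<integral>\<omega>. ?f (fst \<omega>) * ?g (snd \<omega>) \<partial>(stdP I \<Otimes>\<^sub>M stdP J))"
      unfolding sp by (simp add: GI GJ cis_mult)
    also have "\<dots> = (\<integral>x. (\<integral>y. ?f x * ?g y \<partial>stdP J) \<partial>stdP I)"
    proof (subst PP.integral_fst'[symmetric])
      show "integrable (stdP I \<Otimes>\<^sub>M stdP J) (\<lambda>\<omega>. ?f (fst \<omega>) * ?g (snd \<omega>))"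
        by (rule PP.P.integrable_const_bound[where B = 1]) (auto simp: norm_mult)
    qed simp
    also have "\<dots> = (\<integral>x. ?f x \<partial>stdP I) * (\<integral>y. ?g y \<partial>stdP J)"
      by simp
    also have "(\<integral>x. ?f x \<partial>stdP I) = cis (\<Sum>i\<in>I. \<xi> i * m i) * complex_of_real (exp (- (quad_form I K \<xi> / 2)))"
      using g1 by (simp add: gaussian_vector_def)
    also have "(\<integral>x. ?g x \<partial>stdP J) = cis (\<Sum>i\<in>J. \<xi> i * m i) * complex_of_real (exp (- (quad_form J K \<xi> / 2)))"
      using g2 by (simp add: gaussian_vector_def)
    also have "cis (\<Sum>i\<in>I. \<xi> i * m i) * complex_of_real (exp (- (quad_form I K \<xi> / 2)))
       * (cis (\<Sum>i\<in>J. \<xi> i * m i) * complex_of_real (exp (- (quad_form J K \<xi> / 2))))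
      = cis (\<Sum>i\<in>I \<union> J. \<xi> i * m i) * complex_of_real (exp (- (quad_form (I \<union> J) K \<xi> / 2)))"
    proof -
      have 1: "cis (\<Sum>i\<in>I \<union> J. \<xi> i * m i) = cis (\<Sum>i\<in>I. \<xi> i * m i) * cis (\<Sum>i\<in>J. \<xi> i * m i)"
        unfolding cis_mult sp by simp
      have "quad_form (I \<union> J) K \<xi> = quad_form I K \<xi> + quad_form J K \<xi>" by (rule psd_block(2)[OF fin K zero])
      then have "exp (- (quad_form (I \<union> J) K \<xi> / 2)) = exp (- (quad_form I K \<xi> / 2)) * exp (- (quad_form J K \<xi> / 2))"
        by (simp add: exp_add[symmetric] add_divide_distrib)
      then show ?thesis unfolding 1 by simp
    qed
    finally show "(\<integral>\<omega>. cis (\<Sum>i\<in>I \<union> J. \<xi> i * G i \<omega>) \<partial>(stdP I \<Otimes>\<^sub>M stdP J))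
      = cis (\<Sum>i\<in>I \<union> J. \<xi> i * m i) * complex_of_real (exp (- (quad_form (I \<union> J) K \<xi> / 2)))" .
  qed
  then have "ennreal (gauss_density (I \<union> J) m (add_diag K (r\<^sup>2)) v)
     = (\<integral>\<^sup>+\<omega>. ennreal (\<Prod>i\<in>I \<union> J. normal_density (G i \<omega>) r (v i)) \<partial>(stdP I \<Otimes>\<^sub>M stdP J))"
    using fin by (intro gaussian_vector_gauss_density_nn[OF PP.P.prob_space_axioms _ r]) auto
  also have "\<dots> = (\<integral>\<^sup>+\<omega>. ennreal (\<Prod>i\<in>I. normal_density (G1 i (fst \<omega>)) r (v i)) * ennreal (\<Prod>i\<in>J. normal_density (G2 i (snd \<omega>)) r (v i)) \<partial>(stdP I \<Otimes>\<^sub>M stdP J))"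
    using fin by (simp add: prod.union_disjoint GI GJ ennreal_mult prod_nonneg)
  also have "\<dots> = (\<integral>\<^sup>+x. ennreal (\<Prod>i\<in>I. normal_density (G1 i x) r (v i)) \<partial>stdP I) * (\<integral>\<^sup>+x. ennreal (\<Prod>i\<in>J. normal_density (G2 i x) r (v i)) \<partial>stdP J)"
  proof -
    have [measurable]: "(\<lambda>x. \<Prod>i\<in>I. normal_density (G1 i x) r (v i)) \<in> borel_measurable (stdP I)"
      by (intro borel_measurable_prod normal_density_measurable) auto
    have [measurable]: "(\<lambda>x. \<Prod>i\<in>J. normal_density (G2 i x) r (v i)) \<in> borel_measurable (stdP J)"
      by (intro borel_measurable_prod normal_density_measurable) auto
    show ?thesis
      by (subst PJ.nn_integral_fst[symmetric]) (simp_all add: nn_integral_cmult nn_integral_multc)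
  qed
  also have "\<dots> = ennreal (gauss_density I m (add_diag K (r\<^sup>2)) v) * ennreal (gauss_density J m (add_diag K (r\<^sup>2)) v)"
    using gaussian_vector_gauss_density_nn[OF prob_stdP g1 r fin(1)] gaussian_vector_gauss_density_nn[OF prob_stdP g2 r fin(2)] by simp
  finally show ?thesis
    using fin by (simp add: gauss_density_nonneg K r psd_block(1) zero ennreal_mult[symmetric])
qed

locale coord =
  fixes \<mu> :: "real measure"
  assumes prob_\<mu>: "prob_space \<mu>" and sets_\<mu> [measurable_cong, simp]: "sets \<mu> = sets borel"
begin

abbreviation "CM \<equiv> coord_measure \<mu>"

lemma space_\<mu> [simp]: "space \<mu> = UNIV"
  using sets_eq_imp_space_eq[OF sets_\<mu>] by simp

lemma sets_CM [measurable_cong, simp]: "sets (CM i) = sets borel"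
  by (simp add: coord_measure_def)

lemma space_CM [simp]: "space (CM i) = UNIV"
  using sets_eq_imp_space_eq[OF sets_CM] by simp

sublocale CM: product_sigma_finite CM
proof (rule product_sigma_finite.intro)
  show "sigma_finite_measure (CM i)" for i
    unfolding coord_measure_def
    by (cases "snd i = 0") (simp_all add: prob_space_imp_sigma_finite[OF prob_\<mu>] lborel.sigma_finite_measure_axioms)
qed

lemma measurable_component_CM [measurable (raw)]:
  "i \<in> D \<Longrightarrow> (\<lambda>w. w i) \<in> borel_measurable (PiM D CM)"
  using measurable_component_singleton[of i D CM] by simp

lemma gauss_density_measurable_CM [measurable]:
  assumes "finite I" "I \<subseteq> D"
  shows "gauss_density I m S \<in> borel_measurable (PiM D CM)"
  by (rule gauss_density_measurable[of I "\<lambda>_. m" "PiM D CM" "\<lambda>_. S" "\<lambda>v. v"])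
    (use assms in \<open>auto intro!: measurable_component_CM\<close>)

lemma nn_integral_normal_density: "r > 0 \<Longrightarrow> (\<integral>\<^sup>+x. ennreal (normal_density \<nu> r x) \<partial>lborel) = 1"
  by (subst nn_integral_eq_integral) auto

text \<open>For a fixed value of the mixing vector the density is a product over coordinates. Each
  coordinate outside \<open>D\<close> integrates to one: a normal density against Lebesgue measure
  at positive times, the constant \<open>1\<close> against the probability measure
  \<open>\<mu>\<close> at time \<open>0\<close>.\<close>

lemma nn_integral_gauss_density_marginal:
  assumes E: "finite E" "D \<subseteq> E" and K: "psd (pos E) K" and r: "r > 0"
    and F [measurable]: "F \<in> borel_measurable (PiM D CM)"
  shows "(\<integral>\<^sup>+w. F (restrict w D) * ennreal (gauss_density (pos E) m (add_diag K (r\<^sup>2)) w) \<partial>PiM E CM)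
     = (\<integral>\<^sup>+w. F w * ennreal (gauss_density (pos D) m (add_diag K (r\<^sup>2)) w) \<partial>PiM D CM)"
proof -
  define J where "J = E - D"
  have D: "finite D" "finite J" "D \<inter> J = {}" "E = D \<union> J" using E finite_subset by (auto simp: J_def)
  have fin: "finite (pos E)" "finite (pos D)" "finite (pos J)" "pos D \<inter> pos J = {}" "pos E = pos D \<union> pos J"
    using E D by (auto simp: pos_def)
  obtain w1 where "\<And>m. gaussian_vector (stdP (pos E)) (pos E) (\<lambda>i z. m i + (\<Sum>k\<in>pos E. w1 k i * z k)) m K"
    by (rule psd_gaussian_vector[OF fin(1) K]) (rule that)
  then obtain G where G: "gaussian_vector (stdP (pos E)) (pos E) G m K" by blast
  have G': "gaussian_vector (stdP (pos E)) (pos D) G m K" by (rule gaussian_vector_subset[OF G fin(1)]) (simp add: fin)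
  have [measurable]: "i \<in> pos E \<Longrightarrow> G i \<in> borel_measurable (stdP (pos E))" for i using G by (simp add: gaussian_vector_def)
  interpret PE: prob_space "stdP (pos E)" by (rule prob_stdP)
  interpret J: finite_product_sigma_finite CM J by standard (rule D)
  interpret JE: pair_sigma_finite "PiM J CM" "stdP (pos E)" ..
  let ?S = "add_diag K (r\<^sup>2)"
  define A where "A = (\<lambda>x z. \<Prod>i\<in>pos D. normal_density (G i z) r (x i))"
  define B where "B = (\<lambda>y z. \<Prod>i\<in>pos J. normal_density (G i z) r (y i))"
  have A0: "0 \<le> A x z" and B0: "0 \<le> B x z" for x z by (auto simp: A_def B_def prod_nonneg)
  have inner: "(\<integral>\<^sup>+y. ennreal (gauss_density (pos E) m ?S (merge D J (x, y))) \<partial>PiM J CM) = ennreal (gauss_density (pos D) m ?S x)" for x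
  proof -
    have "(\<integral>\<^sup>+y. ennreal (gauss_density (pos E) m ?S (merge D J (x, y))) \<partial>PiM J CM)
       = (\<integral>\<^sup>+y. (\<integral>\<^sup>+z. ennreal (A x z) * ennreal (B y z) \<partial>stdP (pos E)) \<partial>PiM J CM)"
    proof (rule nn_integral_cong)
      fix y
      have "(\<Prod>i\<in>pos E. normal_density (G i z) r (merge D J (x, y) i)) = A x z * B y z" for z
      proof -
        have "(\<Prod>i\<in>pos E. normal_density (G i z) r (merge D J (x, y) i))
           = (\<Prod>i\<in>pos D. normal_density (G i z) r (merge D J (x, y) i)) * (\<Prod>i\<in>pos J. normal_density (G i z) r (merge D J (x, y) i))"
          unfolding fin(5) by (rule prod.union_disjoint) (use fin in auto)
        also have "\<dots> = A x z * B y z"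
          unfolding A_def B_def using D(3)
          by (intro arg_cong2[where f = "(*)"] prod.cong) (auto simp: merge_def pos_def)
        finally show ?thesis .
      qed
      then show "ennreal (gauss_density (pos E) m ?S (merge D J (x, y))) = (\<integral>\<^sup>+z. ennreal (A x z) * ennreal (B y z) \<partial>stdP (pos E))"
        unfolding gaussian_vector_gauss_density_nn[OF prob_stdP G r fin(1)] by (simp add: A0 B0 ennreal_mult)
    qed
    also have "\<dots> = (\<integral>\<^sup>+z. (\<integral>\<^sup>+y. ennreal (A x z) * ennreal (B y z) \<partial>PiM J CM) \<partial>stdP (pos E))"
    proof (rule JE.Fubini'[symmetric])
      have Fs: "i \<in> pos J \<Longrightarrow> (\<lambda>\<omega>. fst \<omega> i) \<in> borel_measurable (PiM J CM \<Otimes>\<^sub>M stdP (pos E))" for i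
        by (simp add: pos_def)
      show "(\<lambda>(y, z). ennreal (A x z) * ennreal (B y z)) \<in> borel_measurable (PiM J CM \<Otimes>\<^sub>M stdP (pos E))"
      proof -
        have Gs: "(\<lambda>\<omega>. G i (snd \<omega>)) \<in> borel_measurable (PiM J CM \<Otimes>\<^sub>M stdP (pos E))" if "i \<in> pos E" for i
          using that by measurable
        have [measurable]: "(\<lambda>\<omega>. A x (snd \<omega>)) \<in> borel_measurable (PiM J CM \<Otimes>\<^sub>M stdP (pos E))"
          unfolding A_def by (intro borel_measurable_prod normal_density_measurable Gs) (simp_all add: fin(5))
        have [measurable]: "(\<lambda>\<omega>. B (fst \<omega>) (snd \<omega>)) \<in> borel_measurable (PiM J CM \<Otimes>\<^sub>M stdP (pos E))"
          unfolding B_def by (intro borel_measurable_prod normal_density_measurable Gs Fs) (simp_all add: fin(5))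
        show ?thesis unfolding case_prod_beta by measurable
      qed
    qed
    also have "\<dots> = (\<integral>\<^sup>+z. ennreal (A x z) * 1 \<partial>stdP (pos E))"
    proof (rule nn_integral_cong)
      fix z
      have [measurable]: "(\<lambda>y. B y z) \<in> borel_measurable (PiM J CM)"
        unfolding B_def by (intro borel_measurable_prod normal_density_measurable) (auto simp: pos_def)
      have "(\<integral>\<^sup>+y. ennreal (B y z) \<partial>PiM J CM) = (\<integral>\<^sup>+y. (\<Prod>i\<in>J. if snd i = 0 then 1 else ennreal (normal_density (G i z) r (y i))) \<partial>PiM J CM)"
      proof (rule nn_integral_cong)
        fix y :: "site_time \<Rightarrow> real"
        have "(\<Prod>i\<in>J. if snd i = 0 then 1 else ennreal (normal_density (G i z) r (y i)))
           = (\<Prod>i\<in>pos J. if snd i = 0 then 1 else ennreal (normal_density (G i z) r (y i)))"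
          by (rule prod.mono_neutral_right) (use D in \<open>auto simp: pos_def\<close>)
        also have "\<dots> = (\<Prod>i\<in>pos J. ennreal (normal_density (G i z) r (y i)))"
          by (rule prod.cong) (auto simp: pos_def)
        also have "\<dots> = ennreal (B y z)" unfolding B_def by (simp add: prod_ennreal)
        finally show "ennreal (B y z) = (\<Prod>i\<in>J. if snd i = 0 then 1 else ennreal (normal_density (G i z) r (y i)))" ..
      qed
      also have "\<dots> = (\<Prod>i\<in>J. \<integral>\<^sup>+y. (if snd i = 0 then 1 else ennreal (normal_density (G i z) r y)) \<partial>CM i)"
        by (rule CM.product_nn_integral_prod[OF D(2)]) simp
      also have "\<dots> = (\<Prod>i\<in>J. 1)"
        using prob_space.emeasure_space_1[OF prob_\<mu>]
        by (intro prod.cong refl) (auto simp: coord_measure_def nn_integral_normal_density r)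
      finally show "(\<integral>\<^sup>+y. ennreal (A x z) * ennreal (B y z) \<partial>PiM J CM) = ennreal (A x z) * 1"
        by (simp add: nn_integral_cmult)
    qed
    also have "\<dots> = ennreal (gauss_density (pos D) m ?S x)"
      unfolding A_def by (simp add: gaussian_vector_gauss_density_nn[OF prob_stdP G' r fin(2)])
    finally show ?thesis .
  qed
  have [measurable]: "(\<lambda>w. F (restrict w D)) \<in> borel_measurable (PiM E CM)"
    using measurable_compose[OF measurable_restrict_subset[OF E(2)] F] .
  have "(\<integral>\<^sup>+w. F (restrict w D) * ennreal (gauss_density (pos E) m ?S w) \<partial>PiM E CM)
     = (\<integral>\<^sup>+x. (\<integral>\<^sup>+y. F (restrict (merge D J (x, y)) D) * ennreal (gauss_density (pos E) m ?S (merge D J (x, y))) \<partial>PiM J CM) \<partial>PiM D CM)"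
    unfolding D(4)
  proof (rule CM.product_nn_integral_fold[OF D(3,1,2)])
    show "(\<lambda>w. F (restrict w D) * ennreal (gauss_density (pos (D \<union> J)) m ?S w)) \<in> borel_measurable (PiM (D \<union> J) CM)"
      unfolding D(4)[symmetric] using gauss_density_measurable_CM[OF fin(1) pos_simps(2)] by simp
  qed
  also have "\<dots> = (\<integral>\<^sup>+x. F x * ennreal (gauss_density (pos D) m ?S x) \<partial>PiM D CM)"
  proof (rule nn_integral_cong)
    fix x assume x: "x \<in> space (PiM D CM)"
    have mm: "(\<lambda>y. merge D J (x, y)) \<in> measurable (PiM J CM) (PiM E CM)"
      unfolding D(4) using x by measurable
    have [measurable]: "(\<lambda>y. gauss_density (pos E) m ?S (merge D J (x, y))) \<in> borel_measurable (PiM J CM)"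
      by (rule measurable_compose[OF mm gauss_density_measurable_CM[OF fin(1) pos_simps(2)]])
    have "restrict (merge D J (x, y)) D = x" for y
      using x D(3) by (auto simp: space_PiM merge_def restrict_def PiE_def extensional_def fun_eq_iff)
    then show "(\<integral>\<^sup>+y. F (restrict (merge D J (x, y)) D) * ennreal (gauss_density (pos E) m ?S (merge D J (x, y))) \<partial>PiM J CM) = F x * ennreal (gauss_density (pos D) m ?S x)"
      by (simp add: nn_integral_cmult inner)
  qed
  finally show ?thesis .
qed

text \<open>Iterates \<open>gauss_density_block\<close>. Positive semidefiniteness on the union
  belongs to the conclusion, because the inductive step requires it for the blocks already
  assembled.\<close>

lemma nn_integral_gauss_density_blocks:
  fixes D :: "'q \<Rightarrow> site_time set"
  assumes Q: "finite Q" and D: "\<And>q. q \<in> Q \<Longrightarrow> finite (D q)" "disjoint_family_on D Q"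
    and K: "\<And>q. q \<in> Q \<Longrightarrow> psd (pos (D q)) K" and r: "r > 0"
    and zero: "\<And>q q' i j. q \<in> Q \<Longrightarrow> q' \<in> Q \<Longrightarrow> q \<noteq> q' \<Longrightarrow> i \<in> D q \<Longrightarrow> j \<in> D q' \<Longrightarrow> K i j = 0"
    and F: "\<And>q. q \<in> Q \<Longrightarrow> F q \<in> borel_measurable (PiM (D q) CM)"
  shows "psd (pos (\<Union>q\<in>Q. D q)) K \<and>
    (\<integral>\<^sup>+w. (\<Prod>q\<in>Q. F q (restrict w (D q))) * ennreal (gauss_density (pos (\<Union>q\<in>Q. D q)) m (add_diag K (r\<^sup>2)) w) \<partial>PiM (\<Union>q\<in>Q. D q) CM)
     = (\<Prod>q\<in>Q. \<integral>\<^sup>+w. F q w * ennreal (gauss_density (pos (D q)) m (add_diag K (r\<^sup>2)) w) \<partial>PiM (D q) CM)"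
  using Q D K zero F
proof (induction Q rule: finite_induct)
  case empty
  \<comment> \<open>On the empty index set the Fourier integral is over a one-point space, so the
    density is \<open>1\<close>.\<close>
  have g: "gauss_density {} m (add_diag K (r\<^sup>2)) w = 1" for w
  proof -
    have "gauss_density {} m (add_diag K (r\<^sup>2)) w = Re (\<integral>x. 1 \<partial>lebP ({} :: site_time set))"
      by (simp add: gauss_density_def gauss_density_fourier_def quad_form_def)
    then show ?thesis by (simp add: PiM_empty)
  qed
  show ?case by (simp add: pos_def psd_def quad_form_def g[unfolded pos_def] PiM_empty nn_integral_count_space_finite)
next
  case (insert q Q)
  let ?U = "\<Union>q\<in>Q. D q" and ?S = "add_diag K (r\<^sup>2)"
  have IH: "psd (pos ?U) K"
    "(\<integral>\<^sup>+w. (\<Prod>q\<in>Q. F q (restrict w (D q))) * ennreal (gauss_density (pos ?U) m ?S w) \<partial>PiM ?U CM)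
     = (\<Prod>q\<in>Q. \<integral>\<^sup>+w. F q w * ennreal (gauss_density (pos (D q)) m ?S w) \<partial>PiM (D q) CM)"
  proof -
    have "psd (pos ?U) K \<and> (\<integral>\<^sup>+w. (\<Prod>q\<in>Q. F q (restrict w (D q))) * ennreal (gauss_density (pos ?U) m ?S w) \<partial>PiM ?U CM)
     = (\<Prod>q\<in>Q. \<integral>\<^sup>+w. F q w * ennreal (gauss_density (pos (D q)) m ?S w) \<partial>PiM (D q) CM)"
    proof (rule insert.IH)
      show "disjoint_family_on D Q" using insert.prems(2) by (auto simp: disjoint_family_on_def)
      show "K i j = 0" if "q \<in> Q" "q' \<in> Q" "q \<noteq> q'" "i \<in> D q" "j \<in> D q'" for q q' i j
        by (rule insert.prems(4)[of q q']) (use that in auto)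
    qed (use insert.prems in auto)
    then show "psd (pos ?U) K"
      "(\<integral>\<^sup>+w. (\<Prod>q\<in>Q. F q (restrict w (D q))) * ennreal (gauss_density (pos ?U) m ?S w) \<partial>PiM ?U CM)
     = (\<Prod>q\<in>Q. \<integral>\<^sup>+w. F q w * ennreal (gauss_density (pos (D q)) m ?S w) \<partial>PiM (D q) CM)"
      by auto
  qed
  have U: "finite ?U" "finite (D q)" "D q \<inter> ?U = {}"
    using insert.hyps insert.prems(1,2) by (auto simp: disjoint_family_on_def)
  have P: "finite (pos ?U)" "finite (pos (D q))" "pos (D q) \<inter> pos ?U = {}"
    using U pos_simps(1)[OF U(1)] pos_simps(1)[OF U(2)] by (auto simp: pos_simps(5))
  have Kq: "psd (pos (D q)) K" using insert.prems by auto
  have z: "i \<in> pos (D q) \<Longrightarrow> j \<in> pos ?U \<Longrightarrow> K i j = 0 \<and> K j i = 0" for i j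
  proof -
    assume a: "i \<in> pos (D q)" "j \<in> pos ?U"
    then obtain p where p: "p \<in> Q" "j \<in> D p" by (auto simp: pos_def)
    then have "p \<noteq> q" using insert.hyps by auto
    then show ?thesis
      using insert.prems(4)[of q p i j] insert.prems(4)[of p q j i] a p by (auto simp: pos_def)
  qed
  have Ui: "(\<Union>q\<in>insert q Q. D q) = D q \<union> ?U" by auto
  have psdU: "psd (pos (D q \<union> ?U)) K"
    unfolding pos_simps(3) by (rule psd_block(1)[OF P(2,1,3) Kq IH(1) z])
  have gdU: "gauss_density (pos (D q \<union> ?U)) m ?S w = gauss_density (pos (D q)) m ?S w * gauss_density (pos ?U) m ?S w" for w
    unfolding pos_simps(3) by (rule gauss_density_block[OF P(2,1,3) Kq IH(1) r z])
  have g0: "0 \<le> gauss_density (pos (D q)) m ?S w" "0 \<le> gauss_density (pos ?U) m ?S w" for w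
    by (rule gauss_density_nonneg[OF P(2) Kq r], rule gauss_density_nonneg[OF P(1) IH(1) r])
  have Fq [measurable]: "F q \<in> borel_measurable (PiM (D q) CM)" using insert.prems by auto
  have FU [measurable]: "(\<lambda>w. \<Prod>q\<in>Q. F q (restrict w (D q))) \<in> borel_measurable (PiM V CM)" if "?U \<subseteq> V" for V
  proof (rule borel_measurable_prod_ennreal)
    fix p assume p: "p \<in> Q"
    then have "D p \<subseteq> V" using that by auto
    then show "(\<lambda>w. F p (restrict w (D p))) \<in> borel_measurable (PiM V CM)"
      by (rule measurable_compose[OF measurable_restrict_subset insert.prems(5)]) (use p in auto)
  qed
  have Fq' [measurable]: "(\<lambda>w. F q (restrict w (D q))) \<in> borel_measurable (PiM (D q \<union> ?U) CM)"
    by (rule measurable_compose[OF measurable_restrict_subset Fq]) auto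
  have [measurable]: "gauss_density (pos (D q)) m ?S \<in> borel_measurable (PiM V CM)" if "D q \<subseteq> V" for V
    using that P by (intro gauss_density_measurable_CM) (auto simp: pos_def)
  have [measurable]: "gauss_density (pos ?U) m ?S \<in> borel_measurable (PiM V CM)" if "?U \<subseteq> V" for V
    using that P by (intro gauss_density_measurable_CM) (auto simp: pos_def)
  have "(\<integral>\<^sup>+w. (\<Prod>q\<in>insert q Q. F q (restrict w (D q))) * ennreal (gauss_density (pos (D q \<union> ?U)) m ?S w) \<partial>PiM (D q \<union> ?U) CM)
     = (\<integral>\<^sup>+x. (\<integral>\<^sup>+y. (F q (restrict (merge (D q) ?U (x, y)) (D q)) * (\<Prod>p\<in>Q. F p (restrict (merge (D q) ?U (x, y)) (D p)))) *
         (ennreal (gauss_density (pos (D q)) m ?S (merge (D q) ?U (x, y))) * ennreal (gauss_density (pos ?U) m ?S (merge (D q) ?U (x, y)))) \<partial>PiM ?U CM) \<partial>PiM (D q) CM)"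
    unfolding gdU using insert.hyps g0
    by (subst CM.product_nn_integral_fold[OF U(3,2,1), symmetric]) (auto simp: ennreal_mult)
  also have "\<dots> = (\<integral>\<^sup>+x. (\<integral>\<^sup>+y. (F q x * ennreal (gauss_density (pos (D q)) m ?S x)) *
         ((\<Prod>q\<in>Q. F q (restrict y (D q))) * ennreal (gauss_density (pos ?U) m ?S y)) \<partial>PiM ?U CM) \<partial>PiM (D q) CM)"
  proof (intro nn_integral_cong)
    fix x y assume xy: "x \<in> space (PiM (D q) CM)" "y \<in> space (PiM ?U CM)"
    have 1: "restrict (merge (D q) ?U (x, y)) (D q) = x"
      using xy U(3) by (auto simp: space_PiM merge_def restrict_def PiE_def extensional_def fun_eq_iff)
    have 2: "restrict (merge (D q) ?U (x, y)) (D p) = restrict y (D p)" if "p \<in> Q" for p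
      using that U(3) by (auto simp: merge_def restrict_def fun_eq_iff)
    have 3: "gauss_density (pos (D q)) m ?S (merge (D q) ?U (x, y)) = gauss_density (pos (D q)) m ?S x"
      by (rule gauss_density_cong) (auto simp: merge_def pos_def)
    have 4: "gauss_density (pos ?U) m ?S (merge (D q) ?U (x, y)) = gauss_density (pos ?U) m ?S y"
      by (rule gauss_density_cong) (use U(3) in \<open>auto simp: merge_def pos_def\<close>)
    have 5: "(\<Prod>p\<in>Q. F p (restrict (merge (D q) ?U (x, y)) (D p))) = (\<Prod>p\<in>Q. F p (restrict y (D p)))"
      by (rule prod.cong) (simp_all only: 2)
    show "(F q (restrict (merge (D q) ?U (x, y)) (D q)) * (\<Prod>p\<in>Q. F p (restrict (merge (D q) ?U (x, y)) (D p)))) *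
         (ennreal (gauss_density (pos (D q)) m ?S (merge (D q) ?U (x, y))) * ennreal (gauss_density (pos ?U) m ?S (merge (D q) ?U (x, y))))
       = (F q x * ennreal (gauss_density (pos (D q)) m ?S x)) * ((\<Prod>q\<in>Q. F q (restrict y (D q))) * ennreal (gauss_density (pos ?U) m ?S y))"
      unfolding 1 3 4 5 by (simp only: mult_ac)
  qed
  also have "\<dots> = (\<integral>\<^sup>+x. F q x * ennreal (gauss_density (pos (D q)) m ?S x) \<partial>PiM (D q) CM) *
       (\<integral>\<^sup>+y. (\<Prod>q\<in>Q. F q (restrict y (D q))) * ennreal (gauss_density (pos ?U) m ?S y) \<partial>PiM ?U CM)"
    by (simp add: nn_integral_cmult nn_integral_multc)
  also have "\<dots> = (\<Prod>q\<in>insert q Q. \<integral>\<^sup>+w. F q w * ennreal (gauss_density (pos (D q)) m ?S w) \<partial>PiM (D q) CM)"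
    unfolding IH(2) prod.insert[OF insert.hyps] ..
  finally show ?case
    unfolding Ui by (intro conjI psdU)
qed

end

section \<open>Noise and triangular shifts\<close>

context coord
begin

definition noise_measure :: "(site_time \<Rightarrow> real) \<Rightarrow> real \<Rightarrow> site_time \<Rightarrow> real measure" where
  "noise_measure c s i = (if snd i = 0 then \<mu> else density lborel (normal_density (c i) s))"

lemma prob_noise_measure: "s > 0 \<Longrightarrow> prob_space (noise_measure c s i)"
  by (simp add: noise_measure_def prob_\<mu> prob_space_normal_density)

lemma sets_noise_measure [measurable_cong, simp]: "sets (noise_measure c s i) = sets borel"
  by (simp add: noise_measure_def)

lemma PiM_noise_measure:
  assumes D: "finite D" and s: "s > 0"
  shows "PiM D (noise_measure c s) = density (PiM D CM) (\<lambda>w. ennreal (\<Prod>i\<in>pos D. normal_density (c i) s (w i)))"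
proof -
  interpret N: product_sigma_finite "noise_measure c s"
    by (intro product_sigma_finite.intro prob_space_imp_sigma_finite prob_noise_measure s)
  have m [measurable]: "(\<lambda>w. \<Prod>i\<in>pos D. normal_density (c i) s (w i)) \<in> borel_measurable (PiM D CM)"
    by (intro borel_measurable_prod normal_density_measurable) (auto simp: pos_def)
  have "density (PiM D CM) (\<lambda>w. ennreal (\<Prod>i\<in>pos D. normal_density (c i) s (w i))) = PiM D (noise_measure c s)"
  proof (rule N.PiM_eqI[OF D])
    show "sets (density (PiM D CM) (\<lambda>w. ennreal (\<Prod>i\<in>pos D. normal_density (c i) s (w i)))) = sets (PiM D (noise_measure c s))"
      by (auto intro!: sets_PiM_cong)
    fix A assume A: "\<And>i. i \<in> D \<Longrightarrow> A i \<in> sets (noise_measure c s i)"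
    then have A' [measurable]: "i \<in> D \<Longrightarrow> A i \<in> sets borel" for i by simp
    have box: "Pi\<^sub>E D A \<in> sets (PiM D CM)" by (rule sets_PiM_I_finite[OF D]) simp
    let ?g = "\<lambda>i x. (if snd i = 0 then 1 else ennreal (normal_density (c i) s x)) * indicator (A i) x"
    have "emeasure (density (PiM D CM) (\<lambda>w. ennreal (\<Prod>i\<in>pos D. normal_density (c i) s (w i)))) (Pi\<^sub>E D A)
      = (\<integral>\<^sup>+w. ennreal (\<Prod>i\<in>pos D. normal_density (c i) s (w i)) * indicator (Pi\<^sub>E D A) w \<partial>PiM D CM)"
      by (rule emeasure_density[OF _ box]) measurable
    also have "\<dots> = (\<integral>\<^sup>+w. (\<Prod>i\<in>D. ?g i (w i)) \<partial>PiM D CM)"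
    proof (rule nn_integral_cong)
      fix w assume w: "w \<in> space (PiM D CM)"
      have "ennreal (\<Prod>i\<in>pos D. normal_density (c i) s (w i)) = (\<Prod>i\<in>pos D. ennreal (normal_density (c i) s (w i)))"
        by (simp add: prod_ennreal)
      also have "\<dots> = (\<Prod>i\<in>pos D. if snd i = 0 then 1 else ennreal (normal_density (c i) s (w i)))"
        by (rule prod.cong) (auto simp: pos_def)
      also have "\<dots> = (\<Prod>i\<in>D. if snd i = 0 then 1 else ennreal (normal_density (c i) s (w i)))"
        by (rule prod.mono_neutral_left) (use D in \<open>auto simp: pos_def\<close>)
      finally have 1: "ennreal (\<Prod>i\<in>pos D. normal_density (c i) s (w i)) = (\<Prod>i\<in>D. if snd i = 0 then 1 else ennreal (normal_density (c i) s (w i)))" .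
      have "w \<in> Pi\<^sub>E D A \<longleftrightarrow> (\<forall>i\<in>D. w i \<in> A i)"
        using w by (auto simp: space_PiM PiE_def)
      then have 2: "indicator (Pi\<^sub>E D A) w = (\<Prod>i\<in>D. indicator (A i) (w i) :: ennreal)"
        using D by (auto simp: indicator_def)
      show "ennreal (\<Prod>i\<in>pos D. normal_density (c i) s (w i)) * indicator (Pi\<^sub>E D A) w = (\<Prod>i\<in>D. ?g i (w i))"
        unfolding 1 2 prod.distrib ..
    qed
    also have "\<dots> = (\<Prod>i\<in>D. \<integral>\<^sup>+x. ?g i x \<partial>CM i)"
      by (rule CM.product_nn_integral_prod[OF D]) (auto intro!: borel_measurable_times_ennreal)
    also have "\<dots> = (\<Prod>i\<in>D. emeasure (noise_measure c s i) (A i))"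
    proof (rule prod.cong[OF refl])
      fix i assume i: "i \<in> D"
      show "(\<integral>\<^sup>+x. ?g i x \<partial>CM i) = emeasure (noise_measure c s i) (A i)"
        using A'[OF i] by (cases "snd i = 0") (simp_all add: coord_measure_def noise_measure_def emeasure_density)
    qed
    finally show "emeasure (density (PiM D CM) (\<lambda>w. ennreal (\<Prod>i\<in>pos D. normal_density (c i) s (w i)))) (Pi\<^sub>E D A)
       = (\<Prod>i\<in>D. emeasure (noise_measure c s i) (A i))" .
  qed
  then show ?thesis ..
qed

lemma nn_integral_lborel_translate:
  fixes h :: "real \<Rightarrow> ennreal"
  assumes "h \<in> borel_measurable borel"
  shows "(\<integral>\<^sup>+y. h (y - c) \<partial>lborel) = (\<integral>\<^sup>+y. h y \<partial>lborel)"
  using nn_integral_real_affine[OF assms, of 1 "- c"] by (simp add: algebra_simps)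

text \<open>The shift of a coordinate depends on earlier times only, so the map is triangular.\<close>

lemma nn_integral_triangular_shift:
  assumes D: "finite D"
    and g: "\<And>i. i \<in> D \<Longrightarrow> g i \<in> borel_measurable (PiM D CM)"
    and dep: "\<And>i w w'. i \<in> D \<Longrightarrow> (\<And>j. j \<in> D \<Longrightarrow> snd j < snd i \<Longrightarrow> w j = w' j) \<Longrightarrow> g i w = g i w'"
    and F: "F \<in> borel_measurable (PiM D CM)"
  shows "(\<integral>\<^sup>+w. F (\<lambda>i\<in>D. if snd i = 0 then w i else w i - g i w) \<partial>PiM D CM) = (\<integral>\<^sup>+w. F w \<partial>PiM D CM)"
  using D g dep F
\<comment> \<open>Coordinates are added in the order of their times. The new one is maximal, so no
  shift depends on it, and integrating over it involves at most a translation of Lebesgue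
  measure.\<close>
proof (induction D arbitrary: F rule: finite_ranking_induct[where f = snd])
  case empty
  have "restrict f {} = (\<lambda>x. undefined)" for f :: "site_time \<Rightarrow> real" by (auto simp: fun_eq_iff)
  then show ?case unfolding PiM_empty by (simp add: nn_integral_count_space_finite)
next
  case (insert x D)
  show ?case
  proof (cases "x \<in> D")
  case True
  then have e: "insert x D = D" by auto
  show ?thesis using insert.prems unfolding e by (rule insert.IH)
  next
  case xD: False
  note F [measurable] = insert.prems(3)
  have gD: "g i (w(x := y)) = g i w" if "i \<in> insert x D" for i w y
  proof (rule insert.prems(2)[OF that])
    fix j assume "j \<in> insert x D" "snd j < snd i"
    then have "j \<noteq> x" using that insert.hyps(2) by (metis insertE leD less_irrefl)
    then show "(w(x := y)) j = w j" by simp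
  qed
  have upd [measurable]: "(\<lambda>w. w(x := y)) \<in> measurable (PiM D CM) (PiM (insert x D) CM)" for y
    by (rule measurable_fun_upd[where J = D]) auto
  have gm: "g i \<in> borel_measurable (PiM D CM)" if "i \<in> insert x D" for i
  proof -
    \<comment> \<open>A field on \<open>D\<close> lacks the coordinate \<open>x\<close>. The filler
      \<open>0\<close> is immaterial by \<open>gD\<close>.\<close>
    have "(\<lambda>w. g i (w(x := 0))) \<in> borel_measurable (PiM D CM)"
      by (rule measurable_compose[OF upd insert.prems(1)[OF that]])
    then show ?thesis using gD[OF that] by simp
  qed
  let ?sh = "\<lambda>D w. \<lambda>i\<in>D. if snd i = 0 then w i else w i - g i w"
  have upd2: "(\<lambda>(w, y). w(x := y)) \<in> measurable (PiM D CM \<Otimes>\<^sub>M CM x) (PiM (insert x D) CM)"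
    by (rule measurable_add_dim)
  have shm: "?sh (insert x D) \<in> measurable (PiM (insert x D) CM) (PiM (insert x D) CM)"
  proof (rule measurable_restrict)
    fix i assume i: "i \<in> insert x D"
    have [measurable]: "(\<lambda>w. w i) \<in> borel_measurable (PiM (insert x D) CM)" by (rule measurable_component_CM[OF i])
    have [measurable]: "g i \<in> borel_measurable (PiM (insert x D) CM)" by (rule insert.prems(1)[OF i])
    show "(\<lambda>w. if snd i = 0 then w i else w i - g i w) \<in> measurable (PiM (insert x D) CM) (CM i)"
      by (simp cong: measurable_cong_sets)
  qed
  have "(\<integral>\<^sup>+w. F (?sh (insert x D) w) \<partial>PiM (insert x D) CM)
     = (\<integral>\<^sup>+w. (\<integral>\<^sup>+y. F (?sh (insert x D) (w(x := y))) \<partial>CM x) \<partial>PiM D CM)"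
    by (rule CM.product_nn_integral_insert[OF insert.hyps(1)])
      (rule xD, rule measurable_compose[OF shm F])
  also have "\<dots> = (\<integral>\<^sup>+w. (\<integral>\<^sup>+y. F ((?sh D w)(x := y)) \<partial>CM x) \<partial>PiM D CM)"
  proof (rule nn_integral_cong)
    fix w assume w: "w \<in> space (PiM D CM)"
    have shw: "?sh D w \<in> space (PiM D CM)" by (simp add: space_PiM)
    have h [measurable]: "(\<lambda>y. F ((?sh D w)(x := y))) \<in> borel_measurable borel"
      using measurable_compose[OF measurable_compose[OF measurable_Pair1'[OF shw] upd2] F]
      by (simp cong: measurable_cong_sets)
    have e: "?sh (insert x D) (w(x := y)) = (?sh D w)(x := (if snd x = 0 then y else y - g x w))" for y
      using xD gD by (auto simp: fun_eq_iff)
    show "(\<integral>\<^sup>+y. F (?sh (insert x D) (w(x := y))) \<partial>CM x) = (\<integral>\<^sup>+y. F ((?sh D w)(x := y)) \<partial>CM x)"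
      unfolding e using nn_integral_lborel_translate[OF h, of "g x w"]
      by (cases "snd x = 0") (simp_all add: coord_measure_def)
  qed
  also have "\<dots> = (\<integral>\<^sup>+w. (\<integral>\<^sup>+y. F (w(x := y)) \<partial>CM x) \<partial>PiM D CM)"
  proof (rule insert.IH)
    show "g i \<in> borel_measurable (PiM D CM)" if "i \<in> D" for i using gm that by auto
    show "g i w = g i w'" if "i \<in> D" "\<And>j. j \<in> D \<Longrightarrow> snd j < snd i \<Longrightarrow> w j = w' j" for i w w'
    proof -
      have "g i (w(x := 0)) = g i (w'(x := 0))"
        by (rule insert.prems(2)) (use that in auto)
      then show ?thesis using gD that by simp
    qed
    show "(\<lambda>w. \<integral>\<^sup>+y. F (w(x := y)) \<partial>CM x) \<in> borel_measurable (PiM D CM)"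
      using measurable_compose[OF upd2 F]
      by (intro sigma_finite_measure.borel_measurable_nn_integral[OF CM.sigma_finite_measures]) (simp add: case_prod_beta)
  qed
  also have "\<dots> = (\<integral>\<^sup>+w. F w \<partial>PiM (insert x D) CM)"
    by (rule CM.product_nn_integral_insert[OF insert.hyps(1) xD F, symmetric])
  finally show ?thesis .
  qed
qed

end

section \<open>Jointly normal families\<close>

text \<open>The sign of \<open>s\<close> is left open, because the parameter that
  \<open>gaussian_family\<close> supplies for \<open>normal_law\<close> may be negative.\<close>

lemma integral_normal_density_affine:
  fixes h :: "real \<Rightarrow> 'b::{banach, second_countable_topology}"
  assumes s: "s \<noteq> 0" and [measurable]: "h \<in> borel_measurable borel"
  shows "integrable (density lborel (\<lambda>x. ennreal (normal_density m s x))) h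
      \<longleftrightarrow> integrable lborel (\<lambda>x. std_normal_density x *\<^sub>R h (m + s * x))" (is ?I)
    and "(\<integral>x. h x \<partial>density lborel (\<lambda>x. ennreal (normal_density m s x)))
      = (\<integral>x. std_normal_density x *\<^sub>R h (m + s * x) \<partial>lborel)" (is ?E)
proof -
  have e: "\<bar>s\<bar> * normal_density m s (m + s * x) = std_normal_density x" for x
  proof -
    have "(s * x)\<^sup>2 / (2 * s\<^sup>2) = x\<^sup>2 / 2" using s by (simp add: power_mult_distrib)
    then show ?thesis using s by (simp add: normal_density_def real_sqrt_mult)
  qed
  have 1: "integrable (density lborel (\<lambda>x. ennreal (normal_density m s x))) h
      \<longleftrightarrow> integrable lborel (\<lambda>x. normal_density m s x *\<^sub>R h x)"
    by (rule integrable_density) auto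
  also have "\<dots> \<longleftrightarrow> integrable lborel (\<lambda>x. normal_density m s (m + s * x) *\<^sub>R h (m + s * x))"
    using s by (rule lborel_integrable_real_affine_iff[symmetric])
  also have "\<dots> \<longleftrightarrow> integrable lborel (\<lambda>x. \<bar>s\<bar> *\<^sub>R (normal_density m s (m + s * x) *\<^sub>R h (m + s * x)))"
  proof
    assume "integrable lborel (\<lambda>x. \<bar>s\<bar> *\<^sub>R (normal_density m s (m + s * x) *\<^sub>R h (m + s * x)))"
    then have "integrable lborel (\<lambda>x. (1 / \<bar>s\<bar>) *\<^sub>R (\<bar>s\<bar> *\<^sub>R (normal_density m s (m + s * x) *\<^sub>R h (m + s * x))))"
      by (rule integrable_scaleR_right)
    then show "integrable lborel (\<lambda>x. normal_density m s (m + s * x) *\<^sub>R h (m + s * x))" using s by simp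
  qed (rule integrable_scaleR_right)
  finally show ?I by (simp only: scaleR_scaleR e)
  have "(\<integral>x. h x \<partial>density lborel (\<lambda>x. ennreal (normal_density m s x)))
     = (\<integral>x. normal_density m s x *\<^sub>R h x \<partial>lborel)"
    by (rule integral_density) auto
  also have "\<dots> = \<bar>s\<bar> *\<^sub>R (\<integral>x. normal_density m s (m + s * x) *\<^sub>R h (m + s * x) \<partial>lborel)"
    using s by (rule lborel_integral_real_affine)
  also have "\<dots> = (\<integral>x. \<bar>s\<bar> *\<^sub>R (normal_density m s (m + s * x) *\<^sub>R h (m + s * x)) \<partial>lborel)"
    by (rule integral_scaleR_right[symmetric])
  finally show ?E by (simp only: scaleR_scaleR e)
qed

lemma normal_law_facts:
  shows "sets (normal_law m s) = sets borel"
    and "(\<integral>x. cis x \<partial>normal_law m s) = cis m * complex_of_real (exp (- (s\<^sup>2 / 2)))"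
    and "integrable (normal_law m s) (\<lambda>x. x)" and "(\<integral>x. x \<partial>normal_law m s) = m"
    and "integrable (normal_law m s) (\<lambda>x. x\<^sup>2)" and "(\<integral>x. (x - m)\<^sup>2 \<partial>normal_law m s) = s\<^sup>2"
proof -
  show "sets (normal_law m s) = sets borel" by (simp add: normal_law_def)
  have "(\<integral>x. cis x \<partial>normal_law m s) = cis m * complex_of_real (exp (- (s\<^sup>2 / 2))) \<and>
    integrable (normal_law m s) (\<lambda>x. x) \<and> (\<integral>x. x \<partial>normal_law m s) = m \<and>
    integrable (normal_law m s) (\<lambda>x. x\<^sup>2) \<and> (\<integral>x. (x - m)\<^sup>2 \<partial>normal_law m s) = s\<^sup>2"
  proof (cases "s = 0")
    case True
    then show ?thesis
      by (auto simp: normal_law_def integral_return integrable_iff_bounded nn_integral_return)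
  next
    case False
    then have N: "normal_law m s = density lborel (\<lambda>x. ennreal (normal_density m s x))"
      by (simp add: normal_law_def)
    note i = integral_normal_density_affine[OF False]
    have i1: "integrable lborel (\<lambda>x. std_normal_density x * x)" using integrable_std_normal_moment[of 1] by simp
    have i2: "integrable lborel (\<lambda>x. std_normal_density x * x\<^sup>2)" using integrable_std_normal_moment[of 2] by simp
    have e1: "(\<integral>x. std_normal_density x * x \<partial>lborel) = 0" using integral_std_normal_moment_odd[of 0] by simp
    have e2: "(\<integral>x. std_normal_density x * x\<^sup>2 \<partial>lborel) = 1" using integral_std_normal_moment_even[of 1] by simp
    have c: "(\<integral>x. cis x \<partial>density lborel (\<lambda>x. ennreal (normal_density m s x))) = cis m * complex_of_real (exp (- (s\<^sup>2 / 2)))"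
    proof -
      have "(\<integral>x. std_normal_density x *\<^sub>R cis (m + s * x) \<partial>lborel) = (\<integral>x. cis m * (std_normal_density x *\<^sub>R cis (s * x)) \<partial>lborel)"
        by (simp add: cis_mult[symmetric] mult_ac)
      also have "\<dots> = cis m * (\<integral>x. std_normal_density x *\<^sub>R cis (s * x) \<partial>lborel)"
        by (rule integral_mult_right_zero)
      also have "(\<integral>x. std_normal_density x *\<^sub>R cis (s * x) \<partial>lborel) = (\<integral>x. cis (s * x) \<partial>density lborel std_normal_density)"
        by (subst integral_density) auto
      finally show ?thesis unfolding i(2)[OF cis_measurable] by (simp only: char_std_normal_cis)
    qed
    have f1: "std_normal_density x *\<^sub>R (m + s * x) = m * std_normal_density x + s * (std_normal_density x * x)" for x
      by (simp add: algebra_simps)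
    have f2: "std_normal_density x *\<^sub>R (m + s * x)\<^sup>2
       = m\<^sup>2 * std_normal_density x + (2 * m * s) * (std_normal_density x * x) + s\<^sup>2 * (std_normal_density x * x\<^sup>2)" for x
      by (simp add: power2_eq_square algebra_simps)
    have f3: "std_normal_density x *\<^sub>R (m + s * x - m)\<^sup>2 = s\<^sup>2 * (std_normal_density x * x\<^sup>2)" for x
      by (simp add: power_mult_distrib)
    have j0: "integrable lborel std_normal_density" by simp
    have a1: "integrable lborel (\<lambda>x. std_normal_density x *\<^sub>R (m + s * x))"
      unfolding f1 by (intro Bochner_Integration.integrable_add integrable_mult_right i1 j0)
    have a2: "integrable lborel (\<lambda>x. std_normal_density x *\<^sub>R (m + s * x)\<^sup>2)"
      unfolding f2 by (intro Bochner_Integration.integrable_add integrable_mult_right i1 i2 j0)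
    have b1: "(\<integral>x. std_normal_density x *\<^sub>R (m + s * x) \<partial>lborel) = m"
      unfolding f1 using i1 e1 by (subst Bochner_Integration.integral_add) auto
    have b2: "(\<integral>x. std_normal_density x *\<^sub>R (m + s * x - m)\<^sup>2 \<partial>lborel) = s\<^sup>2"
      unfolding f3 by (simp add: e2)
    have m1: "(\<lambda>x::real. x) \<in> borel_measurable borel" "(\<lambda>x::real. x\<^sup>2) \<in> borel_measurable borel"
      "(\<lambda>x::real. (x - m)\<^sup>2) \<in> borel_measurable borel" by measurable
    show ?thesis
      unfolding N c i(1)[OF m1(1)] i(2)[OF m1(1)] i(1)[OF m1(2)] i(2)[OF m1(3)] using a1 a2 b1 b2 by blast
  qed
  then show "(\<integral>x. cis x \<partial>normal_law m s) = cis m * complex_of_real (exp (- (s\<^sup>2 / 2)))"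
    "integrable (normal_law m s) (\<lambda>x. x)" "(\<integral>x. x \<partial>normal_law m s) = m"
    "integrable (normal_law m s) (\<lambda>x. x\<^sup>2)" "(\<integral>x. (x - m)\<^sup>2 \<partial>normal_law m s) = s\<^sup>2"
    by auto
qed

text \<open>Each linear combination has some law \<open>normal_law m s\<close>. Its mean and
  variance identify \<open>m\<close> and \<open>s\<^sup>2\<close> as the linear and quadratic
  expressions in the coefficients, and the characteristic function of that law at \<open>1\<close>
  is the required value.\<close>

lemma gaussian_family_gaussian_vector:
  assumes "prob_space P" and X: "gaussian_family P I X" and F: "finite F" "F \<subseteq> I"
  shows "gaussian_vector P F X (\<lambda>i. \<integral>\<omega>. X i \<omega> \<partial>P) (\<lambda>i j. cov P (X i) (X j))"
proof -
  interpret prob_space P by fact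
  have Xm [measurable]: "i \<in> F \<Longrightarrow> X i \<in> borel_measurable P" for i
    using X F by (auto simp: gaussian_family_def)
  have law: "\<exists>m s. distr P borel (\<lambda>\<omega>. \<Sum>i\<in>F'. a i * X i \<omega>) = normal_law m s" if "F' \<subseteq> F" for F' a
    using X that F finite_subset[OF that] unfolding gaussian_family_def by blast
  have int1: "integrable P (X i)" and int2: "integrable P (\<lambda>\<omega>. (X i \<omega>)\<^sup>2)" if i: "i \<in> F" for i
  proof -
    obtain m s where N: "distr P borel (X i) = normal_law m s"
      using law[of "{i}" "\<lambda>_. 1"] i by auto
    show "integrable P (X i)"
      using normal_law_facts(3)[of m s] unfolding N[symmetric] by (subst (asm) integrable_distr_eq) (use i in auto)
    show "integrable P (\<lambda>\<omega>. (X i \<omega>)\<^sup>2)"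
      using normal_law_facts(5)[of m s] unfolding N[symmetric] by (subst (asm) integrable_distr_eq) (use i in auto)
  qed
  define c where "c = (\<lambda>i \<omega>. X i \<omega> - (\<integral>\<omega>. X i \<omega> \<partial>P))"
  have cm [measurable]: "i \<in> F \<Longrightarrow> c i \<in> borel_measurable P" for i unfolding c_def by simp
  have intc2: "integrable P (\<lambda>\<omega>. (c i \<omega>)\<^sup>2)" if "i \<in> F" for i
    unfolding c_def power2_diff using int1[OF that] int2[OF that] by auto
  have intc: "integrable P (\<lambda>\<omega>. c i \<omega> * c j \<omega>)" if "i \<in> F" "j \<in> F" for i j
  proof (rule Bochner_Integration.integrable_bound)
    show "integrable P (\<lambda>\<omega>. (c i \<omega>)\<^sup>2 + (c j \<omega>)\<^sup>2)" using intc2 that by auto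
    have "\<bar>x * y\<bar> \<le> x\<^sup>2 + y\<^sup>2" for x y :: real
    proof -
      have "0 \<le> (\<bar>x\<bar> - \<bar>y\<bar>)\<^sup>2" by simp
      then have "2 * (\<bar>x\<bar> * \<bar>y\<bar>) \<le> x\<^sup>2 + y\<^sup>2" by (simp add: power2_diff mult.assoc)
      moreover have "0 \<le> \<bar>x\<bar> * \<bar>y\<bar>" by simp
      ultimately show ?thesis unfolding abs_mult by linarith
    qed
    then show "AE x in P. norm (c i x * c j x) \<le> norm ((c i x)\<^sup>2 + (c j x)\<^sup>2)" by simp
  qed (use that in measurable)
  show ?thesis
    unfolding gaussian_vector_def
  proof (intro conjI ballI allI)
    fix i assume "i \<in> F" then show "X i \<in> borel_measurable P" by simp
  next
    fix \<xi> :: "'b \<Rightarrow> real"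
    let ?Z = "\<lambda>\<omega>. \<Sum>i\<in>F. \<xi> i * X i \<omega>"
    obtain m s where N: "distr P borel ?Z = normal_law m s" using law[of F \<xi>] by auto
    have m: "m = (\<Sum>i\<in>F. \<xi> i * (\<integral>\<omega>. X i \<omega> \<partial>P))"
    proof -
      have "m = (\<integral>x. x \<partial>distr P borel ?Z)" unfolding N by (simp add: normal_law_facts)
      also have "\<dots> = (\<integral>\<omega>. ?Z \<omega> \<partial>P)" by (rule integral_distr) auto
      also have "\<dots> = (\<Sum>i\<in>F. \<xi> i * (\<integral>\<omega>. X i \<omega> \<partial>P))" using int1 by (subst Bochner_Integration.integral_sum) auto
      finally show ?thesis .
    qed
    have s: "s\<^sup>2 = quad_form F (\<lambda>i j. cov P (X i) (X j)) \<xi>"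
    proof -
      have "s\<^sup>2 = (\<integral>x. (x - m)\<^sup>2 \<partial>distr P borel ?Z)" unfolding N by (simp add: normal_law_facts)
      also have "\<dots> = (\<integral>\<omega>. (?Z \<omega> - m)\<^sup>2 \<partial>P)" by (rule integral_distr) auto
      also have "\<dots> = (\<integral>\<omega>. (\<Sum>i\<in>F. \<Sum>j\<in>F. \<xi> i * \<xi> j * (c i \<omega> * c j \<omega>)) \<partial>P)"
      proof (rule Bochner_Integration.integral_cong[OF refl])
        fix \<omega>
        have "?Z \<omega> - m = (\<Sum>i\<in>F. \<xi> i * c i \<omega>)" by (simp add: m c_def algebra_simps sum_subtractf)
        then show "(?Z \<omega> - m)\<^sup>2 = (\<Sum>i\<in>F. \<Sum>j\<in>F. \<xi> i * \<xi> j * (c i \<omega> * c j \<omega>))"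
          by (simp add: power2_eq_square sum_product mult_ac)
      qed
      also have "\<dots> = (\<Sum>i\<in>F. \<Sum>j\<in>F. \<xi> i * \<xi> j * (\<integral>\<omega>. c i \<omega> * c j \<omega> \<partial>P))"
        using intc by (subst Bochner_Integration.integral_sum)
          (auto intro!: Bochner_Integration.integrable_sum sum.cong simp: Bochner_Integration.integral_sum)
      also have "\<dots> = quad_form F (\<lambda>i j. cov P (X i) (X j)) \<xi>"
        unfolding quad_form_def cov_def c_def by (simp add: mult_ac)
      finally show ?thesis .
    qed
    have "(\<integral>\<omega>. cis (?Z \<omega>) \<partial>P) = (\<integral>x. cis x \<partial>distr P borel ?Z)"
      by (rule integral_distr[symmetric]) auto
    also have "\<dots> = cis (\<Sum>i\<in>F. \<xi> i * (\<integral>\<omega>. X i \<omega> \<partial>P)) * complex_of_real (exp (- (quad_form F (\<lambda>i j. cov P (X i) (X j)) \<xi> / 2)))"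
      unfolding N normal_law_facts m s ..
    finally show "(\<integral>\<omega>. cis (?Z \<omega>) \<partial>P) = cis (\<Sum>i\<in>F. \<xi> i * (\<integral>\<omega>. X i \<omega> \<partial>P)) * complex_of_real (exp (- (quad_form F (\<lambda>i j. cov P (X i) (X j)) \<xi> / 2)))" .
  qed
qed

lemma iid_normal_gaussian_vector:
  assumes "prob_space P" and X: "iid_family P I X (normal_law m s)" and F: "finite F" "F \<subseteq> I"
  shows "gaussian_vector P F X (\<lambda>_. m) (\<lambda>i j. if i = j then s\<^sup>2 else 0)"
proof -
  interpret prob_space P by fact
  have iv: "indep_vars (\<lambda>_. borel) X F"
    using X F by (auto simp: iid_family_def intro: indep_vars_subset)
  have Xm [measurable]: "i \<in> F \<Longrightarrow> X i \<in> borel_measurable P" for i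
    using iv by (auto simp: indep_vars_def)
  show ?thesis
    unfolding gaussian_vector_def
  proof (intro conjI ballI allI)
    fix i assume "i \<in> F" then show "X i \<in> borel_measurable P" by simp
  next
    fix \<xi> :: "'b \<Rightarrow> real"
    have "(\<integral>\<omega>. cis (\<Sum>i\<in>F. \<xi> i * X i \<omega>) \<partial>P) = (\<integral>\<omega>. (\<Prod>i\<in>F. cis (\<xi> i * X i \<omega>)) \<partial>P)"
      by (simp add: prod_cis)
    also have "\<dots> = (\<Prod>i\<in>F. \<integral>\<omega>. cis (\<xi> i * X i \<omega>) \<partial>P)"
    proof (rule indep_vars_lebesgue_integral[OF F(1)])
      show "indep_vars (\<lambda>_. borel) (\<lambda>i \<omega>. cis (\<xi> i * X i \<omega>)) F"
        by (rule indep_vars_compose2[OF iv]) measurable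
      show "integrable P (\<lambda>\<omega>. cis (\<xi> i * X i \<omega>))" if "i \<in> F" for i
        by (rule integrable_const_bound[where B = 1]) (use that in auto)
    qed
    also have "\<dots> = (\<Prod>i\<in>F. cis (\<xi> i * m) * complex_of_real (exp (- (s\<^sup>2 * (\<xi> i)\<^sup>2 / 2))))"
    proof (rule prod.cong[OF refl])
      fix i assume i: "i \<in> F"
      have N: "distr P borel (X i) = normal_law m s" using X F i by (auto simp: iid_family_def)
      have "(\<integral>\<omega>. cis (\<xi> i * X i \<omega>) \<partial>P) = (\<integral>x. cis (\<xi> i * x) \<partial>normal_law m s)"
        unfolding N[symmetric] by (rule integral_distr[symmetric]) (use i in auto)
      also have "\<dots> = cis (\<xi> i * m) * complex_of_real (exp (- (s\<^sup>2 * (\<xi> i)\<^sup>2 / 2)))"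
      proof (cases "s = 0")
        case True
        then show ?thesis by (simp add: normal_law_def integral_return)
      next
        case False
        then have N: "normal_law m s = density lborel (\<lambda>x. ennreal (normal_density m s x))"
          by (simp add: normal_law_def)
        have "(\<integral>x. cis (\<xi> i * x) \<partial>normal_law m s) = (\<integral>x. std_normal_density x *\<^sub>R cis (\<xi> i * (m + s * x)) \<partial>lborel)"
          unfolding N by (rule integral_normal_density_affine(2)[OF False]) measurable
        also have "\<dots> = (\<integral>x. cis (\<xi> i * m) * (std_normal_density x *\<^sub>R cis ((\<xi> i * s) * x)) \<partial>lborel)"
          by (simp add: cis_mult mult_scaleR_right distrib_left mult_ac)
        also have "\<dots> = cis (\<xi> i * m) * (\<integral>x. std_normal_density x *\<^sub>R cis ((\<xi> i * s) * x) \<partial>lborel)"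
          by (rule integral_mult_right_zero)
        also have "(\<integral>x. std_normal_density x *\<^sub>R cis ((\<xi> i * s) * x) \<partial>lborel) = (\<integral>x. cis ((\<xi> i * s) * x) \<partial>density lborel std_normal_density)"
          by (subst integral_density) auto
        finally show ?thesis by (simp only: char_std_normal_cis power_mult_distrib mult.commute[of "(\<xi> i)\<^sup>2"])
      qed
      finally show "(\<integral>\<omega>. cis (\<xi> i * X i \<omega>) \<partial>P) = cis (\<xi> i * m) * complex_of_real (exp (- (s\<^sup>2 * (\<xi> i)\<^sup>2 / 2)))" .
    qed
    also have "\<dots> = cis (\<Sum>i\<in>F. \<xi> i * m) * complex_of_real (\<Prod>i\<in>F. exp (- (s\<^sup>2 * (\<xi> i)\<^sup>2 / 2)))"
      by (simp add: prod.distrib prod_cis)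
    also have "(\<Prod>i\<in>F. exp (- (s\<^sup>2 * (\<xi> i)\<^sup>2 / 2))) = exp (- (quad_form F (\<lambda>i j. if i = j then s\<^sup>2 else 0) \<xi> / 2))"
      by (simp only: exp_sum[OF F(1), symmetric] sum_negf sum_divide_distrib[symmetric] sum_distrib_left[symmetric] quad_form_diag[OF F(1)])
    finally show "(\<integral>\<omega>. cis (\<Sum>i\<in>F. \<xi> i * X i \<omega>) \<partial>P)
      = cis (\<Sum>i\<in>F. \<xi> i * m) * complex_of_real (exp (- (quad_form F (\<lambda>i j. if i = j then s\<^sup>2 else 0) \<xi> / 2)))" .
  qed
qed

section \<open>The network\<close>

text \<open>Inverse of taking increments: recovers the potential of a site from its initial value
  and its increments discounted by \<open>\<gamma>\<close>.\<close>

primrec upath :: "real \<Rightarrow> (site_time \<Rightarrow> real) \<Rightarrow> nat \<Rightarrow> int \<Rightarrow> real" where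
  "upath \<gamma> w 0 j = w (j, 0)"
| "upath \<gamma> w (Suc s) j = \<gamma> * upath \<gamma> w s j + w (j, Suc s)"

lemma upath_cong: "(\<And>r. r \<le> s \<Longrightarrow> w (j, r) = w' (j, r)) \<Longrightarrow> upath \<gamma> w s j = upath \<gamma> w' s j"
  by (induction s) auto

definition grid :: "nat \<Rightarrow> nat \<Rightarrow> site_time set" where
  "grid n t = sites n \<times> {0..t}"

lemma grid_iff: "(j, s) \<in> grid n t \<longleftrightarrow> j \<in> sites n \<and> s \<le> t"
  by (simp add: grid_def)

lemma finite_grid [simp]: "finite (grid n t)"
  by (simp add: grid_def sites_eq)

lemma finite_sites [simp]: "finite (sites n)"
  by (simp add: sites_eq)

lemma (in coord) upath_measurable:
  assumes "\<And>r. r \<le> s \<Longrightarrow> (j, r) \<in> D"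
  shows "(\<lambda>w. upath \<gamma> w s j) \<in> borel_measurable (PiM D CM)"
  using assms
proof (induction s)
  case 0
  then show ?case by (simp add: measurable_component_CM)
next
  case (Suc s)
  have [measurable]: "(\<lambda>w. upath \<gamma> w s j) \<in> borel_measurable (PiM D CM)" "(\<lambda>w. w (j, Suc s)) \<in> borel_measurable (PiM D CM)"
    using Suc by (auto intro: measurable_component_CM)
  show ?case by simp
qed

section \<open>Events generated by the random inputs, and the network as a locale\<close>

lemma vimage_generated:
  "i \<in> I \<Longrightarrow> A \<in> sets borel \<Longrightarrow> X i -` A \<inter> space M \<in> generated_events M I X"
  unfolding generated_events_def by (rule sigma_sets.Basic) blast

lemma generated_subset: "generated_events M I X \<subseteq> Pow (space M)"
proof
  fix A assume "A \<in> generated_events M I X"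
  then have A: "A \<in> sigma_sets (space M) (\<Union>i\<in>I. {X i -` A \<inter> space M | A. A \<in> sets borel})"
    unfolding generated_events_def .
  have "A \<subseteq> space M" by (rule sigma_sets_into_sp[OF _ A]) auto
  then show "A \<in> Pow (space M)" by simp
qed

lemma generated_events_measurable:
  assumes "\<And>i. i \<in> I \<Longrightarrow> X i \<in> borel_measurable M"
  shows "generated_events M I X \<subseteq> sets M"
  unfolding generated_events_def
  by (rule sets.sigma_sets_subset) (use assms in auto)

locale network = coord \<mu>I + P: prob_space P
  for \<mu>I :: "real measure" and P :: "'w measure" +
  fixes T :: nat and \<sigma> \<gamma> \<theta>bar \<theta> Jbar :: real
    and f :: "real \<Rightarrow> real" and \<Lambda> :: "int \<Rightarrow> int \<Rightarrow> real"
    and B :: "int \<Rightarrow> nat \<Rightarrow> 'w \<Rightarrow> real" and th u0 :: "int \<Rightarrow> 'w \<Rightarrow> real"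
    and J :: "nat \<Rightarrow> int \<Rightarrow> int \<Rightarrow> 'w \<Rightarrow> real"
  assumes T: "T \<ge> 1" and \<sigma>: "\<sigma> > 0"
    and f_bij: "bij_betw f UNIV {0<..<1}" and f_lip: "\<exists>L. L-lipschitz_on UNIV f"
    and \<Lambda>_summable: "(\<lambda>(k, l). \<bar>\<Lambda> k l\<bar>) summable_on UNIV"
    and B_iid: "iid_family P (UNIV \<times> {0..T - 1}) (\<lambda>(j, t). B j t) (normal_law 0 \<sigma>)"
    and th_iid: "iid_family P UNIV th (normal_law \<theta>bar \<theta>)"
    and u0_iid: "iid_family P UNIV u0 \<mu>I"
    and J_gauss: "\<And>n. n \<ge> 1 \<Longrightarrow> gaussian_family P (sites n \<times> sites n) (\<lambda>(i, j). J n i j)"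
    and J_mean: "\<And>n i j. n \<ge> 1 \<Longrightarrow> i \<in> sites n \<Longrightarrow> j \<in> sites n \<Longrightarrow>
           (\<integral>\<omega>. J n i j \<omega> \<partial>P) = Jbar / real (card (sites n))"
    and J_cov: "\<And>n i j k l. n \<ge> 1 \<Longrightarrow> i \<in> sites n \<Longrightarrow> j \<in> sites n \<Longrightarrow> k \<in> sites n \<Longrightarrow> l \<in> sites n \<Longrightarrow>
           cov P (J n i j) (J n k l)
             = 1 / real (card (sites n)) * \<Lambda> (site_mod (k - i) n) (site_mod (l - j) n)"
    and indep: "\<And>n. n \<ge> 1 \<Longrightarrow> prob_space.indep_sets P
           (\<lambda>q. [generated_events P (UNIV \<times> {0..T - 1}) (\<lambda>(j, t). B j t),
                 generated_events P UNIV th,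
                 generated_events P UNIV u0,
                 generated_events P (sites n \<times> sites n) (\<lambda>(i, j). J n i j)] ! q) {..<4}"
begin

lemma f_bounds: "0 < f x" "f x < 1"
  using f_bij by (auto simp: bij_betw_def)

lemma f_cont: "continuous_on UNIV f"
  using f_lip lipschitz_on_continuous_on by blast

lemma f_measurable [measurable]: "f \<in> borel_measurable borel"
  using f_cont by (rule borel_measurable_continuous_onI)

text \<open>The noise with time index \<open>s - 1\<close> sits at coordinate \<open>(j, s)\<close>,
  the time of the potential that it enters; with the initial values at time \<open>0\<close> this
  gives one field on the grid.\<close>

definition driver :: "'w \<Rightarrow> site_time \<Rightarrow> real" where
  "driver \<omega> i = (if snd i = 0 then u0 (fst i) \<omega> else B (fst i) (snd i - 1) \<omega>)"

definition drift :: "nat \<Rightarrow> 'w \<Rightarrow> (site_time \<Rightarrow> real) \<Rightarrow> site_time \<Rightarrow> real" where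
  "drift n \<omega> w i = (\<Sum>k\<in>sites n. J n (fst i) k \<omega> * f (upath \<gamma> w (snd i - 1) k)) + th (fst i) \<omega>"

text \<open>The recursion is run for an arbitrary field \<open>b\<close> in place of the driver, so
  that for fixed weights the passage from noise to increments becomes a map that can be
  inverted.\<close>

definition solve :: "nat \<Rightarrow> 'w \<Rightarrow> (site_time \<Rightarrow> real) \<Rightarrow> nat \<Rightarrow> int \<Rightarrow> real" where
  "solve n \<omega> b = potential \<gamma> f (sites n) (\<lambda>i k. J n i k \<omega>) (\<lambda>i. th i \<omega>) (\<lambda>i s. b (i, Suc s)) (\<lambda>i. b (i, 0))"

definition incr :: "nat \<Rightarrow> nat \<Rightarrow> 'w \<Rightarrow> (site_time \<Rightarrow> real) \<Rightarrow> site_time \<Rightarrow> real" where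
  "incr n t \<omega> b = (\<lambda>i\<in>grid n t. if snd i = 0 then b i
      else solve n \<omega> b (snd i) (fst i) - \<gamma> * solve n \<omega> b (snd i - 1) (fst i))"

abbreviation net :: "nat \<Rightarrow> 'w \<Rightarrow> nat \<Rightarrow> int \<Rightarrow> real" where
  "net n \<omega> \<equiv> potential \<gamma> f (sites n) (\<lambda>i k. J n i k \<omega>) (\<lambda>i. th i \<omega>) (\<lambda>i s. B i s \<omega>) (\<lambda>i. u0 i \<omega>)"

abbreviation net_incr :: "nat \<Rightarrow> nat \<Rightarrow> 'w \<Rightarrow> site_time \<Rightarrow> real" where
  "net_incr n t \<omega> \<equiv> incr n t \<omega> (restrict (driver \<omega>) (grid n t))"

lemma solve_driver: "j \<in> sites n \<Longrightarrow> s \<le> t \<Longrightarrow> solve n \<omega> (restrict (driver \<omega>) (grid n t)) s j = net n \<omega> s j"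
proof (induction s arbitrary: j)
  case 0
  then show ?case by (simp add: solve_def grid_def driver_def)
next
  case (Suc s)
  have IH: "solve n \<omega> (restrict (driver \<omega>) (grid n t)) s i = net n \<omega> s i" if "i \<in> sites n" for i
    by (rule Suc.IH[OF that]) (use Suc.prems in simp)
  let ?b = "restrict (driver \<omega>) (grid n t)"
  have "solve n \<omega> ?b (Suc s) j = \<gamma> * solve n \<omega> ?b s j
      + (\<Sum>i\<in>sites n. J n j i \<omega> * f (solve n \<omega> ?b s i)) + th j \<omega> + ?b (j, Suc s)"
    by (simp only: solve_def potential.simps)
  also have "\<dots> = \<gamma> * net n \<omega> s j + (\<Sum>i\<in>sites n. J n j i \<omega> * f (net n \<omega> s i)) + th j \<omega> + ?b (j, Suc s)"
    using IH[OF Suc.prems(1)] by (simp only: IH cong: sum.cong)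
  also have "\<dots> = net n \<omega> (Suc s) j"
    using Suc.prems by (simp add: grid_iff driver_def)
  finally show ?case .
qed

lemma upath_incr: "j \<in> sites n \<Longrightarrow> s \<le> t \<Longrightarrow> upath \<gamma> (incr n t \<omega> b) s j = solve n \<omega> b s j"
proof (induction s)
  case 0
  then show ?case by (simp add: incr_def grid_def solve_def)
next
  case (Suc s)
  then show ?case by (simp add: incr_def grid_def)
qed

lemma upath_net: "j \<in> sites n \<Longrightarrow> s \<le> t \<Longrightarrow> upath \<gamma> (net_incr n t \<omega>) s j = net n \<omega> s j"
  by (simp add: upath_incr solve_driver)

text \<open>Inverse of \<open>incr\<close> for fixed weights, written in the shape of
  \<open>nn_integral_triangular_shift\<close>. The inner conditional matters: at time
  \<open>0\<close> the index \<open>snd i - 1\<close> is again \<open>0\<close>, so the bare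
  \<open>drift\<close> would depend on a coordinate that is not strictly earlier.\<close>

abbreviation sub_drift :: "nat \<Rightarrow> nat \<Rightarrow> 'w \<Rightarrow> (site_time \<Rightarrow> real) \<Rightarrow> site_time \<Rightarrow> real" where
  "sub_drift n t \<omega> w \<equiv> (\<lambda>i\<in>grid n t. if snd i = 0 then w i else w i - (if snd i = 0 then 0 else drift n \<omega> w i))"

lemma solve_sub_drift: "j \<in> sites n \<Longrightarrow> s \<le> t \<Longrightarrow> solve n \<omega> (sub_drift n t \<omega> w) s j = upath \<gamma> w s j"
proof (induction s arbitrary: j)
  case 0
  then show ?case by (simp add: solve_def grid_def)
next
  case (Suc s)
  have IH: "solve n \<omega> (sub_drift n t \<omega> w) s i = upath \<gamma> w s i" if "i \<in> sites n" for i
    by (rule Suc.IH[OF that]) (use Suc.prems in simp)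
  have "solve n \<omega> (sub_drift n t \<omega> w) (Suc s) j = \<gamma> * solve n \<omega> (sub_drift n t \<omega> w) s j
      + (\<Sum>i\<in>sites n. J n j i \<omega> * f (solve n \<omega> (sub_drift n t \<omega> w) s i)) + th j \<omega> + sub_drift n t \<omega> w (j, Suc s)"
    by (simp only: solve_def potential.simps)
  also have "\<dots> = \<gamma> * upath \<gamma> w s j + (\<Sum>i\<in>sites n. J n j i \<omega> * f (upath \<gamma> w s i)) + th j \<omega> + sub_drift n t \<omega> w (j, Suc s)"
    using IH[OF Suc.prems(1)] by (simp only: IH cong: sum.cong)
  also have "\<dots> = upath \<gamma> w (Suc s) j"
    using Suc.prems by (simp add: grid_iff drift_def)
  finally show ?case .
qed

lemma incr_sub_drift:
  assumes "w \<in> space (PiM (grid n t) CM)"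
  shows "incr n t \<omega> (sub_drift n t \<omega> w) = w"
proof
  fix i
  show "incr n t \<omega> (sub_drift n t \<omega> w) i = w i"
  proof (cases "i \<in> grid n t")
    case True
    obtain j s where i: "i = (j, s)" by force
    have js: "j \<in> sites n" "s \<le> t" using True i by (auto simp: grid_def)
    show ?thesis
    proof (cases s)
      case 0
      then show ?thesis using True i by (simp add: incr_def)
    next
      case (Suc r)
      have "incr n t \<omega> (sub_drift n t \<omega> w) i = upath \<gamma> w (Suc r) j - \<gamma> * upath \<gamma> w r j"
        using True js Suc unfolding incr_def i by (simp add: solve_sub_drift)
      then show ?thesis by (simp add: i Suc)
    qed
  next
    case False
    then show ?thesis using assms PiE_arb[of w "grid n t" "\<lambda>_. UNIV" i] by (simp add: incr_def space_PiM)
  qed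
qed

definition JG :: "nat \<Rightarrow> 'w set set" where
  "JG n = generated_events P UNIV th \<union> generated_events P (sites n \<times> sites n) (\<lambda>(i, j). J n i j)"

text \<open>The same probability, seen only on the events of weights and thresholds. With
  \<open>\<omega>\<close> itself as second coordinate, equipped with these events, independence of
  the driver becomes a product measure.\<close>

definition Jalg :: "nat \<Rightarrow> 'w measure" where
  "Jalg n = restr_to_subalg P (sigma (space P) (JG n))"

lemma B_meas [measurable]: "s < T \<Longrightarrow> B j s \<in> borel_measurable P"
  using B_iid T unfolding iid_family_def P.indep_vars_def by (force)

lemma th_meas [measurable]: "th j \<in> borel_measurable P"
  using th_iid unfolding iid_family_def P.indep_vars_def by auto

lemma u0_meas [measurable]: "u0 j \<in> borel_measurable P"
  using u0_iid unfolding iid_family_def P.indep_vars_def by auto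

lemma J_meas [measurable]: "n \<ge> 1 \<Longrightarrow> i \<in> sites n \<Longrightarrow> j \<in> sites n \<Longrightarrow> J n i j \<in> borel_measurable P"
  using J_gauss[of n] unfolding gaussian_family_def by auto

lemma JG_sub: "JG n \<subseteq> Pow (space P)"
  unfolding JG_def by (intro Un_least generated_subset)

lemma Jalg_subalgebra: "n \<ge> 1 \<Longrightarrow> subalgebra P (sigma (space P) (JG n))"
  unfolding subalgebra_def
proof (intro conjI)
  assume n: "n \<ge> 1"
  have "JG n \<subseteq> sets P"
    unfolding JG_def by (intro Un_least generated_events_measurable) (use n in \<open>auto split: prod.splits\<close>)
  then show "sets (sigma (space P) (JG n)) \<subseteq> sets P"
    using JG_sub by (simp add: sets.sigma_sets_subset)
qed (simp add: JG_sub)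

lemma space_Jalg: "space (Jalg n) = space P"
  unfolding Jalg_def by (rule space_restr_to_subalg)

lemma sets_Jalg: "n \<ge> 1 \<Longrightarrow> sets (Jalg n) = sigma_sets (space P) (JG n)"
  unfolding Jalg_def by (simp add: sets_restr_to_subalg[OF Jalg_subalgebra] JG_sub)

lemma emeasure_Jalg: "n \<ge> 1 \<Longrightarrow> A \<in> sets (Jalg n) \<Longrightarrow> emeasure (Jalg n) A = emeasure P A"
  unfolding Jalg_def by (rule emeasure_restr_to_subalg[OF Jalg_subalgebra]) (simp_all add: sets_restr_to_subalg[OF Jalg_subalgebra])

lemma prob_Jalg: "n \<ge> 1 \<Longrightarrow> prob_space (Jalg n)"
  unfolding Jalg_def by (rule prob_space_restr_to_subalg[OF Jalg_subalgebra]) (simp_all add: P.prob_space_axioms)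

lemma th_Jalg: "n \<ge> 1 \<Longrightarrow> th j \<in> borel_measurable (Jalg n)"
  by (rule measurableI) (auto simp: sets_Jalg space_Jalg JG_def intro!: sigma_sets.Basic vimage_generated[of j UNIV])

lemma J_Jalg: "n \<ge> 1 \<Longrightarrow> i \<in> sites n \<Longrightarrow> j \<in> sites n \<Longrightarrow> J n i j \<in> borel_measurable (Jalg n)"
  using vimage_generated[of "(i, j)" "sites n \<times> sites n" _ "\<lambda>(i, j). J n i j" P]
  by (intro measurableI) (auto simp: sets_Jalg space_Jalg JG_def intro!: sigma_sets.Basic)

end

section \<open>Independence of noise and weights\<close>

lemma prob_eq_emeasure_distr:
  assumes "X \<in> measurable M borel" "distr M borel X = D" "A \<in> sets borel"
  shows "measure M (X -` A \<inter> space M) = measure D A"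
  using assms by (auto simp: measure_distr)

lemma (in prob_space) iid_family_box:
  assumes X: "iid_family M I X D" and F: "finite F" "F \<subseteq> I" and A: "\<And>i. i \<in> F \<Longrightarrow> A i \<in> sets borel"
  shows "prob {\<omega> \<in> space M. \<forall>i\<in>F. X i \<omega> \<in> A i} = (\<Prod>i\<in>F. measure D (A i))"
proof (cases "F = {}")
  case True
  then show ?thesis by (simp add: prob_space)
next
  case False
  have iv: "indep_vars (\<lambda>_. borel) X I" and D: "\<And>i. i \<in> I \<Longrightarrow> distr M borel (X i) = D"
    using X by (auto simp: iid_family_def)
  have "{\<omega> \<in> space M. \<forall>i\<in>F. X i \<omega> \<in> A i} = (\<Inter>i\<in>F. X i -` A i \<inter> space M)"
    using False by auto
  also have "prob \<dots> = (\<Prod>i\<in>F. prob (X i -` A i \<inter> space M))"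
    by (rule indep_varsD[OF iv False F]) (use A in auto)
  also have "\<dots> = (\<Prod>i\<in>F. measure D (A i))"
  proof (rule prod.cong[OF refl])
    fix i assume i: "i \<in> F"
    have "X i \<in> measurable M borel" using iv i F by (auto simp: indep_vars_def)
    then show "prob (X i -` A i \<inter> space M) = measure D (A i)"
      by (rule prob_eq_emeasure_distr) (use D A i F in auto)
  qed
  finally show ?thesis .
qed

lemma generated_box:
  assumes F: "finite F" "F \<subseteq> I" and A: "\<And>i. i \<in> F \<Longrightarrow> A i \<in> sets borel"
  shows "{\<omega> \<in> space M. \<forall>i\<in>F. X i \<omega> \<in> A i} \<in> generated_events M I X"
proof -
  define S where "S = sigma (space M) (\<Union>i\<in>I. {X i -` A \<inter> space M | A. A \<in> sets borel})"
  have sub: "(\<Union>i\<in>I. {X i -` A \<inter> space M | A. A \<in> sets borel}) \<subseteq> Pow (space M)" by auto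
  have sS: "sets S = generated_events M I X" "space S = space M"
    using sub by (auto simp: S_def generated_events_def)
  have "{\<omega> \<in> space S. \<forall>i\<in>F. X i \<omega> \<in> A i} \<in> sets S"
  proof (rule sets.sets_Collect_finite_All[OF _ F(1)])
    fix i assume i: "i \<in> F"
    have "{\<omega> \<in> space S. X i \<omega> \<in> A i} = X i -` A i \<inter> space M" by (auto simp: sS)
    then show "{\<omega> \<in> space S. X i \<omega> \<in> A i} \<in> sets S"
      unfolding sS by (simp only:) (rule vimage_generated, use i F A in auto)
  qed
  then show ?thesis by (simp only: sS)
qed

context network
begin

lemma solve_measurable:
  assumes n: "n \<ge> 1" and "j \<in> sites n" "s \<le> t"
  shows "(\<lambda>x. solve n (snd x) (fst x) s j) \<in> borel_measurable (PiM (grid n t) CM \<Otimes>\<^sub>M Jalg n)"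
  using assms(2,3)
proof (induction s arbitrary: j)
  case 0
  have "(\<lambda>x. fst x (j, 0)) \<in> borel_measurable (PiM (grid n t) CM \<Otimes>\<^sub>M Jalg n)"
    by (rule measurable_compose[OF measurable_fst measurable_component_CM]) (use 0 in \<open>simp add: grid_iff\<close>)
  then show ?case by (simp add: solve_def)
next
  case (Suc s)
  let ?N = "PiM (grid n t) CM \<Otimes>\<^sub>M Jalg n"
  have IH: "(\<lambda>x. solve n (snd x) (fst x) s i) \<in> borel_measurable ?N" if "i \<in> sites n" for i
    using Suc.IH[OF that] Suc.prems by simp
  have b: "(\<lambda>x. fst x (j, Suc s)) \<in> borel_measurable ?N"
    by (rule measurable_compose[OF measurable_fst measurable_component_CM]) (use Suc.prems in \<open>simp add: grid_iff\<close>)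
  have t: "(\<lambda>x. th j (snd x)) \<in> borel_measurable ?N"
    by (rule measurable_compose[OF measurable_snd th_Jalg[OF n]])
  have "(\<lambda>x. \<gamma> * solve n (snd x) (fst x) s j + (\<Sum>i\<in>sites n. J n j i (snd x) * f (solve n (snd x) (fst x) s i))
      + th j (snd x) + fst x (j, Suc s)) \<in> borel_measurable ?N"
    using Suc.prems
    by (intro borel_measurable_add borel_measurable_times borel_measurable_const borel_measurable_sum b t IH
        measurable_compose[OF IH f_measurable] measurable_compose[OF measurable_snd J_Jalg[OF n]])
  then show ?case by (simp add: solve_def)
qed

lemma incr_measurable:
  assumes n: "n \<ge> 1"
  shows "(\<lambda>x. incr n t (snd x) (fst x)) \<in> measurable (PiM (grid n t) CM \<Otimes>\<^sub>M Jalg n) (PiM (grid n t) CM)"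
  unfolding incr_def
proof (rule measurable_restrict)
  fix i assume i: "i \<in> grid n t"
  let ?N = "PiM (grid n t) CM \<Otimes>\<^sub>M Jalg n"
  have js: "fst i \<in> sites n" "snd i \<le> t" using i by (auto simp: grid_def)
  have b: "(\<lambda>x. fst x i) \<in> borel_measurable ?N"
    by (rule measurable_compose[OF measurable_fst measurable_component_CM[OF i]])
  have "(\<lambda>x. if snd i = 0 then fst x i else solve n (snd x) (fst x) (snd i) (fst i) - \<gamma> * solve n (snd x) (fst x) (snd i - 1) (fst i))
     \<in> borel_measurable ?N"
    using b solve_measurable[OF n js] solve_measurable[OF n js(1), of "snd i - 1" t] js(2)
    by (cases "snd i = 0") auto
  then show "(\<lambda>x. if snd i = 0 then fst x i else solve n (snd x) (fst x) (snd i) (fst i) - \<gamma> * solve n (snd x) (fst x) (snd i - 1) (fst i))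
     \<in> measurable ?N (CM i)"
    by (simp cong: measurable_cong_sets)
qed

lemma drift_measurable:
  assumes n: "n \<ge> 1" and i: "i \<in> grid n t"
  shows "(\<lambda>x. drift n (snd x) (fst x) i) \<in> borel_measurable (PiM (grid n t) CM \<Otimes>\<^sub>M Jalg n)"
proof -
  let ?N = "PiM (grid n t) CM \<Otimes>\<^sub>M Jalg n"
  have js: "fst i \<in> sites n" "snd i \<le> t" using i by (auto simp: grid_def)
  have "(\<lambda>w. upath \<gamma> w (snd i - 1) k) \<in> borel_measurable (PiM (grid n t) CM)" if "k \<in> sites n" for k
    by (rule upath_measurable) (use that js in \<open>auto simp: grid_def\<close>)
  from measurable_compose[OF measurable_fst this]
  have p: "(\<lambda>x. upath \<gamma> (fst x) (snd i - 1) k) \<in> borel_measurable ?N" if "k \<in> sites n" for k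
    using that by blast
  show ?thesis
    unfolding drift_def using js
    by (intro borel_measurable_add borel_measurable_times borel_measurable_sum measurable_compose[OF p f_measurable]
        measurable_compose[OF measurable_snd J_Jalg[OF n]] measurable_compose[OF measurable_snd th_Jalg[OF n]])
qed

lemma driver_measurable:
  assumes "n \<ge> 1" "t \<le> T"
  shows "(\<lambda>\<omega>. restrict (driver \<omega>) (grid n t)) \<in> measurable P (PiM (grid n t) CM)"
proof (rule measurable_restrict)
  fix i assume i: "i \<in> grid n t"
  then have "snd i \<noteq> 0 \<Longrightarrow> snd i - 1 < T" using assms by (auto simp: grid_def)
  then show "(\<lambda>\<omega>. driver \<omega> i) \<in> measurable P (CM i)"
    unfolding driver_def by (cases "snd i = 0") (auto cong: measurable_cong_sets)
qed

lemma gen_algebra: "sigma_algebra (space P) (generated_events P I X)"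
  unfolding generated_events_def by (rule sigma_algebra_sigma_sets) auto

lemma gen_Int_stable: "Int_stable (generated_events P I X)"
proof -
  interpret sigma_algebra "space P" "generated_events P I X" by (rule gen_algebra)
  show ?thesis by (auto intro: Int_stableI)
qed

abbreviation "BG \<equiv> generated_events P (UNIV \<times> {0..T - 1}) (\<lambda>(j, t). B j t)"
abbreviation "uG \<equiv> generated_events P UNIV u0"

text \<open>The four families are regrouped in pairs: noise with initial values at positions
  \<open>0\<close> and \<open>2\<close>, thresholds with weights at positions \<open>1\<close> and
  \<open>3\<close>.\<close>

lemma indep_groups:
  assumes n: "n \<ge> 1" and A: "A \<in> sigma_sets (space P) (BG \<union> uG)" and C: "C \<in> sigma_sets (space P) (JG n)"
  shows "P.prob (A \<inter> C) = P.prob A * P.prob C"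
proof -
  let ?E = "\<lambda>q :: nat. [BG, generated_events P UNIV th, uG, generated_events P (sites n \<times> sites n) (\<lambda>(i, j). J n i j)] ! q"
  let ?I = "\<lambda>p :: nat. if p = 0 then {0, 2} else {1, 3 :: nat}"
  have U: "(\<Union>p\<in>{0, 1}. ?I p) = {..<4}" by auto
  have st: "Int_stable (?E i)" if "p \<in> {0, 1}" "i \<in> ?I p" for p i
  proof -
    have "i \<in> {0, 1, 2, 3}" using that by (auto split: if_splits)
    then show ?thesis by (elim insertE emptyE) (simp_all add: gen_Int_stable numeral_3_eq_3 numeral_2_eq_2)
  qed
  have "P.indep_sets (\<lambda>p. sigma_sets (space P) (\<Union>i\<in>?I p. ?E i)) {0, 1}"
    by (rule P.indep_sets_collect_sigma) (use indep[OF n] U st in \<open>auto simp: disjoint_family_on_def\<close>)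
  from P.indep_setsD[OF this, of "{0, 1}" "\<lambda>p. if p = 0 then A else C"] A C
  show ?thesis by (simp add: JG_def numeral_3_eq_3 numeral_2_eq_2 Int_commute)
qed

lemma indep_u_B:
  assumes A: "A \<in> BG" and C: "C \<in> uG"
  shows "P.prob (A \<inter> C) = P.prob A * P.prob C"
  using P.indep_setsD[OF indep[of 1], of "{0, 2}" "\<lambda>q. if q = 0 then A else C"] A C
  by (simp add: numeral_2_eq_2 Int_commute)

lemma distr_driver:
  assumes n: "n \<ge> 1" and t: "t \<le> T"
  shows "distr P (PiM (grid n t) CM) (\<lambda>\<omega>. restrict (driver \<omega>) (grid n t)) = PiM (grid n t) (noise_measure (\<lambda>_. 0) \<sigma>)"
proof -
  interpret N: product_sigma_finite "noise_measure (\<lambda>_. 0) \<sigma>"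
    by (intro product_sigma_finite.intro prob_space_imp_sigma_finite prob_noise_measure \<sigma>)
  let ?D = "grid n t"
  show ?thesis
  proof (rule N.PiM_eqI)
    show "finite ?D" by simp
    show "sets (distr P (PiM ?D CM) (\<lambda>\<omega>. restrict (driver \<omega>) ?D)) = sets (PiM ?D (noise_measure (\<lambda>_. 0) \<sigma>))"
      by (auto intro!: sets_PiM_cong)
    fix A assume "\<And>i. i \<in> ?D \<Longrightarrow> A i \<in> sets (noise_measure (\<lambda>_. 0) \<sigma> i)"
    then have A: "i \<in> ?D \<Longrightarrow> A i \<in> sets borel" for i by simp
    have box: "Pi\<^sub>E ?D A \<in> sets (PiM ?D CM)" by (rule sets_PiM_I_finite) (auto simp: A)
    define Z where "Z = {i \<in> ?D. snd i = 0}"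
    have ZD: "finite Z" "finite (pos ?D)" "Z \<inter> pos ?D = {}" "?D = Z \<union> pos ?D"
      by (auto simp: Z_def pos_def)
    define Eu where "Eu = {\<omega> \<in> space P. \<forall>j\<in>fst ` Z. u0 j \<omega> \<in> A (j, 0)}"
    \<comment> \<open>Leads from a coordinate at a positive time back to the index of its noise
      variable; the product over noise indices is reindexed along this injection.\<close>
    define dec where "dec = (\<lambda>i :: site_time. (fst i, snd i - 1))"
    define EB where "EB = {\<omega> \<in> space P. \<forall>i\<in>dec ` pos ?D. (case i of (j, t) \<Rightarrow> B j t) \<omega> \<in> A (fst i, Suc (snd i))}"
    have injd: "inj_on dec (pos ?D)" by (auto simp: inj_on_def dec_def pos_def)
    have injf: "inj_on fst Z" by (auto simp: inj_on_def Z_def)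
    have sub: "dec ` pos ?D \<subseteq> UNIV \<times> {0..T - 1}" using t by (auto simp: dec_def pos_def grid_def)
    have Au: "A (j, 0) \<in> sets borel" if "j \<in> fst ` Z" for j using that A by (auto simp: Z_def)
    have AB: "A (fst i, Suc (snd i)) \<in> sets borel" if "i \<in> dec ` pos ?D" for i using that A by (auto simp: dec_def pos_def)
    have "emeasure (distr P (PiM ?D CM) (\<lambda>\<omega>. restrict (driver \<omega>) ?D)) (Pi\<^sub>E ?D A)
       = emeasure P ((\<lambda>\<omega>. restrict (driver \<omega>) ?D) -` Pi\<^sub>E ?D A \<inter> space P)"
      by (rule emeasure_distr[OF driver_measurable[OF n t] box])
    also have "(\<lambda>\<omega>. restrict (driver \<omega>) ?D) -` Pi\<^sub>E ?D A \<inter> space P = EB \<inter> Eu"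
    proof -
      have a0: "restrict (driver \<omega>) ?D \<in> Pi\<^sub>E ?D A \<longleftrightarrow> (\<forall>i\<in>?D. driver \<omega> i \<in> A i)" for \<omega>
        by (auto simp: PiE_iff)
      have a1: "(\<forall>i\<in>?D. driver \<omega> i \<in> A i) \<longleftrightarrow> (\<forall>i\<in>Z. u0 (fst i) \<omega> \<in> A i) \<and> (\<forall>i\<in>pos ?D. B (fst i) (snd i - 1) \<omega> \<in> A i)" for \<omega>
        by (subst ZD(4)) (auto simp: ball_Un driver_def Z_def pos_def)
      have a2: "(\<forall>i\<in>Z. u0 (fst i) \<omega> \<in> A i) \<longleftrightarrow> (\<forall>j\<in>fst ` Z. u0 j \<omega> \<in> A (j, 0))" for \<omega>
        by (force simp: Z_def)
      have a3: "(\<forall>i\<in>pos ?D. B (fst i) (snd i - 1) \<omega> \<in> A i) \<longleftrightarrow> (\<forall>i\<in>dec ` pos ?D. (case i of (j, t) \<Rightarrow> B j t) \<omega> \<in> A (fst i, Suc (snd i)))" for \<omega>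
        by (auto simp: dec_def pos_def)
      show ?thesis
        unfolding EB_def Eu_def by (rule set_eqI) (simp only: vimage_eq Int_iff mem_Collect_eq a0 a1 a2 a3, blast)
    qed
    also have "emeasure P \<dots> = ennreal (P.prob EB * P.prob Eu)"
    proof -
      have "EB \<in> BG" unfolding EB_def by (rule generated_box) (use ZD sub AB in auto)
      moreover have "Eu \<in> uG" unfolding Eu_def by (rule generated_box) (use ZD Au in auto)
      ultimately show ?thesis by (simp add: P.emeasure_eq_measure indep_u_B)
    qed
    also have "P.prob EB = (\<Prod>i\<in>dec ` pos ?D. measure (normal_law 0 \<sigma>) (A (fst i, Suc (snd i))))"
      unfolding EB_def by (rule P.iid_family_box[OF B_iid _ sub]) (use ZD AB in auto)
    also have "\<dots> = (\<Prod>i\<in>pos ?D. measure (noise_measure (\<lambda>_. 0) \<sigma> i) (A i))"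
      unfolding prod.reindex[OF injd]
      by (rule prod.cong) (use \<sigma> in \<open>auto simp: dec_def pos_def noise_measure_def normal_law_def\<close>)
    also have "P.prob Eu = (\<Prod>j\<in>fst ` Z. measure \<mu>I (A (j, 0)))"
      unfolding Eu_def by (rule P.iid_family_box[OF u0_iid]) (use ZD Au in auto)
    also have "\<dots> = (\<Prod>i\<in>Z. measure (noise_measure (\<lambda>_. 0) \<sigma> i) (A i))"
      unfolding prod.reindex[OF injf] by (rule prod.cong) (auto simp: Z_def noise_measure_def)
    also have "(\<Prod>i\<in>pos ?D. measure (noise_measure (\<lambda>_. 0) \<sigma> i) (A i)) * (\<Prod>i\<in>Z. measure (noise_measure (\<lambda>_. 0) \<sigma> i) (A i))
       = (\<Prod>i\<in>?D. measure (noise_measure (\<lambda>_. 0) \<sigma> i) (A i))"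
      using prod.union_disjoint[OF ZD(1,2,3), of "\<lambda>i. measure (noise_measure (\<lambda>_. 0) \<sigma> i) (A i)"]
      unfolding ZD(4)[symmetric] by (simp only: mult.commute)
    also have "ennreal \<dots> = (\<Prod>i\<in>?D. emeasure (noise_measure (\<lambda>_. 0) \<sigma> i) (A i))"
      by (simp add: prod_ennreal[symmetric] finite_measure.emeasure_eq_measure[OF prob_space.finite_measure[OF prob_noise_measure[OF \<sigma>]]])
    finally show "emeasure (distr P (PiM ?D CM) (\<lambda>\<omega>. restrict (driver \<omega>) ?D)) (Pi\<^sub>E ?D A)
      = (\<Prod>i\<in>?D. emeasure (noise_measure (\<lambda>_. 0) \<sigma> i) (A i))" .
  qed
qed

text \<open>Rectangles determine the law. Since the second component is \<open>\<omega>\<close>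
  itself, the rectangle \<open>A \<times> C\<close> pulls back to an event of the driver intersected
  with \<open>C\<close>, and these two are independent.\<close>

lemma distr_driver_Jalg:
  assumes n: "n \<ge> 1" and t: "t \<le> T"
  shows "distr P (PiM (grid n t) CM \<Otimes>\<^sub>M Jalg n) (\<lambda>\<omega>. (restrict (driver \<omega>) (grid n t), \<omega>))
     = PiM (grid n t) (noise_measure (\<lambda>_. 0) \<sigma>) \<Otimes>\<^sub>M Jalg n"
proof -
  let ?D = "grid n t" and ?X = "\<lambda>\<omega>. restrict (driver \<omega>) (grid n t)"
  interpret J: prob_space "Jalg n" by (rule prob_Jalg[OF n])
  have pN: "prob_space (PiM ?D (noise_measure (\<lambda>_. 0) \<sigma>))" by (intro prob_space_PiM prob_noise_measure \<sigma>)
  have sN: "sets (PiM ?D (noise_measure (\<lambda>_. 0) \<sigma>)) = sets (PiM ?D CM)" by (intro sets_PiM_cong) auto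
  have id: "(\<lambda>\<omega>. \<omega>) \<in> measurable P (Jalg n)"
  proof (rule measurableI)
    fix A assume A: "A \<in> sets (Jalg n)"
    then have "A \<in> sets P"
      using Jalg_subalgebra[OF n] unfolding Jalg_def sets_restr_to_subalg[OF Jalg_subalgebra[OF n]] by (auto simp: subalgebra_def)
    then show "(\<lambda>\<omega>. \<omega>) -` A \<inter> space P \<in> sets P" by simp
  qed (simp add: space_Jalg)
  have pair: "(\<lambda>\<omega>. (?X \<omega>, \<omega>)) \<in> measurable P (PiM ?D CM \<Otimes>\<^sub>M Jalg n)"
    by (rule measurable_Pair[OF driver_measurable[OF n t] id])
  show ?thesis
  proof (rule pair_measure_eqI[symmetric])
    show "sigma_finite_measure (PiM ?D (noise_measure (\<lambda>_. 0) \<sigma>))" using pN by (rule prob_space_imp_sigma_finite)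
    show "sigma_finite_measure (Jalg n)" by (rule J.sigma_finite_measure_axioms)
    show "sets (PiM ?D (noise_measure (\<lambda>_. 0) \<sigma>) \<Otimes>\<^sub>M Jalg n) = sets (distr P (PiM ?D CM \<Otimes>\<^sub>M Jalg n) (\<lambda>\<omega>. (?X \<omega>, \<omega>)))"
      using sN by (simp cong: sets_pair_measure_cong)
    fix A C assume A: "A \<in> sets (PiM ?D (noise_measure (\<lambda>_. 0) \<sigma>))" and C: "C \<in> sets (Jalg n)"
    then have A': "A \<in> sets (PiM ?D CM)" by (simp add: sN)
    have Csp: "C \<subseteq> space P" using sets.sets_into_space[OF C] by (simp add: space_Jalg)
    have XA: "?X -` A \<inter> space P \<in> sigma_sets (space P) (BG \<union> uG)"
    proof -
      define S where "S = sigma (space P) (BG \<union> uG)"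
      have sub: "BG \<union> uG \<subseteq> Pow (space P)" by (intro Un_least generated_subset)
      have sS: "sets S = sigma_sets (space P) (BG \<union> uG)" "space S = space P"
        using sub by (auto simp: S_def)
      have "?X \<in> measurable S (PiM ?D CM)"
      proof (rule measurable_restrict)
        fix i assume i: "i \<in> ?D"
        have "(\<lambda>\<omega>. driver \<omega> i) \<in> borel_measurable S"
        proof (rule measurableI)
          fix b :: "real set" assume b: "b \<in> sets borel"
          show "(\<lambda>\<omega>. driver \<omega> i) -` b \<inter> space S \<in> sets S"
          proof (cases "snd i = 0")
            case True
            then show ?thesis using vimage_generated[OF UNIV_I b, of u0 "fst i" P]
              by (auto simp: sS driver_def intro!: sigma_sets.Basic)
          next
            case False
            have "(fst i, snd i - 1) \<in> UNIV \<times> {0..T - 1}" using i False t by (auto simp: grid_def)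
            from vimage_generated[OF this b, of "\<lambda>(j, t). B j t" P] False show ?thesis
              by (auto simp: sS driver_def intro!: sigma_sets.Basic)
          qed
        qed simp
        then show "(\<lambda>\<omega>. driver \<omega> i) \<in> measurable S (CM i)" by (simp cong: measurable_cong_sets)
      qed
      from measurable_sets[OF this A'] show ?thesis by (simp add: sS)
    qed
    have "emeasure (distr P (PiM ?D CM \<Otimes>\<^sub>M Jalg n) (\<lambda>\<omega>. (?X \<omega>, \<omega>))) (A \<times> C)
       = emeasure P ((\<lambda>\<omega>. (?X \<omega>, \<omega>)) -` (A \<times> C) \<inter> space P)"
      by (rule emeasure_distr[OF pair]) (use A' C in auto)
    also have "(\<lambda>\<omega>. (?X \<omega>, \<omega>)) -` (A \<times> C) \<inter> space P = (?X -` A \<inter> space P) \<inter> C" using Csp by auto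
    also have "emeasure P \<dots> = ennreal (P.prob (?X -` A \<inter> space P) * P.prob C)"
      using C by (simp add: P.emeasure_eq_measure indep_groups[OF n XA] sets_Jalg[OF n])
    also have "\<dots> = emeasure P (?X -` A \<inter> space P) * emeasure P C"
      by (simp add: P.emeasure_eq_measure ennreal_mult)
    also have "emeasure P (?X -` A \<inter> space P) = emeasure (PiM ?D (noise_measure (\<lambda>_. 0) \<sigma>)) A"
      unfolding distr_driver[OF n t, symmetric] by (rule emeasure_distr[OF driver_measurable[OF n t] A', symmetric])
    also have "emeasure P C = emeasure (Jalg n) C" by (rule emeasure_Jalg[OF n C, symmetric])
    finally show "emeasure (PiM ?D (noise_measure (\<lambda>_. 0) \<sigma>)) A * emeasure (Jalg n) C
      = emeasure (distr P (PiM ?D CM \<Otimes>\<^sub>M Jalg n) (\<lambda>\<omega>. (?X \<omega>, \<omega>))) (A \<times> C)" ..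
  qed
qed

end

section \<open>The density of the increments\<close>

lemma quad_form_linear_map:
  assumes "\<And>p. p \<in> Q \<Longrightarrow> a p = (\<Sum>i\<in>I. \<xi> i * L i p)"
  shows "quad_form Q C a = quad_form I (\<lambda>i i'. \<Sum>p\<in>Q. \<Sum>q\<in>Q. L i p * C p q * L i' q) \<xi>"
proof -
  have "quad_form Q C a = (\<Sum>p\<in>Q. \<Sum>q\<in>Q. (\<Sum>i\<in>I. \<xi> i * L i p) * C p q * (\<Sum>i'\<in>I. \<xi> i' * L i' q))"
    unfolding quad_form_def using assms by (intro sum.cong) auto
  also have "\<dots> = (\<Sum>p\<in>Q. \<Sum>q\<in>Q. \<Sum>i\<in>I. \<Sum>i'\<in>I. \<xi> i * (L i p * C p q * L i' q) * \<xi> i')"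
    by (simp add: sum_distrib_left sum_distrib_right mult_ac)
  also have "\<dots> = (\<Sum>p\<in>Q. \<Sum>i\<in>I. \<Sum>q\<in>Q. \<Sum>i'\<in>I. \<xi> i * (L i p * C p q * L i' q) * \<xi> i')"
    by (intro sum.cong refl sum.swap)
  also have "\<dots> = (\<Sum>i\<in>I. \<Sum>p\<in>Q. \<Sum>q\<in>Q. \<Sum>i'\<in>I. \<xi> i * (L i p * C p q * L i' q) * \<xi> i')"
    by (rule sum.swap)
  also have "\<dots> = (\<Sum>i\<in>I. \<Sum>p\<in>Q. \<Sum>i'\<in>I. \<Sum>q\<in>Q. \<xi> i * (L i p * C p q * L i' q) * \<xi> i')"
    by (intro sum.cong refl sum.swap)
  also have "\<dots> = (\<Sum>i\<in>I. \<Sum>i'\<in>I. \<Sum>p\<in>Q. \<Sum>q\<in>Q. \<xi> i * (L i p * C p q * L i' q) * \<xi> i')"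
    by (intro sum.cong refl sum.swap)
  also have "\<dots> = quad_form I (\<lambda>i i'. \<Sum>p\<in>Q. \<Sum>q\<in>Q. L i p * C p q * L i' q) \<xi>"
    unfolding quad_form_def by (simp add: sum_distrib_left sum_distrib_right)
  finally show ?thesis .
qed

lemma gaussian_vector_linear_map:
  assumes G: "gaussian_vector M Q X m C"
  shows "gaussian_vector M I (\<lambda>i \<omega>. \<Sum>p\<in>Q. L i p * X p \<omega>) (\<lambda>i. \<Sum>p\<in>Q. L i p * m p) (\<lambda>i i'. \<Sum>p\<in>Q. \<Sum>q\<in>Q. L i p * C p q * L i' q)"
  unfolding gaussian_vector_def
proof (intro conjI ballI allI)
  have [measurable]: "p \<in> Q \<Longrightarrow> X p \<in> borel_measurable M" for p using G by (simp add: gaussian_vector_def)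
  show "(\<lambda>\<omega>. \<Sum>p\<in>Q. L i p * X p \<omega>) \<in> borel_measurable M" for i by simp
  fix \<xi> :: "'c \<Rightarrow> real"
  define a where "a = (\<lambda>p. \<Sum>i\<in>I. \<xi> i * L i p)"
  have e: "(\<Sum>i\<in>I. \<xi> i * (\<Sum>p\<in>Q. L i p * h p)) = (\<Sum>p\<in>Q. a p * h p)" for h
    unfolding a_def sum_distrib_left sum_distrib_right by (subst sum.swap) (simp add: mult_ac)
  have q: "quad_form Q C a = quad_form I (\<lambda>i i'. \<Sum>p\<in>Q. \<Sum>q\<in>Q. L i p * C p q * L i' q) \<xi>"
    by (rule quad_form_linear_map) (simp add: a_def)
  show "(\<integral>\<omega>. cis (\<Sum>i\<in>I. \<xi> i * (\<Sum>p\<in>Q. L i p * X p \<omega>)) \<partial>M)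
    = cis (\<Sum>i\<in>I. \<xi> i * (\<Sum>p\<in>Q. L i p * m p)) * complex_of_real (exp (- (quad_form I (\<lambda>i i'. \<Sum>p\<in>Q. \<Sum>q\<in>Q. L i p * C p q * L i' q) \<xi> / 2)))"
    unfolding e q[symmetric] using G[unfolded gaussian_vector_def, THEN conjunct2, rule_format, of a] .
qed

text \<open>Independence enters as a factorisation of characteristic functions, the form in which it
  is available for linear functionals of weights and thresholds on one common space.\<close>

lemma gaussian_vector_add:
  assumes G1: "gaussian_vector M I G1 m1 K1" and G2: "gaussian_vector M I G2 m2 K2"
    and ind: "\<And>\<xi>. (\<integral>\<omega>. cis (\<Sum>i\<in>I. \<xi> i * G1 i \<omega>) * cis (\<Sum>i\<in>I. \<xi> i * G2 i \<omega>) \<partial>M)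
        = (\<integral>\<omega>. cis (\<Sum>i\<in>I. \<xi> i * G1 i \<omega>) \<partial>M) * (\<integral>\<omega>. cis (\<Sum>i\<in>I. \<xi> i * G2 i \<omega>) \<partial>M)"
  shows "gaussian_vector M I (\<lambda>i \<omega>. G1 i \<omega> + G2 i \<omega>) (\<lambda>i. m1 i + m2 i) (\<lambda>i j. K1 i j + K2 i j)"
  unfolding gaussian_vector_def
proof (intro conjI ballI allI)
  fix i assume "i \<in> I"
  then have "G1 i \<in> borel_measurable M" "G2 i \<in> borel_measurable M" using G1 G2 by (auto simp: gaussian_vector_def)
  then show "(\<lambda>\<omega>. G1 i \<omega> + G2 i \<omega>) \<in> borel_measurable M" by simp
next
  fix \<xi> :: "'b \<Rightarrow> real"
  have "(\<integral>\<omega>. cis (\<Sum>i\<in>I. \<xi> i * (G1 i \<omega> + G2 i \<omega>)) \<partial>M) = (\<integral>\<omega>. cis (\<Sum>i\<in>I. \<xi> i * G1 i \<omega>) * cis (\<Sum>i\<in>I. \<xi> i * G2 i \<omega>) \<partial>M)"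
    by (simp add: cis_mult algebra_simps sum.distrib)
  also have "\<dots> = (\<integral>\<omega>. cis (\<Sum>i\<in>I. \<xi> i * G1 i \<omega>) \<partial>M) * (\<integral>\<omega>. cis (\<Sum>i\<in>I. \<xi> i * G2 i \<omega>) \<partial>M)" by (rule ind)
  also have "(\<integral>\<omega>. cis (\<Sum>i\<in>I. \<xi> i * G1 i \<omega>) \<partial>M) = cis (\<Sum>i\<in>I. \<xi> i * m1 i) * complex_of_real (exp (- (quad_form I K1 \<xi> / 2)))"
    using G1 by (simp add: gaussian_vector_def)
  also have "(\<integral>\<omega>. cis (\<Sum>i\<in>I. \<xi> i * G2 i \<omega>) \<partial>M) = cis (\<Sum>i\<in>I. \<xi> i * m2 i) * complex_of_real (exp (- (quad_form I K2 \<xi> / 2)))"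
    using G2 by (simp add: gaussian_vector_def)
  also have "cis (\<Sum>i\<in>I. \<xi> i * m1 i) * complex_of_real (exp (- (quad_form I K1 \<xi> / 2)))
       * (cis (\<Sum>i\<in>I. \<xi> i * m2 i) * complex_of_real (exp (- (quad_form I K2 \<xi> / 2))))
      = cis (\<Sum>i\<in>I. \<xi> i * (m1 i + m2 i)) * complex_of_real (exp (- (quad_form I (\<lambda>i j. K1 i j + K2 i j) \<xi> / 2)))"
  proof -
    have 1: "cis (\<Sum>i\<in>I. \<xi> i * (m1 i + m2 i)) = cis (\<Sum>i\<in>I. \<xi> i * m1 i) * cis (\<Sum>i\<in>I. \<xi> i * m2 i)"
      unfolding cis_mult by (simp only: distrib_left sum.distrib)
    have "exp (- (quad_form I (\<lambda>i j. K1 i j + K2 i j) \<xi> / 2)) = exp (- (quad_form I K1 \<xi> / 2)) * exp (- (quad_form I K2 \<xi> / 2))"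
      unfolding quad_form_add exp_add[symmetric] by (simp add: field_simps)
    then show ?thesis unfolding 1 by simp
  qed
  finally show "(\<integral>\<omega>. cis (\<Sum>i\<in>I. \<xi> i * (G1 i \<omega> + G2 i \<omega>)) \<partial>M)
      = cis (\<Sum>i\<in>I. \<xi> i * (m1 i + m2 i)) * complex_of_real (exp (- (quad_form I (\<lambda>i j. K1 i j + K2 i j) \<xi> / 2)))" .
qed

text \<open>A characteristic function is bounded by one in modulus, so the exponent cannot be
  positive.\<close>

lemma gaussian_vector_quad_form_nonneg:
  assumes "prob_space M" and G: "gaussian_vector M I G m K"
  shows "0 \<le> quad_form I K \<xi>"
proof -
  interpret prob_space M by fact
  have [measurable]: "i \<in> I \<Longrightarrow> G i \<in> borel_measurable M" for i using G by (simp add: gaussian_vector_def)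
  have "norm (\<integral>\<omega>. cis (\<Sum>i\<in>I. \<xi> i * G i \<omega>) \<partial>M) \<le> (\<integral>\<omega>. norm (cis (\<Sum>i\<in>I. \<xi> i * G i \<omega>)) \<partial>M)"
    by (rule integral_norm_bound)
  then have "norm (cis (\<Sum>i\<in>I. \<xi> i * m i) * complex_of_real (exp (- (quad_form I K \<xi> / 2)))) \<le> 1"
    using G by (simp add: gaussian_vector_def prob_space)
  then show ?thesis by (simp add: norm_mult)
qed

lemma gaussian_vector_eq:
  assumes "gaussian_vector M I G m K" "\<And>i \<omega>. i \<in> I \<Longrightarrow> G i \<omega> = G' i \<omega>" "\<And>i. i \<in> I \<Longrightarrow> m i = m' i"
    "\<And>i j. i \<in> I \<Longrightarrow> j \<in> I \<Longrightarrow> K i j = K' i j"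
  shows "gaussian_vector M I G' m' K'"
proof -
  have "i \<in> I \<Longrightarrow> G' i = G i" for i using assms(2) by auto
  moreover have "quad_form I K' \<xi> = quad_form I K \<xi>" for \<xi> by (rule quad_form_cong) (use assms in auto)
  moreover have "(\<Sum>i\<in>I. \<xi> i * G' i \<omega>) = (\<Sum>i\<in>I. \<xi> i * G i \<omega>)" for \<xi> \<omega> using assms(2) by simp
  moreover have "(\<Sum>i\<in>I. \<xi> i * m' i) = (\<Sum>i\<in>I. \<xi> i * m i)" for \<xi> using assms(3) by simp
  ultimately show ?thesis using assms(1) by (simp add: gaussian_vector_def)
qed

context network
begin

text \<open>Mean and, in \<open>net_cov\<close>, covariance of the drift when the path inside it is
  held fixed at \<open>w\<close>. At positive times they involve only strictly earlier times of
  \<open>w\<close>, which is what the induction over time rests on.\<close>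

definition net_mean :: "nat \<Rightarrow> (site_time \<Rightarrow> real) \<Rightarrow> site_time \<Rightarrow> real" where
  "net_mean n w i = \<theta>bar + Jbar / real (card (sites n)) * (\<Sum>k\<in>sites n. f (upath \<gamma> w (snd i - 1) k))"

definition net_cov :: "nat \<Rightarrow> (site_time \<Rightarrow> real) \<Rightarrow> site_time \<Rightarrow> site_time \<Rightarrow> real" where
  "net_cov n w i i' = (if fst i = fst i' then \<theta>\<^sup>2 else 0) + 1 / real (card (sites n)) *
     (\<Sum>k\<in>sites n. \<Sum>l\<in>sites n. \<Lambda> (site_mod (fst i' - fst i) n) (site_mod (l - k) n)
        * f (upath \<gamma> w (snd i - 1) k) * f (upath \<gamma> w (snd i' - 1) l))"

lemma indep_cis_J_th:
  assumes n: "n \<ge> 1"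
  shows "(\<integral>\<omega>. cis (\<Sum>p\<in>sites n \<times> sites n. a p * J n (fst p) (snd p) \<omega>) * cis (\<Sum>j\<in>sites n. c j * th j \<omega>) \<partial>P)
     = (\<integral>\<omega>. cis (\<Sum>p\<in>sites n \<times> sites n. a p * J n (fst p) (snd p) \<omega>) \<partial>P) * (\<integral>\<omega>. cis (\<Sum>j\<in>sites n. c j * th j \<omega>) \<partial>P)"
proof -
  let ?X = "\<lambda>\<omega>. cis (\<Sum>p\<in>sites n \<times> sites n. a p * J n (fst p) (snd p) \<omega>)" and ?Y = "\<lambda>\<omega>. cis (\<Sum>j\<in>sites n. c j * th j \<omega>)"
  let ?GJ = "generated_events P (sites n \<times> sites n) (\<lambda>(i, j). J n i j)" and ?GT = "generated_events P UNIV th"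
  have Jm: "p \<in> sites n \<times> sites n \<Longrightarrow> J n (fst p) (snd p) \<in> borel_measurable P" for p
    by (rule J_meas[OF n]) auto
  have X: "?X \<in> borel_measurable P"
    by (intro measurable_compose[OF _ cis_measurable] borel_measurable_sum borel_measurable_times Jm) auto
  have Y: "?Y \<in> borel_measurable P"
    by (intro measurable_compose[OF _ cis_measurable] borel_measurable_sum borel_measurable_times th_meas) auto
  \<comment> \<open>A function that is measurable for every structure making the family
    \<open>Z\<close> measurable is measurable for the events generated by \<open>Z\<close>.
    Instantiated below for the weights and for the thresholds.\<close>
  have S: "h -` A \<inter> space P \<in> generated_events P I Z"
    if h: "\<And>N. (\<And>i. i \<in> I \<Longrightarrow> Z i \<in> borel_measurable N) \<Longrightarrow> h \<in> borel_measurable N" and A: "A \<in> sets borel"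
    for h :: "'w \<Rightarrow> complex" and I :: "'i set" and Z A
  proof -
    define S where "S = sigma (space P) (\<Union>i\<in>I. {Z i -` A \<inter> space P | A. A \<in> sets borel})"
    have sub: "(\<Union>i\<in>I. {Z i -` A \<inter> space P | A. A \<in> sets borel}) \<subseteq> Pow (space P)" by auto
    have sS: "sets S = generated_events P I Z" "space S = space P"
      using sub by (auto simp: S_def generated_events_def)
    have "h \<in> borel_measurable S"
      by (rule h, rule measurableI) (auto simp: sS vimage_generated)
    from measurable_sets[OF this A] show ?thesis by (simp add: sS)
  qed
  have SX: "?X -` A \<inter> space P \<in> ?GJ" if "A \<in> sets borel" for A
  proof (rule S[OF _ that])
    fix N assume N: "\<And>i. i \<in> sites n \<times> sites n \<Longrightarrow> (case i of (i, j) \<Rightarrow> J n i j) \<in> borel_measurable N"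
    have "J n (fst p) (snd p) \<in> borel_measurable N" if "p \<in> sites n \<times> sites n" for p
      using N[OF that] by (simp add: case_prod_beta)
    then show "?X \<in> borel_measurable N"
      by (intro measurable_compose[OF _ cis_measurable] borel_measurable_sum borel_measurable_times) auto
  qed
  have SY: "?Y -` A \<inter> space P \<in> ?GT" if "A \<in> sets borel" for A
  proof (rule S[OF _ that])
    fix N assume N: "\<And>i. i \<in> UNIV \<Longrightarrow> th i \<in> borel_measurable N"
    then show "?Y \<in> borel_measurable N"
      by (intro measurable_compose[OF _ cis_measurable] borel_measurable_sum borel_measurable_times) auto
  qed
  have p: "P.prob (E \<inter> F) = P.prob E * P.prob F" if "E \<in> ?GJ" "F \<in> ?GT" for E F
    using P.indep_setsD[OF indep[OF n], of "{1, 3}" "\<lambda>q. if q = 1 then F else E"] that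
    by (simp add: numeral_3_eq_3 Int_commute mult.commute)
  have "P.indep_var borel ?X borel ?Y"
  proof (rule P.indep_var_eq[THEN iffD2], intro conjI X Y)
    have sX: "sigma_sets (space P) {?X -` A \<inter> space P | A. A \<in> sets borel} \<subseteq> ?GJ"
    proof -
      interpret sigma_algebra "space P" ?GJ by (rule gen_algebra)
      show ?thesis by (rule sigma_sets_subset) (use SX in auto)
    qed
    have sY: "sigma_sets (space P) {?Y -` A \<inter> space P | A. A \<in> sets borel} \<subseteq> ?GT"
    proof -
      interpret sigma_algebra "space P" ?GT by (rule gen_algebra)
      show ?thesis by (rule sigma_sets_subset) (use SY in auto)
    qed
    have "?GJ \<subseteq> P.events" by (rule generated_events_measurable) (use n in auto)
    moreover have "?GT \<subseteq> P.events" by (rule generated_events_measurable) auto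
    ultimately show "P.indep_set (sigma_sets (space P) {?X -` A \<inter> space P | A. A \<in> sets borel})
       (sigma_sets (space P) {?Y -` A \<inter> space P | A. A \<in> sets borel})"
      using sX sY by (intro P.indep_setI p) blast+
  qed
  moreover have "integrable P ?X" by (rule P.integrable_const_bound[where B = 1]) (use X in auto)
  moreover have "integrable P ?Y" by (rule P.integrable_const_bound[where B = 1]) (use Y in auto)
  ultimately show ?thesis by (rule P.indep_var_lebesgue_integral)
qed

text \<open>With the path frozen at \<open>w\<close>, the drift is a linear image of the weights,
  with coefficients \<open>L\<close>, plus a linear image of the thresholds, with coefficients
  \<open>R\<close>. Both are Gaussian and they are independent, so means and covariances are carried
  through the linear maps.\<close>

lemma gaussian_vector_drift:
  assumes n: "n \<ge> 1"
  shows "gaussian_vector P (pos (grid n t)) (\<lambda>i \<omega>. drift n \<omega> w i) (net_mean n w) (net_cov n w)"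
proof -
  let ?V = "sites n" and ?I = "pos (grid n t)"
  define F where "F = (\<lambda>(i :: site_time) k. f (upath \<gamma> w (snd i - 1) k))"
  define L where "L = (\<lambda>(i :: site_time) (p :: int \<times> int). if fst p = fst i then F i (snd p) else 0)"
  define R where "R = (\<lambda>(i :: site_time) (j :: int). if j = fst i then 1 else 0 :: real)"
  have iV: "fst i \<in> ?V" if "i \<in> ?I" for i using that by (auto simp: pos_def grid_def)
  have sL: "(\<Sum>p\<in>?V \<times> ?V. L i p * h p) = (\<Sum>k\<in>?V. F i k * h (fst i, k))" if "i \<in> ?I" for i h
  proof -
    have "(\<Sum>p\<in>?V \<times> ?V. L i p * h p) = (\<Sum>j\<in>?V. \<Sum>k\<in>?V. L i (j, k) * h (j, k))"
      by (simp add: sum.cartesian_product)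
    also have "\<dots> = (\<Sum>j\<in>?V. if j = fst i then (\<Sum>k\<in>?V. F i k * h (fst i, k)) else 0)"
      by (intro sum.cong refl) (auto simp: L_def)
    finally show ?thesis using iV[OF that] by simp
  qed
  have sR: "(\<Sum>j\<in>?V. R i j * h j) = h (fst i)" if "i \<in> ?I" for i h
  proof -
    have "(\<Sum>j\<in>?V. R i j * h j) = (\<Sum>j\<in>?V. if j = fst i then h (fst i) else 0)"
      by (intro sum.cong refl) (auto simp: R_def)
    then show ?thesis using iV[OF that] by simp
  qed
  define C where "C = (\<lambda>p q :: int \<times> int. 1 / real (card ?V) * \<Lambda> (site_mod (fst q - fst p) n) (site_mod (snd q - snd p) n))"
  have J: "gaussian_vector P (?V \<times> ?V) (\<lambda>p. J n (fst p) (snd p)) (\<lambda>_. Jbar / real (card ?V)) C"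
  proof (rule gaussian_vector_eq[OF gaussian_family_gaussian_vector[OF P.prob_space_axioms J_gauss[OF n]]])
    show "finite (?V \<times> ?V)" by simp
  qed (auto simp: J_mean[OF n] J_cov[OF n] C_def)
  have Th: "gaussian_vector P ?V th (\<lambda>_. \<theta>bar) (\<lambda>i j. if i = j then \<theta>\<^sup>2 else 0)"
    by (rule iid_normal_gaussian_vector[OF P.prob_space_axioms th_iid]) auto
  have "gaussian_vector P ?I (\<lambda>i \<omega>. (\<Sum>p\<in>?V \<times> ?V. L i p * J n (fst p) (snd p) \<omega>) + (\<Sum>j\<in>?V. R i j * th j \<omega>))
     (\<lambda>i. (\<Sum>p\<in>?V \<times> ?V. L i p * (Jbar / real (card ?V))) + (\<Sum>j\<in>?V. R i j * \<theta>bar))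
     (\<lambda>i i'. (\<Sum>p\<in>?V \<times> ?V. \<Sum>q\<in>?V \<times> ?V. L i p * C p q * L i' q) + (\<Sum>j\<in>?V. \<Sum>k\<in>?V. R i j * (if j = k then \<theta>\<^sup>2 else 0) * R i' k))"
  proof (rule gaussian_vector_add[OF gaussian_vector_linear_map[OF J] gaussian_vector_linear_map[OF Th]])
    fix \<xi> :: "site_time \<Rightarrow> real"
    have e1: "(\<Sum>i\<in>?I. \<xi> i * (\<Sum>p\<in>?V \<times> ?V. L i p * h p)) = (\<Sum>p\<in>?V \<times> ?V. (\<Sum>i\<in>?I. \<xi> i * L i p) * h p)" for h
      unfolding sum_distrib_left sum_distrib_right by (subst sum.swap) (simp add: mult_ac)
    have e2: "(\<Sum>i\<in>?I. \<xi> i * (\<Sum>j\<in>?V. R i j * h j)) = (\<Sum>j\<in>?V. (\<Sum>i\<in>?I. \<xi> i * R i j) * h j)" for h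
      unfolding sum_distrib_left sum_distrib_right by (subst sum.swap) (simp add: mult_ac)
    show "(\<integral>\<omega>. cis (\<Sum>i\<in>?I. \<xi> i * (\<Sum>p\<in>?V \<times> ?V. L i p * J n (fst p) (snd p) \<omega>)) * cis (\<Sum>i\<in>?I. \<xi> i * (\<Sum>j\<in>?V. R i j * th j \<omega>)) \<partial>P)
      = (\<integral>\<omega>. cis (\<Sum>i\<in>?I. \<xi> i * (\<Sum>p\<in>?V \<times> ?V. L i p * J n (fst p) (snd p) \<omega>)) \<partial>P) * (\<integral>\<omega>. cis (\<Sum>i\<in>?I. \<xi> i * (\<Sum>j\<in>?V. R i j * th j \<omega>)) \<partial>P)"
      unfolding e1 e2 by (rule indep_cis_J_th[OF n])
  qed
  then show ?thesis
  proof (rule gaussian_vector_eq)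
    fix i \<omega> assume i: "i \<in> ?I"
    show "(\<Sum>p\<in>?V \<times> ?V. L i p * J n (fst p) (snd p) \<omega>) + (\<Sum>j\<in>?V. R i j * th j \<omega>) = drift n \<omega> w i"
      unfolding sL[OF i] sR[OF i] by (simp add: drift_def F_def mult.commute)
    show "(\<Sum>p\<in>?V \<times> ?V. L i p * (Jbar / real (card ?V))) + (\<Sum>j\<in>?V. R i j * \<theta>bar) = net_mean n w i"
      unfolding sL[OF i] sR[OF i] by (simp add: net_mean_def F_def sum_distrib_left sum_divide_distrib mult_ac)
  next
    fix i i' assume i: "i \<in> ?I" "i' \<in> ?I"
    have 1: "(\<Sum>p\<in>?V \<times> ?V. \<Sum>q\<in>?V \<times> ?V. L i p * C p q * L i' q)
       = (\<Sum>p\<in>?V \<times> ?V. L i p * (\<Sum>q\<in>?V \<times> ?V. L i' q * C p q))"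
      by (simp add: sum_distrib_left mult_ac)
    have 2: "(\<Sum>j\<in>?V. \<Sum>k\<in>?V. R i j * (if j = k then \<theta>\<^sup>2 else 0) * R i' k)
      = (\<Sum>j\<in>?V. R i j * (\<Sum>k\<in>?V. R i' k * (if j = k then \<theta>\<^sup>2 else 0)))"
      by (simp add: sum_distrib_left mult_ac)
    show "(\<Sum>p\<in>?V \<times> ?V. \<Sum>q\<in>?V \<times> ?V. L i p * C p q * L i' q) + (\<Sum>j\<in>?V. \<Sum>k\<in>?V. R i j * (if j = k then \<theta>\<^sup>2 else 0) * R i' k)
      = net_cov n w i i'"
      unfolding 1 2 sL[OF i(1)] sL[OF i(2)] sR[OF i(1)] sR[OF i(2)]
      by (simp add: net_cov_def C_def F_def sum_distrib_left mult_ac)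
  qed
qed

text \<open>Non-negativity holds because this is the covariance of the drift. Symmetry is drawn from
  the symmetry of \<open>cov\<close>, which yields invariance of \<open>\<Lambda>\<close> under a
  simultaneous reflection of both cyclic arguments.\<close>

lemma psd_net_cov:
  assumes n: "n \<ge> 1"
  shows "psd (pos (grid n t)) (net_cov n w)"
  unfolding psd_def
proof (intro conjI ballI allI)
  show "0 \<le> quad_form (pos (grid n t)) (net_cov n w) \<xi>" for \<xi>
    by (rule gaussian_vector_quad_form_nonneg[OF P.prob_space_axioms gaussian_vector_drift[OF n]])
  fix i i' assume i: "i \<in> pos (grid n t)" "i' \<in> pos (grid n t)"
  have sym: "\<Lambda> (site_mod (j' - j) n) (site_mod (l - k) n) = \<Lambda> (site_mod (j - j') n) (site_mod (k - l) n)"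
    if "j \<in> sites n" "j' \<in> sites n" "k \<in> sites n" "l \<in> sites n" for j j' k l
  proof -
    have "cov P (J n j k) (J n j' l) = cov P (J n j' l) (J n j k)" by (simp add: cov_def mult.commute)
    then show ?thesis using that by (simp add: J_cov[OF n] card_sites)
  qed
  have V: "fst i \<in> sites n" "fst i' \<in> sites n" using i by (auto simp: pos_def grid_def)
  have "(\<Sum>k\<in>sites n. \<Sum>l\<in>sites n. \<Lambda> (site_mod (fst i' - fst i) n) (site_mod (l - k) n)
        * f (upath \<gamma> w (snd i - 1) k) * f (upath \<gamma> w (snd i' - 1) l))
    = (\<Sum>k\<in>sites n. \<Sum>l\<in>sites n. \<Lambda> (site_mod (fst i - fst i') n) (site_mod (k - l) n)
        * f (upath \<gamma> w (snd i' - 1) l) * f (upath \<gamma> w (snd i - 1) k))"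
    by (intro sum.cong refl) (subst sym, use V in \<open>auto simp: mult_ac\<close>)
  also have "\<dots> = (\<Sum>l\<in>sites n. \<Sum>k\<in>sites n. \<Lambda> (site_mod (fst i - fst i') n) (site_mod (k - l) n)
        * f (upath \<gamma> w (snd i' - 1) l) * f (upath \<gamma> w (snd i - 1) k))"
    by (rule sum.swap)
  finally show "net_cov n w i i' = net_cov n w i' i" by (simp add: net_cov_def)
qed

text \<open>The passage from noise to increments is a triangular shift, so the density at \<open>w\<close> is that of noise plus
  drift with the path inside the drift frozen at \<open>w\<close>.\<close>

lemma nn_integral_net_incr:
  assumes n: "n \<ge> 1" and t: "t \<le> T" and F: "F \<in> borel_measurable (PiM (grid n t) CM)"
  shows "(\<integral>\<^sup>+\<omega>. F (net_incr n t \<omega>) \<partial>P)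
    = (\<integral>\<^sup>+w. F w * ennreal (gauss_density (pos (grid n t)) (net_mean n w) (add_diag (net_cov n w) (\<sigma>\<^sup>2)) w) \<partial>PiM (grid n t) CM)"
proof -
  let ?D = "grid n t" and ?NM = "PiM (grid n t) (noise_measure (\<lambda>_. 0) \<sigma>)"
  interpret Jn: prob_space "Jalg n" by (rule prob_Jalg[OF n])
  interpret NM: prob_space ?NM by (intro prob_space_PiM prob_noise_measure \<sigma>)
  interpret NJ: pair_prob_space ?NM "Jalg n" ..
  interpret D: finite_product_sigma_finite CM ?D by standard simp
  interpret DJ: pair_sigma_finite "PiM ?D CM" "Jalg n" ..
  have sN: "sets ?NM = sets (PiM ?D CM)" by (intro sets_PiM_cong) auto
  have Fi: "(\<lambda>x. F (incr n t (snd x) (fst x))) \<in> borel_measurable (PiM ?D CM \<Otimes>\<^sub>M Jalg n)"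
    by (rule measurable_compose[OF incr_measurable[OF n] F])
  have Fi': "(\<lambda>x. F (incr n t (snd x) (fst x))) \<in> borel_measurable (?NM \<Otimes>\<^sub>M Jalg n)"
    using Fi sN by (simp cong: measurable_cong_sets sets_pair_measure_cong)
  have pair: "(\<lambda>\<omega>. (restrict (driver \<omega>) ?D, \<omega>)) \<in> measurable P (PiM ?D CM \<Otimes>\<^sub>M Jalg n)"
  proof (rule measurable_Pair[OF driver_measurable[OF n t]])
    show "(\<lambda>\<omega>. \<omega>) \<in> measurable P (Jalg n)"
    proof (rule measurableI)
      fix A assume A: "A \<in> sets (Jalg n)"
      then have "A \<in> sets P"
        using Jalg_subalgebra[OF n] unfolding Jalg_def sets_restr_to_subalg[OF Jalg_subalgebra[OF n]] by (auto simp: subalgebra_def)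
      then show "(\<lambda>\<omega>. \<omega>) -` A \<inter> space P \<in> sets P" by simp
    qed (simp add: space_Jalg)
  qed
  define \<phi> where "\<phi> = (\<lambda>w. ennreal (\<Prod>i\<in>pos ?D. normal_density 0 \<sigma> (w i)))"
  have \<phi>: "\<phi> \<in> borel_measurable (PiM ?D CM)"
    unfolding \<phi>_def by (intro measurable_compose[OF _ measurable_ennreal] borel_measurable_prod normal_density_measurable)
      (auto simp: pos_def)
  define \<Phi> where "\<Phi> = (\<lambda>\<omega> w. ennreal (\<Prod>i\<in>pos ?D. normal_density (drift n \<omega> w i) \<sigma> (w i)))"
  have \<Phi>: "(\<lambda>x. \<Phi> (snd x) (fst x)) \<in> borel_measurable (PiM ?D CM \<Otimes>\<^sub>M Jalg n)"
    unfolding \<Phi>_def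
    by (intro measurable_compose[OF _ measurable_ennreal] borel_measurable_prod normal_density_measurable drift_measurable[OF n]
        measurable_compose[OF measurable_fst measurable_component_CM]) (auto simp: pos_def)
  have "(\<integral>\<^sup>+\<omega>. F (net_incr n t \<omega>) \<partial>P)
     = (\<integral>\<^sup>+x. F (incr n t (snd x) (fst x)) \<partial>distr P (PiM ?D CM \<Otimes>\<^sub>M Jalg n) (\<lambda>\<omega>. (restrict (driver \<omega>) ?D, \<omega>)))"
    by (subst nn_integral_distr[OF pair]) (simp_all add: Fi)
  also have "\<dots> = (\<integral>\<^sup>+x. F (incr n t (snd x) (fst x)) \<partial>(?NM \<Otimes>\<^sub>M Jalg n))"
    by (simp only: distr_driver_Jalg[OF n t])
  also have "\<dots> = (\<integral>\<^sup>+\<omega>. (\<integral>\<^sup>+b. F (incr n t \<omega> b) \<partial>?NM) \<partial>Jalg n)"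
    using NJ.nn_integral_snd[OF Fi'] by simp
  also have "\<dots> = (\<integral>\<^sup>+\<omega>. (\<integral>\<^sup>+w. F w * \<Phi> \<omega> w \<partial>PiM ?D CM) \<partial>Jalg n)"
  proof (rule nn_integral_cong)
    fix \<omega> assume \<omega>: "\<omega> \<in> space (Jalg n)"
    have Fw: "(\<lambda>b. F (incr n t \<omega> b)) \<in> borel_measurable (PiM ?D CM)"
      using measurable_compose[OF measurable_Pair2'[OF \<omega>] Fi] by simp
    have H: "(\<lambda>b. F (incr n t \<omega> b) * \<phi> b) \<in> borel_measurable (PiM ?D CM)"
      using Fw \<phi> by simp
    have "(\<integral>\<^sup>+b. F (incr n t \<omega> b) \<partial>?NM) = (\<integral>\<^sup>+b. \<phi> b * F (incr n t \<omega> b) \<partial>PiM ?D CM)"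
      unfolding PiM_noise_measure[OF finite_grid \<sigma>] \<phi>_def[symmetric]
      by (rule nn_integral_density[OF \<phi> Fw])
    also have "\<dots> = (\<integral>\<^sup>+b. F (incr n t \<omega> b) * \<phi> b \<partial>PiM ?D CM)" by (simp only: mult.commute)
    \<comment> \<open>The shift formula is read from right to left: for fixed weights the noise is
      expressed through the increments \<open>w\<close>, and \<open>incr\<close> then undoes
      \<open>sub_drift\<close>.\<close>
    also have "\<dots> = (\<integral>\<^sup>+w. F (incr n t \<omega> (sub_drift n t \<omega> w)) * \<phi> (sub_drift n t \<omega> w) \<partial>PiM ?D CM)"
    proof (rule nn_integral_triangular_shift[OF finite_grid _ _ H, symmetric])
      fix i assume i: "i \<in> ?D"
      show "(\<lambda>w. if snd i = 0 then 0 else drift n \<omega> w i) \<in> borel_measurable (PiM ?D CM)"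
        using measurable_compose[OF measurable_Pair2'[OF \<omega>] drift_measurable[OF n i]] by simp
      fix w w' :: "site_time \<Rightarrow> real"
      assume e: "\<And>j. j \<in> ?D \<Longrightarrow> snd j < snd i \<Longrightarrow> w j = w' j"
      show "(if snd i = 0 then 0 else drift n \<omega> w i) = (if snd i = 0 then 0 else drift n \<omega> w' i)"
      proof (cases "snd i = 0")
        case False
        have "upath \<gamma> w (snd i - 1) k = upath \<gamma> w' (snd i - 1) k" if "k \<in> sites n" for k
          by (rule upath_cong, rule e) (use that i False in \<open>auto simp: grid_def\<close>)
        then show ?thesis by (simp add: drift_def)
      qed simp
    qed
    also have "\<dots> = (\<integral>\<^sup>+w. F w * \<Phi> \<omega> w \<partial>PiM ?D CM)"
    proof (rule nn_integral_cong)
      fix w assume w: "w \<in> space (PiM ?D CM)"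
      have "normal_density 0 \<sigma> (sub_drift n t \<omega> w i) = normal_density (drift n \<omega> w i) \<sigma> (w i)" if "i \<in> pos ?D" for i
        using that by (simp add: pos_def normal_density_shift[of "drift n \<omega> w i"])
      then have "\<phi> (sub_drift n t \<omega> w) = \<Phi> \<omega> w"
        unfolding \<phi>_def \<Phi>_def by (intro arg_cong[where f = ennreal] prod.cong refl)
      then show "F (incr n t \<omega> (sub_drift n t \<omega> w)) * \<phi> (sub_drift n t \<omega> w) = F w * \<Phi> \<omega> w"
        by (simp only: incr_sub_drift[OF w])
    qed
    finally show "(\<integral>\<^sup>+b. F (incr n t \<omega> b) \<partial>?NM) = (\<integral>\<^sup>+w. F w * \<Phi> \<omega> w \<partial>PiM ?D CM)" .
  qed
  also have "\<dots> = (\<integral>\<^sup>+w. (\<integral>\<^sup>+\<omega>. F w * \<Phi> \<omega> w \<partial>Jalg n) \<partial>PiM ?D CM)"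
  proof (rule DJ.Fubini')
    show "(\<lambda>(w, \<omega>). F w * \<Phi> \<omega> w) \<in> borel_measurable (PiM ?D CM \<Otimes>\<^sub>M Jalg n)"
      unfolding case_prod_beta by (intro borel_measurable_times_ennreal \<Phi> measurable_compose[OF measurable_fst F])
  qed
  also have "\<dots> = (\<integral>\<^sup>+w. F w * ennreal (gauss_density (pos ?D) (net_mean n w) (add_diag (net_cov n w) (\<sigma>\<^sup>2)) w) \<partial>PiM ?D CM)"
  proof (rule nn_integral_cong)
    fix w assume w: "w \<in> space (PiM ?D CM)"
    have m: "\<Phi> \<omega>' w = \<Phi> \<omega>' w" for \<omega>' ..
    have \<Phi>w: "(\<lambda>\<omega>. \<Phi> \<omega> w) \<in> borel_measurable (Jalg n)"
      using measurable_compose[OF measurable_Pair1'[OF w] \<Phi>] by simp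
    have "(\<integral>\<^sup>+\<omega>. F w * \<Phi> \<omega> w \<partial>Jalg n) = F w * (\<integral>\<^sup>+\<omega>. \<Phi> \<omega> w \<partial>Jalg n)"
      by (rule nn_integral_cmult[OF \<Phi>w])
    also have "(\<integral>\<^sup>+\<omega>. \<Phi> \<omega> w \<partial>Jalg n) = (\<integral>\<^sup>+\<omega>. \<Phi> \<omega> w \<partial>P)"
    proof (rule nn_integral_subalgebra[OF \<Phi>w])
      show "sets (Jalg n) \<subseteq> sets P"
        using Jalg_subalgebra[OF n] unfolding Jalg_def sets_restr_to_subalg[OF Jalg_subalgebra[OF n]] by (auto simp: subalgebra_def)
    qed (simp_all add: space_Jalg emeasure_Jalg[OF n])
    \<comment> \<open>The smoothing formula with \<open>r = \<sigma>\<close>: for fixed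
      \<open>w\<close> the weights and thresholds form the possibly degenerate Gaussian vector, and
      the network noise is the smoothing that gives it a density.\<close>
    also have "\<dots> = ennreal (gauss_density (pos ?D) (net_mean n w) (add_diag (net_cov n w) (\<sigma>\<^sup>2)) w)"
      unfolding \<Phi>_def by (rule gaussian_vector_gauss_density_nn[OF P.prob_space_axioms gaussian_vector_drift[OF n] \<sigma>, symmetric]) (simp add: pos_simps)
    finally show "(\<integral>\<^sup>+\<omega>. F w * \<Phi> \<omega> w \<partial>Jalg n) = F w * ennreal (gauss_density (pos ?D) (net_mean n w) (add_diag (net_cov n w) (\<sigma>\<^sup>2)) w)" .
  qed
  finally show ?thesis .
qed

end

section \<open>The limit law\<close>

lemma space_borel_of: "space (borel_of X) = topspace X"
  by (simp add: borel_of_def space_measure_of_conv)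

lemma sets_borel_of: "sets (borel_of X) = sigma_sets (topspace X) {U. openin X U}"
  unfolding borel_of_def by (rule sets_measure_of) (auto dest: openin_subset)

lemma borel_of_openin: "openin X U \<Longrightarrow> U \<in> sets (borel_of X)"
  by (simp add: sets_borel_of)

lemma borel_of_measurable_real:
  fixes h :: "'a \<Rightarrow> 'b::topological_space"
  assumes "continuous_map X euclidean h"
  shows "h \<in> borel_measurable (borel_of X)"
proof (rule borel_measurableI)
  fix S :: "'b set" assume "open S"
  then have "openin X {x \<in> topspace X. h x \<in> S}"
    using assms by (auto simp: continuous_map_def)
  moreover have "h -` S \<inter> space (borel_of X) = {x \<in> topspace X. h x \<in> S}" by (auto simp: space_borel_of)
  ultimately show "h -` S \<inter> space (borel_of X) \<in> sets (borel_of X)" by (simp add: borel_of_openin)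
qed

lemma borel_of_measurable:
  assumes h: "continuous_map X Y h"
  shows "h \<in> measurable (borel_of X) (borel_of Y)"
  unfolding borel_of_def[of Y]
proof (rule measurable_measure_of)
  show "{U. openin Y U} \<subseteq> Pow (topspace Y)" by (auto dest: openin_subset)
  show "h \<in> space (borel_of X) \<rightarrow> topspace Y"
    using continuous_map_image_subset_topspace[OF h] by (auto simp: space_borel_of)
  fix A assume "A \<in> {U. openin Y U}"
  then have "openin X {x \<in> topspace X. h x \<in> A}" using h by (auto simp: continuous_map_def)
  moreover have "h -` A \<inter> space (borel_of X) = {x \<in> topspace X. h x \<in> A}" by (auto simp: space_borel_of)
  ultimately show "h -` A \<inter> space (borel_of X) \<in> sets (borel_of X)" by (simp add: borel_of_openin)
qed

lemma field_topology_coord: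
  assumes "j \<in> V" "s \<le> T"
  shows "continuous_map (field_topology T V) euclideanreal (\<lambda>u. u j s)"
proof -
  have 1: "continuous_map (field_topology T V) (product_topology (\<lambda>_. euclideanreal) {0..T}) (\<lambda>u. u j)"
    unfolding field_topology_def by (rule continuous_map_product_projection[OF assms(1)])
  have 2: "continuous_map (product_topology (\<lambda>_. euclideanreal) {0..T}) euclideanreal (\<lambda>v. v s)"
    by (rule continuous_map_product_projection) (use assms in auto)
  show ?thesis using continuous_map_compose[OF 1 2] by (simp add: o_def)
qed

lemma continuous_map_field_topology:
  assumes "\<And>x j. x \<in> topspace X \<Longrightarrow> j \<notin> V \<Longrightarrow> F x j = undefined"
    and "\<And>x j s. x \<in> topspace X \<Longrightarrow> j \<in> V \<Longrightarrow> s \<notin> {0..T} \<Longrightarrow> F x j s = undefined"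
    and "\<And>j s. j \<in> V \<Longrightarrow> s \<le> T \<Longrightarrow> continuous_map X euclideanreal (\<lambda>x. F x j s)"
  shows "continuous_map X (field_topology T V) F"
  unfolding field_topology_def continuous_map_componentwise
  using assms by (auto simp: extensional_def image_subset_iff)

lemma topspace_field: "topspace (field_topology T V) = (\<Pi>\<^sub>E j\<in>V. \<Pi>\<^sub>E s\<in>{0..T}. UNIV)"
  by (simp add: field_topology_def)

lemma Psi_continuous: "continuous_map (field_topology T UNIV) (field_topology T UNIV) (Psi T \<gamma> \<theta>bar)"
proof (rule continuous_map_field_topology)
  fix j :: int and s assume s: "s \<le> T"
  show "continuous_map (field_topology T UNIV) euclideanreal (\<lambda>x. Psi T \<gamma> \<theta>bar x j s)"
  proof (cases "s = 0")
    case True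
    then show ?thesis by (simp add: Psi_def field_topology_coord)
  next
    case False
    have "continuous_map (field_topology T UNIV) euclideanreal (\<lambda>u. u j s - \<gamma> * u j (s - 1) - \<theta>bar)"
      using s by (intro continuous_map_diff continuous_map_real_mult_left continuous_map_const[THEN iffD2] field_topology_coord) auto
    then show ?thesis using s False by (simp add: Psi_def)
  qed
qed (auto simp: Psi_def)

lemma embed_continuous:
  "continuous_map euclidean (field_topology T V) (\<lambda>w :: site_time \<Rightarrow> real. \<lambda>j\<in>V. \<lambda>s\<in>{0..T}. w (j, s))"
  by (rule continuous_map_field_topology) auto

text \<open>Test functions act on total functions of site and time instead of extensional fields.
  Potentials, periodic extensions, samples of the limit law and noisy samples can then all be
  inserted into the same \<open>g\<close>.\<close>

definition cyl :: "nat \<Rightarrow> nat \<Rightarrow> ((site_time \<Rightarrow> real) \<Rightarrow> real) \<Rightarrow> bool" where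
  "cyl m t g \<longleftrightarrow> continuous_on UNIV g \<and> bounded (range g) \<and>
     (\<forall>u u'. (\<forall>i\<in>grid m t. u i = u' i) \<longrightarrow> g u = g u')"

lemma cyl_cong: "cyl m t g \<Longrightarrow> (\<And>i. i \<in> grid m t \<Longrightarrow> u i = u' i) \<Longrightarrow> g u = g u'"
  by (auto simp: cyl_def)

lemma cyl_bound:
  assumes "cyl m t g" obtains C where "C > 0" "\<And>u. \<bar>g u\<bar> \<le> C"
  using assms unfolding cyl_def bounded_pos by auto

lemma cyl_measurable: "cyl m t g \<Longrightarrow> g \<in> borel_measurable borel"
  by (auto simp: cyl_def intro: borel_measurable_continuous_onI)

text \<open>The index set is countable, so the Borel sets of the function space are generated by the
  coordinates.\<close>

lemma measurable_site_time:
  fixes F :: "'a \<Rightarrow> site_time \<Rightarrow> real"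
  assumes "\<And>i. (\<lambda>x. F x i) \<in> borel_measurable N"
  shows "F \<in> borel_measurable N"
proof -
  have "(\<lambda>x. \<lambda>i\<in>UNIV. F x i) \<in> measurable N (PiM UNIV (\<lambda>i :: site_time. borel :: real measure))"
    by (rule measurable_restrict) (rule assms)
  then have "F \<in> measurable N (PiM UNIV (\<lambda>i :: site_time. borel :: real measure))"
    by (simp add: restrict_UNIV)
  then show ?thesis
    by (simp only: measurable_cong_sets[OF refl sets_PiM_equal_borel])
qed

lemma cyl_compose_measurable:
  fixes F :: "'a \<Rightarrow> site_time \<Rightarrow> real"
  assumes g: "cyl m t g" and F: "\<And>i. i \<in> grid m t \<Longrightarrow> (\<lambda>x. F x i) \<in> borel_measurable N"
  shows "(\<lambda>x. g (F x)) \<in> borel_measurable N"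
proof -
  \<comment> \<open>Only the coordinates in the grid are assumed measurable; the others are set to
    \<open>0\<close>, which \<open>g\<close> does not see.\<close>
  have "(\<lambda>x i. if i \<in> grid m t then F x i else 0) \<in> borel_measurable N"
  proof (rule measurable_site_time)
    show "(\<lambda>x. if i \<in> grid m t then F x i else 0) \<in> borel_measurable N" for i
      by (cases "i \<in> grid m t") (simp_all add: F)
  qed
  from measurable_compose[OF this cyl_measurable[OF g]]
  have "(\<lambda>x. g (\<lambda>i. if i \<in> grid m t then F x i else 0)) \<in> borel_measurable N" .
  moreover have "g (\<lambda>i. if i \<in> grid m t then F x i else 0) = g (F x)" for x
    by (rule cyl_cong[OF g]) simp
  ultimately show ?thesis by simp
qed

lemma cyl_mono:
  assumes "cyl m t g" "m \<le> m'" "t \<le> t'" shows "cyl m' t' g"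
proof -
  have "grid m t \<subseteq> grid m' t'" using assms by (auto simp: grid_def sites_eq)
  then show ?thesis using assms(1) unfolding cyl_def by blast
qed

abbreviation flat :: "field \<Rightarrow> site_time \<Rightarrow> real" where
  "flat u \<equiv> (\<lambda>i. u (fst i) (snd i))"

text \<open>Unpacks the fixed point equation \<open>is_Q\<close> for \<open>\<mu>e\<close>, with the
  Gaussian law of its later times named \<open>G\<close>.\<close>

locale limit_law = network +
  fixes \<mu>e G :: "field measure"
  assumes stat: "\<mu>e \<in> stationary_measures T"
    and G: "is_stationary_gaussian_law T (mean_coeff Jbar f \<mu>e)
            (\<lambda>k r s. (if k = 0 \<and> r = s then \<sigma>\<^sup>2 else 0) + cov_coeff \<theta> \<Lambda> f \<mu>e k r s) G"
    and law: "distr (distr \<mu>e (field_space T UNIV) (Psi T \<gamma> \<theta>bar))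
            ((\<Pi>\<^sub>M j\<in>UNIV. borel) \<Otimes>\<^sub>M (\<Pi>\<^sub>M j\<in>UNIV. \<Pi>\<^sub>M s\<in>{1..T}. borel))
            (\<lambda>v. (\<lambda>j. v j 0, \<lambda>j. restrict (v j) {1..T}))
          = (\<Pi>\<^sub>M j\<in>UNIV. \<mu>I) \<Otimes>\<^sub>M G"
begin

abbreviation "BPM \<equiv> (\<Pi>\<^sub>M j\<in>(UNIV :: int set). borel :: real measure) \<Otimes>\<^sub>M (\<Pi>\<^sub>M j\<in>(UNIV :: int set). \<Pi>\<^sub>M s\<in>{1..T}. borel :: real measure)"
abbreviation "Z\<mu> \<equiv> (\<Pi>\<^sub>M j\<in>(UNIV :: int set). \<mu>I)"

lemma prob_G: "prob_space G" and sets_G: "sets G = sets (\<Pi>\<^sub>M j\<in>(UNIV :: int set). \<Pi>\<^sub>M s\<in>{1..T}. borel :: real measure)"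
  using G by (auto simp: is_stationary_gaussian_law_def)

lemma prob_\<mu>e: "prob_space \<mu>e" and sets_\<mu>e: "sets \<mu>e = sets (field_space T UNIV)"
  and shift_\<mu>e: "distr \<mu>e (field_space T UNIV) (shift j) = \<mu>e"
  using stat by (auto simp: stationary_measures_def)

lemma space_\<mu>e: "space \<mu>e = topspace (field_topology T UNIV)"
  using sets_eq_imp_space_eq[OF sets_\<mu>e] by (simp add: space_borel_of)

lemma prob_Z: "prob_space Z\<mu>"
  by (intro prob_space_PiM prob_\<mu>)

text \<open>Reunites time \<open>0\<close> with the later times and restores the
  \<open>\<theta>bar\<close> removed by \<open>Psi\<close>; the result is a field of increments in
  the sense expected by \<open>upath\<close>.\<close>

definition join :: "(int \<Rightarrow> real) \<times> field \<Rightarrow> site_time \<Rightarrow> real" where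
  "join x i = (if snd i = 0 then fst x (fst i) else snd x (fst i) (snd i) + \<theta>bar)"

lemma sets_ZG: "sets (Z\<mu> \<Otimes>\<^sub>M G) = sets BPM"
  using sets_G by (intro sets_pair_measure_cong sets_PiM_cong) auto

lemma join_measurable: "snd i \<le> T \<Longrightarrow> (\<lambda>x. join x i) \<in> borel_measurable BPM"
proof -
  assume i: "snd i \<le> T"
  have 1: "(\<lambda>x. fst x (fst i)) \<in> borel_measurable BPM"
    by (rule measurable_compose[OF measurable_fst measurable_component_singleton]) simp
  have m1: "(\<lambda>v. v (fst i)) \<in> measurable (\<Pi>\<^sub>M j\<in>(UNIV :: int set). \<Pi>\<^sub>M s\<in>{1..T}. borel :: real measure) (\<Pi>\<^sub>M s\<in>{1..T}. borel)"
    by (rule measurable_component_singleton) simp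
  have m2: "(\<lambda>v. v (snd i)) \<in> measurable (\<Pi>\<^sub>M s\<in>{1..T}. borel :: real measure) borel" if "snd i \<noteq> 0"
    by (rule measurable_component_singleton) (use i that in auto)
  have 2: "(\<lambda>x. snd x (fst i) (snd i)) \<in> borel_measurable BPM" if "snd i \<noteq> 0"
    by (rule measurable_compose[OF measurable_compose[OF measurable_snd m1] m2[OF that]])
  show ?thesis unfolding join_def using 1 2 by (cases "snd i = 0") auto
qed

lemma upath_join_measurable: "s \<le> T \<Longrightarrow> (\<lambda>x. upath \<gamma> (join x) s j) \<in> borel_measurable BPM"
proof (induction s)
  case 0
  then show ?case using join_measurable[of "(j, 0)"] by simp
next
  case (Suc s)
  then show ?case using join_measurable[of "(j, Suc s)"] by simp
qed

definition split_incr :: "field \<Rightarrow> (int \<Rightarrow> real) \<times> field" where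
  "split_incr u = (let v = Psi T \<gamma> \<theta>bar u in (\<lambda>j. v j 0, \<lambda>j. restrict (v j) {1..T}))"

lemma upath_split: "s \<le> T \<Longrightarrow> upath \<gamma> (join (split_incr u)) s j = u j s"
  by (induction s) (auto simp: join_def split_incr_def Psi_def)

lemma split_incr_measurable: "split_incr \<in> measurable (field_space T UNIV) BPM"
  and distr_split_incr: "distr \<mu>e BPM split_incr = Z\<mu> \<Otimes>\<^sub>M G"
proof -
  let ?FS = "field_space T UNIV"
  let ?sp = "\<lambda>v :: field. (\<lambda>j. v j 0, \<lambda>j. restrict (v j) {1..T})"
  have Psi1: "Psi T \<gamma> \<theta>bar \<in> measurable ?FS ?FS"
    by (rule borel_of_measurable[OF Psi_continuous])
  then have Psi2: "Psi T \<gamma> \<theta>bar \<in> measurable \<mu>e ?FS"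
    by (simp only: measurable_cong_sets[OF sets_\<mu>e refl])
  have sp: "?sp \<in> measurable ?FS BPM"
  proof (rule measurable_Pair)
    have c: "(\<lambda>v. v j s) \<in> borel_measurable ?FS" if "s \<le> T" for j s
      by (rule borel_of_measurable_real[OF field_topology_coord]) (use that in auto)
    have "(\<lambda>v. \<lambda>j\<in>UNIV. v j 0) \<in> measurable ?FS (\<Pi>\<^sub>M j\<in>UNIV. borel)"
      by (rule measurable_restrict) (simp add: c)
    then show "(\<lambda>v. \<lambda>j. v j 0) \<in> measurable ?FS (\<Pi>\<^sub>M j\<in>UNIV. borel)" by (simp add: restrict_UNIV)
    have "(\<lambda>v. \<lambda>j\<in>UNIV. \<lambda>s\<in>{1..T}. v j s) \<in> measurable ?FS (\<Pi>\<^sub>M j\<in>UNIV. \<Pi>\<^sub>M s\<in>{1..T}. borel)"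
      by (intro measurable_restrict c) auto
    then show "(\<lambda>v j. restrict (v j) {1..T}) \<in> measurable ?FS (\<Pi>\<^sub>M j\<in>UNIV. \<Pi>\<^sub>M s\<in>{1..T}. borel)"
      by (simp add: restrict_UNIV)
  qed
  show "split_incr \<in> measurable ?FS BPM"
    using measurable_compose[OF Psi1 sp] by (simp add: split_incr_def[abs_def] Let_def)
  show "distr \<mu>e BPM split_incr = Z\<mu> \<Otimes>\<^sub>M G"
    unfolding law[symmetric] distr_distr[OF sp Psi2] by (simp add: split_incr_def[abs_def] Let_def o_def)
qed

lemma split_incr_measurable': "split_incr \<in> measurable \<mu>e BPM"
  using split_incr_measurable by (simp only: measurable_cong_sets[OF sets_\<mu>e refl])

text \<open>The split increments of a sample of \<open>\<mu>e\<close> have the product law, and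
  \<open>upath\<close> rebuilds the sample from them.\<close>

lemma integral_\<mu>e:
  assumes g: "cyl m t g" and t: "t \<le> T"
  shows "(\<integral>u. g (flat u) \<partial>\<mu>e) = (\<integral>x. g (\<lambda>i. upath \<gamma> (join x) (snd i) (fst i)) \<partial>(Z\<mu> \<Otimes>\<^sub>M G))"
proof -
  let ?H = "\<lambda>x. g (\<lambda>i. upath \<gamma> (join x) (snd i) (fst i))"
  have H: "?H \<in> borel_measurable BPM"
    by (rule cyl_compose_measurable[OF g], rule upath_join_measurable) (use t in \<open>auto simp: grid_def\<close>)
  have "(\<integral>x. ?H x \<partial>(Z\<mu> \<Otimes>\<^sub>M G)) = (\<integral>u. ?H (split_incr u) \<partial>\<mu>e)"
    unfolding distr_split_incr[symmetric] by (rule integral_distr[OF split_incr_measurable' H])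
  also have "\<dots> = (\<integral>u. g (flat u) \<partial>\<mu>e)"
  proof (rule Bochner_Integration.integral_cong[OF refl])
    fix u
    show "?H (split_incr u) = g (flat u)"
      by (rule cyl_cong[OF g], rule upath_split) (use t in \<open>auto simp: grid_def\<close>)
  qed
  finally show ?thesis ..
qed

lemma shift_measurable: "shift j \<in> measurable (field_space T UNIV) (field_space T UNIV)"
proof (rule borel_of_measurable, rule continuous_map_field_topology)
  fix x k s assume "x \<in> topspace (field_topology T UNIV)" "s \<notin> {0..T}"
  then show "shift j x k s = undefined" by (auto simp: topspace_field shift_def PiE_def extensional_def)
next
  fix k s assume "s \<le> T"
  then show "continuous_map (field_topology T UNIV) euclideanreal (\<lambda>x. shift j x k s)"
    unfolding shift_def by (intro field_topology_coord) auto
qed simp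

abbreviation shift_pair :: "int \<Rightarrow> (int \<Rightarrow> real) \<times> field \<Rightarrow> (int \<Rightarrow> real) \<times> field" where
  "shift_pair j x \<equiv> (\<lambda>k. fst x (j + k), \<lambda>k. snd x (j + k))"

text \<open>Splitting into increments commutes with shifts, so the product law inherits stationarity
  from \<open>\<mu>e\<close>.\<close>

lemma nn_integral_shift_pair:
  assumes H: "H \<in> borel_measurable BPM"
  shows "(\<integral>\<^sup>+x. H (shift_pair j x) \<partial>(Z\<mu> \<Otimes>\<^sub>M G)) = (\<integral>\<^sup>+x. H x \<partial>(Z\<mu> \<Otimes>\<^sub>M G))"
proof -
  have sm: "shift j \<in> measurable \<mu>e (field_space T UNIV)"
    using shift_measurable by (simp only: measurable_cong_sets[OF sets_\<mu>e refl])
  have e: "shift_pair j (split_incr u) = split_incr (shift j u)" for u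
    by (simp add: split_incr_def Let_def Psi_def shift_def)
  have shp: "shift_pair j \<in> measurable BPM BPM"
  proof (rule measurable_Pair)
    have "(\<lambda>x. \<lambda>k\<in>UNIV. fst x (j + k)) \<in> measurable BPM (\<Pi>\<^sub>M k\<in>(UNIV :: int set). borel :: real measure)"
      by (intro measurable_restrict measurable_compose[OF measurable_fst measurable_component_singleton]) simp
    then show "(\<lambda>x k. fst x (j + k)) \<in> measurable BPM (\<Pi>\<^sub>M k\<in>(UNIV :: int set). borel :: real measure)"
      by (simp add: restrict_UNIV)
    have "(\<lambda>x. \<lambda>k\<in>UNIV. snd x (j + k)) \<in> measurable BPM (\<Pi>\<^sub>M k\<in>(UNIV :: int set). \<Pi>\<^sub>M s\<in>{1..T}. borel :: real measure)"
      by (intro measurable_restrict measurable_compose[OF measurable_snd measurable_component_singleton]) simp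
    then show "(\<lambda>x k. snd x (j + k)) \<in> measurable BPM (\<Pi>\<^sub>M k\<in>(UNIV :: int set). \<Pi>\<^sub>M s\<in>{1..T}. borel :: real measure)"
      by (simp add: restrict_UNIV)
  qed
  have "(\<integral>\<^sup>+x. H (shift_pair j x) \<partial>(Z\<mu> \<Otimes>\<^sub>M G)) = (\<integral>\<^sup>+u. H (shift_pair j (split_incr u)) \<partial>\<mu>e)"
    unfolding distr_split_incr[symmetric]
    by (rule nn_integral_distr[OF split_incr_measurable']) (simp only: measurable_distr_eq1 measurable_compose[OF shp H])
  also have "\<dots> = (\<integral>\<^sup>+u. H (split_incr (shift j u)) \<partial>\<mu>e)" by (simp only: e)
  also have "\<dots> = (\<integral>\<^sup>+u. H (split_incr u) \<partial>distr \<mu>e (field_space T UNIV) (shift j))"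
    by (rule nn_integral_distr[OF sm, symmetric]) (simp only: measurable_distr_eq1 measurable_compose[OF split_incr_measurable' H] measurable_compose[OF split_incr_measurable H])
  also have "\<dots> = (\<integral>\<^sup>+u. H (split_incr u) \<partial>\<mu>e)" by (simp only: shift_\<mu>e)
  also have "\<dots> = (\<integral>\<^sup>+x. H x \<partial>(Z\<mu> \<Otimes>\<^sub>M G))"
    unfolding distr_split_incr[symmetric]
    by (rule nn_integral_distr[OF split_incr_measurable', symmetric]) (simp only: measurable_distr_eq1 H)
  finally show ?thesis .
qed

lemma cyl_integrable_\<mu>e: "cyl m t g \<Longrightarrow> t \<le> T \<Longrightarrow> (\<lambda>u. g (flat u)) \<in> borel_measurable \<mu>e"
proof -
  assume g: "cyl m t g" and t: "t \<le> T"
  have "(\<lambda>u. g (flat u)) \<in> borel_measurable (field_space T UNIV)"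
    by (rule cyl_compose_measurable[OF g]) (use t in \<open>auto simp: grid_def intro!: borel_of_measurable_real field_topology_coord\<close>)
  then show ?thesis using measurable_cong_sets[OF sets_\<mu>e refl] by blast
qed

end

section \<open>Affine realisation of the noise, and Gaussian densities under the limit law\<close>

lemma emeasure_normal_affine:
  assumes r: "r > 0" and A: "A \<in> sets borel"
  shows "emeasure (density lborel (normal_density c r)) A = emeasure (density lborel std_normal_density) {x. c + r * x \<in> A}"
proof -
  have e: "r * normal_density c r (c + r * x) = std_normal_density x" for x
  proof -
    have "(r * x)\<^sup>2 / (2 * r\<^sup>2) = x\<^sup>2 / 2" using r by (simp add: power_mult_distrib)
    then show ?thesis using r by (simp add: normal_density_def real_sqrt_mult)
  qed
  have A': "{x. c + r * x \<in> A} \<in> sets borel"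
    using measurable_sets[of "\<lambda>x. c + r * x" borel borel A] A by (simp add: vimage_def)
  have "emeasure (density lborel (normal_density c r)) A = (\<integral>\<^sup>+x. ennreal (normal_density c r x) * indicator A x \<partial>lborel)"
    using A by (intro emeasure_density) auto
  also have "\<dots> = ennreal \<bar>r\<bar> * (\<integral>\<^sup>+x. ennreal (normal_density c r (c + r * x)) * indicator A (c + r * x) \<partial>lborel)"
    using r A by (intro nn_integral_real_affine) auto
  also have "\<dots> = (\<integral>\<^sup>+x. ennreal r * (ennreal (normal_density c r (c + r * x)) * indicator A (c + r * x)) \<partial>lborel)"
    using r A A' by (subst nn_integral_cmult) (auto simp: indicator_def)
  also have "\<dots> = (\<integral>\<^sup>+x. ennreal (std_normal_density x) * indicator {x. c + r * x \<in> A} x \<partial>lborel)"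
    using r by (intro nn_integral_cong) (auto simp: e[symmetric] ennreal_mult indicator_def mult.assoc)
  also have "\<dots> = emeasure (density lborel std_normal_density) {x. c + r * x \<in> A}"
    using A' by (intro emeasure_density[symmetric]) auto
  finally show ?thesis .
qed

context coord
begin

abbreviation "PZ \<equiv> PiM (UNIV :: int set) (\<lambda>_. \<mu>)"

definition noisy :: "(site_time \<Rightarrow> real) \<Rightarrow> real \<Rightarrow> (int \<Rightarrow> real) \<Rightarrow> (site_time \<Rightarrow> real) \<Rightarrow> site_time \<Rightarrow> real" where
  "noisy c r z \<zeta> i = (if snd i = 0 then z (fst i) else c i + r * \<zeta> i)"

lemma noisy_measurable:
  "(\<lambda>x. \<lambda>i\<in>D. noisy c r (fst x) (snd x) i) \<in> measurable (PZ \<Otimes>\<^sub>M stdP D) (PiM D CM)"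
proof (rule measurable_restrict)
  fix i assume i: "i \<in> D"
  have "(\<lambda>z. z (fst i)) \<in> measurable PZ \<mu>" by (rule measurable_component_singleton) simp
  then have 0: "(\<lambda>z. z (fst i)) \<in> borel_measurable PZ" by (simp cong: measurable_cong_sets)
  have 1: "(\<lambda>x. fst x (fst i)) \<in> borel_measurable (PZ \<Otimes>\<^sub>M stdP D)"
    by (rule measurable_compose[OF measurable_fst 0])
  have 2: "(\<lambda>x. snd x i) \<in> borel_measurable (PZ \<Otimes>\<^sub>M stdP D)"
    by (rule measurable_compose[OF measurable_snd measurable_stdP_component[OF i]])
  have "(\<lambda>x. noisy c r (fst x) (snd x) i) \<in> borel_measurable (PZ \<Otimes>\<^sub>M stdP D)"
    unfolding noisy_def using 1 2 by (cases "snd i = 0") auto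
  then show "(\<lambda>x. noisy c r (fst x) (snd x) i) \<in> measurable (PZ \<Otimes>\<^sub>M stdP D) (CM i)"
    by (simp cong: measurable_cong_sets)
qed

text \<open>Noise with means \<open>c\<close> is an affine image of standard normals whose law does
  not depend on \<open>c\<close>. In \<open>ref_density\<close> the means are random, and this keeps
  the added noise independent of them.\<close>

lemma PiM_noise_measure_distr:
  assumes D: "finite D" and r: "r > 0"
  shows "PiM D (noise_measure c r) = distr (PZ \<Otimes>\<^sub>M stdP D) (PiM D CM) (\<lambda>x. \<lambda>i\<in>D. noisy c r (fst x) (snd x) i)"
proof -
  interpret N: product_sigma_finite "noise_measure c r"
    by (intro product_sigma_finite.intro prob_space_imp_sigma_finite prob_noise_measure r)
  interpret Z: product_prob_space "\<lambda>_ :: int. \<mu>" UNIV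
    by (intro product_prob_spaceI prob_\<mu>)
  interpret S: product_prob_space "\<lambda>_ :: site_time. density lborel (\<lambda>x. ennreal (std_normal_density x))" D
    by (intro product_prob_spaceI prob_std_normal)
  interpret SD: prob_space "stdP D" by (rule prob_stdP)
  let ?X = "\<lambda>x. \<lambda>i\<in>D. noisy c r (fst x) (snd x) i"
  have "distr (PZ \<Otimes>\<^sub>M stdP D) (PiM D CM) ?X = PiM D (noise_measure c r)"
  proof (rule N.PiM_eqI[OF D])
    show "sets (distr (PZ \<Otimes>\<^sub>M stdP D) (PiM D CM) ?X) = sets (PiM D (noise_measure c r))"
      by (auto intro!: sets_PiM_cong)
    fix A assume "\<And>i. i \<in> D \<Longrightarrow> A i \<in> sets (noise_measure c r i)"
    then have A: "i \<in> D \<Longrightarrow> A i \<in> sets borel" for i by simp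
    have box: "Pi\<^sub>E D A \<in> sets (PiM D CM)" by (rule sets_PiM_I_finite[OF D]) (auto simp: A)
    define Z0 where "Z0 = {i \<in> D. snd i = 0}"
    have ZD: "finite Z0" "finite (pos D)" "Z0 \<inter> pos D = {}" "D = Z0 \<union> pos D"
      using D by (auto simp: Z0_def pos_def)
    have injf: "inj_on fst Z0" by (auto simp: inj_on_def Z0_def)
    define E1 where "E1 = {z \<in> space PZ. \<forall>j\<in>fst ` Z0. z j \<in> A (j, 0)}"
    define E2 where "E2 = {\<zeta> \<in> space (stdP D). \<forall>i\<in>pos D. \<zeta> i \<in> {x. c i + r * x \<in> A i}}"
    have A1: "A (j, 0) \<in> sets \<mu>" if "j \<in> fst ` Z0" for j using that A by (auto simp: Z0_def)
    have A2: "{x. c i + r * x \<in> A i} \<in> sets borel" if "i \<in> pos D" for i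
      using measurable_sets[of "\<lambda>x. c i + r * x" borel borel "A i"] A that by (simp add: vimage_def pos_def)
    have e1: "emeasure PZ E1 = (\<Prod>j\<in>fst ` Z0. emeasure \<mu> (A (j, 0)))"
      unfolding E1_def by (rule Z.emeasure_PiM_Collect) (use ZD A1 in auto)
    have e2: "emeasure (stdP D) E2 = (\<Prod>i\<in>pos D. emeasure (density lborel std_normal_density) {x. c i + r * x \<in> A i})"
      unfolding E2_def by (rule S.emeasure_PiM_Collect) (use ZD A2 in \<open>auto simp: pos_def\<close>)
    have s1: "E1 \<in> sets PZ"
    proof -
      have "E1 = prod_emb UNIV (\<lambda>_. \<mu>) (fst ` Z0) (Pi\<^sub>E (fst ` Z0) (\<lambda>j. A (j, 0)))"
        by (rule set_eqI) (simp add: E1_def prod_emb_def space_PiM restrict_PiE_iff Pi_iff)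
      then show ?thesis using ZD A1 by (simp only:) (rule sets_PiM_I, auto)
    qed
    have s2: "E2 \<in> sets (stdP D)"
      unfolding E2_def
    proof (rule sets.sets_Collect_finite_All[OF _ ZD(2)])
      fix i assume i: "i \<in> pos D"
      have "(\<lambda>\<zeta>. \<zeta> i) \<in> borel_measurable (stdP D)" by (rule measurable_stdP_component) (use i in \<open>auto simp: pos_def\<close>)
      from measurable_sets[OF this A2[OF i]]
      show "{\<zeta> \<in> space (stdP D). \<zeta> i \<in> {x. c i + r * x \<in> A i}} \<in> sets (stdP D)"
        by (simp add: vimage_def Int_def conj_commute)
    qed
    have "emeasure (distr (PZ \<Otimes>\<^sub>M stdP D) (PiM D CM) ?X) (Pi\<^sub>E D A)
       = emeasure (PZ \<Otimes>\<^sub>M stdP D) (?X -` Pi\<^sub>E D A \<inter> space (PZ \<Otimes>\<^sub>M stdP D))"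
      by (rule emeasure_distr[OF noisy_measurable box])
    also have "?X -` Pi\<^sub>E D A \<inter> space (PZ \<Otimes>\<^sub>M stdP D) = E1 \<times> E2"
    proof -
      have a0: "(\<lambda>i\<in>D. noisy c r z \<zeta> i) \<in> Pi\<^sub>E D A \<longleftrightarrow> (\<forall>i\<in>D. noisy c r z \<zeta> i \<in> A i)" for z \<zeta>
        by (auto simp: PiE_iff)
      have a1: "(\<forall>i\<in>D. noisy c r z \<zeta> i \<in> A i) \<longleftrightarrow> (\<forall>i\<in>Z0. z (fst i) \<in> A i) \<and> (\<forall>i\<in>pos D. c i + r * \<zeta> i \<in> A i)" for z \<zeta>
        by (subst ZD(4)) (auto simp: ball_Un noisy_def Z0_def pos_def)
      have a2: "(\<forall>i\<in>Z0. z (fst i) \<in> A i) \<longleftrightarrow> (\<forall>j\<in>fst ` Z0. z j \<in> A (j, 0))" for z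
        by (force simp: Z0_def)
      have "y \<in> ?X -` Pi\<^sub>E D A \<inter> space (PZ \<Otimes>\<^sub>M stdP D) \<longleftrightarrow> y \<in> E1 \<times> E2" for y
        by (cases y) (simp only: vimage_eq Int_iff space_pair_measure mem_Times_iff fst_conv snd_conv a0 a1 a2
            E1_def E2_def mem_Collect_eq, blast)
      then show ?thesis by blast
    qed
    also have "emeasure (PZ \<Otimes>\<^sub>M stdP D) (E1 \<times> E2) = emeasure PZ E1 * emeasure (stdP D) E2"
      by (rule sigma_finite_measure.emeasure_pair_measure_Times[OF prob_space_imp_sigma_finite[OF prob_stdP] s1 s2])
    also have "emeasure PZ E1 = (\<Prod>i\<in>Z0. emeasure (noise_measure c r i) (A i))"
      unfolding e1 prod.reindex[OF injf] by (rule prod.cong) (auto simp: Z0_def noise_measure_def)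
    also have "emeasure (stdP D) E2 = (\<Prod>i\<in>pos D. emeasure (noise_measure c r i) (A i))"
      unfolding e2 by (rule prod.cong) (auto simp: pos_def noise_measure_def emeasure_normal_affine[OF r A])
    also have "(\<Prod>i\<in>Z0. emeasure (noise_measure c r i) (A i)) * (\<Prod>i\<in>pos D. emeasure (noise_measure c r i) (A i))
      = (\<Prod>i\<in>D. emeasure (noise_measure c r i) (A i))"
      using prod.union_disjoint[OF ZD(1,2,3), of "\<lambda>i. emeasure (noise_measure c r i) (A i)"]
      unfolding ZD(4)[symmetric] by simp
    finally show "emeasure (distr (PZ \<Otimes>\<^sub>M stdP D) (PiM D CM) ?X) (Pi\<^sub>E D A) = (\<Prod>i\<in>D. emeasure (noise_measure c r i) (A i))" .
  qed
  then show ?thesis ..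
qed

end

lemma gaussian_vector_shift:
  assumes "gaussian_vector M I G m K"
  shows "gaussian_vector M I (\<lambda>i \<omega>. G i \<omega> + c) (\<lambda>i. m i + c) K"
  unfolding gaussian_vector_def
proof (intro conjI ballI allI)
  fix i assume "i \<in> I"
  then have "G i \<in> borel_measurable M" using assms by (auto simp: gaussian_vector_def)
  then show "(\<lambda>\<omega>. G i \<omega> + c) \<in> borel_measurable M" by simp
next
  fix \<xi> :: "'b \<Rightarrow> real"
  have "(\<integral>\<omega>. cis (\<Sum>i\<in>I. \<xi> i * (G i \<omega> + c)) \<partial>M) = (\<integral>\<omega>. cis (\<Sum>i\<in>I. \<xi> i * c) * cis (\<Sum>i\<in>I. \<xi> i * G i \<omega>) \<partial>M)"
    by (simp add: cis_mult distrib_left sum.distrib add.commute)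
  also have "\<dots> = cis (\<Sum>i\<in>I. \<xi> i * c) * (\<integral>\<omega>. cis (\<Sum>i\<in>I. \<xi> i * G i \<omega>) \<partial>M)"
    by (rule integral_mult_right_zero)
  also have "(\<integral>\<omega>. cis (\<Sum>i\<in>I. \<xi> i * G i \<omega>) \<partial>M) = cis (\<Sum>i\<in>I. \<xi> i * m i) * complex_of_real (exp (- (quad_form I K \<xi> / 2)))"
    using assms by (simp add: gaussian_vector_def)
  finally show "(\<integral>\<omega>. cis (\<Sum>i\<in>I. \<xi> i * (G i \<omega> + c)) \<partial>M) = cis (\<Sum>i\<in>I. \<xi> i * (m i + c)) * complex_of_real (exp (- (quad_form I K \<xi> / 2)))"
    by (simp add: cis_mult distrib_left sum.distrib add.commute mult.assoc[symmetric])
qed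

context limit_law
begin

text \<open>The values that \<open>net_mean\<close> and, with \<open>drift_cov\<close>,
  \<open>net_cov\<close> approach on the good event. The increments are not centred here, hence
  \<open>\<theta>bar\<close>; the variance \<open>\<sigma>\<^sup>2\<close> of the network noise is
  kept apart from \<open>drift_cov\<close>.\<close>

definition drift_mean :: "site_time \<Rightarrow> real" where
  "drift_mean i = mean_coeff Jbar f \<mu>e (snd i) + \<theta>bar"

definition drift_cov :: "site_time \<Rightarrow> site_time \<Rightarrow> real" where
  "drift_cov i i' = cov_coeff \<theta> \<Lambda> f \<mu>e (fst i' - fst i) (snd i) (snd i')"

lemma gaussian_vector_G:
  assumes I: "finite I" "I \<subseteq> UNIV \<times> {1..T}"
  shows "gaussian_vector G I (\<lambda>i v. v (fst i) (snd i) + \<theta>bar) drift_mean (add_diag drift_cov (\<sigma>\<^sup>2))"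
proof -
  let ?X = "\<lambda>(j, s) v. v j s :: real"
  have g: "gaussian_family G (UNIV \<times> {1..T}) ?X"
    and m: "\<And>j r. r \<in> {1..T} \<Longrightarrow> (\<integral>v. v j r \<partial>G) = mean_coeff Jbar f \<mu>e r"
    and c: "\<And>j k r s. r \<in> {1..T} \<Longrightarrow> s \<in> {1..T} \<Longrightarrow> cov G (\<lambda>v. v j r) (\<lambda>v. v (j + k) s)
        = (if k = 0 \<and> r = s then \<sigma>\<^sup>2 else 0) + cov_coeff \<theta> \<Lambda> f \<mu>e k r s"
    using G by (auto simp: is_stationary_gaussian_law_def)
  have "gaussian_vector G I (\<lambda>i v. v (fst i) (snd i)) (\<lambda>i. mean_coeff Jbar f \<mu>e (snd i)) (add_diag drift_cov (\<sigma>\<^sup>2))"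
  proof (rule gaussian_vector_eq[OF gaussian_family_gaussian_vector[OF prob_G g I]])
    fix i i' assume i: "i \<in> I" "i' \<in> I"
    obtain j r j' s where e: "i = (j, r)" "i' = (j', s)" by (cases i, cases i')
    have rs: "r \<in> {1..T}" "s \<in> {1..T}" using i I e by auto
    show "cov G (?X i) (?X i') = add_diag drift_cov (\<sigma>\<^sup>2) i i'"
      using c[OF rs, of j "j' - j"] by (simp add: e drift_cov_def)
  qed (use m I in \<open>auto simp: case_prod_beta\<close>)
  from gaussian_vector_shift[OF this, of \<theta>bar] show ?thesis
    by (rule gaussian_vector_eq) (simp_all add: drift_mean_def)
qed

text \<open>The smoothing formula applied to \<open>G\<close> and read backwards: an extra
  \<open>r\<^sup>2\<close> on the diagonal of the limit covariance means independent noise of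
  deviation \<open>r\<close> added to the sample at every positive time, while time \<open>0\<close>
  keeps its law.\<close>

lemma ref_density:
  assumes D: "finite D" "D \<subseteq> UNIV \<times> {0..T}" and r: "r > 0" and F: "F \<in> borel_measurable (PiM D CM)"
  shows "(\<integral>\<^sup>+w. F w * ennreal (gauss_density (pos D) drift_mean (add_diag (add_diag drift_cov (\<sigma>\<^sup>2)) (r\<^sup>2)) w) \<partial>PiM D CM)
    = (\<integral>\<^sup>+x. (\<integral>\<^sup>+\<zeta>. F (\<lambda>i\<in>D. join x i + (if snd i = 0 then 0 else r * \<zeta> i)) \<partial>stdP D) \<partial>(Z\<mu> \<Otimes>\<^sub>M G))"
proof -
  interpret G: prob_space G by (rule prob_G)
  interpret Z: prob_space Z\<mu> by (rule prob_Z)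
  interpret S: prob_space "stdP D" by (rule prob_stdP)
  interpret D: finite_product_sigma_finite CM D by standard (rule D)
  interpret ZG: pair_prob_space Z\<mu> G ..
  interpret ZS: pair_prob_space Z\<mu> "stdP D" ..
  interpret DG: pair_sigma_finite "PiM D CM" G ..
  have P: "finite (pos D)" "pos D \<subseteq> UNIV \<times> {1..T}" using D by (auto simp: pos_simps)
  note gG = gaussian_vector_G[OF P]
  have vm: "(\<lambda>v. v (fst i) (snd i) + \<theta>bar) \<in> borel_measurable G" if "i \<in> pos D" for i
    using gG that by (auto simp: gaussian_vector_def)
  define c where "c = (\<lambda>(v :: field) (i :: site_time). v (fst i) (snd i) + \<theta>bar)"
  define \<Phi> where "\<Phi> = (\<lambda>v w. ennreal (\<Prod>i\<in>pos D. normal_density (c v i) r (w i)))"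
  have \<Phi>: "(\<lambda>x. \<Phi> (snd x) (fst x)) \<in> borel_measurable (PiM D CM \<Otimes>\<^sub>M G)"
    unfolding \<Phi>_def c_def
    by (intro measurable_compose[OF _ measurable_ennreal] borel_measurable_prod normal_density_measurable
        measurable_compose[OF measurable_snd vm] measurable_compose[OF measurable_fst measurable_component_CM])
      (auto simp: pos_def)
  have \<Phi>v: "\<Phi> v \<in> borel_measurable (PiM D CM)" for v
    unfolding \<Phi>_def
    by (intro measurable_compose[OF _ measurable_ennreal] borel_measurable_prod normal_density_measurable measurable_component_CM)
      (auto simp: pos_def)
  let ?X = "\<lambda>x \<zeta>. \<lambda>i\<in>D. join x i + (if snd i = 0 then 0 else r * \<zeta> i)"
  have Xe: "?X (z, v) \<zeta> = (\<lambda>i\<in>D. noisy (c v) r z \<zeta> i)" for z v \<zeta>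
    by (auto simp: join_def noisy_def c_def)
  have Xm: "(\<lambda>y. ?X (fst y) (snd y)) \<in> measurable (BPM \<Otimes>\<^sub>M stdP D) (PiM D CM)"
  proof (rule measurable_restrict)
    fix i assume i: "i \<in> D"
    have 1: "(\<lambda>y. join (fst y) i) \<in> borel_measurable (BPM \<Otimes>\<^sub>M stdP D)"
      by (rule measurable_compose[OF measurable_fst join_measurable]) (use i D in auto)
    have 2: "(\<lambda>y. snd y i) \<in> borel_measurable (BPM \<Otimes>\<^sub>M stdP D)"
      by (rule measurable_compose[OF measurable_snd measurable_stdP_component[OF i]])
    have "(\<lambda>y. join (fst y) i + (if snd i = 0 then 0 else r * snd y i)) \<in> borel_measurable (BPM \<Otimes>\<^sub>M stdP D)"
      using 1 2 by (cases "snd i = 0") auto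
    then show "(\<lambda>y. join (fst y) i + (if snd i = 0 then 0 else r * snd y i)) \<in> measurable (BPM \<Otimes>\<^sub>M stdP D) (CM i)"
      by (simp cong: measurable_cong_sets)
  qed
  have FX: "(\<lambda>(x, \<zeta>). F (?X x \<zeta>)) \<in> borel_measurable ((Z\<mu> \<Otimes>\<^sub>M G) \<Otimes>\<^sub>M stdP D)"
    unfolding case_prod_beta using measurable_compose[OF Xm F]
    by (simp only: measurable_cong_sets[OF sets_pair_measure_cong[OF sets_ZG refl] refl])
  have "(\<integral>\<^sup>+w. F w * ennreal (gauss_density (pos D) drift_mean (add_diag (add_diag drift_cov (\<sigma>\<^sup>2)) (r\<^sup>2)) w) \<partial>PiM D CM)
     = (\<integral>\<^sup>+w. (\<integral>\<^sup>+v. F w * \<Phi> v w \<partial>G) \<partial>PiM D CM)"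
  proof (rule nn_integral_cong)
    fix w assume w: "w \<in> space (PiM D CM)"
    have "(\<lambda>v. \<Phi> v w) \<in> borel_measurable G" using measurable_compose[OF measurable_Pair1'[OF w] \<Phi>] by simp
    then show "F w * ennreal (gauss_density (pos D) drift_mean (add_diag (add_diag drift_cov (\<sigma>\<^sup>2)) (r\<^sup>2)) w) = (\<integral>\<^sup>+v. F w * \<Phi> v w \<partial>G)"
      unfolding gaussian_vector_gauss_density_nn[OF prob_G gG r P(1)] by (subst nn_integral_cmult) (simp_all add: \<Phi>_def c_def)
  qed
  also have "\<dots> = (\<integral>\<^sup>+v. (\<integral>\<^sup>+w. F w * \<Phi> v w \<partial>PiM D CM) \<partial>G)"
  proof (rule DG.Fubini'[symmetric])
    show "(\<lambda>(w, v). F w * \<Phi> v w) \<in> borel_measurable (PiM D CM \<Otimes>\<^sub>M G)"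
      unfolding case_prod_beta by (intro borel_measurable_times_ennreal \<Phi> measurable_compose[OF measurable_fst F])
  qed
  also have "\<dots> = (\<integral>\<^sup>+v. (\<integral>\<^sup>+z. (\<integral>\<^sup>+\<zeta>. F (?X (z, v) \<zeta>) \<partial>stdP D) \<partial>Z\<mu>) \<partial>G)"
  proof (rule nn_integral_cong)
    fix v
    have "(\<integral>\<^sup>+w. F w * \<Phi> v w \<partial>PiM D CM) = (\<integral>\<^sup>+w. \<Phi> v w * F w \<partial>PiM D CM)" by (simp only: mult.commute)
    also have "\<dots> = (\<integral>\<^sup>+w. F w \<partial>density (PiM D CM) (\<Phi> v))"
      by (rule nn_integral_density[symmetric, OF \<Phi>v F])
    also have "density (PiM D CM) (\<Phi> v) = PiM D (noise_measure (c v) r)"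
      unfolding \<Phi>_def by (rule PiM_noise_measure[OF D(1) r, symmetric])
    also have "(\<integral>\<^sup>+w. F w \<partial>PiM D (noise_measure (c v) r)) = (\<integral>\<^sup>+x. F (\<lambda>i\<in>D. noisy (c v) r (fst x) (snd x) i) \<partial>(Z\<mu> \<Otimes>\<^sub>M stdP D))"
      unfolding PiM_noise_measure_distr[OF D(1) r] by (rule nn_integral_distr[OF noisy_measurable]) (simp add: F)
    also have "\<dots> = (\<integral>\<^sup>+z. (\<integral>\<^sup>+\<zeta>. F (\<lambda>i\<in>D. noisy (c v) r z \<zeta> i) \<partial>stdP D) \<partial>Z\<mu>)"
      using S.nn_integral_fst[OF measurable_compose[OF noisy_measurable F], of "c v" r] by simp
    finally show "(\<integral>\<^sup>+w. F w * \<Phi> v w \<partial>PiM D CM) = (\<integral>\<^sup>+z. (\<integral>\<^sup>+\<zeta>. F (?X (z, v) \<zeta>) \<partial>stdP D) \<partial>Z\<mu>)"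
      by (simp only: Xe)
  qed
  also have "\<dots> = (\<integral>\<^sup>+x. (\<integral>\<^sup>+\<zeta>. F (?X x \<zeta>) \<partial>stdP D) \<partial>(Z\<mu> \<Otimes>\<^sub>M G))"
  proof -
    have "(\<lambda>x. \<integral>\<^sup>+\<zeta>. F (?X x \<zeta>) \<partial>stdP D) \<in> borel_measurable (Z\<mu> \<Otimes>\<^sub>M G)"
      by (rule S.borel_measurable_nn_integral[OF FX])
    from ZG.nn_integral_snd[OF this] show ?thesis by simp
  qed
  finally show ?thesis .
qed

end

section \<open>Blocks under the limit law\<close>

lemma upath_shift: "upath \<gamma> w s (j + k) = upath \<gamma> (\<lambda>i. w (j + fst i, snd i)) s k"
  by (induction s) auto

text \<open>For \<open>y < 0\<close> put \<open>x = - y\<close>: the Taylor lower bound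
  \<open>1 + x + x\<^sup>2 / 2\<close> for \<open>exp x\<close> is inverted, and its product with
  \<open>1 - x + x\<^sup>2\<close> is at least one.\<close>

lemma exp_le_quadratic:
  fixes y :: real
  assumes "\<bar>y\<bar> \<le> 1"
  shows "exp y \<le> 1 + y + y\<^sup>2"
proof (cases "0 \<le> y")
  case True
  then show ?thesis using exp_bound[of y] assms by simp
next
  case False
  define x where "x = - y"
  have x: "0 \<le> x" using False by (simp add: x_def)
  have p: "0 < 1 + x + x\<^sup>2 / 2" using x by (intro add_pos_nonneg) auto
  have "exp y = 1 / exp x" by (simp add: x_def exp_minus inverse_eq_divide)
  also have "\<dots> \<le> 1 / (1 + x + x\<^sup>2 / 2)"
    using exp_lower_Taylor_quadratic[OF x] p by (intro divide_left_mono) auto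
  also have "\<dots> \<le> 1 - x + x\<^sup>2"
  proof -
    have "1 \<le> 1 + x\<^sup>2 / 2 + x ^ 3 / 2 + x ^ 4 / 2" using x by simp
    also have "\<dots> = (1 - x + x\<^sup>2) * (1 + x + x\<^sup>2 / 2)" by (simp add: field_simps power2_eq_square power3_eq_cube power4_eq_xxxx)
    finally show ?thesis using p by (simp add: pos_divide_le_eq)
  qed
  finally show ?thesis by (simp add: x_def)
qed

context limit_law
begin

definition block :: "nat \<Rightarrow> nat \<Rightarrow> int \<Rightarrow> site_time set" where
  "block m t j = (\<lambda>i. (j + fst i, snd i)) ` grid m t"

text \<open>The extra noise accounts for the increase of the covariance in the comparison of densities.\<close>

definition noisy_value :: "((site_time \<Rightarrow> real) \<Rightarrow> real) \<Rightarrow> real \<Rightarrow> (int \<Rightarrow> real) \<times> field \<Rightarrow> (site_time \<Rightarrow> real) \<Rightarrow> real" where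
  "noisy_value g r x \<zeta> = g (\<lambda>i. upath \<gamma> (\<lambda>i. join x i + (if snd i = 0 then 0 else r * \<zeta> i)) (snd i) (fst i))"

lemma noisy_value_measurable:
  assumes g: "cyl m t g" and t: "t \<le> T"
  shows "(\<lambda>y. noisy_value g r (fst y) (snd y)) \<in> borel_measurable (BPM \<Otimes>\<^sub>M stdP (grid m t))"
  unfolding noisy_value_def
proof (rule cyl_compose_measurable[OF g])
  fix i assume i: "i \<in> grid m t"
  have "(\<lambda>y. upath \<gamma> (\<lambda>i. join (fst y) i + (if snd i = 0 then 0 else r * snd y i)) s (fst i)) \<in> borel_measurable (BPM \<Otimes>\<^sub>M stdP (grid m t))"
    if "s \<le> t" for s
    using that
  proof (induction s)
    case 0
    have "(\<lambda>y. join (fst y) (fst i, 0)) \<in> borel_measurable (BPM \<Otimes>\<^sub>M stdP (grid m t))"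
      by (rule measurable_compose[OF measurable_fst join_measurable]) simp
    then show ?case by simp
  next
    case (Suc s)
    have 1: "(\<lambda>y. join (fst y) (fst i, Suc s)) \<in> borel_measurable (BPM \<Otimes>\<^sub>M stdP (grid m t))"
      by (rule measurable_compose[OF measurable_fst join_measurable]) (use Suc t in simp)
    have 2: "(\<lambda>y. snd y (fst i, Suc s)) \<in> borel_measurable (BPM \<Otimes>\<^sub>M stdP (grid m t))"
      by (rule measurable_compose[OF measurable_snd measurable_stdP_component]) (use Suc.prems i in \<open>auto simp: grid_def\<close>)
    show ?case using 1 2 Suc by simp
  qed
  then show "(\<lambda>y. upath \<gamma> (\<lambda>i. join (fst y) i + (if snd i = 0 then 0 else r * snd y i)) (snd i) (fst i)) \<in> borel_measurable (BPM \<Otimes>\<^sub>M stdP (grid m t))"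
    using i by (auto simp: grid_def)
qed

text \<open>The right side does not depend on \<open>j\<close>: stationarity moves the block to the
  origin, and the independent noise variables are relabelled along the same shift.\<close>

lemma block_integral:
  assumes g: "cyl m t g" and t: "t \<le> T" and r: "r > 0" and \<Phi>: "\<Phi> \<in> borel_measurable borel"
  shows "(\<integral>\<^sup>+w. \<Phi> (g (\<lambda>i. upath \<gamma> w (snd i) (j + fst i))) * ennreal (gauss_density (pos (block m t j)) drift_mean (add_diag (add_diag drift_cov (\<sigma>\<^sup>2)) (r\<^sup>2)) w)
       \<partial>PiM (block m t j) CM)
    = (\<integral>\<^sup>+x. (\<integral>\<^sup>+\<zeta>. \<Phi> (noisy_value g r x \<zeta>) \<partial>stdP (grid m t)) \<partial>(Z\<mu> \<Otimes>\<^sub>M G))"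
proof -
  let ?D = "block m t j" and ?g = "grid m t" and ?s = "\<lambda>i :: site_time. (j + fst i, snd i)"
  have D: "finite ?D" "?D \<subseteq> UNIV \<times> {0..T}" using t by (auto simp: block_def grid_def)
  interpret S: prob_space "stdP ?g" by (rule prob_stdP)
  have Fm: "(\<lambda>w. \<Phi> (g (\<lambda>i. upath \<gamma> w (snd i) (j + fst i)))) \<in> borel_measurable (PiM ?D CM)"
    by (rule measurable_compose[OF cyl_compose_measurable[OF g] \<Phi>], rule upath_measurable)
      (auto simp: block_def grid_def image_iff)
  have "(\<integral>\<^sup>+w. \<Phi> (g (\<lambda>i. upath \<gamma> w (snd i) (j + fst i))) * ennreal (gauss_density (pos ?D) drift_mean (add_diag (add_diag drift_cov (\<sigma>\<^sup>2)) (r\<^sup>2)) w) \<partial>PiM ?D CM)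
    = (\<integral>\<^sup>+x. (\<integral>\<^sup>+\<zeta>. \<Phi> (g (\<lambda>i. upath \<gamma> (\<lambda>i\<in>?D. join x i + (if snd i = 0 then 0 else r * \<zeta> i)) (snd i) (j + fst i))) \<partial>stdP ?D) \<partial>(Z\<mu> \<Otimes>\<^sub>M G))"
    by (rule ref_density[OF D r Fm])
  also have "\<dots> = (\<integral>\<^sup>+x. (\<integral>\<^sup>+\<zeta>. \<Phi> (noisy_value g r (shift_pair j x) (\<lambda>i\<in>?g. \<zeta> (?s i))) \<partial>stdP ?D) \<partial>(Z\<mu> \<Otimes>\<^sub>M G))"
  proof (intro nn_integral_cong arg_cong[where f = \<Phi>])
    fix x \<zeta>
    show "g (\<lambda>i. upath \<gamma> (\<lambda>i\<in>?D. join x i + (if snd i = 0 then 0 else r * \<zeta> i)) (snd i) (j + fst i))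
       = noisy_value g r (shift_pair j x) (\<lambda>i\<in>?g. \<zeta> (?s i))"
      unfolding noisy_value_def
    proof (rule cyl_cong[OF g])
      fix i assume i: "i \<in> ?g"
      show "upath \<gamma> (\<lambda>i\<in>?D. join x i + (if snd i = 0 then 0 else r * \<zeta> i)) (snd i) (j + fst i)
        = upath \<gamma> (\<lambda>i. join (shift_pair j x) i + (if snd i = 0 then 0 else r * (\<lambda>i\<in>?g. \<zeta> (?s i)) i)) (snd i) (fst i)"
        unfolding upath_shift
      proof (rule upath_cong)
        fix s assume "s \<le> snd i"
        then have m: "(fst i, s) \<in> ?g" using i by (auto simp: grid_def)
        then have "?s (fst i, s) \<in> ?D" unfolding block_def by (rule imageI)
        then show "(\<lambda>i\<in>?D. join x i + (if snd i = 0 then 0 else r * \<zeta> i)) (j + fst (fst i, s), snd (fst i, s))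
          = join (shift_pair j x) (fst i, s) + (if snd (fst i, s) = 0 then 0 else r * (\<lambda>i\<in>?g. \<zeta> (?s i)) (fst i, s))"
          using m by (simp add: join_def)
      qed
    qed
  qed
  also have "\<dots> = (\<integral>\<^sup>+x. (\<integral>\<^sup>+\<zeta>. \<Phi> (noisy_value g r (shift_pair j x) \<zeta>) \<partial>stdP ?g) \<partial>(Z\<mu> \<Otimes>\<^sub>M G))"
  proof (rule nn_integral_cong)
    fix x assume "x \<in> space (Z\<mu> \<Otimes>\<^sub>M G)"
    have sp: "y \<in> space BPM" if "\<And>k. snd y k \<in> space (\<Pi>\<^sub>M s\<in>{1..T}. borel :: real measure)" for y :: "(int \<Rightarrow> real) \<times> field"
      using that by (simp add: space_pair_measure space_PiM mem_Times_iff PiE_iff extensional_def)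
    have "x \<in> space BPM" using \<open>x \<in> _\<close> sets_eq_imp_space_eq[OF sets_ZG] by (simp only:)
    then have "snd x \<in> space (\<Pi>\<^sub>M j\<in>(UNIV :: int set). \<Pi>\<^sub>M s\<in>{1..T}. borel :: real measure)"
      unfolding space_pair_measure by (simp only: mem_Times_iff)
    then have "snd x k \<in> space (\<Pi>\<^sub>M s\<in>{1..T}. borel :: real measure)" for k
      by (rule measurable_space[OF measurable_component_singleton, rotated]) simp
    then have x: "shift_pair j x \<in> space BPM" by (intro sp) simp
    have m: "(\<lambda>\<zeta>. \<Phi> (noisy_value g r (shift_pair j x) \<zeta>)) \<in> borel_measurable (stdP ?g)"
      using measurable_compose[OF measurable_compose[OF measurable_Pair1'[OF x] noisy_value_measurable[OF g t]] \<Phi>] by simp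
    have d: "distr (stdP ?D) (stdP ?g) (\<lambda>\<zeta>. \<lambda>i\<in>?g. \<zeta> (?s i)) = stdP ?g"
      by (rule distr_PiM_reindex[of ?D "\<lambda>_. density lborel std_normal_density" ?s ?g])
        (auto simp: inj_on_def block_def intro: prob_std_normal)
    have rm: "(\<lambda>\<zeta>. \<lambda>i\<in>?g. \<zeta> (?s i)) \<in> measurable (stdP ?D) (stdP ?g)"
      by (rule measurable_restrict, rule measurable_component_singleton) (auto simp: block_def)
    have "(\<integral>\<^sup>+\<zeta>. \<Phi> (noisy_value g r (shift_pair j x) \<zeta>) \<partial>stdP ?g)
       = (\<integral>\<^sup>+\<zeta>. \<Phi> (noisy_value g r (shift_pair j x) \<zeta>) \<partial>distr (stdP ?D) (stdP ?g) (\<lambda>\<zeta>. \<lambda>i\<in>?g. \<zeta> (?s i)))"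
      by (simp only: d)
    also have "\<dots> = (\<integral>\<^sup>+\<zeta>. \<Phi> (noisy_value g r (shift_pair j x) (\<lambda>i\<in>?g. \<zeta> (?s i))) \<partial>stdP ?D)"
      by (rule nn_integral_distr[OF rm]) (simp add: m)
    finally show "(\<integral>\<^sup>+\<zeta>. \<Phi> (noisy_value g r (shift_pair j x) (\<lambda>i\<in>?g. \<zeta> (?s i))) \<partial>stdP ?D)
       = (\<integral>\<^sup>+\<zeta>. \<Phi> (noisy_value g r (shift_pair j x) \<zeta>) \<partial>stdP ?g)" ..
  qed
  also have "\<dots> = (\<integral>\<^sup>+x. (\<integral>\<^sup>+\<zeta>. \<Phi> (noisy_value g r x \<zeta>) \<partial>stdP ?g) \<partial>(Z\<mu> \<Otimes>\<^sub>M G))"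
  proof (rule nn_integral_shift_pair)
    show "(\<lambda>x. \<integral>\<^sup>+\<zeta>. \<Phi> (noisy_value g r x \<zeta>) \<partial>stdP ?g) \<in> borel_measurable BPM"
      by (rule S.borel_measurable_nn_integral)
        (use measurable_compose[OF noisy_value_measurable[OF g t] \<Phi>] in \<open>simp add: case_prod_beta\<close>)
  qed
  finally show ?thesis .
qed

abbreviation "Qm m t \<equiv> (Z\<mu> \<Otimes>\<^sub>M G) \<Otimes>\<^sub>M stdP (grid m t)"

lemma prob_Qm: "prob_space (Qm m t)"
proof -
  interpret G: prob_space G by (rule prob_G)
  interpret Z: prob_space Z\<mu> by (rule prob_Z)
  interpret S: prob_space "stdP (grid m t)" by (rule prob_stdP)
  interpret ZG: pair_prob_space Z\<mu> G ..
  interpret ZGS: pair_prob_space "Z\<mu> \<Otimes>\<^sub>M G" "stdP (grid m t)" ..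
  show ?thesis by (rule ZGS.P.prob_space_axioms)
qed

lemma noisy_value_measurable_Qm:
  assumes g: "cyl m t g" and t: "t \<le> T"
  shows "(\<lambda>y. noisy_value g r (fst y) (snd y)) \<in> borel_measurable (Qm m t)"
  using noisy_value_measurable[OF g t] by (simp only: measurable_cong_sets[OF sets_pair_measure_cong[OF sets_ZG refl] refl])

lemma noisy_value_0:
  assumes g: "cyl m t g" and t: "t \<le> T"
  shows "(\<integral>y. noisy_value g 0 (fst y) (snd y) \<partial>Qm m t) = (\<integral>u. g (flat u) \<partial>\<mu>e)"
proof -
  interpret G: prob_space G by (rule prob_G)
  interpret Z: prob_space Z\<mu> by (rule prob_Z)
  interpret S: prob_space "stdP (grid m t)" by (rule prob_stdP)
  interpret ZG: pair_prob_space Z\<mu> G ..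
  interpret ZGS: pair_prob_space "Z\<mu> \<Otimes>\<^sub>M G" "stdP (grid m t)" ..
  obtain C where C: "\<And>u. \<bar>g u\<bar> \<le> C" using cyl_bound[OF g] by metis
  let ?H = "\<lambda>x. g (\<lambda>i. upath \<gamma> (join x) (snd i) (fst i))"
  have e: "noisy_value g 0 x \<zeta> = ?H x" for x \<zeta>
  proof -
    have "(\<lambda>i. join x i + (if snd i = 0 then 0 else 0 * \<zeta> i)) = join x" by (rule ext) simp
    then show ?thesis by (simp only: noisy_value_def)
  qed
  have "integrable (Qm m t) (\<lambda>y. noisy_value g 0 (fst y) (snd y))"
    by (rule ZGS.P.integrable_const_bound[where B = C]) (use C noisy_value_measurable_Qm[OF g t, of 0] in \<open>auto simp: noisy_value_def\<close>)
  from ZGS.integral_fst'[OF this]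
  have "(\<integral>y. noisy_value g 0 (fst y) (snd y) \<partial>Qm m t) = (\<integral>x. (\<integral>\<zeta>. noisy_value g 0 x \<zeta> \<partial>stdP (grid m t)) \<partial>(Z\<mu> \<Otimes>\<^sub>M G))" by simp
  also have "\<dots> = (\<integral>x. ?H x \<partial>(Z\<mu> \<Otimes>\<^sub>M G))" by (simp add: e S.prob_space)
  also have "\<dots> = (\<integral>u. g (flat u) \<partial>\<mu>e)" by (rule integral_\<mu>e[OF g t, symmetric])
  finally show ?thesis .
qed

text \<open>For a fixed sample the path is continuous in \<open>r\<close>, and \<open>g\<close> is
  continuous and bounded, so dominated convergence applies. This is what makes a small increase of
  the covariance harmless.\<close>

lemma noisy_value_tendsto:
  assumes g: "cyl m t g" and t: "t \<le> T"
  shows "((\<lambda>r. \<integral>y. noisy_value g r (fst y) (snd y) \<partial>Qm m t) \<longlongrightarrow> (\<integral>u. g (flat u) \<partial>\<mu>e)) (at_right 0)"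
proof (rule tendsto_at_right_sequentially[of 0 1])
  interpret Q: prob_space "Qm m t" by (rule prob_Qm)
  obtain C where C: "\<And>u. \<bar>g u\<bar> \<le> C" using cyl_bound[OF g] by metis
  fix S :: "nat \<Rightarrow> real" assume S: "S \<longlonglongrightarrow> 0"
  have gU: "continuous_on UNIV g" using g by (simp add: cyl_def)
  show "(\<lambda>n. \<integral>y. noisy_value g (S n) (fst y) (snd y) \<partial>Qm m t) \<longlonglongrightarrow> (\<integral>u. g (flat u) \<partial>\<mu>e)"
    unfolding noisy_value_0[OF g t, symmetric]
  proof (rule integral_dominated_convergence[where w = "\<lambda>_. C"])
    show "AE y in Qm m t. (\<lambda>n. noisy_value g (S n) (fst y) (snd y)) \<longlonglongrightarrow> noisy_value g 0 (fst y) (snd y)"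
    proof (rule AE_I2)
      fix y
      let ?w = "\<lambda>r i. join (fst y) i + (if snd i = 0 then 0 else r * snd y i)"
      have p: "continuous_on UNIV (\<lambda>r. upath \<gamma> (?w r) s j)" for s j
      proof (induction s)
        case (Suc s)
        have "continuous_on UNIV (\<lambda>r. \<gamma> * upath \<gamma> (?w r) s j + (join (fst y) (j, Suc s) + r * snd y (j, Suc s)))"
          by (intro continuous_intros Suc)
        then show ?case by simp
      qed simp
      have "continuous_on UNIV (\<lambda>r i. upath \<gamma> (?w r) (snd i) (fst i))"
        by (rule continuous_on_coordinatewise_then_product, rule p)
      then have "continuous_on UNIV (\<lambda>r. noisy_value g r (fst y) (snd y))"
        unfolding noisy_value_def by (rule continuous_on_compose2[OF gU _ subset_UNIV])
      then have "isCont (\<lambda>r. noisy_value g r (fst y) (snd y)) 0" by (simp add: continuous_on_eq_continuous_at)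
      then show "(\<lambda>n. noisy_value g (S n) (fst y) (snd y)) \<longlonglongrightarrow> noisy_value g 0 (fst y) (snd y)"
        by (rule isCont_tendsto_compose[OF _ S])
    qed
  qed (use C noisy_value_measurable_Qm[OF g t] in \<open>auto simp: noisy_value_def\<close>)
qed simp

text \<open>Second-order bound for the exponential moment of one centred block. Both
  \<open>g\<close> and its mean are bounded by \<open>C\<close>, so
  \<open>lam * (2 * C) \<le> 1\<close> keeps the exponent in the range of
  \<open>exp_le_quadratic\<close>; the linear term is the shift of the mean caused by the noise,
  below \<open>\<epsilon>\<close> for small variance. The bound \<open>\<tau>\<close> serves all
  sites \<open>j\<close>.\<close>

lemma block_mgf:
  assumes g: "cyl m t g" and t: "t \<le> T" and C: "\<And>u. \<bar>g u\<bar> \<le> C" and lam: "0 < lam" "lam * (2 * C) \<le> 1" and \<epsilon>: "\<epsilon> > 0"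
  obtains \<tau> where "\<tau> > 0"
    "\<And>a j. 0 < a \<Longrightarrow> a < \<tau> \<Longrightarrow>
      (\<integral>\<^sup>+w. ennreal (exp (lam * (g (\<lambda>i. upath \<gamma> w (snd i) (j + fst i)) - (\<integral>u. g (flat u) \<partial>\<mu>e))))
         * ennreal (gauss_density (pos (block m t j)) drift_mean (add_diag (add_diag drift_cov (\<sigma>\<^sup>2)) a) w) \<partial>PiM (block m t j) CM)
      \<le> ennreal (exp (lam * \<epsilon> + (lam * (2 * C))\<^sup>2))"
proof -
  interpret G: prob_space G by (rule prob_G)
  interpret Z: prob_space Z\<mu> by (rule prob_Z)
  interpret S: prob_space "stdP (grid m t)" by (rule prob_stdP)
  interpret ZG: pair_prob_space Z\<mu> G ..
  interpret Q: prob_space "Qm m t" by (rule prob_Qm)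
  interpret \<mu>e: prob_space \<mu>e by (rule prob_\<mu>e)
  define e where "e = (\<integral>u. g (flat u) \<partial>\<mu>e)"
  have "integrable \<mu>e (\<lambda>u. g (flat u))"
    by (rule \<mu>e.integrable_const_bound[where B = C]) (use C cyl_integrable_\<mu>e[OF g t] in auto)
  then have "norm e \<le> (\<integral>u. C \<partial>\<mu>e)"
    unfolding e_def by (intro order_trans[OF integral_norm_bound integral_mono]) (use C in auto)
  then have eC: "\<bar>e\<bar> \<le> C" by (simp add: \<mu>e.prob_space)
  have "eventually (\<lambda>r. (\<integral>y. noisy_value g r (fst y) (snd y) \<partial>Qm m t) < e + \<epsilon>) (at_right 0)"
    using noisy_value_tendsto[OF g t] by (rule order_tendstoD) (simp add: e_def \<epsilon>)
  then obtain b where b: "b > 0" "\<And>r. 0 < r \<Longrightarrow> r < b \<Longrightarrow> (\<integral>y. noisy_value g r (fst y) (snd y) \<partial>Qm m t) < e + \<epsilon>"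
    unfolding eventually_at_right_field by auto
  show thesis
  \<comment> \<open>The threshold is squared because \<open>a\<close> is a variance, whereas the
    noise in \<open>noisy_value\<close> is measured by its deviation \<open>sqrt a\<close>.\<close>
  proof (rule that[of "b\<^sup>2"])
    show "b\<^sup>2 > 0" using b by simp
    fix a :: real and j :: int assume a: "0 < a" "a < b\<^sup>2"
    define r where "r = sqrt a"
    have r: "r > 0" "r < b" "r\<^sup>2 = a" using a b by (auto simp: r_def real_less_lsqrt)
    let ?Y = "\<lambda>y. noisy_value g r (fst y) (snd y)"
    have Y: "\<bar>?Y y\<bar> \<le> C" for y using C by (simp add: noisy_value_def)
    note Ym = noisy_value_measurable_Qm[OF g t, of r]
    have iY: "integrable (Qm m t) ?Y" by (rule Q.integrable_const_bound[where B = C]) (use Y Ym in auto)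
    have yb: "\<bar>lam * (?Y y - e)\<bar> \<le> lam * (2 * C)" for y
    proof -
      have "\<bar>?Y y - e\<bar> \<le> 2 * C" using Y[of y] eC by linarith
      then show ?thesis using lam(1) by (simp add: abs_mult)
    qed
    have \<Phi>: "(\<lambda>y. ennreal (exp (lam * (y - e)))) \<in> borel_measurable borel" by measurable
    have "(\<integral>\<^sup>+w. ennreal (exp (lam * (g (\<lambda>i. upath \<gamma> w (snd i) (j + fst i)) - e)))
         * ennreal (gauss_density (pos (block m t j)) drift_mean (add_diag (add_diag drift_cov (\<sigma>\<^sup>2)) a) w) \<partial>PiM (block m t j) CM)
       = (\<integral>\<^sup>+x. (\<integral>\<^sup>+\<zeta>. ennreal (exp (lam * (noisy_value g r x \<zeta> - e))) \<partial>stdP (grid m t)) \<partial>(Z\<mu> \<Otimes>\<^sub>M G))"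
      unfolding r(3)[symmetric] by (rule block_integral[OF g t r(1) \<Phi>])
    also have "\<dots> = (\<integral>\<^sup>+y. ennreal (exp (lam * (?Y y - e))) \<partial>Qm m t)"
      using S.nn_integral_fst[OF measurable_compose[OF Ym \<Phi>]] by simp
    also have "\<dots> \<le> (\<integral>\<^sup>+y. ennreal (1 + lam * (?Y y - e) + (lam * (2 * C))\<^sup>2) \<partial>Qm m t)"
    proof (intro nn_integral_mono ennreal_leI)
      fix y
      have "exp (lam * (?Y y - e)) \<le> 1 + lam * (?Y y - e) + (lam * (?Y y - e))\<^sup>2"
        by (rule exp_le_quadratic) (use yb[of y] lam in linarith)
      moreover have "(lam * (?Y y - e))\<^sup>2 \<le> (lam * (2 * C))\<^sup>2"
        using yb[of y] by (metis abs_ge_zero power2_abs power_mono)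
      ultimately show "exp (lam * (?Y y - e)) \<le> 1 + lam * (?Y y - e) + (lam * (2 * C))\<^sup>2" by linarith
    qed
    also have "\<dots> = ennreal (\<integral>y. 1 + lam * (?Y y - e) + (lam * (2 * C))\<^sup>2 \<partial>Qm m t)"
    proof (rule nn_integral_eq_integral)
      show "integrable (Qm m t) (\<lambda>y. 1 + lam * (?Y y - e) + (lam * (2 * C))\<^sup>2)" using iY by simp
      show "AE y in Qm m t. 0 \<le> 1 + lam * (?Y y - e) + (lam * (2 * C))\<^sup>2"
      proof (rule AE_I2)
        fix y
        have "0 \<le> (lam * (2 * C))\<^sup>2" by simp
        then show "0 \<le> 1 + lam * (?Y y - e) + (lam * (2 * C))\<^sup>2" using yb[of y] lam(2) by linarith
      qed
    qed
    also have "(\<integral>y. 1 + lam * (?Y y - e) + (lam * (2 * C))\<^sup>2 \<partial>Qm m t) = 1 + lam * ((\<integral>y. ?Y y \<partial>Qm m t) - e) + (lam * (2 * C))\<^sup>2"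
      using iY by (simp add: Q.prob_space)
    also have "\<dots> \<le> 1 + (lam * \<epsilon> + (lam * (2 * C))\<^sup>2)"
      using b(2)[OF r(1,2)] lam(1) by (simp add: mult_left_mono less_imp_le)
    also have "\<dots> \<le> exp (lam * \<epsilon> + (lam * (2 * C))\<^sup>2)" by (rule exp_ge_add_one_self)
    finally show "(\<integral>\<^sup>+w. ennreal (exp (lam * (g (\<lambda>i. upath \<gamma> w (snd i) (j + fst i)) - (\<integral>u. g (flat u) \<partial>\<mu>e))))
         * ennreal (gauss_density (pos (block m t j)) drift_mean (add_diag (add_diag drift_cov (\<sigma>\<^sup>2)) a) w) \<partial>PiM (block m t j) CM)
      \<le> ennreal (exp (lam * \<epsilon> + (lam * (2 * C))\<^sup>2))"
      unfolding e_def[symmetric] by (simp add: ennreal_leI)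
  qed
qed

end

section \<open>Empirical averages\<close>

lemma site_mod_id: "k \<in> sites n \<Longrightarrow> site_mod k n = k"
  unfolding site_mod_def sites_eq by (subst mod_pos_pos_trivial) auto

lemma site_mod_eq_iff: "site_mod a n = site_mod b n \<longleftrightarrow> (2 * int n + 1) dvd (a - b)"
proof -
  have "site_mod a n = site_mod b n \<longleftrightarrow> (a + int n) mod (2 * int n + 1) = (b + int n) mod (2 * int n + 1)"
    by (simp add: site_mod_def)
  also have "\<dots> \<longleftrightarrow> (2 * int n + 1) dvd ((a + int n) - (b + int n))" by (rule mod_eq_dvd_iff)
  finally show ?thesis by simp
qed

lemma site_mod_dvd: "(2 * int n + 1) dvd (site_mod a n - a)"
  using site_mod_eq_iff[of "site_mod a n" n a] site_mod_id[OF site_mod_in_sites] by blast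

lemma site_mod_add: "site_mod (site_mod a n + b) n = site_mod (a + b) n"
  unfolding site_mod_eq_iff using site_mod_dvd[of n a] by simp

lemma bij_site_mod: "bij_betw (\<lambda>k. site_mod (c + k) n) (sites n) (sites n)"
proof -
  have "inj_on (\<lambda>k. site_mod (c + k) n) (sites n)"
  proof (rule inj_onI)
    fix k l assume kl: "k \<in> sites n" "l \<in> sites n" and "site_mod (c + k) n = site_mod (c + l) n"
    then have "(2 * int n + 1) dvd (k - l)" by (simp add: site_mod_eq_iff)
    moreover have "\<bar>k - l\<bar> < 2 * int n + 1" using kl by (auto simp: sites_eq)
    ultimately have "k - l = 0" using dvd_imp_le_int[of "k - l" "2 * int n + 1"] by fastforce
    then show "k = l" by simp
  qed
  moreover have "(\<lambda>k. site_mod (c + k) n) ` sites n \<subseteq> sites n" using site_mod_in_sites by auto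
  ultimately show ?thesis
    unfolding bij_betw_def using endo_inj_surj[of "sites n"] by auto
qed

lemma bij_site_mod_diff: "bij_betw (\<lambda>k. site_mod (k - c) n) (sites n) (sites n)"
  using bij_site_mod[of "- c" n] by (simp add: add.commute)

lemma sum_site_mod_diff: "(\<Sum>k\<in>sites n. h (site_mod (k - c) n)) = (\<Sum>a\<in>sites n. h a)"
  by (rule sum.reindex_bij_betw[OF bij_site_mod_diff])

text \<open>Schur test: each term is bounded by the absolute entry times the mean of the two
  squares, and symmetry turns column sums into row sums.\<close>

lemma quad_form_row_bound:
  assumes I: "finite I" and sym: "\<And>i j. i \<in> I \<Longrightarrow> j \<in> I \<Longrightarrow> E i j = E j i"
    and row: "\<And>i. i \<in> I \<Longrightarrow> (\<Sum>j\<in>I. \<bar>E i j\<bar>) \<le> \<delta>"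
  shows "\<bar>quad_form I E \<xi>\<bar> \<le> \<delta> * (\<Sum>i\<in>I. (\<xi> i)\<^sup>2)"
proof -
  have p: "\<bar>x * e * y\<bar> \<le> \<bar>e\<bar> * x\<^sup>2 / 2 + \<bar>e\<bar> * y\<^sup>2 / 2" for x e y :: real
  proof -
    have "0 \<le> \<bar>e\<bar> * (\<bar>x\<bar> - \<bar>y\<bar>)\<^sup>2" by simp
    then show ?thesis by (simp add: power2_diff abs_mult algebra_simps)
  qed
  have "\<bar>quad_form I E \<xi>\<bar> \<le> (\<Sum>i\<in>I. \<Sum>j\<in>I. \<bar>\<xi> i * E i j * \<xi> j\<bar>)"
    unfolding quad_form_def by (intro order_trans[OF sum_abs] sum_mono sum_abs)
  also have "\<dots> \<le> (\<Sum>i\<in>I. \<Sum>j\<in>I. \<bar>E i j\<bar> * (\<xi> i)\<^sup>2 / 2 + \<bar>E i j\<bar> * (\<xi> j)\<^sup>2 / 2)"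
    by (intro sum_mono p)
  also have "\<dots> = (\<Sum>i\<in>I. \<Sum>j\<in>I. \<bar>E i j\<bar> * (\<xi> i)\<^sup>2 / 2) + (\<Sum>i\<in>I. \<Sum>j\<in>I. \<bar>E i j\<bar> * (\<xi> j)\<^sup>2 / 2)"
    by (simp add: sum.distrib)
  also have "(\<Sum>i\<in>I. \<Sum>j\<in>I. \<bar>E i j\<bar> * (\<xi> j)\<^sup>2 / 2) = (\<Sum>j\<in>I. \<Sum>i\<in>I. \<bar>E i j\<bar> * (\<xi> j)\<^sup>2 / 2)"
    by (rule sum.swap)
  also have "\<dots> = (\<Sum>i\<in>I. \<Sum>j\<in>I. \<bar>E i j\<bar> * (\<xi> i)\<^sup>2 / 2)"
    by (intro sum.cong refl) (subst sym, auto)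
  also have "(\<Sum>i\<in>I. \<Sum>j\<in>I. \<bar>E i j\<bar> * (\<xi> i)\<^sup>2 / 2) + (\<Sum>i\<in>I. \<Sum>j\<in>I. \<bar>E i j\<bar> * (\<xi> i)\<^sup>2 / 2)
      = (\<Sum>i\<in>I. (\<Sum>j\<in>I. \<bar>E i j\<bar>) * (\<xi> i)\<^sup>2)"
    by (simp add: sum_distrib_right sum_divide_distrib[symmetric])
  also have "\<dots> \<le> (\<Sum>i\<in>I. \<delta> * (\<xi> i)\<^sup>2)"
    by (intro sum_mono mult_right_mono row) auto
  finally show ?thesis by (simp add: sum_distrib_left)
qed

text \<open>The form in which summability of \<open>\<Lambda>\<close> is used: finite sums away from
  a large finite set are small.\<close>

lemma summable_tail:
  fixes h :: "'a \<Rightarrow> real"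
  assumes s: "h summable_on UNIV" and h: "\<And>x. 0 \<le> h x" and \<epsilon>: "\<epsilon> > 0"
  obtains F0 where "finite F0" "\<And>F. finite F \<Longrightarrow> F \<inter> F0 = {} \<Longrightarrow> sum h F \<le> \<epsilon>"
proof -
  have hs: "(sum h \<longlongrightarrow> infsum h UNIV) (finite_subsets_at_top UNIV)"
    using has_sum_infsum[OF s] by (simp add: has_sum_def)
  have "eventually (\<lambda>F. dist (sum h F) (infsum h UNIV) < \<epsilon>) (finite_subsets_at_top UNIV)"
    using hs \<epsilon> by (rule tendstoD)
  then obtain F0 where F0: "finite F0" "\<And>F. finite F \<Longrightarrow> F0 \<subseteq> F \<Longrightarrow> dist (sum h F) (infsum h UNIV) < \<epsilon>"
    unfolding eventually_finite_subsets_at_top by auto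
  show thesis
  proof (rule that[OF F0(1)])
    fix F assume F: "finite F" "F \<inter> F0 = {}"
    have "sum h (F0 \<union> F) \<le> infsum h UNIV"
      by (rule finite_sum_le_infsum[OF s]) (use F F0 h in auto)
    moreover have "sum h (F0 \<union> F) = sum h F0 + sum h F" using F F0 by (intro sum.union_disjoint) auto
    moreover have "infsum h UNIV - \<epsilon> < sum h F0" using F0(2)[OF F0(1)] by (simp add: dist_real_def abs_less_iff)
    ultimately show "sum h F \<le> \<epsilon>" by simp
  qed
qed

text \<open>The integral of \<open>g\<close> against the empirical measure of the periodic extension
  of \<open>x\<close>.\<close>

definition cyclic_average :: "nat \<Rightarrow> ((site_time \<Rightarrow> real) \<Rightarrow> real) \<Rightarrow> (site_time \<Rightarrow> real) \<Rightarrow> real" where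
  "cyclic_average n g x = (\<Sum>j\<in>sites n. g (\<lambda>i. x (site_mod (j + fst i) n, snd i))) / real (card (sites n))"

context limit_law
begin

text \<open>Cyclic averages of \<open>rate\<close> and \<open>rate_product\<close> are all that
  \<open>net_mean\<close> and \<open>net_cov\<close> see of a path, so control of these two kinds of
  observables determines the density approximately.\<close>

definition rate :: "nat \<Rightarrow> (site_time \<Rightarrow> real) \<Rightarrow> real" where
  "rate s u = f (u (0, s))"

definition rate_product :: "int \<Rightarrow> nat \<Rightarrow> nat \<Rightarrow> (site_time \<Rightarrow> real) \<Rightarrow> real" where
  "rate_product l r s u = f (u (0, r)) * f (u (l, s))"

lemma f_continuous_coord: "continuous_on UNIV (\<lambda>u :: site_time \<Rightarrow> real. f (u i))"
  by (rule continuous_on_compose2[OF f_cont continuous_on_product_coordinates subset_UNIV])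

lemma cyl_rate: "cyl 0 s (rate s)"
  unfolding cyl_def
proof (intro conjI)
  show "continuous_on UNIV (rate s)" unfolding rate_def[abs_def] by (rule f_continuous_coord)
  have "norm (rate s u) \<le> 1" for u using f_bounds[of "u (0, s)"] by (simp add: rate_def)
  then show "bounded (range (rate s))" by (auto simp: bounded_iff)
qed (auto simp: rate_def grid_def sites_def)

lemma rate_product_bounds: "0 \<le> rate_product l r s u" "rate_product l r s u \<le> 1"
  using f_bounds[of "u (0, r)"] f_bounds[of "u (l, s)"] mult_mono[of "f (u (0, r))" 1 "f (u (l, s))" 1]
  by (auto simp: rate_product_def)

lemma cyl_rate_product: "cyl (nat \<bar>l\<bar>) (max r s) (rate_product l r s)"
  unfolding cyl_def
proof (intro conjI)
  show "continuous_on UNIV (rate_product l r s)"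
    unfolding rate_product_def[abs_def] by (intro continuous_on_mult f_continuous_coord)
  have "norm (rate_product l r s u) \<le> 1" for u using rate_product_bounds[of l r s u] by simp
  then show "bounded (range (rate_product l r s))" by (auto simp: bounded_iff)
qed (auto simp: rate_product_def grid_def sites_def)

abbreviation pathc :: "(site_time \<Rightarrow> real) \<Rightarrow> site_time \<Rightarrow> real" where
  "pathc w \<equiv> (\<lambda>i. upath \<gamma> w (snd i) (fst i))"

abbreviation lim_mean :: "((site_time \<Rightarrow> real) \<Rightarrow> real) \<Rightarrow> real" where
  "lim_mean g \<equiv> (\<integral>u. g (flat u) \<partial>\<mu>e)"

lemma net_mean_cyclic_average: "net_mean n w i = \<theta>bar + Jbar * cyclic_average n (rate (snd i - 1)) (pathc w)"
  by (simp add: net_mean_def cyclic_average_def rate_def site_mod_id cong: sum.cong)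

text \<open>For each \<open>k\<close> the inner sum is reindexed by \<open>l\<close> to
  \<open>k + l\<close> modulo the window. The weight \<open>\<Lambda>\<close> then depends on the
  lag alone, and the sum over \<open>k\<close> becomes a cyclic average at that lag.\<close>

lemma net_cov_cyclic_average:
  "net_cov n w i i' = (if fst i = fst i' then \<theta>\<^sup>2 else 0)
    + (\<Sum>l\<in>sites n. \<Lambda> (site_mod (fst i' - fst i) n) l * cyclic_average n (rate_product l (snd i - 1) (snd i' - 1)) (pathc w))"
proof -
  let ?a = "site_mod (fst i' - fst i) n"
  define p where "p = (\<lambda>k. f (upath \<gamma> w (snd i - 1) k))"
  define q where "q = (\<lambda>k. f (upath \<gamma> w (snd i' - 1) k))"
  have e: "cyclic_average n (rate_product l (snd i - 1) (snd i' - 1)) (pathc w) = (\<Sum>k\<in>sites n. p k * q (site_mod (k + l) n)) / real (card (sites n))" for l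
    by (simp add: cyclic_average_def rate_product_def p_def q_def site_mod_id cong: sum.cong)
  have "(\<Sum>k\<in>sites n. \<Sum>l\<in>sites n. \<Lambda> ?a (site_mod (l - k) n) * p k * q l)
     = (\<Sum>k\<in>sites n. \<Sum>l\<in>sites n. \<Lambda> ?a l * (p k * q (site_mod (k + l) n)))"
  proof (rule sum.cong[OF refl])
    fix k
    have s: "site_mod (site_mod (k + l) n - k) n = l" if "l \<in> sites n" for l
      using site_mod_add[of "k + l" n "- k"] site_mod_id[OF that] by simp
    have "(\<Sum>l\<in>sites n. \<Lambda> ?a (site_mod (l - k) n) * p k * q l)
       = (\<Sum>l\<in>sites n. \<Lambda> ?a (site_mod (site_mod (k + l) n - k) n) * p k * q (site_mod (k + l) n))"
      by (rule sum.reindex_bij_betw[OF bij_site_mod, symmetric])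
    then show "(\<Sum>l\<in>sites n. \<Lambda> ?a (site_mod (l - k) n) * p k * q l) = (\<Sum>l\<in>sites n. \<Lambda> ?a l * (p k * q (site_mod (k + l) n)))"
      by (simp add: s mult.assoc cong: sum.cong)
  qed
  also have "\<dots> = (\<Sum>l\<in>sites n. \<Lambda> ?a l * (\<Sum>k\<in>sites n. p k * q (site_mod (k + l) n)))"
    unfolding sum_distrib_left by (rule sum.swap)
  finally have X: "(\<Sum>k\<in>sites n. \<Sum>l\<in>sites n. \<Lambda> ?a (site_mod (l - k) n) * p k * q l)
     = (\<Sum>l\<in>sites n. \<Lambda> ?a l * Y l)" if "Y = (\<lambda>l. \<Sum>k\<in>sites n. p k * q (site_mod (k + l) n))" for Y
    unfolding that .
  define Y where "Y = (\<lambda>l. \<Sum>k\<in>sites n. p k * q (site_mod (k + l) n))"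
  have "net_cov n w i i' = (if fst i = fst i' then \<theta>\<^sup>2 else 0) + 1 / real (card (sites n)) *
     (\<Sum>k\<in>sites n. \<Sum>l\<in>sites n. \<Lambda> ?a (site_mod (l - k) n) * p k * q l)"
    by (simp only: net_cov_def p_def q_def)
  also have "\<dots> = (if fst i = fst i' then \<theta>\<^sup>2 else 0) + (\<Sum>l\<in>sites n. \<Lambda> ?a l * (Y l / real (card (sites n))))"
    unfolding X[OF Y_def] by (simp add: sum_divide_distrib)
  finally show ?thesis unfolding e Y_def .
qed

lemma cyclic_average_rate_product_bounds: "0 \<le> cyclic_average n (rate_product l r s) x" "cyclic_average n (rate_product l r s) x \<le> 1"
proof -
  have "(\<Sum>j\<in>sites n. rate_product l r s (\<lambda>i. x (site_mod (j + fst i) n, snd i))) \<le> (\<Sum>j\<in>sites n. 1)"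
    by (intro sum_mono rate_product_bounds)
  then show "cyclic_average n (rate_product l r s) x \<le> 1" by (simp add: cyclic_average_def card_sites divide_le_eq)
  show "0 \<le> cyclic_average n (rate_product l r s) x" unfolding cyclic_average_def by (intro divide_nonneg_nonneg sum_nonneg rate_product_bounds) simp
qed

lemma lim_rate_product_bounds:
  assumes "r \<le> T" "s \<le> T"
  shows "0 \<le> lim_mean (rate_product l r s)" "lim_mean (rate_product l r s) \<le> 1"
proof -
  interpret \<mu>e: prob_space \<mu>e by (rule prob_\<mu>e)
  have m: "(\<lambda>u. rate_product l r s (flat u)) \<in> borel_measurable \<mu>e"
    by (rule cyl_integrable_\<mu>e[OF cyl_rate_product]) (use assms in simp)
  have i: "integrable \<mu>e (\<lambda>u. rate_product l r s (flat u))"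
    by (rule \<mu>e.integrable_const_bound[where B = 1]) (use m rate_product_bounds in auto)
  show "0 \<le> lim_mean (rate_product l r s)" by (rule Bochner_Integration.integral_nonneg) (rule rate_product_bounds)
  have "lim_mean (rate_product l r s) \<le> (\<integral>u. 1 \<partial>\<mu>e)" by (rule integral_mono[OF i]) (use rate_product_bounds in auto)
  then show "lim_mean (rate_product l r s) \<le> 1" by (simp add: \<mu>e.prob_space)
qed

text \<open>Only finitely many conditions, with a number independent of \<open>n\<close>, so that a
  union bound applies; lags beyond \<open>L\<close> are handled by the tail of
  \<open>\<Lambda>\<close>. All times are strictly below \<open>t\<close>, which is enough for
  densities up to time \<open>t\<close>.\<close>

definition good :: "nat \<Rightarrow> nat \<Rightarrow> nat \<Rightarrow> real \<Rightarrow> (site_time \<Rightarrow> real) \<Rightarrow> bool" where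
  "good n t L \<rho> x \<longleftrightarrow> (\<forall>s<t. \<bar>cyclic_average n (rate s) x - lim_mean (rate s)\<bar> \<le> \<rho>) \<and>
     (\<forall>r<t. \<forall>s<t. \<forall>l\<in>{- int L..int L}. \<bar>cyclic_average n (rate_product l r s) x - lim_mean (rate_product l r s)\<bar> \<le> \<rho>)"

definition "total\<Lambda> = (\<Sum>\<^sub>\<infinity>(k, l)\<in>UNIV. \<bar>\<Lambda> k l\<bar>)"

text \<open>Stated for arbitrary finite sets outside the square, because the sums that occur run
  over windows growing with \<open>n\<close>.\<close>

definition tail_le :: "nat \<Rightarrow> real \<Rightarrow> bool" where
  "tail_le L \<delta> \<longleftrightarrow> (\<forall>F. finite F \<longrightarrow> (\<forall>(k, l)\<in>F. \<bar>k\<bar> > int L \<or> \<bar>l\<bar> > int L) \<longrightarrow> (\<Sum>(k, l)\<in>F. \<bar>\<Lambda> k l\<bar>) \<le> \<delta>)"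

lemma total\<Lambda>_bound: "finite F \<Longrightarrow> (\<Sum>(k, l)\<in>F. \<bar>\<Lambda> k l\<bar>) \<le> total\<Lambda>"
  unfolding total\<Lambda>_def by (rule finite_sum_le_infsum[OF \<Lambda>_summable]) auto

lemma total\<Lambda>_nonneg: "0 \<le> total\<Lambda>"
  using total\<Lambda>_bound[of "{}"] by simp

lemma tail_le_ex: "\<delta> > 0 \<Longrightarrow> \<exists>L. tail_le L \<delta>"
proof -
  assume "\<delta> > 0"
  obtain F0 where F0: "finite F0" "\<And>F. finite F \<Longrightarrow> F \<inter> F0 = {} \<Longrightarrow> (\<Sum>(k, l)\<in>F. \<bar>\<Lambda> k l\<bar>) \<le> \<delta>"
    by (rule summable_tail[OF \<Lambda>_summable _ \<open>\<delta> > 0\<close>]) auto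
  define L where "L = nat (Max (insert 0 ((\<lambda>(k, l). max \<bar>k\<bar> \<bar>l\<bar>) ` F0)))"
  have L: "\<bar>k\<bar> \<le> int L \<and> \<bar>l\<bar> \<le> int L" if "(k, l) \<in> F0" for k l
  proof -
    have "max \<bar>k\<bar> \<bar>l\<bar> \<le> Max (insert 0 ((\<lambda>(k, l). max \<bar>k\<bar> \<bar>l\<bar>) ` F0))"
      by (rule Max_ge) (use F0(1) that in force)+
    moreover have "0 \<le> Max (insert 0 ((\<lambda>(k, l). max \<bar>k\<bar> \<bar>l\<bar>) ` F0))" by (rule Max_ge) (use F0(1) in auto)
    ultimately show ?thesis unfolding L_def by simp
  qed
  have "tail_le L \<delta>"
    unfolding tail_le_def
  proof (intro allI impI)
    fix F assume F: "finite F" "\<forall>(k, l)\<in>F. \<bar>k\<bar> > int L \<or> \<bar>l\<bar> > int L"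
    show "(\<Sum>(k, l)\<in>F. \<bar>\<Lambda> k l\<bar>) \<le> \<delta>" by (rule F0(2)[OF F(1)]) (use F(2) L in fastforce)
  qed
  then show ?thesis by blast
qed

section \<open>Errors of mean and covariance on the good event\<close>

lemma sum_pos_grid: "(\<Sum>i\<in>pos (grid n t). h i) = (\<Sum>j\<in>sites n. \<Sum>s\<in>{1..t}. h (j, s))"
proof -
  have "pos (grid n t) = sites n \<times> {1..t}" by (auto simp: pos_def grid_def)
  then show ?thesis by (simp add: sum.cartesian_product)
qed

lemma net_mean_good:
  assumes "good n t L \<rho> (pathc w)" "i \<in> pos (grid n t)"
  shows "\<bar>net_mean n w i - drift_mean i\<bar> \<le> \<bar>Jbar\<bar> * \<rho>"
proof -
  have "snd i - 1 < t" using assms(2) by (auto simp: pos_def grid_def)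
  then have 1: "\<bar>cyclic_average n (rate (snd i - 1)) (pathc w) - lim_mean (rate (snd i - 1))\<bar> \<le> \<rho>"
    using assms(1) by (simp add: good_def)
  have "net_mean n w i - drift_mean i = Jbar * (cyclic_average n (rate (snd i - 1)) (pathc w) - lim_mean (rate (snd i - 1)))"
    by (simp add: net_mean_cyclic_average drift_mean_def mean_coeff_def rate_def algebra_simps)
  then show ?thesis using 1 by (simp add: abs_mult mult_left_mono)
qed

text \<open>The weight is \<open>\<rho>\<close> for the controlled lags and the trivial bound
  \<open>1\<close>, valid because \<open>f\<close> takes values in the unit interval, for the
  others.\<close>

lemma sum_weighted_tail:
  assumes L: "tail_le L \<delta>" and A: "finite A" and \<rho>: "0 \<le> \<rho>"
  shows "(\<Sum>(k, l)\<in>A. \<bar>\<Lambda> k l\<bar> * (if \<bar>l\<bar> \<le> int L then \<rho> else 1)) \<le> \<rho> * total\<Lambda> + \<delta>"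
proof -
  let ?A1 = "{x \<in> A. \<bar>snd x\<bar> \<le> int L}" and ?A2 = "{x \<in> A. \<not> \<bar>snd x\<bar> \<le> int L}"
  have "(\<Sum>(k, l)\<in>A. \<bar>\<Lambda> k l\<bar> * (if \<bar>l\<bar> \<le> int L then \<rho> else 1))
     = (\<Sum>(k, l)\<in>?A1. \<bar>\<Lambda> k l\<bar> * \<rho>) + (\<Sum>(k, l)\<in>?A2. \<bar>\<Lambda> k l\<bar>)"
  proof -
    have "A = ?A1 \<union> ?A2" by auto
    then have "(\<Sum>(k, l)\<in>A. \<bar>\<Lambda> k l\<bar> * (if \<bar>l\<bar> \<le> int L then \<rho> else 1))
      = (\<Sum>(k, l)\<in>?A1 \<union> ?A2. \<bar>\<Lambda> k l\<bar> * (if \<bar>l\<bar> \<le> int L then \<rho> else 1))" by simp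
    also have "\<dots> = (\<Sum>(k, l)\<in>?A1. \<bar>\<Lambda> k l\<bar> * (if \<bar>l\<bar> \<le> int L then \<rho> else 1)) + (\<Sum>(k, l)\<in>?A2. \<bar>\<Lambda> k l\<bar> * (if \<bar>l\<bar> \<le> int L then \<rho> else 1))"
      by (rule sum.union_disjoint) (use A in auto)
    also have "\<dots> = (\<Sum>(k, l)\<in>?A1. \<bar>\<Lambda> k l\<bar> * \<rho>) + (\<Sum>(k, l)\<in>?A2. \<bar>\<Lambda> k l\<bar>)"
      by (intro arg_cong2[where f = "(+)"] sum.cong refl) auto
    finally show ?thesis .
  qed
  also have "(\<Sum>(k, l)\<in>?A1. \<bar>\<Lambda> k l\<bar> * \<rho>) = \<rho> * (\<Sum>(k, l)\<in>?A1. \<bar>\<Lambda> k l\<bar>)"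
    by (simp add: sum_distrib_left case_prod_beta mult.commute)
  also have "\<dots> \<le> \<rho> * total\<Lambda>" using A \<rho> by (intro mult_left_mono total\<Lambda>_bound) auto
  also have "(\<Sum>(k, l)\<in>?A2. \<bar>\<Lambda> k l\<bar>) \<le> \<delta>"
    using L[unfolded tail_le_def, rule_format, of ?A2] A by auto
  finally show ?thesis by simp
qed

text \<open>Two good paths have averages within \<open>\<rho>\<close> of common limits, hence within
  \<open>2 * \<rho>\<close> of each other; beyond lag \<open>L\<close> two averages in the unit
  interval differ by at most \<open>1\<close>. Summing over a whole row runs through every cyclic
  lag once per time, so the bound is uniform in the row and in \<open>n\<close>.\<close>

lemma net_cov_good_good:
  assumes w: "good n t L \<rho> (pathc w)" "good n t L \<rho> (pathc w')" and L: "tail_le L \<delta>" and \<rho>: "0 \<le> \<rho>"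
    and i: "i \<in> pos (grid n t)"
  shows "(\<Sum>i'\<in>pos (grid n t). \<bar>net_cov n w i i' - net_cov n w' i i'\<bar>) \<le> real t * (2 * \<rho> * total\<Lambda> + \<delta>)"
proof -
  define c where "c = (\<lambda>l. if \<bar>l\<bar> \<le> int L then 2 * \<rho> else (1 :: real))"
  have r: "snd i - 1 < t" using i by (auto simp: pos_def grid_def)
  have one: "\<bar>net_cov n w i (j', s) - net_cov n w' i (j', s)\<bar> \<le> (\<Sum>l\<in>sites n. \<bar>\<Lambda> (site_mod (j' - fst i) n) l\<bar> * c l)"
    if s: "s \<in> {1..t}" for j' s
  proof -
    have "net_cov n w i (j', s) - net_cov n w' i (j', s) = (\<Sum>l\<in>sites n. \<Lambda> (site_mod (j' - fst i) n) l *
       (cyclic_average n (rate_product l (snd i - 1) (s - 1)) (pathc w) - cyclic_average n (rate_product l (snd i - 1) (s - 1)) (pathc w')))"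
      by (simp add: net_cov_cyclic_average sum_subtractf algebra_simps)
    also have "\<bar>\<dots>\<bar> \<le> (\<Sum>l\<in>sites n. \<bar>\<Lambda> (site_mod (j' - fst i) n) l\<bar> * c l)"
    proof (rule order_trans[OF sum_abs sum_mono])
      fix l
      let ?M = "cyclic_average n (rate_product l (snd i - 1) (s - 1))"
      have "\<bar>?M (pathc w) - ?M (pathc w')\<bar> \<le> c l"
      proof (cases "\<bar>l\<bar> \<le> int L")
        case True
        then have l: "l \<in> {- int L..int L}" by auto
        have s1: "s - 1 < t" using s by auto
        have "\<bar>?M (pathc w) - lim_mean (rate_product l (snd i - 1) (s - 1))\<bar> \<le> \<rho>" "\<bar>?M (pathc w') - lim_mean (rate_product l (snd i - 1) (s - 1))\<bar> \<le> \<rho>"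
          using w r s1 l unfolding good_def by blast+
        then show ?thesis using True unfolding c_def by simp linarith
      next
        case False
        then show ?thesis
          using cyclic_average_rate_product_bounds[of n l "snd i - 1" "s - 1" "pathc w"] cyclic_average_rate_product_bounds[of n l "snd i - 1" "s - 1" "pathc w'"]
          unfolding c_def by simp linarith
      qed
      then show "\<bar>\<Lambda> (site_mod (j' - fst i) n) l * (?M (pathc w) - ?M (pathc w'))\<bar> \<le> \<bar>\<Lambda> (site_mod (j' - fst i) n) l\<bar> * c l"
        unfolding abs_mult by (intro mult_left_mono) auto
    qed
    finally show ?thesis .
  qed
  have "(\<Sum>i'\<in>pos (grid n t). \<bar>net_cov n w i i' - net_cov n w' i i'\<bar>)
     \<le> (\<Sum>j'\<in>sites n. \<Sum>s\<in>{1..t}. \<Sum>l\<in>sites n. \<bar>\<Lambda> (site_mod (j' - fst i) n) l\<bar> * c l)"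
    unfolding sum_pos_grid by (intro sum_mono one)
  also have "\<dots> = real t * (\<Sum>j'\<in>sites n. \<Sum>l\<in>sites n. \<bar>\<Lambda> (site_mod (j' - fst i) n) l\<bar> * c l)"
    by (simp add: sum_distrib_left)
  also have "(\<Sum>j'\<in>sites n. \<Sum>l\<in>sites n. \<bar>\<Lambda> (site_mod (j' - fst i) n) l\<bar> * c l) = (\<Sum>a\<in>sites n. \<Sum>l\<in>sites n. \<bar>\<Lambda> a l\<bar> * c l)"
    by (rule sum_site_mod_diff)
  also have "\<dots> = (\<Sum>(a, l)\<in>sites n \<times> sites n. \<bar>\<Lambda> a l\<bar> * c l)" by (simp add: sum.cartesian_product)
  also have "\<dots> \<le> (2 * \<rho>) * total\<Lambda> + \<delta>"
    unfolding c_def by (rule sum_weighted_tail[OF L]) (use \<rho> in auto)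
  finally show ?thesis by (simp add: mult_left_mono)
qed

text \<open>Restricted to sites whose difference lies in the window, where cyclic and ordinary lag
  agree. One \<open>\<delta>\<close> is due to uncontrolled lags inside the window, the other to
  truncating the infinite sum in the limit covariance.\<close>

lemma net_cov_good_limit:
  assumes w: "good n t L \<rho> (pathc w)" and L: "tail_le L \<delta>" and \<rho>: "0 \<le> \<rho>" and n: "L \<le> n" and t: "t \<le> T"
    and d: "fst i' - fst i \<in> sites n" and i: "snd i \<in> {1..t}" "snd i' \<in> {1..t}"
  shows "\<bar>net_cov n w i i' - drift_cov i i'\<bar> \<le> \<rho> * total\<Lambda> + 2 * \<delta>"
proof -
  let ?d = "fst i' - fst i" and ?r = "snd i - 1" and ?s = "snd i' - 1"
  define h where "h = (\<lambda>l. \<Lambda> ?d l * lim_mean (rate_product l ?r ?s))"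
  have rs: "?r < t" "?s < t" using i by auto
  have lb: "\<bar>lim_mean (rate_product l ?r ?s)\<bar> \<le> 1" for l
    using lim_rate_product_bounds[of ?r ?s l] rs t by simp
  have hb: "\<bar>h l\<bar> \<le> \<bar>\<Lambda> ?d l\<bar>" for l
    unfolding h_def abs_mult using mult_left_mono[OF lb, of "\<bar>\<Lambda> ?d l\<bar>"] by simp
  have Ls: "(\<lambda>l. \<bar>\<Lambda> ?d l\<bar>) summable_on UNIV"
  proof (rule nonneg_bdd_above_summable_on)
    show "bdd_above (sum (\<lambda>l. \<bar>\<Lambda> ?d l\<bar>) ` {F. F \<subseteq> UNIV \<and> finite F})"
    proof (rule bdd_aboveI2)
      fix F :: "int set" assume "F \<in> {F. F \<subseteq> UNIV \<and> finite F}"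
      then have "finite F" by simp
      then have "(\<Sum>(k, l)\<in>{?d} \<times> F. \<bar>\<Lambda> k l\<bar>) \<le> total\<Lambda>" by (intro total\<Lambda>_bound) auto
      moreover have "(\<Sum>(k, l)\<in>{?d} \<times> F. \<bar>\<Lambda> k l\<bar>) = (\<Sum>l\<in>F. \<bar>\<Lambda> ?d l\<bar>)"
        unfolding sum.cartesian_product[symmetric] by simp
      ultimately show "sum (\<lambda>l. \<bar>\<Lambda> ?d l\<bar>) F \<le> total\<Lambda>" by simp
    qed
  qed simp
  have hs: "h summable_on UNIV"
    by (rule abs_summable_summable, rule summable_on_comparison_test[OF Ls]) (use hb in auto)
  then have lim: "(sum h \<longlongrightarrow> infsum h UNIV) (finite_subsets_at_top UNIV)"
    using has_sum_infsum by (auto simp: has_sum_def)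
  \<comment> \<open>The limit sum is compared with its part in the window through larger finite
    sets; the extra lags exceed \<open>L\<close> because \<open>L \<le> n\<close>.\<close>
  have "eventually (\<lambda>F. \<bar>sum h F - sum h (sites n)\<bar> \<le> \<delta>) (finite_subsets_at_top UNIV)"
    unfolding eventually_finite_subsets_at_top
  proof (intro exI[of _ "sites n"] conjI allI impI)
    fix F assume F: "finite F \<and> sites n \<subseteq> F \<and> F \<subseteq> UNIV"
    have "sum h F - sum h (sites n) = sum h (F - sites n)" using F by (simp add: sum_diff)
    also have "\<bar>\<dots>\<bar> \<le> (\<Sum>l\<in>F - sites n. \<bar>\<Lambda> ?d l\<bar>)" by (intro order_trans[OF sum_abs sum_mono] hb)
    also have "\<dots> = (\<Sum>(k, l)\<in>{?d} \<times> (F - sites n). \<bar>\<Lambda> k l\<bar>)"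
      unfolding sum.cartesian_product[symmetric] by simp
    also have "\<dots> \<le> \<delta>"
      using L[unfolded tail_le_def, rule_format, of "{?d} \<times> (F - sites n)"] F n by (auto simp: sites_def)
    finally show "\<bar>sum h F - sum h (sites n)\<bar> \<le> \<delta>" .
  qed auto
  then have inf: "\<bar>infsum h UNIV - sum h (sites n)\<bar> \<le> \<delta>"
    by (rule tendsto_upperbound[OF tendsto_rabs[OF tendsto_diff[OF lim tendsto_const]]]) simp
  have K: "drift_cov i i' = (if fst i = fst i' then \<theta>\<^sup>2 else 0) + infsum h UNIV"
    by (simp add: drift_cov_def cov_coeff_def corr_coeff_def h_def rate_product_def)
  have C: "net_cov n w i i' = (if fst i = fst i' then \<theta>\<^sup>2 else 0) + (\<Sum>l\<in>sites n. \<Lambda> ?d l * cyclic_average n (rate_product l ?r ?s) (pathc w))"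
    unfolding net_cov_cyclic_average site_mod_id[OF d] ..
  have "\<bar>(\<Sum>l\<in>sites n. \<Lambda> ?d l * cyclic_average n (rate_product l ?r ?s) (pathc w)) - sum h (sites n)\<bar>
     \<le> (\<Sum>l\<in>sites n. \<bar>\<Lambda> ?d l\<bar> * (if \<bar>l\<bar> \<le> int L then \<rho> else 1))"
    unfolding h_def sum_subtractf[symmetric] right_diff_distrib[symmetric]
  proof (rule order_trans[OF sum_abs sum_mono])
    fix l
    have "\<bar>cyclic_average n (rate_product l ?r ?s) (pathc w) - lim_mean (rate_product l ?r ?s)\<bar> \<le> (if \<bar>l\<bar> \<le> int L then \<rho> else 1)"
    proof (cases "\<bar>l\<bar> \<le> int L")
      case True
      then have "l \<in> {- int L..int L}" by auto
      then show ?thesis using w rs True unfolding good_def by simp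
    next
      case False
      have "\<bar>cyclic_average n (rate_product l ?r ?s) (pathc w) - lim_mean (rate_product l ?r ?s)\<bar> \<le> 1"
        using cyclic_average_rate_product_bounds[of n l ?r ?s "pathc w"] lim_rate_product_bounds[of ?r ?s l] rs t by (simp add: abs_le_iff)
      then show ?thesis using False by simp
    qed
    then show "\<bar>\<Lambda> ?d l * (cyclic_average n (rate_product l ?r ?s) (pathc w) - lim_mean (rate_product l ?r ?s))\<bar> \<le> \<bar>\<Lambda> ?d l\<bar> * (if \<bar>l\<bar> \<le> int L then \<rho> else 1)"
      unfolding abs_mult by (intro mult_left_mono) auto
  qed
  also have "\<dots> = (\<Sum>(k, l)\<in>{?d} \<times> sites n. \<bar>\<Lambda> k l\<bar> * (if \<bar>l\<bar> \<le> int L then \<rho> else 1))"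
    unfolding sum.cartesian_product[symmetric] by simp
  also have "\<dots> \<le> \<rho> * total\<Lambda> + \<delta>" by (rule sum_weighted_tail[OF L]) (use \<rho> in auto)
  finally show ?thesis using inf unfolding K C by linarith
qed

lemma net_cov_off:
  assumes "fst i \<noteq> fst i'"
  shows "\<bar>net_cov n w i i'\<bar> \<le> (\<Sum>l\<in>sites n. \<bar>\<Lambda> (site_mod (fst i' - fst i) n) l\<bar>)"
proof -
  have "\<bar>net_cov n w i i'\<bar> \<le> (\<Sum>l\<in>sites n. \<bar>\<Lambda> (site_mod (fst i' - fst i) n) l * cyclic_average n (rate_product l (snd i - 1) (snd i' - 1)) (pathc w)\<bar>)"
    unfolding net_cov_cyclic_average using assms by (simp add: sum_abs)
  also have "\<dots> \<le> (\<Sum>l\<in>sites n. \<bar>\<Lambda> (site_mod (fst i' - fst i) n) l\<bar>)"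
  proof (rule sum_mono)
    fix l
    have "\<bar>cyclic_average n (rate_product l (snd i - 1) (snd i' - 1)) (pathc w)\<bar> \<le> 1" using cyclic_average_rate_product_bounds by simp
    from mult_left_mono[OF this, of "\<bar>\<Lambda> (site_mod (fst i' - fst i) n) l\<bar>"]
    show "\<bar>\<Lambda> (site_mod (fst i' - fst i) n) l * cyclic_average n (rate_product l (snd i - 1) (snd i' - 1)) (pathc w)\<bar> \<le> \<bar>\<Lambda> (site_mod (fst i' - fst i) n) l\<bar>"
      by (simp add: abs_mult)
  qed
  finally show ?thesis .
qed

text \<open>With \<open>\<sigma>\<^sup>2\<close> on the diagonal this kernel is exactly the
  covariance of \<open>G\<close>, which is symmetric and non-negative.\<close>

lemma psd_drift_cov:
  assumes I: "finite I" "I \<subseteq> UNIV \<times> {1..T}"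
  shows "psd I (add_diag drift_cov (\<sigma>\<^sup>2))"
  unfolding psd_def
proof (intro conjI ballI allI)
  show "0 \<le> quad_form I (add_diag drift_cov (\<sigma>\<^sup>2)) \<xi>" for \<xi> by (rule gaussian_vector_quad_form_nonneg[OF prob_G gaussian_vector_G[OF I]])
  fix i i' assume i: "i \<in> I" "i' \<in> I"
  have c: "\<And>j k r s. r \<in> {1..T} \<Longrightarrow> s \<in> {1..T} \<Longrightarrow> cov G (\<lambda>v. v j r) (\<lambda>v. v (j + k) s)
        = (if k = 0 \<and> r = s then \<sigma>\<^sup>2 else 0) + cov_coeff \<theta> \<Lambda> f \<mu>e k r s"
    using G by (auto simp: is_stationary_gaussian_law_def)
  have e: "add_diag drift_cov (\<sigma>\<^sup>2) p q = cov G (\<lambda>v. v (fst p) (snd p)) (\<lambda>v. v (fst q) (snd q))" if "p \<in> I" "q \<in> I" for p q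
  proof -
    have "snd p \<in> {1..T}" "snd q \<in> {1..T}" using that I by auto
    from c[OF this, of "fst p" "fst q - fst p"] show ?thesis by (cases p, cases q) (simp add: drift_cov_def)
  qed
  show "add_diag drift_cov (\<sigma>\<^sup>2) i i' = add_diag drift_cov (\<sigma>\<^sup>2) i' i"
    unfolding e[OF i] e[OF i(2,1)] by (simp add: cov_def mult.commute)
qed

end

section \<open>Residue classes of blocks\<close>

context limit_law
begin

lemma id_Jalg: "n \<ge> 1 \<Longrightarrow> (\<lambda>\<omega>. \<omega>) \<in> measurable P (Jalg n)"
proof (rule measurableI)
  fix A assume n: "n \<ge> 1" and A: "A \<in> sets (Jalg n)"
  then have "A \<in> sets P"
    using Jalg_subalgebra[OF n] unfolding Jalg_def sets_restr_to_subalg[OF Jalg_subalgebra[OF n]] by (auto simp: subalgebra_def)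
  then show "(\<lambda>\<omega>. \<omega>) -` A \<inter> space P \<in> sets P" by simp
qed (simp add: space_Jalg)

lemma net_incr_measurable:
  assumes n: "n \<ge> 1" and t: "t \<le> T"
  shows "net_incr n t \<in> measurable P (PiM (grid n t) CM)"
  using measurable_compose[OF measurable_Pair[OF driver_measurable[OF n t] id_Jalg[OF n]] incr_measurable[OF n]] by simp

text \<open>The sites \<open>class_site n m R a q\<close>, \<open>q < Q\<close>, form the \<open>a\<close>-th residue class; the blocks around them are at
  cyclic distance at least \<open>R - 2 m\<close>.\<close>

definition class_site :: "nat \<Rightarrow> nat \<Rightarrow> nat \<Rightarrow> nat \<Rightarrow> nat \<Rightarrow> int" where
  "class_site n m R a q = - int n + int m + int a + int (R * q)"

text \<open>The margin \<open>m\<close> at both ends of the window prevents blocks from wrapping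
  around.\<close>

lemma class_site_range:
  assumes "a < R" "q < Q" "R * Q + 2 * m \<le> 2 * n + 1" "\<bar>k\<bar> \<le> int m"
  shows "class_site n m R a q + k \<in> sites n"
proof -
  have "R * (q + 1) \<le> R * Q" using assms(2) by (intro mult_le_mono2) simp
  then have "R * q + R \<le> R * Q" by simp
  then have "int (R * q) + int R \<le> int (R * Q)" by linarith
  moreover have "int (R * Q) + 2 * int m \<le> 2 * int n + 1" using assms(3) by linarith
  ultimately show ?thesis
    using assms(1,4) unfolding class_site_def sites_eq by (simp only: atLeastAtMost_iff) linarith
qed

text \<open>If the cyclic lag were at most \<open>R'\<close>, it would differ from
  \<open>i' - i\<close> by less than one period, because the room left at the ends bounds the
  ordinary lag; a multiple of the period that small is zero. Then the ordinary lag would be at most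
  \<open>R'\<close> as well, whereas blocks in one class are \<open>R - 2 * m\<close> apart.\<close>

lemma class_site_far:
  assumes q: "q < Q" "q' < Q" "q \<noteq> q'" and Q: "R * Q + 2 * m \<le> 2 * n + 1" and R: "R = R' + 2 * m + 1"
    and i: "\<bar>i - class_site n m R a q\<bar> \<le> int m" and i': "\<bar>i' - class_site n m R a q'\<bar> \<le> int m"
  shows "\<bar>site_mod (i' - i) n\<bar> > int R'"
proof (rule ccontr)
  assume "\<not> \<bar>site_mod (i' - i) n\<bar> > int R'"
  then have s: "\<bar>site_mod (i' - i) n\<bar> \<le> int R'" by simp
  have gap: "int R \<le> \<bar>int (R * q') - int (R * q)\<bar> \<and> \<bar>int (R * q') - int (R * q)\<bar> + int R \<le> int (R * Q)"
  proof -
    have *: "int R \<le> int (R * y) - int (R * x) \<and> int (R * y) - int (R * x) + int R \<le> int (R * Q)" if "x < y" "y < Q" for x y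
    proof -
      have "R * (x + 1) \<le> R * y" "R * (y + 1) \<le> R * Q" using that by (intro mult_le_mono2; simp)+
      then have "R * x + R \<le> R * y" "R * y + R \<le> R * Q" by simp_all
      then show ?thesis by linarith
    qed
    consider "q < q'" | "q' < q" using q(3) by linarith
    then show ?thesis using *[of q q'] *[of q' q] q(1,2) by cases linarith+
  qed
  have D: "\<bar>i' - i\<bar> \<ge> int R - 2 * int m" "\<bar>i' - i\<bar> \<le> int (R * Q) - int R + 2 * int m"
    using gap i i' unfolding class_site_def by linarith+
  have Qi: "int (R * Q) + 2 * int m \<le> 2 * int n + 1" using Q by linarith
  have Ri: "int R = int R' + 2 * int m + 1" using R by simp
  have "\<bar>site_mod (i' - i) n - (i' - i)\<bar> < 2 * int n + 1" using s D Qi Ri by linarith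
  then have "site_mod (i' - i) n - (i' - i) = 0"
    using dvd_imp_le_int[of "site_mod (i' - i) n - (i' - i)" "2 * int n + 1"] site_mod_dvd[of n "i' - i"] by fastforce
  then show False using s D(1) Ri by linarith
qed

definition same_block :: "nat \<Rightarrow> nat \<Rightarrow> nat \<Rightarrow> nat \<Rightarrow> nat \<Rightarrow> site_time \<Rightarrow> site_time \<Rightarrow> bool" where
  "same_block n m R Q a i i' \<longleftrightarrow> (\<exists>q<Q. \<bar>fst i - class_site n m R a q\<bar> \<le> int m \<and> \<bar>fst i' - class_site n m R a q\<bar> \<le> int m)"

definition block_cov :: "nat \<Rightarrow> nat \<Rightarrow> nat \<Rightarrow> nat \<Rightarrow> nat \<Rightarrow> site_time \<Rightarrow> site_time \<Rightarrow> real" where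
  "block_cov n m R Q a i i' = (if same_block n m R Q a i i' then drift_cov i i' else 0)"

abbreviation blocks :: "nat \<Rightarrow> nat \<Rightarrow> nat \<Rightarrow> nat \<Rightarrow> nat \<Rightarrow> nat \<Rightarrow> site_time set" where
  "blocks n m R Q t a \<equiv> (\<Union>q\<in>{..<Q}. block m t (class_site n m R a q))"

lemma block_iff: "i \<in> block m t j \<longleftrightarrow> \<bar>fst i - j\<bar> \<le> int m \<and> snd i \<le> t"
proof
  assume "i \<in> block m t j" then show "\<bar>fst i - j\<bar> \<le> int m \<and> snd i \<le> t"
    by (auto simp: block_def grid_def sites_def)
next
  assume "\<bar>fst i - j\<bar> \<le> int m \<and> snd i \<le> t"
  then have "i = (j + fst (fst i - j, snd i), snd (fst i - j, snd i))" "(fst i - j, snd i) \<in> grid m t"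
    by (auto simp: grid_def sites_def)
  then show "i \<in> block m t j" unfolding block_def by blast
qed

lemma finite_block: "finite (block m t j)"
  by (simp add: block_def)

lemma blocks_subset:
  assumes "a < R" "R * Q + 2 * m \<le> 2 * n + 1"
  shows "blocks n m R Q t a \<subseteq> grid n t"
proof
  fix i assume "i \<in> blocks n m R Q t a"
  then obtain q where q: "q < Q" "\<bar>fst i - class_site n m R a q\<bar> \<le> int m" "snd i \<le> t" by (auto simp: block_iff)
  from class_site_range[OF assms(1) q(1) assms(2) q(2)] q(3) show "i \<in> grid n t"
    by (cases i) (simp add: grid_iff)
qed

lemma card_blocks: "card (pos (blocks n m R Q t a)) \<le> Q * ((2 * m + 1) * t)"
proof -
  have b: "card (pos (block m t j)) \<le> (2 * m + 1) * t" for j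
  proof -
    have "pos (block m t j) \<subseteq> {j - int m..j + int m} \<times> {1..t}" by (auto simp: pos_def block_iff)
    then have "card (pos (block m t j)) \<le> card ({j - int m..j + int m} \<times> {1..t})" by (intro card_mono) auto
    also have "\<dots> = (2 * m + 1) * t" by (simp add: card_cartesian_product nat_add_distrib nat_mult_distrib)
    finally show ?thesis .
  qed
  have "pos (blocks n m R Q t a) = (\<Union>q\<in>{..<Q}. pos (block m t (class_site n m R a q)))" by (auto simp: pos_def)
  then have "card (pos (blocks n m R Q t a)) \<le> (\<Sum>q\<in>{..<Q}. card (pos (block m t (class_site n m R a q))))"
    by (simp only:) (rule card_UN_le, simp)
  also have "\<dots> \<le> (\<Sum>q\<in>{..<Q}. (2 * m + 1) * t)" by (intro sum_mono b)
  finally show ?thesis by simp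
qed

text \<open>A row meets its own block in a number of entries that does not grow with
  \<open>n\<close>, each close to the limit. Entries in other blocks have cyclic lag beyond
  \<open>R'\<close>, and together they are bounded by a tail of \<open>\<Lambda>\<close>; the error
  is thus uniform in the number of blocks.\<close>

lemma row_blocks:
  assumes w: "good n t L \<rho> (pathc w)" and L: "tail_le L \<delta>" and R': "tail_le R' \<delta>'" and \<rho>: "0 \<le> \<rho>" and t: "t \<le> T"
    and n: "L \<le> n" "2 * m \<le> n" and a: "a < R" and Q: "R * Q + 2 * m \<le> 2 * n + 1" and R: "R = R' + 2 * m + 1"
    and i: "i \<in> pos (blocks n m R Q t a)" and \<delta>: "0 \<le> \<delta>"
  shows "(\<Sum>i'\<in>pos (blocks n m R Q t a). \<bar>net_cov n w i i' - block_cov n m R Q a i i'\<bar>)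
    \<le> real ((2 * m + 1) * t) * (\<rho> * total\<Lambda> + 2 * \<delta>) + real t * \<delta>'"
proof -
  let ?I = "pos (blocks n m R Q t a)" and ?sb = "same_block n m R Q a"
  define \<beta> where "\<beta> = \<rho> * total\<Lambda> + 2 * \<delta>"
  have \<beta>: "0 \<le> \<beta>" using \<rho> \<delta> total\<Lambda>_nonneg by (simp add: \<beta>_def)
  have sub: "?I \<subseteq> pos (grid n t)" using blocks_subset[OF a Q] by (rule pos_simps(4))
  have fin: "finite ?I" using sub by (rule finite_subset) (simp add: pos_simps)
  obtain q where q: "q < Q" "\<bar>fst i - class_site n m R a q\<bar> \<le> int m" "snd i \<in> {1..t}"
    using i by (auto simp: pos_def block_iff)
  \<comment> \<open>Two blocks sharing a site coincide: otherwise the site would have cyclic lag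
    greater than \<open>R'\<close> from itself.\<close>
  have uniq: "\<bar>fst i' - class_site n m R a q\<bar> \<le> int m" if sb: "?sb i i'" for i'
  proof -
    obtain p where p: "p < Q" "\<bar>fst i - class_site n m R a p\<bar> \<le> int m" "\<bar>fst i' - class_site n m R a p\<bar> \<le> int m"
      using sb unfolding same_block_def by blast
    have "p = q"
    proof (rule ccontr)
      assume "p \<noteq> q"
      from class_site_far[OF q(1) p(1) this[symmetric] Q R q(2) p(2)] have "\<bar>site_mod 0 n\<bar> > int R'" by simp
      moreover have "site_mod 0 n = 0" by (rule site_mod_id) (simp add: sites_def)
      ultimately show False by simp
    qed
    then show ?thesis using p by simp
  qed
  \<comment> \<open>Bounds an entry between different blocks by a function of the cyclic lag, so
    that the sum over the row can be extended to all lags and reindexed.\<close>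
  define h where "h = (\<lambda>k. if \<bar>k\<bar> > int R' then (\<Sum>l\<in>sites n. \<bar>\<Lambda> k l\<bar>) else 0)"
  have h0: "0 \<le> h k" for k by (simp add: h_def sum_nonneg)
  have one: "\<bar>net_cov n w i i' - block_cov n m R Q a i i'\<bar> \<le> (if ?sb i i' then \<beta> else 0) + h (site_mod (fst i' - fst i) n)"
    if i': "i' \<in> ?I" for i'
  proof (cases "?sb i i'")
    case True
    have "\<bar>fst i' - fst i\<bar> \<le> 2 * int m" using uniq[OF True] q(2) by linarith
    then have d: "fst i' - fst i \<in> sites n" using n(2) by (simp add: sites_def)
    have s: "snd i' \<in> {1..t}" using i' by (auto simp: pos_def block_iff)
    have "\<bar>net_cov n w i i' - drift_cov i i'\<bar> \<le> \<beta>"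
      unfolding \<beta>_def by (rule net_cov_good_limit[OF w L \<rho> n(1) t d q(3) s])
    then show ?thesis using True h0[of "site_mod (fst i' - fst i) n"] by (simp add: block_cov_def)
  next
    case False
    obtain q' where q': "q' < Q" "\<bar>fst i' - class_site n m R a q'\<bar> \<le> int m" using i' by (auto simp: pos_def block_iff)
    have "q \<noteq> q'" using False q q' by (auto simp: same_block_def)
    then have far: "\<bar>site_mod (fst i' - fst i) n\<bar> > int R'" by (rule class_site_far[OF q(1) q'(1) _ Q R q(2) q'(2)])
    have "fst i \<noteq> fst i'"
    proof
      assume "fst i = fst i'"
      moreover have "site_mod 0 n = 0" by (rule site_mod_id) (simp add: sites_def)
      ultimately show False using far by simp
    qed
    from net_cov_off[OF this, of n w] far False show ?thesis by (simp add: block_cov_def h_def)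
  qed
  have "(\<Sum>i'\<in>?I. \<bar>net_cov n w i i' - block_cov n m R Q a i i'\<bar>) \<le> (\<Sum>i'\<in>?I. (if ?sb i i' then \<beta> else 0)) + (\<Sum>i'\<in>?I. h (site_mod (fst i' - fst i) n))"
    unfolding sum.distrib[symmetric] by (intro sum_mono one)
  also have "(\<Sum>i'\<in>?I. (if ?sb i i' then \<beta> else 0)) \<le> real ((2 * m + 1) * t) * \<beta>"
  proof -
    have "{i' \<in> ?I. ?sb i i'} \<subseteq> {class_site n m R a q - int m..class_site n m R a q + int m} \<times> {1..t}"
    proof
      fix i' assume "i' \<in> {i' \<in> ?I. ?sb i i'}"
      then have "\<bar>fst i' - class_site n m R a q\<bar> \<le> int m" "snd i' \<in> {1..t}" using uniq by (auto simp: pos_def block_iff)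
      then show "i' \<in> {class_site n m R a q - int m..class_site n m R a q + int m} \<times> {1..t}" by (cases i') auto
    qed
    then have "card {i' \<in> ?I. ?sb i i'} \<le> card ({class_site n m R a q - int m..class_site n m R a q + int m} \<times> {1..t})"
      by (intro card_mono) auto
    also have "\<dots> = (2 * m + 1) * t" by (simp add: card_cartesian_product nat_add_distrib nat_mult_distrib)
    finally have "real (card {i' \<in> ?I. ?sb i i'}) * \<beta> \<le> real ((2 * m + 1) * t) * \<beta>"
      using \<beta> by (intro mult_right_mono) (simp_all only: of_nat_le_iff)
    moreover have "(\<Sum>i'\<in>?I. (if ?sb i i' then \<beta> else 0)) = real (card {i' \<in> ?I. ?sb i i'}) * \<beta>"
      using fin by (simp add: sum.If_cases Int_def)
    ultimately show ?thesis by simp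
  qed
  also have "(\<Sum>i'\<in>?I. h (site_mod (fst i' - fst i) n)) \<le> (\<Sum>i'\<in>pos (grid n t). h (site_mod (fst i' - fst i) n))"
    by (rule sum_mono2) (use sub h0 in \<open>auto simp: pos_simps\<close>)
  also have "\<dots> = real t * (\<Sum>j'\<in>sites n. h (site_mod (j' - fst i) n))"
    unfolding sum_pos_grid by (simp add: sum_distrib_left)
  also have "(\<Sum>j'\<in>sites n. h (site_mod (j' - fst i) n)) = (\<Sum>k\<in>sites n. h k)" by (rule sum_site_mod_diff)
  also have "\<dots> = (\<Sum>k\<in>{k \<in> sites n. \<bar>k\<bar> > int R'}. \<Sum>l\<in>sites n. \<bar>\<Lambda> k l\<bar>)"
    unfolding h_def by (rule sum.inter_filter[symmetric]) simp
  also have "\<dots> = (\<Sum>(k, l)\<in>{k \<in> sites n. \<bar>k\<bar> > int R'} \<times> sites n. \<bar>\<Lambda> k l\<bar>)"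
    by (simp add: sum.cartesian_product)
  also have "\<dots> \<le> \<delta>'"
    using R'[unfolded tail_le_def, rule_format, of "{k \<in> sites n. \<bar>k\<bar> > int R'} \<times> sites n"] by auto
  finally show ?thesis unfolding \<beta>_def by (simp add: mult_left_mono)
qed

lemma same_block_sym: "same_block n m R Q a i i' = same_block n m R Q a i' i"
  by (auto simp: same_block_def)

text \<open>The diagonal increase \<open>a1\<close> left by freezing the parameters is counted as an
  error of the replacement by block diagonal covariance, hence its place in \<open>row\<close>. The
  price \<open>\<kappa>\<close> is charged per coordinate of the class only, and the sum over blocks
  in the exponent becomes a product of equal bounds.\<close>

lemma class_integral:
  assumes n: "n \<ge> 1" and t: "t \<le> T" and g: "cyl m t g" and a: "a < R" and Q: "R * Q + 2 * m \<le> 2 * n + 1"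
    and R: "R = R' + 2 * m + 1" and a1: "a1 > 0" and a2: "a2 > 0"
    and dom: "\<And>m1 m2 S1 S2 v. psd (pos (blocks n m R Q t a)) (add_diag S1 (- (\<sigma>\<^sup>2))) \<Longrightarrow>
       (\<And>i j. i \<in> pos (blocks n m R Q t a) \<Longrightarrow> j \<in> pos (blocks n m R Q t a) \<Longrightarrow> S2 i j = S2 j i) \<Longrightarrow>
       (\<And>\<xi>. \<bar>quad_form (pos (blocks n m R Q t a)) S1 \<xi> - quad_form (pos (blocks n m R Q t a)) S2 \<xi>\<bar> \<le> \<delta>2 * (\<Sum>i\<in>pos (blocks n m R Q t a). (\<xi> i)\<^sup>2)) \<Longrightarrow>
       (\<And>i. i \<in> pos (blocks n m R Q t a) \<Longrightarrow> \<bar>m1 i - m2 i\<bar> \<le> \<delta>2) \<Longrightarrow>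
       gauss_density (pos (blocks n m R Q t a)) m1 S1 v \<le> exp (\<kappa> * real (card (pos (blocks n m R Q t a)))) * gauss_density (pos (blocks n m R Q t a)) m2 (add_diag S2 a2) v"
    and row: "\<And>i. i \<in> pos (blocks n m R Q t a) \<Longrightarrow> (\<Sum>i'\<in>pos (blocks n m R Q t a). \<bar>net_cov n w i i' - block_cov n m R Q a i i'\<bar>) + a1 \<le> \<delta>2"
    and mean: "\<And>i. i \<in> pos (grid n t) \<Longrightarrow> \<bar>net_mean n w i - drift_mean i\<bar> \<le> \<delta>2"
    and \<kappa>: "\<kappa> \<ge> 0"
    and mgf: "\<And>j. (\<integral>\<^sup>+w. ennreal (exp (lam * (g (\<lambda>i. upath \<gamma> w (snd i) (j + fst i)) - e)))
         * ennreal (gauss_density (pos (block m t j)) drift_mean (add_diag (add_diag drift_cov (\<sigma>\<^sup>2)) a2) w) \<partial>PiM (block m t j) CM) \<le> ennreal (exp b)"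
  shows "(\<integral>\<^sup>+v. ennreal (exp (lam * (\<Sum>q<Q. g (\<lambda>i. upath \<gamma> v (snd i) (class_site n m R a q + fst i)) - e)))
      * ennreal (gauss_density (pos (grid n t)) (net_mean n w) (add_diag (add_diag (net_cov n w) (\<sigma>\<^sup>2)) a1) v) \<partial>PiM (grid n t) CM)
    \<le> ennreal (exp (\<kappa> * real (Q * ((2 * m + 1) * t)) + real Q * b))"
proof -
  let ?U = "blocks n m R Q t a" and ?D = "\<lambda>q. block m t (class_site n m R a q)" and ?K = "add_diag (block_cov n m R Q a) (\<sigma>\<^sup>2)"
  let ?g = "\<lambda>v j. g (\<lambda>i. upath \<gamma> v (snd i) (j + fst i))"
  define F where "F = (\<lambda>q v. ennreal (exp (lam * (?g v (class_site n m R a q) - e))))"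
  have subU: "?U \<subseteq> grid n t" by (rule blocks_subset[OF a Q])
  have finU: "finite ?U" by (simp add: finite_block)
  have finI: "finite (pos ?U)" by (rule pos_simps(1)[OF finU])
  have Fm: "F q \<in> borel_measurable (PiM (?D q) CM)" for q
  proof -
    have "(\<lambda>v. ?g v (class_site n m R a q)) \<in> borel_measurable (PiM (?D q) CM)"
      by (rule cyl_compose_measurable[OF g], rule upath_measurable) (auto simp: block_iff grid_def sites_def)
    then show ?thesis unfolding F_def by simp
  qed
  have Fr: "F q (restrict v V) = F q v" if "?D q \<subseteq> V" for q v V
  proof -
    have "?g (restrict v V) (class_site n m R a q) = ?g v (class_site n m R a q)"
    proof (rule cyl_cong[OF g], rule upath_cong)
      fix i r assume "i \<in> grid m t" "r \<le> snd i"
      then have "(class_site n m R a q + fst i, r) \<in> ?D q" by (auto simp: block_iff grid_def sites_def)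
      then show "restrict v V (class_site n m R a q + fst i, r) = v (class_site n m R a q + fst i, r)" using that by auto
    qed
    then show ?thesis by (simp add: F_def)
  qed
  define H where "H = (\<lambda>v. \<Prod>q<Q. F q (restrict v (?D q)))"
  have Hm: "H \<in> borel_measurable (PiM ?U CM)"
    unfolding H_def
  proof (rule borel_measurable_prod_ennreal)
    fix q assume "q \<in> {..<Q}"
    then have "?D q \<subseteq> ?U" by auto
    then show "(\<lambda>v. F q (restrict v (?D q))) \<in> borel_measurable (PiM ?U CM)"
      by (rule measurable_compose[OF measurable_restrict_subset Fm])
  qed
  have He: "ennreal (exp (lam * (\<Sum>q<Q. ?g v (class_site n m R a q) - e))) = H (restrict v ?U)" for v
  proof -
    have "H (restrict v ?U) = (\<Prod>q<Q. F q v)"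
      unfolding H_def
    proof (rule prod.cong[OF refl])
      fix q assume "q \<in> {..<Q}"
      then have "?D q \<subseteq> ?U" by auto
      then show "F q (restrict (restrict v ?U) (?D q)) = F q v" by (simp only: Fr[OF order_refl] Fr)
    qed
    also have "\<dots> = ennreal (\<Prod>q<Q. exp (lam * (?g v (class_site n m R a q) - e)))"
      unfolding F_def by (rule prod_ennreal) simp
    also have "(\<Prod>q<Q. exp (lam * (?g v (class_site n m R a q) - e))) = exp (lam * (\<Sum>q<Q. ?g v (class_site n m R a q) - e))"
      by (simp add: exp_sum[symmetric] sum_distrib_left)
    finally show ?thesis ..
  qed
  have psdc: "psd (pos (grid n t)) (add_diag (net_cov n w) c)" if "c \<ge> 0" for c
    unfolding psd_def
  proof (intro conjI ballI allI)
    show "add_diag (net_cov n w) c i j = add_diag (net_cov n w) c j i" if "i \<in> pos (grid n t)" "j \<in> pos (grid n t)" for i j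
      using psd_sym[OF psd_net_cov[OF n] that] by simp
    have "0 \<le> quad_form (pos (grid n t)) (net_cov n w) \<xi>" for \<xi> using psd_net_cov[OF n] by (simp add: psd_def)
    moreover have "0 \<le> c * (\<Sum>i\<in>pos (grid n t). (\<xi> i)\<^sup>2)" for \<xi> using that by (simp add: sum_nonneg)
    ultimately show "0 \<le> quad_form (pos (grid n t)) (add_diag (net_cov n w) c) \<xi>" for \<xi>
      by (simp add: quad_form_add_diag pos_simps)
  qed
  have sa1: "(sqrt a1)\<^sup>2 = a1" "sqrt a1 > 0" and sa2: "(sqrt a2)\<^sup>2 = a2" "sqrt a2 > 0" using a1 a2 by auto
  have "(\<integral>\<^sup>+v. ennreal (exp (lam * (\<Sum>q<Q. ?g v (class_site n m R a q) - e)))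
      * ennreal (gauss_density (pos (grid n t)) (net_mean n w) (add_diag (add_diag (net_cov n w) (\<sigma>\<^sup>2)) a1) v) \<partial>PiM (grid n t) CM)
    = (\<integral>\<^sup>+v. H (restrict v ?U) * ennreal (gauss_density (pos (grid n t)) (net_mean n w) (add_diag (add_diag (net_cov n w) (\<sigma>\<^sup>2)) ((sqrt a1)\<^sup>2)) v) \<partial>PiM (grid n t) CM)"
    by (simp only: He sa1)
  \<comment> \<open>Exact marginalisation: the parameters are frozen at \<open>w\<close> and do not
    depend on the variable of integration.\<close>
  also have "\<dots> = (\<integral>\<^sup>+v. H v * ennreal (gauss_density (pos ?U) (net_mean n w) (add_diag (add_diag (net_cov n w) (\<sigma>\<^sup>2)) ((sqrt a1)\<^sup>2)) v) \<partial>PiM ?U CM)"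
    by (rule nn_integral_gauss_density_marginal[OF finite_grid subU psdc sa1(2) Hm]) simp
  also have "\<dots> \<le> (\<integral>\<^sup>+v. ennreal (exp (\<kappa> * real (Q * ((2 * m + 1) * t)))) * (H v * ennreal (gauss_density (pos ?U) drift_mean (add_diag ?K ((sqrt a2)\<^sup>2)) v)) \<partial>PiM ?U CM)"
  proof (rule nn_integral_mono)
    fix v
    let ?S1 = "add_diag (add_diag (net_cov n w) (\<sigma>\<^sup>2)) a1"
    have subp: "pos ?U \<subseteq> pos (grid n t)" by (rule pos_simps(4)[OF subU])
    have KS: "block_cov n m R Q a i j = block_cov n m R Q a j i" if "i \<in> pos ?U" "j \<in> pos ?U" for i j
    proof -
      have "add_diag drift_cov (\<sigma>\<^sup>2) i j = add_diag drift_cov (\<sigma>\<^sup>2) j i"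
        by (rule psd_sym[OF psd_drift_cov[OF finI]]) (use that t in \<open>auto simp: pos_def block_iff\<close>)
      then have "drift_cov i j = drift_cov j i" by (cases "i = j") auto
      then show ?thesis by (simp add: block_cov_def same_block_sym[of n m R Q a i j])
    qed
    have d: "gauss_density (pos ?U) (net_mean n w) ?S1 v \<le> exp (\<kappa> * real (card (pos ?U))) * gauss_density (pos ?U) drift_mean (add_diag ?K a2) v"
    proof (rule dom)
      have "add_diag ?S1 (- (\<sigma>\<^sup>2)) = add_diag (net_cov n w) a1" by (auto simp: fun_eq_iff)
      then show "psd (pos ?U) (add_diag ?S1 (- (\<sigma>\<^sup>2)))"
        using psd_subset[OF psdc[of a1] _ subp] a1 by (simp add: pos_simps)
      show "?K i j = ?K j i" if "i \<in> pos ?U" "j \<in> pos ?U" for i j using KS[OF that] by simp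
      show "\<bar>net_mean n w i - drift_mean i\<bar> \<le> \<delta>2" if "i \<in> pos ?U" for i using mean subp that by blast
      fix \<xi>
      define E where "E = add_diag (\<lambda>i j. net_cov n w i j - block_cov n m R Q a i j) a1"
      have "quad_form (pos ?U) ?S1 \<xi> - quad_form (pos ?U) ?K \<xi> = quad_form (pos ?U) E \<xi>"
        unfolding quad_form_diff[symmetric] E_def by (rule quad_form_cong) auto
      also have "\<bar>\<dots>\<bar> \<le> \<delta>2 * (\<Sum>i\<in>pos ?U. (\<xi> i)\<^sup>2)"
      proof (rule quad_form_row_bound[OF finI])
        fix i j assume ij: "i \<in> pos ?U" "j \<in> pos ?U"
        have "net_cov n w i j = net_cov n w j i" by (rule psd_sym[OF psd_net_cov[OF n, of t]]) (use ij subp in auto)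
        then show "E i j = E j i" using KS[OF ij] by (simp add: E_def)
      next
        fix i assume i: "i \<in> pos ?U"
        have "(\<Sum>j\<in>pos ?U. \<bar>E i j\<bar>) \<le> (\<Sum>j\<in>pos ?U. \<bar>net_cov n w i j - block_cov n m R Q a i j\<bar> + (if i = j then a1 else 0))"
          unfolding E_def using a1 by (intro sum_mono) auto
        also have "\<dots> = (\<Sum>j\<in>pos ?U. \<bar>net_cov n w i j - block_cov n m R Q a i j\<bar>) + a1"
          using i finI by (simp add: sum.distrib)
        also have "\<dots> \<le> \<delta>2" by (rule row[OF i])
        finally show "(\<Sum>j\<in>pos ?U. \<bar>E i j\<bar>) \<le> \<delta>2" .
      qed
      finally show "\<bar>quad_form (pos ?U) ?S1 \<xi> - quad_form (pos ?U) ?K \<xi>\<bar> \<le> \<delta>2 * (\<Sum>i\<in>pos ?U. (\<xi> i)\<^sup>2)" .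
    qed
    have p1: "0 \<le> gauss_density (pos ?U) (net_mean n w) ?S1 v"
    proof -
      have "0 \<le> gauss_density (pos ?U) (net_mean n w) (add_diag (add_diag (net_cov n w) (\<sigma>\<^sup>2)) ((sqrt a1)\<^sup>2)) v"
        by (rule gauss_density_nonneg[OF finI psd_subset[OF psdc _ subp] sa1(2)]) (simp_all add: pos_simps)
      then show ?thesis unfolding sa1(1) .
    qed
    have c1: "exp (\<kappa> * real (card (pos ?U))) \<le> exp (\<kappa> * real (Q * ((2 * m + 1) * t)))"
      using card_blocks[of m t n R a Q] \<kappa> by (simp only: exp_le_cancel_iff) (intro mult_left_mono, simp_all only: of_nat_le_iff)
    \<comment> \<open>Non-negativity of the dominating density is read off the domination itself, as
      the dominated one is non-negative.\<close>
    have p2: "0 \<le> gauss_density (pos ?U) drift_mean (add_diag ?K a2) v"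
    proof -
      have "0 \<le> exp (\<kappa> * real (card (pos ?U))) * gauss_density (pos ?U) drift_mean (add_diag ?K a2) v" using p1 d by linarith
      then show ?thesis by (simp add: zero_le_mult_iff)
    qed
    have "gauss_density (pos ?U) (net_mean n w) ?S1 v \<le> exp (\<kappa> * real (Q * ((2 * m + 1) * t))) * gauss_density (pos ?U) drift_mean (add_diag ?K a2) v"
      using d mult_right_mono[OF c1 p2] by linarith
    then have "ennreal (gauss_density (pos ?U) (net_mean n w) ?S1 v) \<le> ennreal (exp (\<kappa> * real (Q * ((2 * m + 1) * t)))) * ennreal (gauss_density (pos ?U) drift_mean (add_diag ?K a2) v)"
      using p2 by (simp add: ennreal_mult[symmetric] ennreal_leI)
    from mult_left_mono[OF this zero_le, of "H v"]
    show "H v * ennreal (gauss_density (pos ?U) (net_mean n w) (add_diag (add_diag (net_cov n w) (\<sigma>\<^sup>2)) ((sqrt a1)\<^sup>2)) v)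
      \<le> ennreal (exp (\<kappa> * real (Q * ((2 * m + 1) * t)))) * (H v * ennreal (gauss_density (pos ?U) drift_mean (add_diag ?K ((sqrt a2)\<^sup>2)) v))"
      unfolding sa1 sa2 by (simp only: mult_ac)
  qed
  also have "\<dots> = ennreal (exp (\<kappa> * real (Q * ((2 * m + 1) * t)))) * (\<integral>\<^sup>+v. H v * ennreal (gauss_density (pos ?U) drift_mean (add_diag ?K ((sqrt a2)\<^sup>2)) v) \<partial>PiM ?U CM)"
    using Hm gauss_density_measurable_CM[OF finI pos_simps(2)] by (intro nn_integral_cmult) simp
  also have "(\<integral>\<^sup>+v. H v * ennreal (gauss_density (pos ?U) drift_mean (add_diag ?K ((sqrt a2)\<^sup>2)) v) \<partial>PiM ?U CM)
     = (\<Prod>q<Q. \<integral>\<^sup>+v. F q v * ennreal (gauss_density (pos (?D q)) drift_mean (add_diag ?K ((sqrt a2)\<^sup>2)) v) \<partial>PiM (?D q) CM)"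
    unfolding H_def
  proof (rule conjunct2[OF nn_integral_gauss_density_blocks[OF _ _ _ _ sa2(2) _ Fm]])
    have far: False if "q \<noteq> q'" "q < Q" "q' < Q" "\<bar>x - class_site n m R a q\<bar> \<le> int m" "\<bar>x - class_site n m R a q'\<bar> \<le> int m" for q q' x
    proof -
      from class_site_far[OF that(2,3,1) Q R that(4,5)] have "\<bar>site_mod 0 n\<bar> > int R'" by simp
      moreover have "site_mod 0 n = 0" by (rule site_mod_id) (simp add: sites_def)
      ultimately show False by simp
    qed
    show "disjoint_family_on ?D {..<Q}"
      unfolding disjoint_family_on_def using far by (fastforce simp: block_iff)
    show "?K i j = 0" if qq: "q \<in> {..<Q}" "q' \<in> {..<Q}" "q \<noteq> q'" "i \<in> ?D q" "j \<in> ?D q'" for q q' i j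
    proof -
      have i: "\<bar>fst i - class_site n m R a q\<bar> \<le> int m" and j: "\<bar>fst j - class_site n m R a q'\<bar> \<le> int m" using qq by (auto simp: block_iff)
      have "\<not> same_block n m R Q a i j"
      proof
        assume "same_block n m R Q a i j"
        then obtain p where p: "p < Q" "\<bar>fst i - class_site n m R a p\<bar> \<le> int m" "\<bar>fst j - class_site n m R a p\<bar> \<le> int m"
          by (auto simp: same_block_def)
        have "p = q" using far[of p q "fst i"] p i qq by auto
        moreover have "p = q'" using far[of p q' "fst j"] p j qq by auto
        ultimately show False using qq by simp
      qed
      moreover have "i \<noteq> j" using far[of q q' "fst i"] qq i j by auto
      ultimately show ?thesis by (simp add: block_cov_def)
    qed
    show "psd (pos (?D q)) ?K" if q: "q \<in> {..<Q}" for q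
    proof -
      have sb: "same_block n m R Q a i j" if "i \<in> pos (?D q)" "j \<in> pos (?D q)" for i j
        using that q by (auto simp: pos_def block_iff same_block_def)
      have p: "psd (pos (?D q)) (add_diag drift_cov (\<sigma>\<^sup>2))"
        by (rule psd_drift_cov) (use t in \<open>auto simp: pos_simps finite_block block_iff\<close>)
      have "quad_form (pos (?D q)) ?K \<xi> = quad_form (pos (?D q)) (add_diag drift_cov (\<sigma>\<^sup>2)) \<xi>" for \<xi>
        by (rule quad_form_cong) (auto simp: block_cov_def sb)
      moreover have "?K i j = add_diag drift_cov (\<sigma>\<^sup>2) i j" if "i \<in> pos (?D q)" "j \<in> pos (?D q)" for i j
        using sb[OF that] by (simp add: block_cov_def)
      ultimately show ?thesis using p unfolding psd_def by (metis (no_types, lifting))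
    qed
  qed (simp_all add: finite_block)
  also have "\<dots> \<le> (\<Prod>q<Q. ennreal (exp b))"
  proof (rule prod_mono_ennreal)
    fix q assume q: "q \<in> {..<Q}"
    have "gauss_density (pos (?D q)) drift_mean (add_diag ?K ((sqrt a2)\<^sup>2)) v = gauss_density (pos (?D q)) drift_mean (add_diag (add_diag drift_cov (\<sigma>\<^sup>2)) a2) v" for v
    proof (rule gauss_density_cong)
      fix i j assume "i \<in> pos (?D q)" "j \<in> pos (?D q)"
      then have "same_block n m R Q a i j" using q by (auto simp: pos_def block_iff same_block_def)
      then show "add_diag ?K ((sqrt a2)\<^sup>2) i j = add_diag (add_diag drift_cov (\<sigma>\<^sup>2)) a2 i j" by (simp add: block_cov_def sa2)
    qed simp_all
    then show "(\<integral>\<^sup>+v. F q v * ennreal (gauss_density (pos (?D q)) drift_mean (add_diag ?K ((sqrt a2)\<^sup>2)) v) \<partial>PiM (?D q) CM) \<le> ennreal (exp b)"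
      unfolding F_def by (simp only: mgf)
  qed
  also have "(\<Prod>q<Q. ennreal (exp b)) = ennreal (exp (real Q * b))"
    by (simp add: ennreal_power exp_of_nat_mult)
  finally have "(\<integral>\<^sup>+v. ennreal (exp (lam * (\<Sum>q<Q. ?g v (class_site n m R a q) - e)))
      * ennreal (gauss_density (pos (grid n t)) (net_mean n w) (add_diag (add_diag (net_cov n w) (\<sigma>\<^sup>2)) a1) v) \<partial>PiM (grid n t) CM)
    \<le> ennreal (exp (\<kappa> * real (Q * ((2 * m + 1) * t)))) * ennreal (exp (real Q * b))"
    by (simp add: mult_left_mono)
  then show ?thesis by (simp add: ennreal_mult[symmetric] exp_add)
qed

end

section \<open>Exponential deviation bound\<close>

lemma sum_residue_classes:
  fixes h :: "int \<Rightarrow> real"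
  shows "(\<Sum>j\<in>{c..<c + int (R * Q)}. h j) = (\<Sum>a<R. \<Sum>q<Q. h (c + int a + int (R * q)))"
proof -
  have "(\<Sum>j\<in>{c..<c + int (R * Q)}. h j) = (\<Sum>x<R * Q. h (c + int x))"
    by (rule sum.reindex_bij_witness[of _ "\<lambda>x. c + int x" "\<lambda>j. nat (j - c)"]) (auto simp del: of_nat_mult)
  also have "\<dots> = (\<Sum>q<Q. \<Sum>x\<in>{q * R..<q * R + R}. h (c + int x))"
    by (simp only: sum.nat_group mult.commute[of R Q])
  also have "\<dots> = (\<Sum>q<Q. \<Sum>a<R. h (c + int a + int (R * q)))"
  proof (rule sum.cong[OF refl])
    fix q
    show "(\<Sum>x\<in>{q * R..<q * R + R}. h (c + int x)) = (\<Sum>a<R. h (c + int a + int (R * q)))"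
      by (rule sum.reindex_bij_witness[of _ "\<lambda>a. q * R + a" "\<lambda>x. x - q * R"]) (auto simp: algebra_simps)
  qed
  also have "\<dots> = (\<Sum>a<R. \<Sum>q<Q. h (c + int a + int (R * q)))" by (rule sum.swap)
  finally show ?thesis .
qed

context limit_law
begin

lemma cyclic_average_measurable:
  assumes "\<And>j. j \<in> sites n \<Longrightarrow> (\<lambda>v. g (\<lambda>i. pathc v (site_mod (j + fst i) n, snd i))) \<in> borel_measurable N"
  shows "(\<lambda>v. cyclic_average n g (pathc v)) \<in> borel_measurable N"
  unfolding cyclic_average_def by (intro borel_measurable_divide borel_measurable_sum assms) auto

lemma cyl_path_measurable:
  assumes g: "cyl m t' g" and t: "t' \<le> t"
  shows "(\<lambda>v. g (\<lambda>i. pathc v (site_mod (j + fst i) n, snd i))) \<in> borel_measurable (PiM (grid n t) CM)"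
proof (rule cyl_compose_measurable[OF g])
  fix i assume "i \<in> grid m t'"
  then have "snd i \<le> t" using t by (auto simp: grid_def)
  then show "(\<lambda>v. pathc v (site_mod (j + fst i) n, snd i)) \<in> borel_measurable (PiM (grid n t) CM)"
    by (simp, intro upath_measurable) (simp add: grid_iff site_mod_in_sites)
qed

lemma good_measurable: "{v \<in> space (PiM (grid n t) CM). good n t L \<rho> (pathc v)} \<in> sets (PiM (grid n t) CM)"
proof -
  let ?M = "PiM (grid n t) CM"
  have 1: "(\<lambda>v. cyclic_average n (rate s) (pathc v)) \<in> borel_measurable ?M" if "s < t" for s
    by (intro cyclic_average_measurable cyl_path_measurable[OF cyl_rate]) (use that in simp)
  have 2: "(\<lambda>v. cyclic_average n (rate_product l r s) (pathc v)) \<in> borel_measurable ?M" if "r < t" "s < t" for r s l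
    by (intro cyclic_average_measurable cyl_path_measurable[OF cyl_rate_product]) (use that in simp)
  have A: "{v \<in> space ?M. \<forall>s\<in>{..<t}. \<bar>cyclic_average n (rate s) (pathc v) - lim_mean (rate s)\<bar> \<le> \<rho>} \<in> sets ?M"
    by (intro sets.sets_Collect_finite_All borel_measurable_le borel_measurable_abs borel_measurable_diff 1) auto
  have B: "{v \<in> space ?M. \<forall>r\<in>{..<t}. \<forall>s\<in>{..<t}. \<forall>l\<in>{- int L..int L}. \<bar>cyclic_average n (rate_product l r s) (pathc v) - lim_mean (rate_product l r s)\<bar> \<le> \<rho>} \<in> sets ?M"
    by (intro sets.sets_Collect_finite_All borel_measurable_le borel_measurable_abs borel_measurable_diff 2) auto
  have eq: "{v \<in> space ?M. good n t L \<rho> (pathc v)}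
     = {v \<in> space ?M. \<forall>s\<in>{..<t}. \<bar>cyclic_average n (rate s) (pathc v) - lim_mean (rate s)\<bar> \<le> \<rho>}
      \<inter> {v \<in> space ?M. \<forall>r\<in>{..<t}. \<forall>s\<in>{..<t}. \<forall>l\<in>{- int L..int L}. \<bar>cyclic_average n (rate_product l r s) (pathc v) - lim_mean (rate_product l r s)\<bar> \<le> \<rho>}"
    unfolding good_def by auto
  from sets.Int[OF A B] show ?thesis unfolding eq .
qed

text \<open>Pigeonhole: if every class stayed below \<open>\<epsilon> / 2\<close> per block, the
  covered sites would contribute at most \<open>\<epsilon> / 2\<close> times the window, and the at
  most \<open>2 * m + R\<close> uncovered sites, by \<open>big\<close>, at most a further
  \<open>\<epsilon> / 4\<close> of it.\<close>

lemma deviation_class: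
  assumes g: "cyl m t g" and C: "\<And>u. \<bar>g u\<bar> \<le> C" and e: "\<bar>e\<bar> \<le> C" and R: "R > 0" and n: "R * Q + 2 * m \<le> 2 * n + 1"
    and left: "2 * n + 1 < R * Q + 2 * m + R" and big: "2 * C * (2 * real m + real R) \<le> \<epsilon> / 4 * (2 * real n + 1)" and \<epsilon>: "\<epsilon> > 0"
    and dev: "(\<Sum>j\<in>sites n. g (\<lambda>i. pathc v (site_mod (j + fst i) n, snd i)) - e) \<ge> \<epsilon> * (2 * real n + 1)"
  shows "\<exists>a<R. real Q * \<epsilon> / 2 \<le> (\<Sum>q<Q. g (\<lambda>i. upath \<gamma> v (snd i) (class_site n m R a q + fst i)) - e)"
proof (rule ccontr)
  let ?h = "\<lambda>j. g (\<lambda>i. pathc v (site_mod (j + fst i) n, snd i)) - e"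
  let ?c = "- int n + int m"
  let ?A = "{?c..<?c + int (R * Q)}"
  assume neg: "\<not> ?thesis"
  have C0: "0 \<le> C" using e by linarith
  have h2: "?h j \<le> 2 * C" for j using C[of "\<lambda>i. pathc v (site_mod (j + fst i) n, snd i)"] e by linarith
  have n': "int (R * Q) + 2 * int m \<le> 2 * int n + 1" using n by linarith
  have sub: "?A \<subseteq> sites n" using n' by (auto simp: sites_eq simp del: of_nat_mult)
  have in1: "?h j = g (\<lambda>i. upath \<gamma> v (snd i) (j + fst i)) - e" if j: "j \<in> ?A" for j
  proof -
    have "g (\<lambda>i. pathc v (site_mod (j + fst i) n, snd i)) = g (\<lambda>i. upath \<gamma> v (snd i) (j + fst i))"
    proof (rule cyl_cong[OF g])
      fix i assume "i \<in> grid m t"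
      then have "\<bar>fst i\<bar> \<le> int m" by (auto simp: grid_def sites_def)
      then have "j + fst i \<in> sites n" using j n' by (auto simp: sites_eq simp del: of_nat_mult)
      then show "pathc v (site_mod (j + fst i) n, snd i) = upath \<gamma> v (snd i) (j + fst i)" by (simp add: site_mod_id)
    qed
    then show ?thesis by simp
  qed
  have "(\<Sum>j\<in>sites n. ?h j) = (\<Sum>j\<in>?A. ?h j) + (\<Sum>j\<in>sites n - ?A. ?h j)"
    by (subst sum.subset_diff[OF sub]) auto
  also have "(\<Sum>j\<in>sites n - ?A. ?h j) \<le> (\<Sum>j\<in>sites n - ?A. 2 * C)" by (intro sum_mono h2)
  also have "\<dots> \<le> (2 * real m + real R) * (2 * C)"
  proof -
    have "card (sites n - ?A) = 2 * n + 1 - R * Q" using sub by (simp add: card_Diff_subset card_sites del: of_nat_mult)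
    then have "card (sites n - ?A) \<le> 2 * m + R" using left by linarith
    then have "real (card (sites n - ?A)) \<le> real (2 * m + R)" by (simp only: of_nat_le_iff)
    then have "real (card (sites n - ?A)) \<le> 2 * real m + real R" by (simp del: of_nat_mult)
    then show ?thesis using C0 by (simp add: mult_right_mono)
  qed
  also have "(\<Sum>j\<in>?A. ?h j) = (\<Sum>j\<in>?A. g (\<lambda>i. upath \<gamma> v (snd i) (j + fst i)) - e)"
    by (rule sum.cong[OF refl], rule in1)
  also have "\<dots> = (\<Sum>a<R. \<Sum>q<Q. g (\<lambda>i. upath \<gamma> v (snd i) (class_site n m R a q + fst i)) - e)"
    unfolding sum_residue_classes class_site_def by (simp only: add.assoc)
  also have "\<dots> \<le> (\<Sum>a<R. real Q * \<epsilon> / 2)"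
    using neg by (intro sum_mono) (auto simp: not_le less_imp_le)
  also have "\<dots> = \<epsilon> / 2 * real (R * Q)" by simp
  also have "\<dots> \<le> \<epsilon> / 2 * (2 * real n + 1)"
  proof (intro mult_left_mono)
    have "R * Q \<le> 2 * n + 1" using n by linarith
    then have "real (R * Q) \<le> real (2 * n + 1)" by (simp only: of_nat_le_iff)
    then show "real (R * Q) \<le> 2 * real n + 1" by simp
  qed (use \<epsilon> in simp)
  finally have "(\<Sum>j\<in>sites n. ?h j) \<le> \<epsilon> / 2 * (2 * real n + 1) + \<epsilon> / 4 * (2 * real n + 1)"
    using big by (simp add: mult.commute)
  moreover have "\<epsilon> * (2 * real n + 1) > \<epsilon> / 2 * (2 * real n + 1) + \<epsilon> / 4 * (2 * real n + 1)"
  proof -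
    have "\<epsilon> * (2 * real n + 1) > 0" using \<epsilon> by (intro mult_pos_pos) auto
    then show ?thesis by (simp add: field_simps)
  qed
  ultimately show False using dev by linarith
qed

lemma lim_mean_bound:
  assumes g: "cyl m t g" and t: "t \<le> T" and C: "\<And>u. \<bar>g u\<bar> \<le> C"
  shows "\<bar>lim_mean g\<bar> \<le> C"
proof -
  interpret \<mu>e: prob_space \<mu>e by (rule prob_\<mu>e)
  have "integrable \<mu>e (\<lambda>u. g (flat u))"
    by (rule \<mu>e.integrable_const_bound[where B = C]) (use C cyl_integrable_\<mu>e[OF g t] in auto)
  then have "norm (lim_mean g) \<le> (\<integral>u. C \<partial>\<mu>e)"
    by (intro order_trans[OF integral_norm_bound integral_mono]) (use C in auto)
  then show ?thesis by (simp add: \<mu>e.prob_space)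
qed

text \<open>The constants are chosen backwards: \<open>lam\<close> from \<open>\<epsilon>\<close>,
  then the noise bound \<open>\<tau>\<close>, the tolerance \<open>\<delta>2\<close> of the block
  comparison, the class width \<open>R\<close>, the tolerance \<open>\<delta>1\<close> of the
  freezing step, and last the accuracy \<open>\<rho>\<close> and the range \<open>L\<close> demanded
  of a good path. None of them depends on \<open>n\<close>.\<close>

lemma one_sided_deviation:
  assumes t: "t \<le> T" and g: "cyl m t g" and \<epsilon>: "\<epsilon> > 0"
  obtains L \<rho> c R n0 where "\<rho> > 0" "c > 0"
    "\<And>n. n \<ge> n0 \<Longrightarrow> P.prob {\<omega> \<in> space P. good n t L \<rho> (pathc (net_incr n t \<omega>)) \<and>
       \<epsilon> \<le> cyclic_average n g (pathc (net_incr n t \<omega>)) - lim_mean g} \<le> real R * exp (- (c * real n))"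
proof -
  obtain C where C: "C > 0" "\<And>u. \<bar>g u\<bar> \<le> C" using cyl_bound[OF g] by metis
  define e where "e = lim_mean g"
  have eC: "\<bar>e\<bar> \<le> C" unfolding e_def by (rule lim_mean_bound[OF g t C(2)])
  \<comment> \<open>The first bound keeps the exponent at most \<open>1\<close>; the second makes
    the quadratic term of the exponential moment at most
    \<open>lam * \<epsilon> / 8\<close>.\<close>
  define lam where "lam = min (1 / (2 * C)) (\<epsilon> / (32 * C\<^sup>2))"
  have lam0: "lam > 0" using C \<epsilon> by (simp add: lam_def)
  have lamC: "lam * (2 * C) \<le> 1"
  proof -
    have "lam * (2 * C) \<le> 1 / (2 * C) * (2 * C)" unfolding lam_def using C by (intro mult_right_mono) auto
    then show ?thesis using C by simp
  qed
  have lamsq: "(lam * (2 * C))\<^sup>2 \<le> lam * (\<epsilon> / 8)"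
  proof -
    have "lam * (4 * C\<^sup>2) \<le> \<epsilon> / (32 * C\<^sup>2) * (4 * C\<^sup>2)" unfolding lam_def using C by (intro mult_right_mono) auto
    also have "\<dots> = \<epsilon> / 8" using C by simp
    finally have "lam * (lam * (4 * C\<^sup>2)) \<le> lam * (\<epsilon> / 8)" using lam0 by (intro mult_left_mono) auto
    then show ?thesis by (simp add: power2_eq_square mult_ac)
  qed
  define b where "b = lam * (\<epsilon> / 8) + (lam * (2 * C))\<^sup>2"
  have b: "b \<le> lam * \<epsilon> / 4"
  proof -
    have "lam * (\<epsilon> / 8) + lam * (\<epsilon> / 8) = lam * \<epsilon> / 4" by simp
    then show ?thesis unfolding b_def using lamsq by linarith
  qed
  obtain \<tau> where \<tau>: "\<tau> > 0" "\<And>a j. 0 < a \<Longrightarrow> a < \<tau> \<Longrightarrow>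
      (\<integral>\<^sup>+w. ennreal (exp (lam * (g (\<lambda>i. upath \<gamma> w (snd i) (j + fst i)) - e)))
         * ennreal (gauss_density (pos (block m t j)) drift_mean (add_diag (add_diag drift_cov (\<sigma>\<^sup>2)) a) w) \<partial>PiM (block m t j) CM) \<le> ennreal (exp b)"
    unfolding e_def b_def by (rule block_mgf[OF g t C(2) lam0 lamC, of "\<epsilon> / 8"]) (use \<epsilon> in simp, blast)
  \<comment> \<open>One sixteenth of \<open>lam * \<epsilon>\<close> per block; the added
    \<open>1\<close> keeps the denominator positive at \<open>t = 0\<close>.\<close>
  define \<kappa>2 where "\<kappa>2 = lam * \<epsilon> / (16 * real ((2 * m + 1) * t + 1))"
  have \<kappa>2: "\<kappa>2 > 0" using lam0 \<epsilon> unfolding \<kappa>2_def by (intro divide_pos_pos mult_pos_pos) (simp_all del: of_nat_add of_nat_mult)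
  obtain \<delta>2 a2 where \<delta>2: "\<delta>2 > 0" and a2: "0 < a2" "a2 < \<tau>" and
    dom2: "\<And>(I :: site_time set) m1 m2 S1 S2 v. finite I \<Longrightarrow> psd I (add_diag S1 (- (\<sigma>\<^sup>2))) \<Longrightarrow>
       (\<And>i j. i \<in> I \<Longrightarrow> j \<in> I \<Longrightarrow> S2 i j = S2 j i) \<Longrightarrow>
       (\<And>\<xi>. \<bar>quad_form I S1 \<xi> - quad_form I S2 \<xi>\<bar> \<le> \<delta>2 * (\<Sum>i\<in>I. (\<xi> i)\<^sup>2)) \<Longrightarrow>
       (\<And>i. i \<in> I \<Longrightarrow> \<bar>m1 i - m2 i\<bar> \<le> \<delta>2) \<Longrightarrow>
       gauss_density I m1 S1 v \<le> exp (\<kappa>2 * real (card I)) * gauss_density I m2 (add_diag S2 a2) v"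
    by (rule gauss_density_domination[OF \<sigma> \<kappa>2 \<tau>(1)]) blast
  \<comment> \<open>A quarter of \<open>\<delta>2\<close> is granted to the covariances between
    blocks, which recur once per time; this fixes \<open>R'\<close> and hence
    \<open>R\<close>.\<close>
  define \<delta>t where "\<delta>t = \<delta>2 / (4 * (real t + 1))"
  have \<delta>t: "\<delta>t > 0" "real t * \<delta>t \<le> \<delta>2 / 4" using \<delta>2 by (auto simp: \<delta>t_def field_simps)
  obtain R' where R': "tail_le R' \<delta>t" using tail_le_ex[OF \<delta>t(1)] by blast
  define R where "R = R' + 2 * m + 1"
  have R0: "R > 0" by (simp add: R_def)
  \<comment> \<open>Freezing is paid on all \<open>(2 * n + 1) * t\<close> coordinates, at most
    about \<open>2 * R * Q * t\<close> of them, while the gain is proportional to \<open>Q\<close>;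
    hence the division by \<open>R\<close>.\<close>
  define \<kappa>1 where "\<kappa>1 = lam * \<epsilon> / (32 * real R * (real t + 1))"
  have \<kappa>1: "\<kappa>1 > 0" using lam0 \<epsilon> R0 unfolding \<kappa>1_def by (intro divide_pos_pos mult_pos_pos) auto
  obtain \<delta>1 a1 where \<delta>1: "\<delta>1 > 0" and a1: "0 < a1" "a1 < \<delta>2 / 4" and
    dom1: "\<And>(I :: site_time set) m1 m2 S1 S2 v. finite I \<Longrightarrow> psd I (add_diag S1 (- (\<sigma>\<^sup>2))) \<Longrightarrow>
       (\<And>i j. i \<in> I \<Longrightarrow> j \<in> I \<Longrightarrow> S2 i j = S2 j i) \<Longrightarrow>
       (\<And>\<xi>. \<bar>quad_form I S1 \<xi> - quad_form I S2 \<xi>\<bar> \<le> \<delta>1 * (\<Sum>i\<in>I. (\<xi> i)\<^sup>2)) \<Longrightarrow>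
       (\<And>i. i \<in> I \<Longrightarrow> \<bar>m1 i - m2 i\<bar> \<le> \<delta>1) \<Longrightarrow>
       gauss_density I m1 S1 v \<le> exp (\<kappa>1 * real (card I)) * gauss_density I m2 (add_diag S2 a1) v"
    by (rule gauss_density_domination[OF \<sigma> \<kappa>1, of "\<delta>2 / 4"]) (use \<delta>2 in \<open>simp, blast\<close>)
  \<comment> \<open>One accuracy for both comparisons. Row sums multiply it by up to three times the
    number of coordinates of a block, and the factor \<open>16\<close> leaves room for the quarter
    shares of \<open>\<delta>2\<close>.\<close>
  define \<eta> where "\<eta> = min \<delta>1 \<delta>2 / (16 * real (2 * m + 1) * (real t + 1))"
  have \<eta>0: "\<eta> > 0" using \<delta>1 \<delta>2 by (simp add: \<eta>_def)
  have \<eta>1: "16 * real (2 * m + 1) * (real t + 1) * \<eta> = min \<delta>1 \<delta>2"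
  proof -
    have "16 * real (2 * m + 1) * (real t + 1) \<noteq> 0" by (simp del: of_nat_add of_nat_mult)
    then show ?thesis unfolding \<eta>_def times_divide_eq_right by (rule nonzero_mult_div_cancel_left)
  qed
  have mt: "1 \<le> real (2 * m + 1)" "1 \<le> real t + 1" by simp_all
  have \<eta>t: "3 * (real t * \<eta>) \<le> \<delta>1" and \<eta>m: "real ((2 * m + 1) * t) * (3 * \<eta>) \<le> \<delta>2 / 4" and \<eta>s: "2 * \<eta> \<le> \<delta>1" "\<eta> \<le> \<delta>2"
  proof -
    define X where "X = real (2 * m + 1) * (real t + 1) * \<eta>"
    have "16 * X = min \<delta>1 \<delta>2" using \<eta>1 by (simp only: X_def mult.assoc)
    then have X: "16 * X \<le> \<delta>1" "16 * X \<le> \<delta>2" by linarith+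
    have x1: "real t * \<eta> \<le> X"
    proof -
      have "1 * (real t * \<eta>) \<le> real (2 * m + 1) * ((real t + 1) * \<eta>)"
        using \<eta>0 by (intro mult_mono mult_right_mono) auto
      then show ?thesis by (simp add: X_def mult.assoc)
    qed
    have x2: "\<eta> \<le> X"
    proof -
      have "1 * (1 * \<eta>) \<le> real (2 * m + 1) * ((real t + 1) * \<eta>)"
        using \<eta>0 by (intro mult_mono mult_right_mono) auto
      then show ?thesis by (simp add: X_def mult.assoc)
    qed
    have x3: "real ((2 * m + 1) * t) * \<eta> \<le> X"
      unfolding X_def using \<eta>0 by (intro mult_right_mono) (auto simp: algebra_simps)
    show "3 * (real t * \<eta>) \<le> \<delta>1" "2 * \<eta> \<le> \<delta>1" "\<eta> \<le> \<delta>2" using x1 x2 X \<eta>0 by linarith+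
    have "real ((2 * m + 1) * t) * (3 * \<eta>) = 3 * (real ((2 * m + 1) * t) * \<eta>)" by simp
    then show "real ((2 * m + 1) * t) * (3 * \<eta>) \<le> \<delta>2 / 4" using x2 x3 X \<eta>0 by linarith
  qed
  obtain L where L: "tail_le L \<eta>" using tail_le_ex[OF \<eta>0] by blast
  \<comment> \<open>Dividing by the sum serves the covariance, where \<open>\<rho>\<close> is
    multiplied by \<open>total\<Lambda>\<close>, and the mean, where it is multiplied by
    \<open>\<bar>Jbar\<bar>\<close>.\<close>
  define \<rho> where "\<rho> = \<eta> / (total\<Lambda> + \<bar>Jbar\<bar> + 1)"
  have \<rho>0: "\<rho> > 0" using \<eta>0 total\<Lambda>_nonneg by (simp add: \<rho>_def)
  have \<rho>\<Lambda>: "\<rho> * total\<Lambda> \<le> \<eta>" and \<rho>J: "\<bar>Jbar\<bar> * \<rho> \<le> \<eta>"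
    using \<eta>0 total\<Lambda>_nonneg by (auto simp: \<rho>_def divide_le_eq mult_left_mono)
  define c where "c = lam * \<epsilon> / (16 * real R)"
  have c0: "c > 0" using lam0 \<epsilon> R0 by (simp add: c_def)
  \<comment> \<open>From here on \<open>L\<close> and the blocks fit into the window, the classes
    together cover at least half of it, and the uncovered sites weigh at most
    \<open>\<epsilon> / 4\<close>.\<close>
  define n0 where "n0 = max 1 (max (max L (2 * m)) (max (2 * m + R) (nat \<lceil>4 * (2 * C * (2 * real m + real R)) / \<epsilon>\<rceil>)))"
  have main: "P.prob {\<omega> \<in> space P. good n t L \<rho> (pathc (net_incr n t \<omega>)) \<and>
       \<epsilon> \<le> cyclic_average n g (pathc (net_incr n t \<omega>)) - lim_mean g} \<le> real R * exp (- (c * real n))" if n0: "n \<ge> n0" for n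
  proof -
    have n: "n \<ge> 1" "L \<le> n" "2 * m \<le> n" "2 * m + R \<le> n" using n0 unfolding n0_def by auto
    have "4 * (2 * C * (2 * real m + real R)) / \<epsilon> \<le> real n"
    proof -
      have "nat \<lceil>4 * (2 * C * (2 * real m + real R)) / \<epsilon>\<rceil> \<le> n" using n0 unfolding n0_def by auto
      then show ?thesis by linarith
    qed
    then have big: "2 * C * (2 * real m + real R) \<le> \<epsilon> / 4 * (2 * real n + 1)"
    proof -
      assume "4 * (2 * C * (2 * real m + real R)) / \<epsilon> \<le> real n"
      then have "4 * (2 * C * (2 * real m + real R)) \<le> \<epsilon> * real n" using \<epsilon> by (simp add: divide_le_eq mult.commute)
      moreover have "\<epsilon> * real n \<le> \<epsilon> * (2 * real n + 1)" using \<epsilon> by (intro mult_left_mono) auto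
      ultimately show ?thesis by simp
    qed
    define Q where "Q = (2 * n + 1 - 2 * m) div R"
    have Q1: "R * Q \<le> 2 * n + 1 - 2 * m" unfolding Q_def by simp
    have Q2: "2 * n + 1 - 2 * m < R * Q + R"
      unfolding Q_def using R0 dividend_less_times_div[of R "2 * n + 1 - 2 * m"] by simp
    have Q: "R * Q + 2 * m \<le> 2 * n + 1" "2 * n + 1 < R * Q + 2 * m + R" using Q1 Q2 n by linarith+
    have NQ: "2 * real n + 1 \<le> 2 * real R * real Q"
    proof -
      have "2 * n + 1 \<le> 2 * (R * Q)" using Q(2) n(4) by linarith
      then have "real (2 * n + 1) \<le> real (2 * (R * Q))" by (simp only: of_nat_le_iff)
      then show ?thesis by simp
    qed
    let ?D = "grid n t" and ?S = "\<lambda>w. add_diag (net_cov n w) (\<sigma>\<^sup>2)"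
    let ?dev = "\<lambda>v. \<epsilon> \<le> cyclic_average n g (pathc v) - lim_mean g"
    define A where "A = {v \<in> space (PiM ?D CM). good n t L \<rho> (pathc v)} \<inter> {v \<in> space (PiM ?D CM). ?dev v}"
    have Am: "A \<in> sets (PiM ?D CM)"
    proof -
      have "(\<lambda>v. cyclic_average n g (pathc v)) \<in> borel_measurable (PiM ?D CM)"
        by (intro cyclic_average_measurable cyl_path_measurable[OF g]) simp
      then have "{v \<in> space (PiM ?D CM). ?dev v} \<in> sets (PiM ?D CM)" by measurable
      then show ?thesis unfolding A_def using good_measurable by (rule sets.Int[rotated])
    qed
    note nm = net_incr_measurable[OF n(1) t]
    let ?E = "{\<omega> \<in> space P. good n t L \<rho> (pathc (net_incr n t \<omega>)) \<and> ?dev (net_incr n t \<omega>)}"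
    have Eeq: "?E = net_incr n t -` A \<inter> space P"
      using measurable_space[OF nm] by (auto simp: A_def)
    have "emeasure P ?E = (\<integral>\<^sup>+\<omega>. indicator A (net_incr n t \<omega>) \<partial>P)"
    proof -
      have "emeasure P ?E = emeasure (distr P (PiM ?D CM) (net_incr n t)) A"
        unfolding Eeq by (rule emeasure_distr[OF nm Am, symmetric])
      also have "\<dots> = (\<integral>\<^sup>+v. indicator A v \<partial>distr P (PiM ?D CM) (net_incr n t))" using Am by simp
      also have "\<dots> = (\<integral>\<^sup>+\<omega>. indicator A (net_incr n t \<omega>) \<partial>P)" by (rule nn_integral_distr[OF nm]) (use Am in simp)
      finally show ?thesis .
    qed
    also have "\<dots> = (\<integral>\<^sup>+v. indicator A v * ennreal (gauss_density (pos ?D) (net_mean n v) (?S v) v) \<partial>PiM ?D CM)"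
      by (rule nn_integral_net_incr[OF n(1) t]) (use Am in simp)
    also have "\<dots> \<le> ennreal (real R * exp (- (c * real n)))"
    proof (cases "A = {}")
      case True
      then show ?thesis by simp
    next
      case False
      \<comment> \<open>Any path of the event serves for freezing the parameters; without one the
        event is empty and its probability zero.\<close>
      then obtain w where w: "good n t L \<rho> (pathc w)" unfolding A_def by auto
      let ?g = "\<lambda>v a. \<Sum>q<Q. g (\<lambda>i. upath \<gamma> v (snd i) (class_site n m R a q + fst i)) - e"
      let ?gauss_density = "\<lambda>v. gauss_density (pos ?D) (net_mean n w) (add_diag (?S w) a1) v"
      define G' where "G' = exp (\<kappa>1 * real (card (pos ?D)))"
      \<comment> \<open>The Markov factor: on the event some class sum is at least
        \<open>real Q * \<epsilon> / 2\<close>.\<close>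
      define B' where "B' = exp (- (lam * (real Q * \<epsilon> / 2)))"
      have finD: "finite (pos ?D)" by (simp add: pos_simps)
      have psdc: "psd (pos ?D) (net_cov n v)" for v by (rule psd_net_cov[OF n(1)])
      have gd0: "0 \<le> ?gauss_density v" for v
      proof -
        have "psd (pos ?D) (?S w)"
          unfolding psd_def
        proof (intro conjI ballI allI)
          show "?S w i j = ?S w j i" if "i \<in> pos ?D" "j \<in> pos ?D" for i j using psd_sym[OF psdc that] by simp
          have "0 \<le> \<sigma>\<^sup>2 * (\<Sum>i\<in>pos ?D. (\<xi> i)\<^sup>2)" for \<xi> by (simp add: sum_nonneg)
          then show "0 \<le> quad_form (pos ?D) (?S w) \<xi>" for \<xi>
            using psdc[of w] by (simp add: quad_form_add_diag[OF finD] psd_def)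
        qed
        have sq: "(sqrt a1)\<^sup>2 = a1" using a1(1) by simp
        from gauss_density_nonneg[OF finD \<open>psd (pos ?D) (?S w)\<close>, of "sqrt a1", unfolded sq] a1(1) show ?thesis by simp
      qed
      have pt: "indicator A v * ennreal (gauss_density (pos ?D) (net_mean n v) (?S v) v)
         \<le> (\<Sum>a<R. ennreal (G' * B') * (ennreal (exp (lam * ?g v a)) * ennreal (?gauss_density v)))" for v
      proof (cases "v \<in> A")
        case True
        then have gv: "good n t L \<rho> (pathc v)" and dv: "?dev v" by (auto simp: A_def)
        have "gauss_density (pos ?D) (net_mean n v) (?S v) v \<le> G' * ?gauss_density v"
          unfolding G'_def
        proof (rule dom1[OF finD])
          have "add_diag (?S v) (- (\<sigma>\<^sup>2)) = net_cov n v" by (auto simp: fun_eq_iff)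
          then show "psd (pos ?D) (add_diag (?S v) (- (\<sigma>\<^sup>2)))" using psdc by simp
          show "?S w i j = ?S w j i" if "i \<in> pos ?D" "j \<in> pos ?D" for i j using psd_sym[OF psdc that] by simp
          show "\<bar>net_mean n v i - net_mean n w i\<bar> \<le> \<delta>1" if i: "i \<in> pos ?D" for i
            using net_mean_good[OF gv i] net_mean_good[OF w i] \<rho>J \<eta>s by linarith
          fix \<xi>
          have "quad_form (pos ?D) (?S v) \<xi> - quad_form (pos ?D) (?S w) \<xi> = quad_form (pos ?D) (\<lambda>i j. net_cov n v i j - net_cov n w i j) \<xi>"
            unfolding quad_form_diff[symmetric] by (rule quad_form_cong) auto
          also have "\<bar>\<dots>\<bar> \<le> \<delta>1 * (\<Sum>i\<in>pos ?D. (\<xi> i)\<^sup>2)"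
          proof (rule quad_form_row_bound[OF finD])
            fix i j assume ij: "i \<in> pos ?D" "j \<in> pos ?D"
            show "net_cov n v i j - net_cov n w i j = net_cov n v j i - net_cov n w j i"
              by (simp only: psd_sym[OF psdc[of v] ij] psd_sym[OF psdc[of w] ij])
          next
            fix i assume i: "i \<in> pos ?D"
            have "(\<Sum>j\<in>pos ?D. \<bar>net_cov n v i j - net_cov n w i j\<bar>) \<le> real t * (2 * \<rho> * total\<Lambda> + \<eta>)"
              by (rule net_cov_good_good[OF gv w L less_imp_le[OF \<rho>0] i])
            also have "\<dots> \<le> real t * (3 * \<eta>)" using \<rho>\<Lambda> by (intro mult_left_mono) auto
            also have "\<dots> \<le> \<delta>1" using \<eta>t by simp
            finally show "(\<Sum>j\<in>pos ?D. \<bar>net_cov n v i j - net_cov n w i j\<bar>) \<le> \<delta>1" .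
          qed
          finally show "\<bar>quad_form (pos ?D) (?S v) \<xi> - quad_form (pos ?D) (?S w) \<xi>\<bar> \<le> \<delta>1 * (\<Sum>i\<in>pos ?D. (\<xi> i)\<^sup>2)" .
        qed
        moreover obtain a where a: "a < R" "real Q * \<epsilon> / 2 \<le> ?g v a"
        proof -
          have "(\<Sum>j\<in>sites n. g (\<lambda>i. pathc v (site_mod (j + fst i) n, snd i)) - e) = (cyclic_average n g (pathc v) - e) * (2 * real n + 1)"
          proof -
            have "2 * real n + 1 \<noteq> 0" using of_nat_0_le_iff[of n, where 'a = real] by linarith
            then show ?thesis by (simp add: cyclic_average_def sum_subtractf card_sites field_simps)
          qed
          moreover have "\<epsilon> * (2 * real n + 1) \<le> (cyclic_average n g (pathc v) - e) * (2 * real n + 1)"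
            using dv by (intro mult_right_mono) (auto simp: e_def)
          ultimately have "\<epsilon> * (2 * real n + 1) \<le> (\<Sum>j\<in>sites n. g (\<lambda>i. pathc v (site_mod (j + fst i) n, snd i)) - e)" by simp
          from deviation_class[OF g C(2) eC R0 Q big \<epsilon> this] that show thesis by blast
        qed
        have "1 \<le> B' * exp (lam * ?g v a)"
        proof -
          have "lam * (real Q * \<epsilon> / 2) \<le> lam * ?g v a" using a(2) lam0 by (intro mult_left_mono) auto
          then show ?thesis unfolding B'_def by (simp add: exp_add[symmetric])
        qed
        then have "G' * ?gauss_density v \<le> (G' * ?gauss_density v) * (B' * exp (lam * ?g v a))"
          using gd0[of v] mult_left_mono[of 1 "B' * exp (lam * ?g v a)" "G' * ?gauss_density v"] by (simp add: G'_def)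
        ultimately have "gauss_density (pos ?D) (net_mean n v) (?S v) v \<le> (G' * B') * (exp (lam * ?g v a) * ?gauss_density v)"
          by (simp add: mult_ac)
        then have "ennreal (gauss_density (pos ?D) (net_mean n v) (?S v) v) \<le> ennreal (G' * B') * (ennreal (exp (lam * ?g v a)) * ennreal (?gauss_density v))"
          using gd0[of v] by (simp add: ennreal_mult[symmetric] G'_def B'_def ennreal_leI)
        also have "\<dots> \<le> (\<Sum>a<R. ennreal (G' * B') * (ennreal (exp (lam * ?g v a)) * ennreal (?gauss_density v)))"
          using a(1) by (intro member_le_sum[of a]) auto
        finally show ?thesis using True by simp
      qed simp
      have gm: "(\<lambda>v. ennreal (exp (lam * ?g v a)) * ennreal (?gauss_density v)) \<in> borel_measurable (PiM ?D CM)" if "a < R" for a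
      proof -
        have "(\<lambda>v. g (\<lambda>i. upath \<gamma> v (snd i) (class_site n m R a q + fst i))) \<in> borel_measurable (PiM ?D CM)" if "q < Q" for q
        proof (rule cyl_compose_measurable[OF g], rule upath_measurable)
          fix i r assume "i \<in> grid m t" "r \<le> snd i"
          then show "(class_site n m R a q + fst i, r) \<in> ?D"
            using class_site_range[OF \<open>a < R\<close> \<open>q < Q\<close> Q(1)] by (auto simp: grid_def sites_def)
        qed
        then have "(\<lambda>v. ?g v a) \<in> borel_measurable (PiM ?D CM)" by (intro borel_measurable_sum borel_measurable_diff) auto
        moreover have "gauss_density (pos ?D) (net_mean n w) (add_diag (?S w) a1) \<in> borel_measurable (PiM ?D CM)"
          by (rule gauss_density_measurable_CM[OF finD pos_simps(2)])
        ultimately show ?thesis by measurable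
      qed
      have "(\<integral>\<^sup>+v. indicator A v * ennreal (gauss_density (pos ?D) (net_mean n v) (?S v) v) \<partial>PiM ?D CM)
         \<le> (\<integral>\<^sup>+v. (\<Sum>a<R. ennreal (G' * B') * (ennreal (exp (lam * ?g v a)) * ennreal (?gauss_density v))) \<partial>PiM ?D CM)"
        by (intro nn_integral_mono pt)
      also have "\<dots> = (\<Sum>a<R. ennreal (G' * B') * (\<integral>\<^sup>+v. ennreal (exp (lam * ?g v a)) * ennreal (?gauss_density v) \<partial>PiM ?D CM))"
      proof (subst nn_integral_sum)
        fix a assume "a \<in> {..<R}"
        then show "(\<lambda>v. ennreal (G' * B') * (ennreal (exp (lam * ?g v a)) * ennreal (?gauss_density v))) \<in> borel_measurable (PiM ?D CM)"
          by (intro borel_measurable_times_ennreal[OF borel_measurable_const gm]) simp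
      qed (intro sum.cong refl nn_integral_cmult gm, simp)
      also have "\<dots> \<le> (\<Sum>a<R. ennreal (G' * B') * ennreal (exp (\<kappa>2 * real (Q * ((2 * m + 1) * t)) + real Q * b)))"
      proof (intro sum_mono mult_left_mono)
        fix a assume "a \<in> {..<R}"
        then have a: "a < R" by simp
        have finU: "finite (pos (blocks n m R Q t a))" by (rule pos_simps(1)) (simp add: finite_block)
        show "(\<integral>\<^sup>+v. ennreal (exp (lam * ?g v a)) * ennreal (?gauss_density v) \<partial>PiM ?D CM)
           \<le> ennreal (exp (\<kappa>2 * real (Q * ((2 * m + 1) * t)) + real Q * b))"
        proof (rule class_integral[OF n(1) t g a Q(1) R_def a1(1) a2(1) dom2[OF finU]])
          show "(\<Sum>i'\<in>pos (blocks n m R Q t a). \<bar>net_cov n w i i' - block_cov n m R Q a i i'\<bar>) + a1 \<le> \<delta>2"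
            if i: "i \<in> pos (blocks n m R Q t a)" for i
          proof -
            have "(\<Sum>i'\<in>pos (blocks n m R Q t a). \<bar>net_cov n w i i' - block_cov n m R Q a i i'\<bar>)
               \<le> real ((2 * m + 1) * t) * (\<rho> * total\<Lambda> + 2 * \<eta>) + real t * \<delta>t"
              by (rule row_blocks[OF w L R' less_imp_le[OF \<rho>0] t n(2,3) a Q(1) R_def i less_imp_le[OF \<eta>0]])
            also have "real ((2 * m + 1) * t) * (\<rho> * total\<Lambda> + 2 * \<eta>) \<le> real ((2 * m + 1) * t) * (3 * \<eta>)"
              using \<rho>\<Lambda> by (intro mult_left_mono) auto
            also have "\<dots> \<le> \<delta>2 / 4" by (rule \<eta>m)
            also note \<delta>t(2)
            finally have "(\<Sum>i'\<in>pos (blocks n m R Q t a). \<bar>net_cov n w i i' - block_cov n m R Q a i i'\<bar>) \<le> \<delta>2 / 4 + \<delta>2 / 4"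
              by simp
            then show ?thesis using a1(2) \<delta>2 by linarith
          qed
          show "\<bar>net_mean n w i - drift_mean i\<bar> \<le> \<delta>2" if "i \<in> pos ?D" for i
            using net_mean_good[OF w that] \<rho>J \<eta>s(2) by linarith
        qed (use \<kappa>2 \<tau>(2)[OF a2] in auto)
      qed simp
      also have "\<dots> = ennreal (real R * (G' * B' * exp (\<kappa>2 * real (Q * ((2 * m + 1) * t)) + real Q * b)))"
        by (simp add: G'_def B'_def ennreal_mult[symmetric] ennreal_of_nat_eq_real_of_nat)
      also have "\<dots> \<le> ennreal (real R * exp (- (c * real n)))"
      proof (intro ennreal_leI mult_left_mono)
        have cD: "card (pos ?D) = (2 * n + 1) * t"
        proof -
          have "pos ?D = sites n \<times> {1..t}" by (auto simp: pos_def grid_def)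
          then show ?thesis by (simp add: card_cartesian_product card_sites)
        qed
        have x1: "\<kappa>1 * real (card (pos ?D)) \<le> lam * \<epsilon> * real Q / 16"
        proof -
          have "real (card (pos ?D)) \<le> (2 * real R * real Q) * (real t + 1)"
            unfolding cD using NQ by (simp only: of_nat_mult) (intro mult_mono, auto)
          then have "\<kappa>1 * real (card (pos ?D)) \<le> \<kappa>1 * ((2 * real R * real Q) * (real t + 1))"
            using \<kappa>1 by (intro mult_left_mono) auto
          also have "\<dots> = lam * \<epsilon> * real Q / 16"
          proof -
            have *: "x * y / (32 * r * z) * ((2 * r * q) * z) = x * y * q / 16" if "r \<noteq> 0" "z \<noteq> 0" for x y r z q :: real
              using that by (simp add: field_simps)
            show ?thesis unfolding \<kappa>1_def by (rule *) (use R0 in auto)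
          qed
          finally show ?thesis .
        qed
        have x2: "\<kappa>2 * real (Q * ((2 * m + 1) * t)) \<le> lam * \<epsilon> * real Q / 16"
        proof -
          define Y where "Y = real ((2 * m + 1) * t)"
          have "Y \<ge> 0" by (simp add: Y_def)
          have k: "\<kappa>2 = lam * \<epsilon> / (16 * (Y + 1))" by (simp add: \<kappa>2_def Y_def)
          have "\<kappa>2 * Y \<le> \<kappa>2 * (Y + 1)" using \<kappa>2 by (intro mult_left_mono) auto
          also have "\<dots> = lam * \<epsilon> / 16" unfolding k using \<open>Y \<ge> 0\<close> by (simp add: field_simps)
          finally have "real Q * (\<kappa>2 * Y) \<le> real Q * (lam * \<epsilon> / 16)" by (intro mult_left_mono) auto
          moreover have "\<kappa>2 * real (Q * ((2 * m + 1) * t)) = real Q * (\<kappa>2 * Y)"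
            unfolding Y_def of_nat_mult[of Q] by (simp only: mult_ac)
          moreover have "real Q * (lam * \<epsilon> / 16) = lam * \<epsilon> * real Q / 16" by simp
          ultimately show ?thesis by linarith
        qed
        have x3: "real Q * b \<le> lam * \<epsilon> * real Q / 4"
          using mult_left_mono[OF b, of "real Q"] by (simp add: mult_ac)
        have x4: "c * real n \<le> lam * \<epsilon> * real Q / 8"
        proof -
          have "real n \<le> 2 * real R * real Q" using NQ by linarith
          then have "c * real n \<le> c * (2 * real R * real Q)" using c0 by (intro mult_left_mono) auto
          also have "\<dots> = lam * \<epsilon> * real Q / 8" unfolding c_def using R0 by (simp add: field_simps)
          finally show ?thesis .
        qed
        \<comment> \<open>In units of \<open>lam * \<epsilon> * real Q\<close>: the two comparisons
          cost \<open>1 / 16\<close> each and the exponential moments \<open>1 / 4\<close>, the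
          Markov factor gains \<open>1 / 2\<close>, and the remaining \<open>1 / 8\<close> covers
          \<open>c * real n\<close>.\<close>
        have "\<kappa>1 * real (card (pos ?D)) + - (lam * (real Q * \<epsilon> / 2)) + (\<kappa>2 * real (Q * ((2 * m + 1) * t)) + real Q * b) \<le> - (c * real n)"
          using x1 x2 x3 x4 by (simp add: field_simps)
        then show "G' * B' * exp (\<kappa>2 * real (Q * ((2 * m + 1) * t)) + real Q * b) \<le> exp (- (c * real n))"
          unfolding G'_def B'_def by (simp add: exp_add[symmetric])
      qed simp
      finally show ?thesis .
    qed
    finally show ?thesis
      by (simp add: P.emeasure_eq_measure ennreal_le_iff)
  qed
  show thesis by (rule that[OF \<rho>0 c0 main])
qed

end

section \<open>Almost sure convergence of cylinder averages\<close>

context limit_law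
begin

abbreviation conf :: "nat \<Rightarrow> 'a \<Rightarrow> site_time \<Rightarrow> real" where
  "conf n \<omega> \<equiv> (\<lambda>i. net n \<omega> (snd i) (fst i))"

definition deviation :: "nat \<Rightarrow> ((site_time \<Rightarrow> real) \<Rightarrow> real) \<Rightarrow> real \<Rightarrow> 'a set" where
  "deviation n g \<epsilon> = {\<omega> \<in> space P. \<epsilon> \<le> \<bar>cyclic_average n g (conf n \<omega>) - lim_mean g\<bar>}"

lemma cyclic_average_conf:
  assumes g: "cyl m s g" and s: "s \<le> t"
  shows "cyclic_average n g (pathc (net_incr n t \<omega>)) = cyclic_average n g (conf n \<omega>)"
proof -
  have "g (\<lambda>i. pathc (net_incr n t \<omega>) (site_mod (j + fst i) n, snd i)) = g (\<lambda>i. conf n \<omega> (site_mod (j + fst i) n, snd i))" for j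
  proof (rule cyl_cong[OF g])
    fix i assume "i \<in> grid m s"
    then have "snd i \<le> t" using s by (auto simp: grid_def)
    then show "pathc (net_incr n t \<omega>) (site_mod (j + fst i) n, snd i) = conf n \<omega> (site_mod (j + fst i) n, snd i)"
      using upath_net[OF site_mod_in_sites] by simp
  qed
  then show ?thesis by (simp only: cyclic_average_def)
qed

lemma cyclic_average_conf_measurable:
  assumes n: "n \<ge> 1" and g: "cyl m t g" and t: "t \<le> T"
  shows "(\<lambda>\<omega>. cyclic_average n g (conf n \<omega>)) \<in> borel_measurable P"
proof -
  have "(\<lambda>v. cyclic_average n g (pathc v)) \<in> borel_measurable (PiM (grid n t) CM)"
    by (intro cyclic_average_measurable cyl_path_measurable[OF g]) simp
  from measurable_compose[OF net_incr_measurable[OF n t] this]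
  show ?thesis by (simp only: cyclic_average_conf[OF g order_refl])
qed

lemma deviation_measurable:
  assumes n: "n \<ge> 1" and g: "cyl m t g" and t: "t \<le> T"
  shows "deviation n g \<epsilon> \<in> sets P"
proof -
  note cyclic_average_conf_measurable[OF assms, measurable]
  show ?thesis unfolding deviation_def by measurable
qed

lemma not_good_subset:
  "{\<omega> \<in> space P. \<not> good n t L \<rho> (pathc (net_incr n t \<omega>))}
   \<subseteq> (\<Union>s\<in>{..<t}. deviation n (rate s) \<rho>) \<union> (\<Union>(r, s, l)\<in>{..<t} \<times> {..<t} \<times> {- int L..int L}. deviation n (rate_product l r s) \<rho>)"
proof
  fix \<omega> assume "\<omega> \<in> {\<omega> \<in> space P. \<not> good n t L \<rho> (pathc (net_incr n t \<omega>))}"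
  then have \<omega>: "\<omega> \<in> space P" and ng: "\<not> good n t L \<rho> (pathc (net_incr n t \<omega>))" by auto
  from ng consider s where "s < t" "\<rho> < \<bar>cyclic_average n (rate s) (pathc (net_incr n t \<omega>)) - lim_mean (rate s)\<bar>"
    | r s l where "r < t" "s < t" "l \<in> {- int L..int L}" "\<rho> < \<bar>cyclic_average n (rate_product l r s) (pathc (net_incr n t \<omega>)) - lim_mean (rate_product l r s)\<bar>"
    unfolding good_def by (meson not_le)
  then show "\<omega> \<in> (\<Union>s\<in>{..<t}. deviation n (rate s) \<rho>) \<union> (\<Union>(r, s, l)\<in>{..<t} \<times> {..<t} \<times> {- int L..int L}. deviation n (rate_product l r s) \<rho>)"
  proof cases
    case 1
    then have "\<omega> \<in> deviation n (rate s) \<rho>"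
      using \<omega> cyclic_average_conf[OF cyl_rate[of s], of t n \<omega>] by (simp add: deviation_def)
    then show ?thesis using 1 by blast
  next
    case 2
    then have "\<omega> \<in> deviation n (rate_product l r s) \<rho>"
      using \<omega> cyclic_average_conf[OF cyl_rate_product[of l r s], of t n \<omega>] by (simp add: deviation_def)
    then show ?thesis using 2 by blast
  qed
qed

lemma good_event_measurable:
  assumes n: "n \<ge> 1" and t: "t \<le> T"
  shows "{\<omega> \<in> space P. good n t L \<rho> (pathc (net_incr n t \<omega>))} \<in> sets P"
proof -
  have "{\<omega> \<in> space P. good n t L \<rho> (pathc (net_incr n t \<omega>))}
      = net_incr n t -` {v \<in> space (PiM (grid n t) CM). good n t L \<rho> (pathc v)} \<inter> space P"
    using measurable_space[OF net_incr_measurable[OF n t]] by auto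
  then show ?thesis using measurable_sets[OF net_incr_measurable[OF n t] good_measurable] by simp
qed

text \<open>Failure of \<open>good\<close> at level \<open>t\<close> is a finite union of deviations
  of \<open>rate\<close> and \<open>rate_product\<close> at times below \<open>t\<close>, all of
  which are summable by hypothesis.\<close>

lemma not_good_summable:
  assumes t: "t \<le> T" and \<rho>: "\<rho> > 0"
    and IH: "\<And>s m g \<epsilon>. s < t \<Longrightarrow> cyl m s g \<Longrightarrow> \<epsilon> > 0 \<Longrightarrow> summable (\<lambda>n. P.prob (deviation n g \<epsilon>))"
  shows "summable (\<lambda>n. P.prob {\<omega> \<in> space P. \<not> good n t L \<rho> (pathc (net_incr n t \<omega>))})"
proof (rule summable_comparison_test')
  let ?I = "{..<t} \<times> {..<t} \<times> {- int L..int L}"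
  let ?b = "\<lambda>n. (\<Sum>s\<in>{..<t}. P.prob (deviation n (rate s) \<rho>)) + (\<Sum>(r, s, l)\<in>?I. P.prob (deviation n (rate_product l r s) \<rho>))"
  show "summable ?b"
    unfolding case_prod_beta
  proof (intro summable_add summable_sum)
    show "summable (\<lambda>n. P.prob (deviation n (rate s) \<rho>))" if "s \<in> {..<t}" for s
      by (rule IH[OF _ cyl_rate \<rho>]) (use that in simp)
    show "summable (\<lambda>n. P.prob (deviation n (rate_product (snd (snd i)) (fst i) (fst (snd i))) \<rho>))" if "i \<in> ?I" for i
      by (rule IH[OF _ cyl_rate_product \<rho>]) (use that in auto)
  qed
  fix n :: nat assume n: "1 \<le> n"
  have m1: "deviation n (rate s) \<rho> \<in> sets P" if "s \<in> {..<t}" for s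
    by (rule deviation_measurable[OF n cyl_rate]) (use that t in simp)
  have m2: "deviation n (rate_product l r s) \<rho> \<in> sets P" if "r < t" "s < t" for l r s
    by (rule deviation_measurable[OF n cyl_rate_product]) (use that t in simp)
  let ?U1 = "\<Union>s\<in>{..<t}. deviation n (rate s) \<rho>" and ?U2 = "\<Union>i\<in>?I. (case i of (r, s, l) \<Rightarrow> deviation n (rate_product l r s) \<rho>)"
  have u1: "?U1 \<in> sets P" using m1 by (intro sets.finite_UN) auto
  have u2: "?U2 \<in> sets P" using m2 by (intro sets.finite_UN) auto
  have "P.prob {\<omega> \<in> space P. \<not> good n t L \<rho> (pathc (net_incr n t \<omega>))} \<le> P.prob (?U1 \<union> ?U2)"
    by (rule P.finite_measure_mono[OF not_good_subset]) (use u1 u2 in simp)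
  also have "\<dots> \<le> P.prob ?U1 + P.prob ?U2" by (rule measure_Un_le[OF u1 u2])
  also have "P.prob ?U1 \<le> (\<Sum>s\<in>{..<t}. P.prob (deviation n (rate s) \<rho>))"
    by (rule measure_UNION_le) (use m1 in auto)
  also have "P.prob ?U2 \<le> (\<Sum>i\<in>?I. P.prob (case i of (r, s, l) \<Rightarrow> deviation n (rate_product l r s) \<rho>))"
    by (rule measure_UNION_le) (use m2 in auto)
  also have "\<dots> = (\<Sum>(r, s, l)\<in>?I. P.prob (deviation n (rate_product l r s) \<rho>))"
    by (rule sum.cong) auto
  finally show "norm (P.prob {\<omega> \<in> space P. \<not> good n t L \<rho> (pathc (net_incr n t \<omega>))}) \<le> ?b n"
      by (simp only: real_norm_def abs_of_nonneg[OF measure_nonneg])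
qed

lemma cyl_uminus: "cyl m t g \<Longrightarrow> cyl m t (\<lambda>u. - g u)"
proof -
  assume g: "cyl m t g"
  obtain C where "C > 0" "\<And>u. \<bar>g u\<bar> \<le> C" using cyl_bound[OF g] by blast
  then have "bounded (range (\<lambda>u. - g u))" by (intro boundedI[of _ C]) auto
  moreover have "continuous_on UNIV (\<lambda>u. - g u)"
    using g by (intro continuous_on_minus) (simp add: cyl_def)
  moreover have "- g u = - g u'" if "\<forall>i\<in>grid m t. u i = u' i" for u u'
    using cyl_cong[OF g, of u u'] that by simp
  ultimately show ?thesis unfolding cyl_def by blast
qed

text \<open>A deviation either occurs on the good event, where its probability is exponentially
  small, or lies in the failure of that event, which is summable by the hypothesis on earlier
  times.\<close>

lemma one_sided_summable:
  assumes t: "t \<le> T" and g: "cyl m t g" and \<epsilon>: "\<epsilon> > 0"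
    and IH: "\<And>s m g \<epsilon>. s < t \<Longrightarrow> cyl m s g \<Longrightarrow> \<epsilon> > 0 \<Longrightarrow> summable (\<lambda>n. P.prob (deviation n g \<epsilon>))"
  shows "summable (\<lambda>n. P.prob {\<omega> \<in> space P. \<epsilon> \<le> cyclic_average n g (conf n \<omega>) - lim_mean g})"
proof -
  obtain L \<rho> c R n0 where \<rho>: "\<rho> > 0" and c: "c > 0"
    and dev: "\<And>n. n \<ge> n0 \<Longrightarrow> P.prob {\<omega> \<in> space P. good n t L \<rho> (pathc (net_incr n t \<omega>)) \<and>
       \<epsilon> \<le> cyclic_average n g (pathc (net_incr n t \<omega>)) - lim_mean g} \<le> real R * exp (- (c * real n))"
    by (rule one_sided_deviation[OF t g \<epsilon>]) blast
  let ?ng = "\<lambda>n. {\<omega> \<in> space P. \<not> good n t L \<rho> (pathc (net_incr n t \<omega>))}"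
  let ?gauss_density = "\<lambda>n. {\<omega> \<in> space P. good n t L \<rho> (pathc (net_incr n t \<omega>))}"
  let ?E = "\<lambda>n. {\<omega> \<in> space P. \<epsilon> \<le> cyclic_average n g (conf n \<omega>) - lim_mean g}"
  have "summable (\<lambda>n. exp (- c) ^ n)" using c by (intro summable_geometric) simp
  then have "summable (\<lambda>n. real R * exp (- (c * real n)))"
    by (intro summable_mult) (simp add: exp_of_nat_mult[symmetric] mult.commute)
  then have s: "summable (\<lambda>n. real R * exp (- (c * real n)) + P.prob (?ng n))"
    by (rule summable_add[OF _ not_good_summable[OF t \<rho> IH]])
  show ?thesis
  proof (rule summable_comparison_test'[OF s])
    fix n assume n: "max 1 n0 \<le> n"
    then have n1: "n \<ge> 1" by simp
    note cyclic_average_conf_measurable[OF n1 g t, measurable]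
    have E: "?E n \<in> sets P" by measurable
    have gauss_density: "?gauss_density n \<in> sets P" by (rule good_event_measurable[OF n1 t])
    have "?ng n = space P - ?gauss_density n" by auto
    then have ng: "?ng n \<in> sets P" using gauss_density by simp
    have "P.prob (?E n) \<le> P.prob ((?gauss_density n \<inter> ?E n) \<union> ?ng n)"
      by (rule P.finite_measure_mono) (use E gauss_density ng in auto)
    also have "\<dots> \<le> P.prob (?gauss_density n \<inter> ?E n) + P.prob (?ng n)"
      by (rule measure_Un_le[OF sets.Int[OF gauss_density E] ng])
    also have "?gauss_density n \<inter> ?E n = {\<omega> \<in> space P. good n t L \<rho> (pathc (net_incr n t \<omega>)) \<and>
       \<epsilon> \<le> cyclic_average n g (pathc (net_incr n t \<omega>)) - lim_mean g}"
      by (auto simp: cyclic_average_conf[OF g order_refl])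
    also have "P.prob \<dots> \<le> real R * exp (- (c * real n))" by (rule dev) (use n in simp)
    finally show "norm (P.prob (?E n)) \<le> real R * exp (- (c * real n)) + P.prob (?ng n)"
      by (simp only: real_norm_def abs_of_nonneg[OF measure_nonneg])
  qed
qed

text \<open>Strong induction over time, with the window radius and the test function left general
  because earlier times are needed for \<open>rate_product\<close> at every lag. The two signs are
  covered by \<open>g\<close> and its negative.\<close>

lemma deviation_summable: "t \<le> T \<Longrightarrow> cyl m t g \<Longrightarrow> \<epsilon> > 0 \<Longrightarrow> summable (\<lambda>n. P.prob (deviation n g \<epsilon>))"
proof (induction t arbitrary: m g \<epsilon> rule: less_induct)
  case (less t)
  have IH: "summable (\<lambda>n. P.prob (deviation n g' \<epsilon>'))" if "s < t" "cyl m' s g'" "\<epsilon>' > 0" for s m' g' \<epsilon>'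
    by (rule less.IH[OF that(1) _ that(2,3)]) (use that(1) less.prems(1) in simp)
  let ?E = "\<lambda>g n. {\<omega> \<in> space P. \<epsilon> \<le> cyclic_average n g (conf n \<omega>) - lim_mean g}"
  note s1 = one_sided_summable[OF less.prems IH]
  note s2 = one_sided_summable[OF less.prems(1) cyl_uminus[OF less.prems(2)] less.prems(3) IH]
  show ?case
  proof (rule summable_comparison_test'[OF summable_add[OF s1 s2]])
    fix n :: nat assume n: "1 \<le> n"
    note cyclic_average_conf_measurable[OF n less.prems(2,1), measurable]
    note cyclic_average_conf_measurable[OF n cyl_uminus[OF less.prems(2)] less.prems(1), measurable]
    have m1: "?E g n \<in> sets P" by measurable
    have m2: "?E (\<lambda>u. - g u) n \<in> sets P" by measurable
    have neg: "cyclic_average n (\<lambda>u. - g u) x = - cyclic_average n g x" for x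
      by (simp add: cyclic_average_def sum_negf)
    have "deviation n g \<epsilon> \<subseteq> ?E g n \<union> ?E (\<lambda>u. - g u) n"
      by (auto simp: deviation_def neg abs_if split: if_splits)
    then have "P.prob (deviation n g \<epsilon>) \<le> P.prob (?E g n \<union> ?E (\<lambda>u. - g u) n)"
      by (rule P.finite_measure_mono) (use m1 m2 in simp)
    also have "\<dots> \<le> P.prob (?E g n) + P.prob (?E (\<lambda>u. - g u) n)"
      by (rule measure_Un_le[OF m1 m2])
    finally show "norm (P.prob (deviation n g \<epsilon>)) \<le> P.prob (?E g n) + P.prob (?E (\<lambda>u. - g u) n)"
      by (simp only: real_norm_def abs_of_nonneg[OF measure_nonneg])
  qed
qed

lemma cyclic_average_limit:
  assumes g: "cyl m T g"
  shows "AE \<omega> in P. (\<lambda>n. cyclic_average n g (conf n \<omega>)) \<longlonglongrightarrow> lim_mean g"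
proof -
  \<comment> \<open>Countably many tolerances suffice. The index is shifted by one because the
    inputs, and hence the measurability of deviations, are given for
    \<open>n \<ge> 1\<close>.\<close>
  have "AE \<omega> in P. eventually (\<lambda>n. \<omega> \<in> space P - deviation (Suc n) g (inverse (real (Suc k)))) sequentially" for k
  proof (rule borel_cantelli_AE1)
    show "deviation (Suc n) g (inverse (real (Suc k))) \<in> sets P" for n
      by (rule deviation_measurable[OF _ g]) simp_all
    show "summable (\<lambda>n. P.prob (deviation (Suc n) g (inverse (real (Suc k)))))"
      by (subst summable_Suc_iff, rule deviation_summable[OF order_refl g]) simp
  qed (simp add: P.emeasure_eq_measure)
  then have "AE \<omega> in P. \<forall>k. eventually (\<lambda>n. \<omega> \<in> space P - deviation (Suc n) g (inverse (real (Suc k)))) sequentially"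
    by (simp only: AE_all_countable) simp
  then show ?thesis
  proof (rule AE_mp[OF _ AE_I2[OF impI]])
    fix \<omega> assume "\<omega> \<in> space P" and ev: "\<forall>k. eventually (\<lambda>n. \<omega> \<in> space P - deviation (Suc n) g (inverse (real (Suc k)))) sequentially"
    have "(\<lambda>n. cyclic_average (Suc n) g (conf (Suc n) \<omega>)) \<longlonglongrightarrow> lim_mean g"
    proof (rule tendstoI)
      fix e :: real assume "e > 0"
      then obtain k where k: "inverse (real (Suc k)) < e" using reals_Archimedean by blast
      from ev have "eventually (\<lambda>n. \<omega> \<in> space P - deviation (Suc n) g (inverse (real (Suc k)))) sequentially" by blast
      then show "eventually (\<lambda>n. dist (cyclic_average (Suc n) g (conf (Suc n) \<omega>)) (lim_mean g) < e) sequentially"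
        by (rule eventually_mono) (use k in \<open>auto simp: deviation_def dist_real_def\<close>)
    qed
    then show "(\<lambda>n. cyclic_average n g (conf n \<omega>)) \<longlonglongrightarrow> lim_mean g" by (rule LIMSEQ_imp_Suc)
  qed
qed

end

section \<open>Weak convergence of the empirical measure\<close>

text \<open>Rational parameters make the family countable, so that one null set serves all test functions.\<close>

definition bump :: "nat \<Rightarrow> rat \<times> nat \<times> nat \<times> rat list \<Rightarrow> (site_time \<Rightarrow> real) \<Rightarrow> real" where
  "bump t p w = (case p of (a, m, K, xs) \<Rightarrow>
     of_rat a * max 0 (1 - real K * (\<Sum>i\<in>grid m t. \<bar>w i - of_rat (xs ! to_nat i)\<bar>)))"

lemma cyl_bump: "\<exists>m. cyl m t (bump t p)"
proof -
  obtain a m K xs where p: "p = (a, m, K, xs)" by (cases p)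
  have "continuous_on UNIV (bump t p)"
    unfolding bump_def p prod.case by (intro continuous_intros continuous_on_product_coordinates)
  moreover have "bounded (range (bump t p))"
  proof (rule boundedI)
    fix x assume "x \<in> range (bump t p)"
    then obtain w where x: "x = bump t p w" by blast
    have "0 \<le> real K * (\<Sum>i\<in>grid m t. \<bar>w i - of_rat (xs ! to_nat i)\<bar>)" by (simp add: sum_nonneg)
    then have "\<bar>max 0 (1 - real K * (\<Sum>i\<in>grid m t. \<bar>w i - of_rat (xs ! to_nat i)\<bar>))\<bar> \<le> 1" by linarith
    then have "\<bar>of_rat a\<bar> * \<bar>max 0 (1 - real K * (\<Sum>i\<in>grid m t. \<bar>w i - of_rat (xs ! to_nat i)\<bar>))\<bar> \<le> \<bar>of_rat a :: real\<bar>"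
      by (rule mult_left_le) simp
    then show "norm x \<le> \<bar>of_rat a\<bar>" unfolding x bump_def p prod.case real_norm_def abs_mult .
  qed
  moreover have "bump t p u = bump t p u'" if "\<forall>i\<in>grid m t. u i = u' i" for u u'
    unfolding bump_def p prod.case using that by simp
  ultimately have "cyl m t (bump t p)" unfolding cyl_def by blast
  then show ?thesis ..
qed

lemma cyl_const: "cyl m t (\<lambda>_. c)"
  unfolding cyl_def by (auto intro: boundedI[of _ "\<bar>c\<bar>"])

lemma cyl_max:
  assumes g: "cyl m t g" and h: "cyl m t h"
  shows "cyl m t (\<lambda>w. max (g w) (h w))"
proof -
  obtain C where C: "\<And>u. \<bar>g u\<bar> \<le> C" using cyl_bound[OF g] by blast
  obtain D where D: "\<And>u. \<bar>h u\<bar> \<le> D" using cyl_bound[OF h] by blast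
  have "continuous_on UNIV (\<lambda>w. max (g w) (h w))"
    using g h by (intro continuous_on_max) (simp_all add: cyl_def)
  moreover have "bounded (range (\<lambda>w. max (g w) (h w)))"
  proof (rule boundedI)
    fix x assume "x \<in> range (\<lambda>w. max (g w) (h w))"
    then obtain w where "x = max (g w) (h w)" by blast
    then show "norm x \<le> max C D" using C[of w] D[of w] by (simp add: max_def abs_if split: if_splits)
  qed
  moreover have "max (g u) (h u) = max (g u') (h u')" if "\<forall>i\<in>grid m t. u i = u' i" for u u'
    using cyl_cong[OF g, of u u'] cyl_cong[OF h, of u u'] that by simp
  ultimately show ?thesis unfolding cyl_def by blast
qed

text \<open>The inserted \<open>0\<close> gives the empty set a maximum and keeps the approximation
  non-negative, so that non-negative functions are approximated from below with a uniform
  bound.\<close>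

definition bump_max :: "nat \<Rightarrow> (rat \<times> nat \<times> nat \<times> rat list) set \<Rightarrow> (site_time \<Rightarrow> real) \<Rightarrow> real" where
  "bump_max t I w = Max (insert 0 ((\<lambda>p. bump t p w) ` I))"

lemma cyl_bump_max:
  assumes "finite I"
  shows "\<exists>m. cyl m t (bump_max t I)"
  using assms
proof induction
  case empty
  have "bump_max t {} = (\<lambda>_. 0)" by (auto simp: bump_max_def)
  then show ?case using cyl_const[of 0 t 0] by auto
next
  case (insert p I)
  obtain m where m: "cyl m t (bump_max t I)" using insert.IH by blast
  obtain m' where m': "cyl m' t (bump t p)" using cyl_bump by blast
  have "bump_max t (insert p I) = (\<lambda>w. max (bump t p w) (bump_max t I w))"
    using insert.hyps by (auto simp: bump_max_def fun_eq_iff insert_commute[of 0])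
  then have "cyl (max m m') t (bump_max t (insert p I))"
    using cyl_max[OF cyl_mono[OF m', of "max m m'" t] cyl_mono[OF m, of "max m m'" t]] by simp
  then show ?case ..
qed

text \<open>The superlevel set is open in the product topology, so it contains a box around
  \<open>v\<close> that restricts finitely many coordinates. Their sites bound \<open>m\<close>;
  coordinates at times beyond \<open>t\<close> may be reset to those of \<open>v\<close> by
  \<open>dep\<close>.\<close>

lemma open_grid_neighbourhood:
  fixes g :: "(site_time \<Rightarrow> real) \<Rightarrow> real"
  assumes g: "continuous_on UNIV g" and dep: "\<And>u u'. (\<And>i. snd i \<le> t \<Longrightarrow> u i = u' i) \<Longrightarrow> g u = g u'" and y: "y < g v"
  shows "\<exists>m. \<exists>\<delta>>0. \<forall>w. (\<forall>i\<in>grid m t. \<bar>w i - v i\<bar> < \<delta>) \<longrightarrow> y < g w"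
proof -
  have "open {w. y < g w}" by (rule open_Collect_less[OF continuous_on_const g])
  then have "openin (product_topology (\<lambda>_. euclidean) UNIV) {w. y < g w}" by (simp add: open_fun_def)
  from product_topology_open_contains_basis[OF this, of v] y
  obtain X where X: "v \<in> (\<Pi>\<^sub>E i\<in>UNIV. X i)" "\<And>i. open (X i)" "finite {i. X i \<noteq> UNIV}" "(\<Pi>\<^sub>E i\<in>UNIV. X i) \<subseteq> {w. y < g w}"
    by auto
  let ?F = "{i. X i \<noteq> UNIV}"
  have vX: "v i \<in> X i" for i using PiE_mem[OF X(1)] by simp
  have "\<exists>e>0. \<forall>z. \<bar>z - v i\<bar> < e \<longrightarrow> z \<in> X i" for i
  proof -
    obtain e where "e > 0" "ball (v i) e \<subseteq> X i" using vX[of i] X(2)[of i] open_contains_ball by blast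
    then show ?thesis by (intro exI[of _ e]) (auto simp: subset_iff dist_real_def abs_minus_commute)
  qed
  then obtain e where e: "\<And>i. e i > 0" "\<And>i z. \<bar>z - v i\<bar> < e i \<Longrightarrow> z \<in> X i" by metis
  define \<delta> where "\<delta> = Min (insert 1 (e ` ?F))"
  have \<delta>: "\<delta> > 0" using X(3) e(1) by (auto simp: \<delta>_def)
  have \<delta>e: "\<delta> \<le> e i" if "i \<in> ?F" for i using X(3) that by (auto simp: \<delta>_def intro!: Min_le)
  obtain m where m: "\<forall>k\<in>(\<lambda>i. nat \<bar>fst i\<bar>) ` ?F. k \<le> m"
    using X(3) finite_nat_set_iff_bounded_le[of "(\<lambda>i. nat \<bar>fst i\<bar>) ` ?F"] by blast
  show ?thesis
  proof (intro exI[of _ m] exI[of _ \<delta>] conjI \<delta> allI impI)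
    fix w assume w: "\<forall>i\<in>grid m t. \<bar>w i - v i\<bar> < \<delta>"
    \<comment> \<open>Agrees with \<open>w\<close> wherever \<open>g\<close> looks and with
      \<open>v\<close> at later times, where the box might otherwise be left.\<close>
    let ?w = "\<lambda>i. if snd i \<le> t then w i else v i"
    have "?w i \<in> X i" for i
    proof (cases "i \<in> ?F \<and> snd i \<le> t")
      case True
      then have "nat \<bar>fst i\<bar> \<le> m" using m by blast
      then have "i \<in> grid m t" using True by (auto simp: grid_def sites_def mem_Times_iff)
      then show ?thesis using bspec[OF w, of i] \<delta>e[of i] e(2)[of "w i" i] True by auto
    next
      case False
      then show ?thesis using vX[of i] by auto
    qed
    then have "?w \<in> (\<Pi>\<^sub>E i\<in>UNIV. X i)" by (simp add: PiE_iff)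
    then have "y < g ?w" using X(4) by blast
    moreover have "g ?w = g w" by (rule dep) simp
    ultimately show "y < g w" by simp
  qed
qed

text \<open>A tent of rational height between \<open>g v - \<eta>\<close> and \<open>g v\<close>, so
  steep that it vanishes outside a neighbourhood on which \<open>g\<close> exceeds this height, lies
  below \<open>g\<close>. Its centre must be rational, hence only close to \<open>v\<close>, and the
  value lost at \<open>v\<close> by the displacement is made small.\<close>

lemma bump_below:
  fixes g :: "(site_time \<Rightarrow> real) \<Rightarrow> real"
  assumes g: "continuous_on UNIV g" and dep: "\<And>u u'. (\<And>i. snd i \<le> t \<Longrightarrow> u i = u' i) \<Longrightarrow> g u = g u'"
    and g0: "\<And>w. 0 \<le> g w" and \<eta>: "\<eta> > 0"
  shows "\<exists>p. (\<forall>w. bump t p w \<le> g w) \<and> g v - \<eta> < bump t p v"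
proof (cases "g v - \<eta> < 0")
  case True
  \<comment> \<open>The zero function, of height \<open>0\<close>, already lies above
    \<open>g v - \<eta>\<close>.\<close>
  show ?thesis by (rule exI[of _ "(0, 0, 0, [])"]) (use True g0 in \<open>simp_all add: bump_def\<close>)
next
  case False
  obtain a :: rat where a: "g v - \<eta> < of_rat a" "of_rat a < g v"
    using of_rat_dense[of "g v - \<eta>" "g v"] \<eta> by auto
  have a0: "(0::real) < of_rat a" using a False by linarith
  obtain m \<delta> where \<delta>: "\<delta> > 0" "\<forall>w. (\<forall>i\<in>grid m t. \<bar>w i - v i\<bar> < \<delta>) \<longrightarrow> of_rat a < g w"
    using open_grid_neighbourhood[OF g dep a(2)] by blast
  obtain K where K: "real K > 2 / \<delta>" using reals_Archimedean2 by blast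
  have K0: "real K > 0" using K \<delta>(1) by (meson divide_pos_pos less_trans zero_less_numeral)
  define N where "N = real (card (grid m t))"
  define D where "D = of_rat a * real K * (N + 1)"
  have N0: "N \<ge> 0" by (simp add: N_def)
  then have D0: "D > 0" unfolding D_def using a0 K0 by (intro mult_pos_pos) auto
  \<comment> \<open>Distance allowed between centre and \<open>v\<close>: the first bound keeps the
    support of the tent, of radius below \<open>\<delta> / 2\<close>, inside the neighbourhood; the
    second keeps the loss at \<open>v\<close> below the excess of the height over
    \<open>g v - \<eta>\<close>.\<close>
  define \<kappa> where "\<kappa> = min (\<delta> / 2) ((of_rat a - (g v - \<eta>)) / D)"
  have \<kappa>0: "\<kappa> > 0" using \<delta>(1) a(1) D0 by (simp add: \<kappa>_def)
  have "\<exists>q :: rat. \<bar>v i - of_rat q\<bar> < \<kappa>" for i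
  proof -
    obtain q :: rat where "v i - \<kappa> < of_rat q" "of_rat q < v i + \<kappa>"
      using of_rat_dense[of "v i - \<kappa>" "v i + \<kappa>"] \<kappa>0 by auto
    then show ?thesis by (intro exI[of _ q]) linarith
  qed
  then obtain c :: "site_time \<Rightarrow> rat" where c: "\<And>i. \<bar>v i - of_rat (c i)\<bar> < \<kappa>" by metis
  obtain M where M: "\<forall>k\<in>to_nat ` grid m t. k < M"
    using finite_nat_set_iff_bounded[of "to_nat ` grid m t"] by auto
  \<comment> \<open>The centre is stored as a list indexed by codes of site and time; it is long
    enough to contain the codes of the whole grid.\<close>
  define xs where "xs = map (\<lambda>k. c (from_nat k)) [0..<M]"
  have xs: "xs ! to_nat i = c i" if "i \<in> grid m t" for i using M that by (simp add: xs_def)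
  define S :: "(site_time \<Rightarrow> real) \<Rightarrow> real" where "S w = (\<Sum>i\<in>grid m t. \<bar>w i - of_rat (c i)\<bar>)" for w
  have b: "bump t (a, m, K, xs) w = of_rat a * max 0 (1 - real K * S w)" for w
    unfolding bump_def prod.case S_def by (simp add: xs cong: sum.cong)
  show ?thesis
  proof (intro exI[of _ "(a, m, K, xs)"] conjI allI)
    fix w
    show "bump t (a, m, K, xs) w \<le> g w"
    proof (cases "real K * S w < 1")
      case True
      have "\<bar>w i - v i\<bar> < \<delta>" if i: "i \<in> grid m t" for i
      proof -
        have "\<bar>w i - of_rat (c i)\<bar> \<le> S w" unfolding S_def by (rule member_le_sum[OF i]) auto
        moreover have "S w < 1 / real K" using True K0 by (simp add: field_simps)
        moreover have "1 / real K < \<delta> / 2" using K K0 \<delta>(1) by (simp add: field_simps)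
        moreover have "\<kappa> \<le> \<delta> / 2" unfolding \<kappa>_def by (rule min.cobounded1)
        ultimately show ?thesis using c[of i] by linarith
      qed
      then have "of_rat a < g w" using \<delta>(2) by blast
      moreover have "0 \<le> S w" unfolding S_def by (rule sum_nonneg) simp
      then have "max 0 (1 - real K * S w) \<le> 1" using K0 by simp
      then have "of_rat a * max 0 (1 - real K * S w) \<le> of_rat a" using a0 by (intro mult_left_le) auto
      ultimately show ?thesis unfolding b by linarith
    next
      case False
      then show ?thesis using g0[of w] unfolding b by (simp add: max_def)
    qed
  next
    have "S v \<le> (\<Sum>i\<in>grid m t. \<kappa>)" unfolding S_def by (intro sum_mono less_imp_le c)
    then have "S v \<le> N * \<kappa>" by (simp add: N_def)
    then have "of_rat a * (real K * S v) \<le> of_rat a * (real K * (N * \<kappa>))"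
      using a0 by (intro mult_left_mono) auto
    also have "\<dots> < D * \<kappa>" using a0 K0 \<kappa>0 by (simp add: D_def algebra_simps)
    also have "\<dots> \<le> of_rat a - (g v - \<eta>)"
    proof -
      have "\<kappa> \<le> (of_rat a - (g v - \<eta>)) / D" unfolding \<kappa>_def by (rule min.cobounded2)
      then show ?thesis using D0 by (simp add: pos_le_divide_eq mult.commute)
    qed
    finally have "g v - \<eta> < of_rat a * (1 - real K * S v)" by (simp add: algebra_simps)
    also have "\<dots> \<le> of_rat a * max 0 (1 - real K * S v)" using a0 by (intro mult_left_mono) auto
    finally show "g v - \<eta> < bump t (a, m, K, xs) v" unfolding b .
  qed
qed

lemma cyclic_average_mono: "(\<And>w. g w \<le> h w) \<Longrightarrow> cyclic_average n g x \<le> cyclic_average n h x"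
  unfolding cyclic_average_def by (intro divide_right_mono sum_mono) auto

context limit_law
begin

lemma flat_measurable_\<mu>e:
  assumes g: "continuous_on UNIV g" and dep: "\<And>u u'. (\<And>i. snd i \<le> T \<Longrightarrow> u i = u' i) \<Longrightarrow> g u = g u'"
  shows "(\<lambda>u. g (flat u)) \<in> borel_measurable \<mu>e"
proof -
  have "(\<lambda>u i. if snd i \<le> T then flat u i else 0) \<in> borel_measurable (field_space T UNIV)"
  proof (rule measurable_site_time)
    show "(\<lambda>u. if snd i \<le> T then flat u i else 0) \<in> borel_measurable (field_space T UNIV)" for i
      by (cases "snd i \<le> T") (auto intro: borel_of_measurable_real field_topology_coord)
  qed
  from measurable_compose[OF this borel_measurable_continuous_onI[OF g]]
  have "(\<lambda>u. g (\<lambda>i. if snd i \<le> T then flat u i else 0)) \<in> borel_measurable (field_space T UNIV)" .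
  moreover have "g (\<lambda>i. if snd i \<le> T then flat u i else 0) = g (flat u)" for u by (rule dep) simp
  ultimately have "(\<lambda>u. g (flat u)) \<in> borel_measurable (field_space T UNIV)" by simp
  then show ?thesis by (simp only: measurable_cong_sets[OF sets_\<mu>e refl])
qed

text \<open>Maxima of finitely many bumps below \<open>g\<close> increase to \<open>g\<close>
  pointwise, so by dominated convergence one of them has a limit mean above
  \<open>lim_mean g - \<eta>\<close>. Its cyclic averages converge and lie below those of
  \<open>g\<close>.\<close>

lemma cyclic_average_liminf:
  assumes x: "\<And>I. finite I \<Longrightarrow> (\<lambda>n. cyclic_average n (bump_max T I) (x n)) \<longlonglongrightarrow> lim_mean (bump_max T I)"
    and g: "continuous_on UNIV g" and dep: "\<And>u u'. (\<And>i. snd i \<le> T \<Longrightarrow> u i = u' i) \<Longrightarrow> g u = g u'"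
    and g0: "\<And>w. 0 \<le> g w" and C: "\<And>w. g w \<le> C" and \<eta>: "\<eta> > 0"
  shows "eventually (\<lambda>n. lim_mean g - \<eta> < cyclic_average n g (x n)) sequentially"
proof -
  interpret \<mu>e: prob_space \<mu>e by (rule prob_\<mu>e)
  \<comment> \<open>The bumps below \<open>g\<close> among the first \<open>N + 1\<close> codes:
    finite for each \<open>N\<close>, and eventually containing every bump below
    \<open>g\<close>.\<close>
  define I where "I N = {p. to_nat p \<le> N \<and> (\<forall>w. bump T p w \<le> g w)}" for N :: nat
  have fin: "finite (I N)" for N
    by (rule finite_subset[OF _ finite_imageI[of "{..N}" from_nat]]) (auto simp: I_def intro!: rev_image_eqI[of "to_nat _"])
  have le: "bump_max T (I N) w \<le> g w" for N w
    unfolding bump_max_def by (rule Max.boundedI) (use fin g0 in \<open>auto simp: I_def\<close>)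
  have ge0: "0 \<le> bump_max T (I N) w" for N w
    unfolding bump_max_def using fin by (intro Max_ge) auto
  have lim: "(\<lambda>N. bump_max T (I N) w) \<longlonglongrightarrow> g w" for w
  proof (rule tendstoI)
    fix e :: real assume e: "e > 0"
    obtain p where p: "\<forall>w. bump T p w \<le> g w" "g w - e < bump T p w"
      using bump_below[OF g dep g0 e] by blast
    show "eventually (\<lambda>N. dist (bump_max T (I N) w) (g w) < e) sequentially"
      using eventually_ge_at_top[of "to_nat p"]
    proof (rule eventually_mono)
      fix N assume "to_nat p \<le> N"
      then have "p \<in> I N" using p(1) by (simp add: I_def)
      then have "bump T p w \<le> bump_max T (I N) w"
        unfolding bump_max_def using fin by (intro Max_ge) auto
      then show "dist (bump_max T (I N) w) (g w) < e" using p(2) le[of N w] by (simp add: dist_real_def)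
    qed
  qed
  have "(\<lambda>N. lim_mean (bump_max T (I N))) \<longlonglongrightarrow> lim_mean g"
  proof (rule integral_dominated_convergence[where w = "\<lambda>_. C"])
    show "(\<lambda>u. g (flat u)) \<in> borel_measurable \<mu>e" by (rule flat_measurable_\<mu>e[OF g dep])
    show "(\<lambda>u. bump_max T (I N) (flat u)) \<in> borel_measurable \<mu>e" for N
    proof -
      obtain m where "cyl m T (bump_max T (I N))" using cyl_bump_max[OF fin] by blast
      then show ?thesis by (rule cyl_integrable_\<mu>e) simp
    qed
    show "AE u in \<mu>e. (\<lambda>N. bump_max T (I N) (flat u)) \<longlonglongrightarrow> g (flat u)" using lim by simp
    show "AE u in \<mu>e. norm (bump_max T (I N) (flat u)) \<le> C" for N
      using ge0 order_trans[OF le C] by simp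
  qed simp
  from order_tendstoD(1)[OF this, of "lim_mean g - \<eta>"] \<eta>
  obtain N where N: "lim_mean g - \<eta> < lim_mean (bump_max T (I N))"
    by (auto simp: eventually_sequentially)
  from order_tendstoD(1)[OF x[OF fin] N] show ?thesis
  proof (rule eventually_mono)
    fix n assume "lim_mean g - \<eta> < cyclic_average n (bump_max T (I N)) (x n)"
    then show "lim_mean g - \<eta> < cyclic_average n g (x n)" using cyclic_average_mono[of "bump_max T (I N)" g n "x n"] le by fastforce
  qed
qed

lemma cyclic_average_const_add: "cyclic_average n (\<lambda>w. c + s * g w) x = c + s * cyclic_average n g x"
  by (simp add: cyclic_average_def sum.distrib sum_distrib_left[symmetric] card_sites add_divide_distrib)

text \<open>The lower bound is applied to \<open>C + g\<close> and \<open>C - g\<close>, which are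
  non-negative and bounded by \<open>2 * C\<close>.\<close>

lemma cyclic_average_tendsto:
  assumes x: "\<And>I. finite I \<Longrightarrow> (\<lambda>n. cyclic_average n (bump_max T I) (x n)) \<longlonglongrightarrow> lim_mean (bump_max T I)"
    and g: "continuous_on UNIV g" and dep: "\<And>u u'. (\<And>i. snd i \<le> T \<Longrightarrow> u i = u' i) \<Longrightarrow> g u = g u'"
    and C: "\<And>w. \<bar>g w\<bar> \<le> C"
  shows "(\<lambda>n. cyclic_average n g (x n)) \<longlonglongrightarrow> lim_mean g"
proof (rule tendstoI)
  interpret \<mu>e: prob_space \<mu>e by (rule prob_\<mu>e)
  fix e :: real assume e: "e > 0"
  have int: "integrable \<mu>e (\<lambda>u. g (flat u))"
    by (rule \<mu>e.integrable_const_bound[where B = C]) (use C flat_measurable_\<mu>e[OF g dep] in auto)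
  have one: "eventually (\<lambda>n. s * lim_mean g - e < s * cyclic_average n g (x n)) sequentially" if s: "\<bar>s\<bar> = 1" for s
  proof -
    have b: "\<bar>s * g w\<bar> \<le> C" for w using C[of w] s by (simp add: abs_mult)
    have "eventually (\<lambda>n. lim_mean (\<lambda>w. C + s * g w) - e < cyclic_average n (\<lambda>w. C + s * g w) (x n)) sequentially"
    proof (rule cyclic_average_liminf[OF x _ _ _ _ e])
      show "continuous_on UNIV (\<lambda>w. C + s * g w)" by (intro continuous_intros g)
      show "C + s * g u = C + s * g u'" if "\<And>i. snd i \<le> T \<Longrightarrow> u i = u' i" for u u'
        using dep[OF that] by simp
      show "0 \<le> C + s * g w" for w using b[of w] by linarith
      show "C + s * g w \<le> 2 * C" for w using b[of w] by linarith
    qed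
    moreover have "lim_mean (\<lambda>w. C + s * g w) = C + s * lim_mean g"
      using int by (simp add: \<mu>e.prob_space)
    ultimately show ?thesis by (simp add: cyclic_average_const_add)
  qed
  have "eventually (\<lambda>n. 1 * lim_mean g - e < 1 * cyclic_average n g (x n) \<and> -1 * lim_mean g - e < -1 * cyclic_average n g (x n)) sequentially"
    by (intro eventually_conj one) simp_all
  then show "eventually (\<lambda>n. dist (cyclic_average n g (x n)) (lim_mean g) < e) sequentially"
    by (rule eventually_mono) (simp add: dist_real_def abs_less_iff)
qed

text \<open>The quantifier over test functions stands inside the almost sure statement: the
  exceptional set is the one of the countable collection of finite sets of bumps. The functions may
  depend on all sites, as is required for weak convergence on the whole lattice.\<close>

lemma cyclic_average_tendsto_AE:
  "AE \<omega> in P. \<forall>g C. continuous_on UNIV g \<longrightarrow> (\<forall>u u'. (\<forall>i. snd i \<le> T \<longrightarrow> u i = u' i) \<longrightarrow> g u = g u') \<longrightarrow>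
     (\<forall>w. \<bar>g w\<bar> \<le> C) \<longrightarrow> (\<lambda>n. cyclic_average n g (conf n \<omega>)) \<longlonglongrightarrow> lim_mean g"
proof -
  have "AE \<omega> in P. \<forall>I\<in>Collect finite. (\<lambda>n. cyclic_average n (bump_max T I) (conf n \<omega>)) \<longlonglongrightarrow> lim_mean (bump_max T I)"
  proof (rule AE_ball_countable')
    fix I :: "(rat \<times> nat \<times> nat \<times> rat list) set" assume "I \<in> Collect finite"
    then obtain m where "cyl m T (bump_max T I)" using cyl_bump_max by blast
    then show "AE \<omega> in P. (\<lambda>n. cyclic_average n (bump_max T I) (conf n \<omega>)) \<longlonglongrightarrow> lim_mean (bump_max T I)"
      by (rule cyclic_average_limit)
  qed (rule countable_Collect_finite)
  then show ?thesis
  proof (rule AE_mp[OF _ AE_I2[OF impI]], intro allI impI)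
    fix \<omega> and g :: "(site_time \<Rightarrow> real) \<Rightarrow> real" and C
    assume x: "\<forall>I\<in>Collect finite. (\<lambda>n. cyclic_average n (bump_max T I) (conf n \<omega>)) \<longlonglongrightarrow> lim_mean (bump_max T I)"
      and g: "continuous_on UNIV g" "\<forall>u u'. (\<forall>i. snd i \<le> T \<longrightarrow> u i = u' i) \<longrightarrow> g u = g u'" "\<forall>w. \<bar>g w\<bar> \<le> C"
    show "(\<lambda>n. cyclic_average n g (conf n \<omega>)) \<longlonglongrightarrow> lim_mean g"
      by (rule cyclic_average_tendsto[where C = C, OF _ g(1)]) (use x g(2,3) in auto)
  qed
qed

section \<open>Transfer to extensional fields and to the empirical measure\<close>

abbreviation embed :: "int set \<Rightarrow> (site_time \<Rightarrow> real) \<Rightarrow> field" where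
  "embed V w \<equiv> (\<lambda>j\<in>V. \<lambda>s\<in>{0..T}. w (j, s))"

lemma embed_bounded:
  assumes h: "h \<in> bounded_continuous (field_topology T V)"
  obtains C where "\<And>w. \<bar>h (embed V w)\<bar> \<le> C"
proof -
  obtain C where C: "\<forall>x\<in>h ` topspace (field_topology T V). norm x \<le> C"
    using h by (auto simp: bounded_continuous_def bounded_iff)
  show thesis
  proof (rule that)
    fix w
    have "embed V w \<in> topspace (field_topology T V)" by (auto simp: topspace_field)
    then show "\<bar>h (embed V w)\<bar> \<le> C" using C by (metis imageI real_norm_def)
  qed
qed

lemma embed_comp_continuous:
  assumes h: "h \<in> bounded_continuous (field_topology T V)"
  shows "continuous_on UNIV (\<lambda>w. h (embed V w))"
proof -
  have "continuous_map euclidean euclideanreal (h \<circ> embed V)"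
    by (rule continuous_map_compose[OF embed_continuous]) (use h in \<open>simp add: bounded_continuous_def\<close>)
  then show ?thesis by (simp add: o_def)
qed

text \<open>For \<open>m \<le> n\<close> the observation window lies inside the sites on which the
  cyclic shift is defined, so no default value is met.\<close>

lemma embed_conf:
  assumes "m \<le> n"
  shows "restrict (cyclic_shift n j (network_field T \<gamma> f J th B u0 n \<omega>)) (sites m)
    = embed (sites m) (\<lambda>i. conf n \<omega> (site_mod (j + fst i) n, snd i))"
proof -
  have "sites m \<subseteq> sites n" using assms by (auto simp: sites_def)
  then show ?thesis
    by (auto simp: fun_eq_iff restrict_def cyclic_shift_def network_field_def site_mod_in_sites)
qed

lemma cylinder_law:
  assumes h: "h \<in> bounded_continuous (field_topology T (sites m))"
  shows "AE \<omega> in P.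
     (\<lambda>n. 1 / real (card (sites n)) *
        (\<Sum>j\<in>sites n. h (restrict (cyclic_shift n j (network_field T \<gamma> f J th B u0 n \<omega>)) (sites m))))
       \<longlonglongrightarrow> (\<integral>x. h x \<partial>marginal T (sites m) \<mu>e)"
proof -
  let ?g = "\<lambda>w. h (embed (sites m) w)"
  obtain C where C: "\<And>w. \<bar>?g w\<bar> \<le> C" by (rule embed_bounded[OF h]) blast
  have cong: "?g u = ?g u'" if "\<forall>i\<in>grid m T. u i = u' i" for u u'
  proof -
    have "embed (sites m) u = embed (sites m) u'" using that by (auto simp: fun_eq_iff grid_def restrict_def)
    then show ?thesis by simp
  qed
  have "bounded (range ?g)" by (rule boundedI[of _ C]) (use C in auto)
  then have g: "cyl m T ?g"
    unfolding cyl_def by (intro conjI allI impI embed_comp_continuous[OF h] cong)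
  have "(\<integral>x. h x \<partial>marginal T (sites m) \<mu>e) = (\<integral>u. h (restrict u (sites m)) \<partial>\<mu>e)"
    unfolding marginal_def
  proof (rule integral_distr)
    have "continuous_map (field_topology T UNIV) (field_topology T (sites m)) (\<lambda>u. restrict u (sites m))"
    proof (rule continuous_map_field_topology)
      fix x j s assume "x \<in> topspace (field_topology T UNIV)" "j \<in> sites m" "s \<notin> {0..T}"
      then show "restrict x (sites m) j s = undefined" by (auto simp: topspace_field PiE_def extensional_def)
    qed (auto intro: field_topology_coord)
    from borel_of_measurable[OF this] show "(\<lambda>u. restrict u (sites m)) \<in> measurable \<mu>e (field_space T (sites m))"
      by (simp only: measurable_cong_sets[OF sets_\<mu>e refl])
    show "h \<in> borel_measurable (field_space T (sites m))"
      by (rule borel_of_measurable_real) (use h in \<open>simp add: bounded_continuous_def\<close>)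
  qed
  also have "\<dots> = lim_mean ?g"
  proof (rule Bochner_Integration.integral_cong[OF refl])
    fix u assume "u \<in> space \<mu>e"
    then have "u j \<in> extensional {0..T}" for j by (auto simp: space_\<mu>e topspace_field PiE_iff)
    then have "restrict u (sites m) = embed (sites m) (flat u)" by (auto simp: fun_eq_iff restrict_def extensional_def)
    then show "h (restrict u (sites m)) = ?g (flat u)" by simp
  qed
  finally have lim: "(\<integral>x. h x \<partial>marginal T (sites m) \<mu>e) = lim_mean ?g" .
  from cyclic_average_limit[OF g] show ?thesis
  proof (rule AE_mp[OF _ AE_I2[OF impI]])
    fix \<omega> assume lm: "(\<lambda>n. cyclic_average n ?g (conf n \<omega>)) \<longlonglongrightarrow> lim_mean ?g"
    have "eventually (\<lambda>n. cyclic_average n ?g (conf n \<omega>) = 1 / real (card (sites n)) *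
        (\<Sum>j\<in>sites n. h (restrict (cyclic_shift n j (network_field T \<gamma> f J th B u0 n \<omega>)) (sites m)))) sequentially"
      using eventually_ge_at_top[of m]
    proof (rule eventually_mono)
      fix n assume n: "m \<le> n"
      show "cyclic_average n ?g (conf n \<omega>) = 1 / real (card (sites n)) *
        (\<Sum>j\<in>sites n. h (restrict (cyclic_shift n j (network_field T \<gamma> f J th B u0 n \<omega>)) (sites m)))"
        unfolding embed_conf[OF n] cyclic_average_def by (simp only: divide_inverse mult_1 mult.commute)
    qed
    from Lim_transform_eventually[OF lm this] show "(\<lambda>n. 1 / real (card (sites n)) *
        (\<Sum>j\<in>sites n. h (restrict (cyclic_shift n j (network_field T \<gamma> f J th B u0 n \<omega>)) (sites m))))
       \<longlonglongrightarrow> (\<integral>x. h x \<partial>marginal T (sites m) \<mu>e)" unfolding lim .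
  qed
qed

end

text \<open>The empirical measure is the image of the uniform distribution on the sites under the
  shifts of the periodic extension, which reduces the integral to a finite mean.\<close>

lemma integral_empirical_measure:
  fixes h :: "field \<Rightarrow> real"
  assumes h: "h \<in> borel_measurable (field_space T UNIV)"
    and sp: "\<And>k. k \<in> sites n \<Longrightarrow> shift k (periodise n u) \<in> space (field_space T UNIV)"
  shows "(\<integral>x. h x \<partial>empirical_measure T n u) = (\<Sum>k\<in>sites n. h (shift k (periodise n u))) / real (card (sites n))"
proof -
  let ?\<phi> = "\<lambda>k. shift k (periodise n u)" and ?U = "uniform_count_measure (sites n)"
  have fin: "finite (sites n)" by (simp add: sites_eq)
  have \<phi>: "?\<phi> \<in> measurable ?U (field_space T UNIV)"
    using sp by (auto simp: measurable_def sets_uniform_count_measure space_uniform_count_measure)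
  have "empirical_measure T n u = distr ?U (field_space T UNIV) ?\<phi>"
  proof (rule measure_eqI)
    show s: "sets (empirical_measure T n u) = sets (distr ?U (field_space T UNIV) ?\<phi>)"
      unfolding empirical_measure_def by (simp add: sets.sigma_sets_eq)
    fix A assume "A \<in> sets (empirical_measure T n u)"
    then have A: "A \<in> sets (field_space T UNIV)" unfolding s by simp
    have "(\<Sum>k\<in>sites n. indicator A (?\<phi> k) :: ennreal) = of_nat (card {k \<in> sites n. ?\<phi> k \<in> A})"
      using fin by (simp add: indicator_def sum.If_cases Int_def)
    moreover have "real (card (sites n)) > 0" by (simp add: card_sites)
    moreover have "?\<phi> -` A \<inter> sites n = {k \<in> sites n. ?\<phi> k \<in> A}" by auto
    ultimately show "emeasure (empirical_measure T n u) A = emeasure (distr ?U (field_space T UNIV) ?\<phi>) A"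
      unfolding emeasure_empirical_measure[OF A] emeasure_distr[OF \<phi> A]
      using fin by (simp add: space_uniform_count_measure emeasure_uniform_count_measure
          ennreal_of_nat_eq_real_of_nat divide_ennreal)
  qed
  then show ?thesis
    by (simp add: integral_distr[OF \<phi> h] integral_uniform_count_measure[OF fin])
qed

context limit_law
begin

text \<open>Every bounded continuous \<open>h\<close> becomes a test function of site and time
  through \<open>embed\<close>; the integral against the empirical measure is then its cyclic
  average, and all \<open>h\<close> share one exceptional set.\<close>

lemma empirical_law:
  "AE \<omega> in P. weakly_converges (field_topology T UNIV)
     (\<lambda>n. empirical_measure T n (network_field T \<gamma> f J th B u0 n \<omega>)) \<mu>e"
  using cyclic_average_tendsto_AE
proof (rule AE_mp[OF _ AE_I2[OF impI]])
  fix \<omega>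
  assume lm: "\<forall>g C. continuous_on UNIV g \<longrightarrow> (\<forall>u u'. (\<forall>i. snd i \<le> T \<longrightarrow> u i = u' i) \<longrightarrow> g u = g u') \<longrightarrow>
     (\<forall>w. \<bar>g w\<bar> \<le> C) \<longrightarrow> (\<lambda>n. cyclic_average n g (conf n \<omega>)) \<longlonglongrightarrow> lim_mean g"
  let ?N = "\<lambda>n. network_field T \<gamma> f J th B u0 n \<omega>"
  show "weakly_converges (field_topology T UNIV) (\<lambda>n. empirical_measure T n (?N n)) \<mu>e"
    unfolding weakly_converges_def
  proof
    fix h assume h: "h \<in> bounded_continuous (field_topology T UNIV)"
    let ?g = "\<lambda>w. h (embed UNIV w)"
    obtain C where C: "\<And>w. \<bar>?g w\<bar> \<le> C" by (rule embed_bounded[OF h]) blast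
    have dep: "?g u = ?g u'" if "\<forall>i. snd i \<le> T \<longrightarrow> u i = u' i" for u u'
    proof -
      have "embed UNIV u = embed UNIV u'" using that by (auto simp: fun_eq_iff restrict_def)
      then show ?thesis by simp
    qed
    have "(\<lambda>n. cyclic_average n ?g (conf n \<omega>)) \<longlonglongrightarrow> lim_mean ?g"
      using lm[rule_format, of ?g C, OF embed_comp_continuous[OF h] _ C] dep by blast
    moreover have "lim_mean ?g = (\<integral>u. h u \<partial>\<mu>e)"
    proof (rule Bochner_Integration.integral_cong[OF refl])
      fix u assume "u \<in> space \<mu>e"
      then have "u j \<in> extensional {0..T}" for j by (auto simp: space_\<mu>e topspace_field PiE_iff)
      then have "embed UNIV (flat u) = u" by (auto simp: fun_eq_iff restrict_def extensional_def)
      then show "?g (flat u) = h u" by simp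
    qed
    moreover have "cyclic_average n ?g (conf n \<omega>) = (\<integral>u. h u \<partial>empirical_measure T n (?N n))" for n
    proof -
      have sh: "shift k (periodise n (?N n)) = embed UNIV (\<lambda>i. conf n \<omega> (site_mod (k + fst i) n, snd i))" for k
        by (auto simp: fun_eq_iff shift_def periodise_def network_field_def site_mod_in_sites)
      have "(\<integral>u. h u \<partial>empirical_measure T n (?N n)) = (\<Sum>k\<in>sites n. h (shift k (periodise n (?N n)))) / real (card (sites n))"
      proof (rule integral_empirical_measure)
        show "h \<in> borel_measurable (field_space T UNIV)"
          by (rule borel_of_measurable_real) (use h in \<open>simp add: bounded_continuous_def\<close>)
        show "shift k (periodise n (?N n)) \<in> space (field_space T UNIV)" for k
          unfolding sh by (auto simp: space_borel_of topspace_field)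
      qed
      then show ?thesis unfolding sh cyclic_average_def ..
    qed
    ultimately show "(\<lambda>n. \<integral>u. h u \<partial>empirical_measure T n (?N n)) \<longlonglongrightarrow> (\<integral>u. h u \<partial>\<mu>e)" by simp
  qed
qed

end

theorem theorem4p4:
  fixes T :: nat
    and P :: "'w measure"
    and \<sigma> \<gamma> \<theta>bar \<theta> Jbar :: real
    and f :: "real \<Rightarrow> real"
    and \<Lambda> :: "int \<Rightarrow> int \<Rightarrow> real"
    and \<mu>I :: "real measure"
    and B :: "int \<Rightarrow> nat \<Rightarrow> 'w \<Rightarrow> real"
    and th u0 :: "int \<Rightarrow> 'w \<Rightarrow> real"
    and J :: "nat \<Rightarrow> int \<Rightarrow> int \<Rightarrow> 'w \<Rightarrow> real"
    and \<mu>\<^sub>e :: "field measure"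
  assumes "T \<ge> 1"
    and "prob_space P"
    and "\<sigma> > 0" and "0 \<le> \<gamma>" and "\<gamma> < 1"
    and "mono f" and "bij_betw f UNIV {0<..<1}" and "\<exists>L. L-lipschitz_on UNIV f"
    and "prob_space \<mu>I" and "sets \<mu>I = sets borel"
    and "(\<lambda>(k, l). \<bar>\<Lambda> k l\<bar>) summable_on UNIV"
    and "iid_family P (UNIV \<times> {0..T - 1}) (\<lambda>(j, t). B j t) (normal_law 0 \<sigma>)"
    and "iid_family P UNIV th (normal_law \<theta>bar \<theta>)"
    and "iid_family P UNIV u0 \<mu>I"
    and "\<And>n. n \<ge> 1 \<Longrightarrow> gaussian_family P (sites n \<times> sites n) (\<lambda>(i, j). J n i j)"
    and "\<And>n i j. n \<ge> 1 \<Longrightarrow> i \<in> sites n \<Longrightarrow> j \<in> sites n \<Longrightarrow>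
           (\<integral>\<omega>. J n i j \<omega> \<partial>P) = Jbar / real (card (sites n))"
    and "\<And>n i j k l. n \<ge> 1 \<Longrightarrow> i \<in> sites n \<Longrightarrow> j \<in> sites n \<Longrightarrow> k \<in> sites n \<Longrightarrow> l \<in> sites n \<Longrightarrow>
           cov P (J n i j) (J n k l)
             = 1 / real (card (sites n)) * \<Lambda> (site_mod (k - i) n) (site_mod (l - j) n)"
    and "\<And>n. n \<ge> 1 \<Longrightarrow> prob_space.indep_sets P
           (\<lambda>q. [generated_events P (UNIV \<times> {0..T - 1}) (\<lambda>(j, t). B j t),
                 generated_events P UNIV th,
                 generated_events P UNIV u0,
                 generated_events P (sites n \<times> sites n) (\<lambda>(i, j). J n i j)] ! q) {..<4}"
    and "\<mu>\<^sub>e \<in> stationary_measures T"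
    and "is_Q T \<gamma> \<sigma> \<theta>bar \<theta> Jbar \<Lambda> f \<mu>I \<mu>\<^sub>e \<mu>\<^sub>e"
  shows "(\<forall>m > 0. \<forall>h \<in> bounded_continuous (field_topology T (sites m)).
           AE \<omega> in P.
             (\<lambda>n. 1 / real (card (sites n)) *
                  (\<Sum>j\<in>sites n. h (restrict (cyclic_shift n j (network_field T \<gamma> f J th B u0 n \<omega>)) (sites m))))
             \<longlonglongrightarrow> (\<integral>x. h x \<partial>marginal T (sites m) \<mu>\<^sub>e))
       \<and> (AE \<omega> in P.
             weakly_converges (field_topology T UNIV)
               (\<lambda>n. empirical_measure T n (network_field T \<gamma> f J th B u0 n \<omega>)) \<mu>\<^sub>e)"
proof -
  obtain G where G: "is_stationary_gaussian_law T (mean_coeff Jbar f \<mu>\<^sub>e)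
      (\<lambda>k r s. (if k = 0 \<and> r = s then \<sigma>\<^sup>2 else 0) + cov_coeff \<theta> \<Lambda> f \<mu>\<^sub>e k r s) G"
    "distr (distr \<mu>\<^sub>e (field_space T UNIV) (Psi T \<gamma> \<theta>bar))
      ((\<Pi>\<^sub>M j\<in>UNIV. borel) \<Otimes>\<^sub>M (\<Pi>\<^sub>M j\<in>UNIV. \<Pi>\<^sub>M s\<in>{1..T}. borel))
      (\<lambda>v. (\<lambda>j. v j 0, \<lambda>j. restrict (v j) {1..T})) = (\<Pi>\<^sub>M j\<in>UNIV. \<mu>I) \<Otimes>\<^sub>M G"
    using assms(20) unfolding is_Q_def by blast
  interpret limit_law \<mu>I P T \<sigma> \<gamma> \<theta>bar \<theta> Jbar f \<Lambda> B th u0 J \<mu>\<^sub>e G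
    by (intro limit_law.intro network.intro coord.intro network_axioms.intro limit_law_axioms.intro)
      (fact G assms)+
  show ?thesis using cylinder_law empirical_law by blast
qed

end
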